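(* Let $n>16$ and $\lambda\vdash n$. Then $s_{(n-3,3)}\ast s_\lambda$ is multiplicity free if and only if $\lambda$ is one of $(n)$, $(1^n)$, $(n-1,1)$, $(2,1^{n-2})$, or, when $n$ is even, $\lambda=(n/2,n/2)$ or $\lambda=(2^{n/2})$.
   Context: For $\lambda,\mu\vdash n$, the Kronecker product is $s_\lambda\ast s_\mu=\sum_{\nu\vdash n}g_{\lambda,\mu,\nu}s_\nu$, where $g_{\lambda,\mu,\nu}$ is the multiplicity of the irreducible $S_n$-character $\chi^\nu$ in the pointwise product $\chi^\lambda\chi^\mu$. A symmetric function is multiplicity free if every coefficient in its expansion in Schur functions is $0$ or $1$. $(a^k)$ denotes the partition with $k$ parts all equal to $a$. *)

theory Defs
  imports
    Complex_Main
    "HOL-Library.Function_Algebras"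
    "HOL-Library.FuncSet"
    "HOL-Library.Multiset"
    "HOL-Combinatorics.Permutations"
begin

definition is_partition :: "nat list \<Rightarrow> bool" where
  "is_partition \<alpha> \<longleftrightarrow> sorted_wrt (\<ge>) \<alpha> \<and> 0 \<notin> set \<alpha>"

definition partitions_of :: "nat \<Rightarrow> nat list set" where
  "partitions_of n = {\<alpha>. is_partition \<alpha> \<and> sum_list \<alpha> = n}"

definition diagram :: "nat list \<Rightarrow> (nat \<times> nat) set" where
  "diagram \<alpha> = {(i, j). i < length \<alpha> \<and> j < \<alpha> ! i}"


definition cfun_scale :: "complex \<Rightarrow> ('a \<Rightarrow> complex) \<Rightarrow> ('a \<Rightarrow> complex)" where
  "cfun_scale c v = (\<lambda>x. c * v x)"

global_interpretation cfun: vector_space cfun_scale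
  by unfold_locales (auto simp: cfun_scale_def fun_eq_iff algebra_simps)

text \<open>The trace of a linear endomorphism \<open>f\<close> of a finite-dimensional subspace \<open>V\<close>, computed
  in an arbitrary basis of \<open>V\<close>.\<close>

definition cfun_trace :: "('a \<Rightarrow> complex) set \<Rightarrow> (('a \<Rightarrow> complex) \<Rightarrow> ('a \<Rightarrow> complex)) \<Rightarrow> complex" where
  "cfun_trace V f =
     (let B = (SOME B. cfun.independent B \<and> cfun.span B = V)
      in \<Sum>b\<in>B. cfun.representation B (f b) b)"


text \<open>The symmetric group \<open>S\<^sub>n\<close> is \<open>{p. p permutes {..<n}}\<close>. A tableau of shape \<open>\<alpha>\<close> is encoded
  by the map \<open>T\<close> sending each entry to the cell containing it, so that \<open>fst (T k)\<close> and
  \<open>snd (T k)\<close> are the row and the column of the entry \<open>k\<close>. Its tabloid (the tableau up to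
  reordering the rows) is the map sending each entry to its row; a permutation \<open>p\<close> sends the
  tabloid \<open>r\<close> to \<open>r \<circ> inv p\<close>. The permutation module on tabloids consists of complex functions
  on tabloids, with \<open>p\<close> acting by \<open>(p v) r = v (r \<circ> p)\<close>.\<close>

definition tableaux :: "nat list \<Rightarrow> (nat \<Rightarrow> nat \<times> nat) set" where
  "tableaux \<alpha> = {T. bij_betw T {..<sum_list \<alpha>} (diagram \<alpha>)}"

definition tabloid :: "nat list \<Rightarrow> (nat \<Rightarrow> nat \<times> nat) \<Rightarrow> (nat \<Rightarrow> nat)" where
  "tabloid \<alpha> T = restrict (fst \<circ> T) {..<sum_list \<alpha>}"

definition column_stabilizer :: "nat list \<Rightarrow> (nat \<Rightarrow> nat \<times> nat) \<Rightarrow> (nat \<Rightarrow> nat) set" where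
  "column_stabilizer \<alpha> T =
     {p. p permutes {..<sum_list \<alpha>} \<and> (\<forall>k<sum_list \<alpha>. snd (T (p k)) = snd (T k))}"

definition polytabloid :: "nat list \<Rightarrow> (nat \<Rightarrow> nat \<times> nat) \<Rightarrow> ((nat \<Rightarrow> nat) \<Rightarrow> complex)" where
  "polytabloid \<alpha> T =
     (\<lambda>r. \<Sum>p\<in>column_stabilizer \<alpha> T.
        of_int (sign p) * (if r = tabloid \<alpha> T \<circ> inv p then 1 else 0))"

definition specht_module :: "nat list \<Rightarrow> ((nat \<Rightarrow> nat) \<Rightarrow> complex) set" where
  "specht_module \<alpha> = cfun.span (polytabloid \<alpha> ` tableaux \<alpha>)"

definition perm_act :: "(nat \<Rightarrow> nat) \<Rightarrow> ((nat \<Rightarrow> nat) \<Rightarrow> complex) \<Rightarrow> ((nat \<Rightarrow> nat) \<Rightarrow> complex)" where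
  "perm_act p v = (\<lambda>r. v (r \<circ> p))"

text \<open>The irreducible character indexed by \<open>\<alpha>\<close> is the character of the Specht module.\<close>

definition irr_char :: "nat list \<Rightarrow> (nat \<Rightarrow> nat) \<Rightarrow> complex" where
  "irr_char \<alpha> p = cfun_trace (specht_module \<alpha>) (perm_act p)"

text \<open>The multiplicity of an irreducible character \<open>\<phi>\<close> in a character \<open>\<psi>\<close> of \<open>S\<^sub>n\<close> is
  their inner product.\<close>

definition char_multiplicity :: "nat \<Rightarrow> ((nat \<Rightarrow> nat) \<Rightarrow> complex) \<Rightarrow> ((nat \<Rightarrow> nat) \<Rightarrow> complex) \<Rightarrow> complex" where
  "char_multiplicity n \<phi> \<psi> = (\<Sum>p | p permutes {..<n}. \<psi> p * cnj (\<phi> p)) / fact n"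

definition kronecker_coeff :: "nat list \<Rightarrow> nat list \<Rightarrow> nat list \<Rightarrow> complex" where
  "kronecker_coeff \<alpha> \<beta> \<gamma> =
     char_multiplicity (sum_list \<alpha>) (irr_char \<gamma>) (\<lambda>p. irr_char \<alpha> p * irr_char \<beta> p)"


text \<open>Symmetric functions are formal power series in variables \<open>x\<^sub>0, x\<^sub>1, \<dots>\<close>, given by their
  coefficients; the multiset \<open>M\<close> stands for the monomial \<open>\<Prod>i\<in>#M. x\<^sub>i\<close>.\<close>

type_synonym symfun = "nat multiset \<Rightarrow> complex"

definition ssyt :: "nat list \<Rightarrow> (nat \<times> nat \<Rightarrow> nat) set" where
  "ssyt \<alpha> = {T \<in> extensional (diagram \<alpha>).
     (\<forall>i j j'. (i, j) \<in> diagram \<alpha> \<longrightarrow> (i, j') \<in> diagram \<alpha> \<longrightarrow> j < j' \<longrightarrow> T (i, j) \<le> T (i, j')) \<and>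
     (\<forall>i i' j. (i, j) \<in> diagram \<alpha> \<longrightarrow> (i', j) \<in> diagram \<alpha> \<longrightarrow> i < i' \<longrightarrow> T (i, j) < T (i', j))}"

definition schur :: "nat list \<Rightarrow> symfun" where
  "schur \<alpha> = (\<lambda>M. of_nat (card {T \<in> ssyt \<alpha>. image_mset T (mset_set (diagram \<alpha>)) = M}))"

definition is_schur_expansion :: "(nat list \<Rightarrow> complex) \<Rightarrow> symfun \<Rightarrow> bool" where
  "is_schur_expansion c f \<longleftrightarrow>
     finite {\<gamma>. c \<gamma> \<noteq> 0} \<and> (\<forall>\<gamma>. c \<gamma> \<noteq> 0 \<longrightarrow> is_partition \<gamma>) \<and>
     f = (\<lambda>M. \<Sum>\<gamma> | c \<gamma> \<noteq> 0. c \<gamma> * schur \<gamma> M)"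

definition multiplicity_free :: "symfun \<Rightarrow> bool" where
  "multiplicity_free f \<longleftrightarrow> (\<exists>c. is_schur_expansion c f \<and> (\<forall>\<gamma>. c \<gamma> = 0 \<or> c \<gamma> = 1))"

definition kronecker_schur :: "nat list \<Rightarrow> nat list \<Rightarrow> symfun" where
  "kronecker_schur \<alpha> \<beta> =
     (\<lambda>M. \<Sum>\<gamma>\<in>partitions_of (sum_list \<alpha>). kronecker_coeff \<alpha> \<beta> \<gamma> * schur \<gamma> M)"

end

theory Submission
  imports Defs
begin

text \<open>The trace of a permutation on a Specht module is an average of coefficients of the polytabloid,
  which makes it a class function of norm one.  It pairs to zero with the permutation character of every
  Young subgroup whose type is not dominated by the shape, and so does the Jacobi--Trudi virtual
  character; both have norm one and pair to one, hence they agree.  The two Pieri rules for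
  Jacobi--Trudi characters give the restriction to a Young subgroup of type (n-k,k).

  Since s_(n-3,3) is h_(n-3) * h_3 - h_(n-2) * h_2, the Kronecker coefficient of
  (n-3,3) with diagrams I and J is B3 I J - B2 I J, where
  Bk sums over the common subdiagrams obtained by removing k cells the inner product of the two
  skew characters of degree k.  For a diagram with many corners, or with two corners or one
  corner and enough room, the difference is at least two already for J = I or for J
  obtained from I by moving a single cell; the remaining diagrams are exactly those in
  the list.\<close>

section \<open>Permutation characters and Specht characters\<close>

text \<open>The irreducible characters are defined as traces on Specht modules in an arbitrary
  basis, whereas restriction and Pieri rules are elementary only for permutation characters. The
  bridge is the Young symmetrizer. The column antisymmetrizer has rank one on tabloids, so the
  symmetrizer is idempotent up to a scalar; this yields a projection onto the Specht module and with
  it a formula for the trace that contains no basis.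

  In the classification, the coefficient at J = I grows like the cube of the number of corners,
  because three corners carry the regular character of the symmetric group on three points, while
  the subtracted form grows like the square. The work is therefore in diagrams with one or two
  corners, where single dominoes and connected triples of cells are counted and, if these are too
  few, a cell is moved. The bound 16 discards small diagrams with too little room, such as the
  staircase (3,2,1) and the square of side three. For (n-1,1) the symmetry of the Kronecker product
  is used to exchange the roles of the two factors.\<close>

definition content :: "nat set \<Rightarrow> (nat \<Rightarrow> nat) \<Rightarrow> nat \<Rightarrow> nat" where
  "content S w i = card {k \<in> S. w k = i}"

text \<open>Contents take integer values because Jacobi--Trudi indices can be negative. Tabloids of
  shape \<open>\<alpha>\<close> are exactly such words, with the parts of \<open>\<alpha>\<close> as
  content.\<close>

definition words :: "nat set \<Rightarrow> (nat \<Rightarrow> int) \<Rightarrow> (nat \<Rightarrow> nat) set" where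
  "words S \<beta> = {w \<in> extensional S. \<forall>i. int (content S w i) = \<beta> i}"

text \<open>The character induced from the trivial character of a Young subgroup of type
  \<open>\<beta>\<close>; as a symmetric function, the product of the
  \<open>h_(\<beta> i)\<close>.\<close>

definition perm_char :: "nat set \<Rightarrow> (nat \<Rightarrow> int) \<Rightarrow> (nat \<Rightarrow> nat) \<Rightarrow> real" where
  "perm_char S \<beta> p = real (card {w \<in> words S \<beta>. w \<circ> p = w})"

definition class_fun :: "nat \<Rightarrow> ((nat \<Rightarrow> nat) \<Rightarrow> real) \<Rightarrow> bool" where
  "class_fun n F \<longleftrightarrow> (\<forall>p g. p permutes {..<n} \<longrightarrow> g permutes {..<n} \<longrightarrow> F (g \<circ> p \<circ> inv g) = F p)"

text \<open>Complex conjugation is absent because the characters involved are real-valued.\<close>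

definition char_ip :: "nat \<Rightarrow> ((nat \<Rightarrow> nat) \<Rightarrow> real) \<Rightarrow> ((nat \<Rightarrow> nat) \<Rightarrow> real) \<Rightarrow> real" where
  "char_ip n F G = (\<Sum>p | p permutes {..<n}. F p * G p) / fact n"

section \<open>Words, their stabilisers, and orbit counting\<close>

lemma content_comp:
  assumes "finite S" "g permutes S"
  shows "content S (w \<circ> g) i = content S w i"
proof -
  have "bij_betw g {k \<in> S. (w \<circ> g) k = i} {k \<in> S. w k = i}"
    using assms(2) by (intro bij_betwI[where g = "inv g"])
      (auto simp: permutes_in_image permutes_inv permutes_inverses)
  then show ?thesis unfolding content_def by (rule bij_betw_same_card)
qed

lemma extensional_comp:
  "w \<in> extensional S \<Longrightarrow> g permutes S \<Longrightarrow> w \<circ> g \<in> extensional S"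
  by (auto simp: extensional_def permutes_def)

lemma words_comp:
  assumes "finite S" "g permutes S" "w \<in> words S \<beta>"
  shows "w \<circ> g \<in> words S \<beta>"
  using assms by (auto simp: words_def content_comp extensional_comp)

lemma words_transitive:
  assumes "finite S" "w \<in> words S \<beta>" "w' \<in> words S \<beta>"
  obtains g where "g permutes S" "w = w' \<circ> g"
proof -
  have c: "count (image_mset v (mset_set S)) i = content S v i" for v i
    using assms(1) by (simp add: count_image_mset content_def vimage_def Int_def conj_commute)
  have "image_mset w (mset_set S) = image_mset w' (mset_set S)"
    using assms(2,3) by (intro multiset_eqI) (simp add: c words_def, metis of_nat_eq_iff)
  then obtain g where g: "g permutes S" "\<forall>x\<in>S. w x = w' (g x)"
    using image_mset_eq_implies_permutes[OF assms(1)] by metis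
  have "w = w' \<circ> g"
  proof
    fix x show "w x = (w' \<circ> g) x"
      using g assms(2,3) by (cases "x \<in> S") (auto simp: words_def extensional_def permutes_def)
  qed
  with g that show ?thesis by blast
qed

lemma finite_words [simp]:
  assumes "finite S" shows "finite (words S \<beta>)"
proof (cases "words S \<beta> = {}")
  case False
  then obtain w where w: "w \<in> words S \<beta>" by blast
  have "words S \<beta> \<subseteq> (\<lambda>g. w \<circ> g) ` {g. g permutes S}"
    using words_transitive[OF assms _ w] by blast
  then show ?thesis using finite_permutations[OF assms] finite_subset by blast
qed simp

text \<open>The set on the right is a coset of the stabiliser: composing with any \<open>g\<close>
  such that \<open>w = w' \<circ> g\<close> is a bijection.\<close>

lemma card_stabilizer_coset:
  assumes "finite S" "w \<in> words S \<beta>" "w' \<in> words S \<beta>"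
  shows "card {p. p permutes S \<and> w \<circ> p = w} = card {p. p permutes S \<and> w' \<circ> p = w}"
proof -
  obtain g where g: "g permutes S" "w = w' \<circ> g" using words_transitive[OF assms] by blast
  have i: "g \<circ> inv g = id" "inv g \<circ> g = id" using g(1) by (simp_all add: permutes_inv_o)
  have "bij_betw (\<lambda>p. g \<circ> p) {p. p permutes S \<and> w \<circ> p = w} {p. p permutes S \<and> w' \<circ> p = w}"
  proof (rule bij_betwI[where g = "\<lambda>p. inv g \<circ> p"])
    show "(\<circ>) g \<in> {p. p permutes S \<and> w \<circ> p = w} \<rightarrow> {p. p permutes S \<and> w' \<circ> p = w}"
      using g by (auto simp: permutes_compose o_assoc)
    show "(\<circ>) (inv g) \<in> {p. p permutes S \<and> w' \<circ> p = w} \<rightarrow> {p. p permutes S \<and> w \<circ> p = w}"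
    proof (safe)
      fix p assume p: "p permutes S" "w = w' \<circ> p"
      show "inv g \<circ> p permutes S" using p(1) g(1) permutes_compose permutes_inv by blast
      have "w' \<circ> p \<circ> (inv g \<circ> p) = (w' \<circ> g) \<circ> (inv g \<circ> p)" using g(2) p(2) by simp
      also have "\<dots> = w' \<circ> (g \<circ> inv g) \<circ> p" by (simp add: o_assoc)
      finally show "w' \<circ> p \<circ> (inv g \<circ> p) = w' \<circ> p" by (simp add: i)
    qed
  qed (simp_all add: o_assoc i)
  then show ?thesis by (rule bij_betw_same_card)
qed

text \<open>Orbit counting: each permutation \<open>p\<close> takes a fixed word \<open>w'\<close>
  to exactly one word \<open>w' \<circ> p\<close>, so the cosets partition the whole group.\<close>

lemma sum_card_stabilizer:
  assumes "finite S" "words S \<beta> \<noteq> {}"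
  shows "(\<Sum>w\<in>words S \<beta>. card {p. p permutes S \<and> w \<circ> p = w}) = fact (card S)"
proof -
  obtain w' where w': "w' \<in> words S \<beta>" using assms by blast
  have fin: "finite {p. p permutes S}" using finite_permutations[OF assms(1)] .
  have "(\<Sum>w\<in>words S \<beta>. card {p. p permutes S \<and> w \<circ> p = w}) =
    (\<Sum>w\<in>words S \<beta>. card {p \<in> {p. p permutes S}. w' \<circ> p = w})"
    using card_stabilizer_coset[OF assms(1) _ w'] by (intro sum.cong) auto
  also have "\<dots> = (\<Sum>w\<in>words S \<beta>. \<Sum>p | p \<in> {p. p permutes S} \<and> w' \<circ> p = w. 1)" by simp
  also have "\<dots> = (\<Sum>p | p permutes S. 1)"
    by (rule sum.group[OF fin]) (use assms w' words_comp in auto)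
  also have "\<dots> = fact (card S)" using card_permutations[OF refl assms(1)] by simp
  finally show ?thesis .
qed

lemma sum_perm_conj:
  assumes "g permutes S"
  shows "(\<Sum>p | p permutes S. F p) = (\<Sum>p | p permutes S. F (g \<circ> p \<circ> inv g))"
proof (rule sum.reindex_bij_witness[where i = "\<lambda>p. g \<circ> p \<circ> inv g" and j = "\<lambda>p. inv g \<circ> p \<circ> g"])
  have i: "g \<circ> inv g = id" "inv g \<circ> g = id" using assms by (simp_all add: permutes_inv_o)
  have i': "g (inv g x) = x" "inv g (g x) = x" for x
    using assms by (simp_all add: permutes_inverses)
  fix p assume "p \<in> {p. p permutes S}"
  moreover have "g \<circ> (inv g \<circ> p \<circ> g) \<circ> inv g = p" by (simp add: fun_eq_iff i')
  ultimately show "g \<circ> (inv g \<circ> p \<circ> g) \<circ> inv g = p" "inv g \<circ> (g \<circ> p \<circ> inv g) \<circ> g = p"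
    "inv g \<circ> p \<circ> g \<in> {p. p permutes S}" "g \<circ> p \<circ> inv g \<in> {p. p permutes S}"
    "F (g \<circ> (inv g \<circ> p \<circ> g) \<circ> inv g) = F p"
    using assms by (auto simp: i' intro!: permutes_compose permutes_inv)
qed

lemma perm_char_eq_sum:
  assumes "finite S"
  shows "perm_char S \<beta> p = (\<Sum>w\<in>words S \<beta>. if w \<circ> p = w then 1 else 0)"
  using assms by (simp add: perm_char_def sum.If_cases Int_def conj_commute)

lemma comp_fixed_conj:
  fixes g :: "'a \<Rightarrow> 'a"
  assumes "bij g"
  shows "w \<circ> g \<circ> p = w \<circ> g \<longleftrightarrow> w \<circ> (g \<circ> p \<circ> inv g) = w"
proof -
  have i': "g (inv g x) = x" "inv g (g x) = x" for x
    using assms by (simp_all add: bij_is_surj surj_f_inv_f bij_is_inj)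
  show ?thesis by (auto simp: fun_eq_iff i') (metis i')+
qed

lemma class_fun_perm_char: "class_fun n (perm_char {..<n} \<beta>)"
  unfolding class_fun_def
proof (intro allI impI)
  fix p g assume p: "p permutes {..<n}" and g: "g permutes {..<n}"
  have "bij_betw (\<lambda>w. w \<circ> g) {w \<in> words {..<n} \<beta>. w \<circ> (g \<circ> p \<circ> inv g) = w}
     {w \<in> words {..<n} \<beta>. w \<circ> p = w}"
  proof (rule bij_betwI[where g = "\<lambda>w. w \<circ> inv g"])
    show "(\<lambda>w. w \<circ> g) \<in> {w \<in> words {..<n} \<beta>. w \<circ> (g \<circ> p \<circ> inv g) = w} \<rightarrow> {w \<in> words {..<n} \<beta>. w \<circ> p = w}"
      using g by (auto simp: words_comp comp_fixed_conj[OF permutes_bij[OF g]])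
    show "(\<lambda>w. w \<circ> inv g) \<in> {w \<in> words {..<n} \<beta>. w \<circ> p = w} \<rightarrow> {w \<in> words {..<n} \<beta>. w \<circ> (g \<circ> p \<circ> inv g) = w}"
      using g by (auto simp: words_comp permutes_inv fun_eq_iff permutes_inverses)
  qed (use g in \<open>auto simp: fun_eq_iff permutes_inverses\<close>)
  then show "perm_char {..<n} \<beta> (g \<circ> p \<circ> inv g) = perm_char {..<n} \<beta> p"
    by (simp add: perm_char_def bij_betw_same_card)
qed

text \<open>Averaging over all permutations against a permutation character is averaging over the
  stabiliser of one word (a Young subgroup).\<close>

lemma sum_perm_char_stabilizer:
  assumes F: "class_fun n F" and w: "w \<in> words {..<n} \<beta>"
  shows "char_ip n (perm_char {..<n} \<beta>) F =
    (\<Sum>p | p permutes {..<n} \<and> w \<circ> p = w. F p) / card {p. p permutes {..<n} \<and> w \<circ> p = w}"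
proof -
  let ?G = "{p. p permutes {..<n}}"
  have fin: "finite ?G" using finite_permutations by blast
  define St where "St v = {p. p permutes {..<n} \<and> v \<circ> p = v}" for v :: "nat \<Rightarrow> nat"
  \<comment> \<open>If \<open>v = w \<circ> g\<close>, conjugation by \<open>g\<close> turns the
    stabiliser of \<open>v\<close> into that of \<open>w\<close>, and class functions are constant
    along it; hence all words contribute equally.\<close>
  have St: "(\<Sum>p\<in>St v. F p) = (\<Sum>p\<in>St w. F p) \<and> card (St v) = card (St w)" if v: "v \<in> words {..<n} \<beta>" for v
  proof -
    obtain g where g: "g permutes {..<n}" "v = w \<circ> g" using words_transitive[OF _ v w] by blast
    have *: "(\<Sum>p\<in>St v. H p) = (\<Sum>p\<in>St w. H p)" if "class_fun n H" for H
    proof -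
      have "(\<Sum>p\<in>St w. H p) = (\<Sum>p | p permutes {..<n}. if w \<circ> p = w then H p else 0)"
        unfolding St_def by (simp add: sum.If_cases[OF fin] Int_def)
      also have "\<dots> = (\<Sum>p | p permutes {..<n}. if w \<circ> (g \<circ> p \<circ> inv g) = w then H (g \<circ> p \<circ> inv g) else 0)"
        using sum_perm_conj[OF g(1)] by blast
      also have "\<dots> = (\<Sum>p | p permutes {..<n}. if v \<circ> p = v then H p else 0)"
        using that g by (intro sum.cong)
          (auto simp: class_fun_def comp_fixed_conj[OF permutes_bij[OF g(1)], symmetric])
      also have "\<dots> = (\<Sum>p\<in>St v. H p)"
        unfolding St_def by (simp add: sum.If_cases[OF fin] Int_def)
      finally show ?thesis by simp
    qed
    have "(\<Sum>p\<in>St v. 1::real) = (\<Sum>p\<in>St w. 1)" by (rule *) (simp add: class_fun_def)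
    with *[OF F] show ?thesis by simp
  qed
  have "(\<Sum>p\<in>?G. perm_char {..<n} \<beta> p * F p) =
     (\<Sum>p\<in>?G. \<Sum>v\<in>words {..<n} \<beta>. if v \<circ> p = v then F p else 0)"
    by (simp add: perm_char_eq_sum sum_distrib_right) (intro sum.cong, auto)
  also have "\<dots> = (\<Sum>v\<in>words {..<n} \<beta>. \<Sum>p\<in>?G. if v \<circ> p = v then F p else 0)" by (rule sum.swap)
  also have "\<dots> = (\<Sum>v\<in>words {..<n} \<beta>. \<Sum>p\<in>St v. F p)"
    unfolding St_def by (simp add: sum.If_cases[OF fin] Int_def)
  also have "\<dots> = real (card (words {..<n} \<beta>)) * (\<Sum>p\<in>St w. F p)" using St by simp
  finally have A: "(\<Sum>p\<in>?G. perm_char {..<n} \<beta> p * F p) = real (card (words {..<n} \<beta>)) * (\<Sum>p\<in>St w. F p)" .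
  have "fact n = (\<Sum>v\<in>words {..<n} \<beta>. card (St v))"
    using sum_card_stabilizer[of "{..<n}" \<beta>] w unfolding St_def by fastforce
  also have "\<dots> = card (words {..<n} \<beta>) * card (St w)" using St by simp
  finally have B: "(fact n :: real) = real (card (words {..<n} \<beta>)) * real (card (St w))"
    by (metis of_nat_fact of_nat_mult)
  have "card (words {..<n} \<beta>) \<noteq> 0" using B by (metis fact_nonzero mult_zero_left of_nat_0)
  then show ?thesis unfolding char_ip_def A B St_def[symmetric] by simp
qed

lemma partial_sum_words:
  assumes "finite S" "w \<in> words S \<beta>"
  shows "int (card {k \<in> S. w k < i}) = (\<Sum>l<i. \<beta> l)"
proof -
  have "{k \<in> S. w k < i} = (\<Union>l<i. {k \<in> S. w k = l})" by auto
  also have "card \<dots> = (\<Sum>l<i. card {k \<in> S. w k = l})"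
    using assms(1) by (intro card_UN_disjoint) auto
  finally show ?thesis using assms(2) by (simp add: words_def content_def)
qed

lemma char_ip_commute: "char_ip n F G = char_ip n G F"
  by (simp add: char_ip_def mult.commute)

lemma char_ip_sum_left:
  "char_ip n (\<lambda>p. \<Sum>x\<in>A. c x * F x p) G = (\<Sum>x\<in>A. c x * char_ip n (F x) G)"
  by (simp add: char_ip_def sum_distrib_right sum_divide_distrib sum_distrib_left mult.assoc)
     (rule sum.swap)

lemma char_ip_sum_right:
  "char_ip n F (\<lambda>p. \<Sum>x\<in>A. c x * G x p) = (\<Sum>x\<in>A. c x * char_ip n F (G x))"
  by (subst (1 2) char_ip_commute) (rule char_ip_sum_left)

text \<open>The hypothesis \<open>id\<close> factors the identity of \<open>V\<close> through the
  coordinate space of \<open>\<Omega>\<close>: evaluate at the points, then recombine the vectors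
  \<open>P s\<close>. By cyclicity, the trace of \<open>f\<close> is that of the induced matrix on
  \<open>\<Omega>\<close>, even if the \<open>P s\<close> are linearly dependent. This disposes of
  the arbitrary basis in \<open>cfun_trace\<close>.\<close>

lemma cfun_trace_eq_sum_kernel:
  assumes fin: "finite \<Omega>" and sub: "cfun.subspace V"
    and PV: "\<And>s. s \<in> \<Omega> \<Longrightarrow> P s \<in> V"
    and id: "\<And>v. v \<in> V \<Longrightarrow> v = (\<Sum>s\<in>\<Omega>. cfun_scale (v s) (P s))"
    and fV: "\<And>v. v \<in> V \<Longrightarrow> f v \<in> V" and lin: "Vector_Spaces.linear cfun_scale cfun_scale f"
  shows "cfun_trace V f = (\<Sum>s\<in>\<Omega>. f (P s) s)"
proof -
  define B where "B = (SOME B. cfun.independent B \<and> cfun.span B = V)"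
  have "\<exists>B. cfun.independent B \<and> cfun.span B = V"
  proof -
    obtain B where "B \<subseteq> V" "cfun.independent B" "V \<subseteq> cfun.span B"
      using cfun.maximal_independent_subset by blast
    then show ?thesis using cfun.span_minimal[OF _ sub] by blast
  qed
  then have B: "cfun.independent B" "cfun.span B = V"
    unfolding B_def by (metis (mono_tags, lifting) someI_ex)+
  have "V \<subseteq> cfun.span (P ` \<Omega>)"
  proof
    fix v assume "v \<in> V"
    then have "v = (\<Sum>s\<in>\<Omega>. cfun_scale (v s) (P s))" by (rule id)
    also have "\<dots> \<in> cfun.span (P ` \<Omega>)"
      by (intro cfun.span_sum cfun.span_scale cfun.span_base) auto
    finally show "v \<in> cfun.span (P ` \<Omega>)" .
  qed
  then have finB: "finite B"
    using cfun.independent_span_bound[of "P ` \<Omega>" B] fin B cfun.span_superset by fastforce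
  interpret f: Vector_Spaces.linear cfun_scale cfun_scale f by (rule lin)
  have rep: "cfun.representation B v b = (\<Sum>s\<in>\<Omega>. v s * cfun.representation B (P s) b)"
    if v: "v \<in> V" for v b
  proof -
    have "cfun.representation B v = cfun.representation B (\<Sum>s\<in>\<Omega>. cfun_scale (v s) (P s))"
      using id[OF v] by simp
    also have "\<dots> = (\<lambda>b. \<Sum>s\<in>\<Omega>. cfun.representation B (cfun_scale (v s) (P s)) b)"
      using B PV by (intro cfun.representation_sum) (auto intro!: cfun.span_scale)
    also have "\<dots> = (\<lambda>b. \<Sum>s\<in>\<Omega>. v s * cfun.representation B (P s) b)"
      using B PV by (intro ext sum.cong) (auto simp: cfun.representation_scale)
    finally show ?thesis by simp
  qed
  have P: "P s = (\<Sum>b\<in>B. cfun_scale (cfun.representation B (P s) b) b)" if "s \<in> \<Omega>" for s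
    using cfun.sum_representation_eq[OF B(1) _ finB order.refl, of "P s"] PV[OF that] B(2) by simp
  have BV: "b \<in> V" if "b \<in> B" for b using that B(2) cfun.span_superset by blast
  have sum_app: "(\<Sum>b\<in>B. F b) x = (\<Sum>b\<in>B. F b x)" for F :: "('a \<Rightarrow> complex) \<Rightarrow> 'a \<Rightarrow> complex" and x
    by (induction B rule: infinite_finite_induct) auto
  have "cfun_trace V f = (\<Sum>b\<in>B. cfun.representation B (f b) b)"
    unfolding cfun_trace_def B_def[symmetric] by simp
  also have "\<dots> = (\<Sum>b\<in>B. \<Sum>s\<in>\<Omega>. f b s * cfun.representation B (P s) b)"
    using BV fV rep by (intro sum.cong) auto
  also have "\<dots> = (\<Sum>s\<in>\<Omega>. \<Sum>b\<in>B. f b s * cfun.representation B (P s) b)" by (rule sum.swap)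
  also have "\<dots> = (\<Sum>s\<in>\<Omega>. f (P s) s)"
  proof (rule sum.cong)
    fix s assume s: "s \<in> \<Omega>"
    have "f (P s) = f (\<Sum>b\<in>B. cfun_scale (cfun.representation B (P s) b) b)" using P[OF s] by simp
    also have "\<dots> = (\<Sum>b\<in>B. cfun_scale (cfun.representation B (P s) b) (f b))"
      by (simp add: f.sum f.scale)
    finally show "(\<Sum>b\<in>B. f b s * cfun.representation B (P s) b) = f (P s) s"
      by (simp add: sum_app cfun_scale_def mult.commute)
  qed simp
  finally show ?thesis .
qed

section \<open>Partitions as functions padded by zeros, and their diagrams\<close>

definition part_fun :: "nat list \<Rightarrow> nat \<Rightarrow> nat" where
  "part_fun \<alpha> i = (if i < length \<alpha> then \<alpha> ! i else 0)"

lemma diagram_part_fun: "diagram \<alpha> = {(i, j). j < part_fun \<alpha> i}"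
  by (auto simp: diagram_def part_fun_def split: if_splits)

lemma part_fun_antitone:
  assumes "is_partition \<alpha>" "i \<le> j" shows "part_fun \<alpha> j \<le> part_fun \<alpha> i"
  using assms by (auto simp: is_partition_def part_fun_def sorted_wrt_iff_nth_less le_less)

lemma sum_part_fun: "length \<alpha> \<le> N \<Longrightarrow> (\<Sum>i<N. part_fun \<alpha> i) = sum_list \<alpha>"
proof -
  assume "length \<alpha> \<le> N"
  then have "(\<Sum>i<N. part_fun \<alpha> i) = (\<Sum>i<length \<alpha>. part_fun \<alpha> i)"
    by (intro sum.mono_neutral_right) (auto simp: part_fun_def)
  then show ?thesis by (simp add: sum_list_sum_nth atLeast0LessThan part_fun_def)
qed

lemma card_diagram_row: "card {x \<in> diagram \<alpha>. fst x = i} = part_fun \<alpha> i"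
proof -
  have "{x \<in> diagram \<alpha>. fst x = i} = (\<lambda>j. (i, j)) ` {..<part_fun \<alpha> i}"
    by (auto simp: diagram_part_fun)
  then show ?thesis by (simp add: card_image inj_on_def)
qed

lemma finite_diagram [simp]: "finite (diagram \<alpha>)"
proof -
  have "diagram \<alpha> = (SIGMA i:{..<length \<alpha>}. {..<\<alpha> ! i})" by (auto simp: diagram_def)
  then show ?thesis by simp
qed

lemma card_diagram: "card (diagram \<alpha>) = sum_list \<alpha>"
proof -
  have "diagram \<alpha> = (SIGMA i:{..<length \<alpha>}. {..<\<alpha> ! i})" by (auto simp: diagram_def)
  then show ?thesis by (simp add: sum_list_sum_nth atLeast0LessThan)
qed

lemma lessThan_of_down_closed:
  fixes A :: "nat set"
  assumes "finite A" "\<And>i j. i \<in> A \<Longrightarrow> j < i \<Longrightarrow> j \<in> A"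
  shows "A = {..<card A}"
proof (cases "A = {}")
  case False
  have "A \<subseteq> {..Max A}" using assms(1) by auto
  moreover have "{..Max A} \<subseteq> A"
    using assms(2) Max_in[OF assms(1) False] by (metis atMost_iff le_neq_implies_less subsetI)
  ultimately have "A = {..Max A}" by blast
  then show ?thesis by (metis card_atMost lessThan_Suc_atMost)
qed simp

section \<open>The Young symmetrizer of a fixed tableau and the character of its Specht
  module\<close>

locale young_tableau =
  fixes \<alpha> :: "nat list" and n :: nat and T :: "nat \<Rightarrow> nat \<times> nat"
  assumes part: "is_partition \<alpha>" and n_def: "n = sum_list \<alpha>"
    and T: "bij_betw T {..<n} (diagram \<alpha>)"
begin

definition "r0 = tabloid \<alpha> T"
definition "C = column_stabilizer \<alpha> T"
abbreviation "G \<equiv> {p. p permutes {..<n}}"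
text \<open>The row stabiliser of \<open>T\<close>.\<close>

definition "Y = {y \<in> G. r0 \<circ> y = r0}"
definition "shape i = int (part_fun \<alpha> i)"
abbreviation "Om \<equiv> words {..<n} shape"

text \<open>The matrix of the column antisymmetrizer acting on tabloids.\<close>

definition Z :: "(nat \<Rightarrow> nat) \<Rightarrow> (nat \<Rightarrow> nat) \<Rightarrow> real" where
  "Z r t = (\<Sum>q\<in>C. if r \<circ> q = t then of_int (sign q) else 0)"

text \<open>\<open>eps r\<close> is the coefficient of the polytabloid of \<open>T\<close> at the tabloid \<open>r\<close>.\<close>

definition eps :: "(nat \<Rightarrow> nat) \<Rightarrow> real" where "eps r = Z r r0"

text \<open>As a function of \<open>g\<close>, \<open>eps (r0 \<circ> g)\<close> lists the
  coefficients of a Young symmetrizer; \<open>nrm\<close> is the scalar by which its square differs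
  from it (see \<open>eps_convolution\<close>).\<close>

definition nrm :: real where "nrm = (\<Sum>y\<in>Y. \<Sum>r\<in>Om. eps (r \<circ> y) * eps r)"

text \<open>The condition under which a word survives column antisymmetrization.\<close>

definition col_inj :: "(nat \<Rightarrow> nat) \<Rightarrow> bool" where
  "col_inj w \<longleftrightarrow> (\<forall>a<n. \<forall>b<n. snd (T a) = snd (T b) \<longrightarrow> w a = w b \<longrightarrow> a = b)"

lemma finG [simp]: "finite G" using finite_permutations by blast

lemma C_iff: "q \<in> C \<longleftrightarrow> q permutes {..<n} \<and> (\<forall>k<n. snd (T (q k)) = snd (T k))"
  by (simp add: C_def column_stabilizer_def n_def)

lemma C_sub: "C \<subseteq> G" by (auto simp: C_iff)
lemma finC [simp]: "finite C" using finite_subset[OF C_sub finG] .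
lemma finY [simp]: "finite Y" unfolding Y_def by simp

lemma perm_less: "p permutes {..<n} \<Longrightarrow> p k < n \<longleftrightarrow> k < n"
  using permutes_in_image[of p "{..<n}" k] by simp

lemma C_id: "id \<in> C" by (simp add: C_iff permutes_id)
lemma C_comp: "p \<in> C \<Longrightarrow> q \<in> C \<Longrightarrow> p \<circ> q \<in> C"
  by (auto simp: C_iff permutes_compose perm_less)
lemma C_inv: "p \<in> C \<Longrightarrow> inv p \<in> C"
proof -
  assume p: "p \<in> C"
  then have p': "p permutes {..<n}" by (simp add: C_iff)
  have "snd (T (inv p k)) = snd (T k)" if "k < n" for k
    using p that perm_less[OF permutes_inv[OF p']] permutes_inverses(1)[OF p', of k]
    unfolding C_iff by metis
  then show ?thesis using p' by (simp add: C_iff permutes_inv)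
qed

lemma Cpermutes: "q \<in> C \<Longrightarrow> q permutes {..<n}" by (simp add: C_iff)
lemma Ypermutes: "q \<in> Y \<Longrightarrow> q permutes {..<n}" by (simp add: Y_def)

lemma sign_comp: "p permutes {..<n} \<Longrightarrow> q permutes {..<n} \<Longrightarrow> sign (p \<circ> q) = sign p * sign q"
  using sign_compose permutation_permutes finite_lessThan by blast
lemma sign_inv: "p permutes {..<n} \<Longrightarrow> sign (inv p) = sign p"
  using sign_inverse permutation_permutes finite_lessThan by blast

lemma comp_inv: "p permutes {..<n} \<Longrightarrow> p (inv p x) = x" "p permutes {..<n} \<Longrightarrow> inv p (p x) = x"
  by (simp_all add: permutes_inverses)

lemma comp_eq_iff: "p permutes {..<n} \<Longrightarrow> r \<circ> p = t \<longleftrightarrow> r = t \<circ> inv p"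
  by (auto simp: fun_eq_iff comp_inv) (metis comp_inv(1))

lemma r0_apply: "r0 k = (if k < n then fst (T k) else undefined)"
  by (simp add: r0_def tabloid_def n_def)

lemma T_in: "k < n \<Longrightarrow> T k \<in> diagram \<alpha>" using T by (auto simp: bij_betw_def)
lemma T_inj: "a < n \<Longrightarrow> b < n \<Longrightarrow> T a = T b \<Longrightarrow> a = b" using T by (auto simp: bij_betw_def inj_on_def)

lemma r0_in: "r0 \<in> Om"
proof -
  have "card {k \<in> {..<n}. r0 k = i} = part_fun \<alpha> i" for i
  proof -
    have "bij_betw T {k \<in> {..<n}. r0 k = i} {x \<in> diagram \<alpha>. fst x = i}"
    proof (rule bij_betw_subset[OF T])
      show "{k \<in> {..<n}. r0 k = i} \<subseteq> {..<n}" by auto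
      have "T ` {k \<in> {..<n}. r0 k = i} = {x \<in> T ` {..<n}. fst x = i}" by (auto simp: r0_apply)
      also have "T ` {..<n} = diagram \<alpha>" using T by (simp add: bij_betw_def)
      finally show "T ` {k \<in> {..<n}. r0 k = i} = {x \<in> diagram \<alpha>. fst x = i}" .
    qed
    then show ?thesis using card_diagram_row[of \<alpha> i] by (simp add: bij_betw_same_card)
  qed
  then show ?thesis by (auto simp: words_def shape_def content_def r0_apply extensional_def)
qed

lemma Om_comp: "r \<in> Om \<Longrightarrow> g permutes {..<n} \<Longrightarrow> r \<circ> g \<in> Om"
  by (simp add: words_comp)

text \<open>Row and column stabilisers meet trivially, since a cell is determined by its row and its
  column.\<close>

lemma YC: "q \<in> C \<Longrightarrow> r0 \<circ> q = r0 \<Longrightarrow> q = id"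
proof
  fix k assume q: "q \<in> C" "r0 \<circ> q = r0"
  show "q k = id k"
  proof (cases "k < n")
    case True
    then have "q k < n" using q C_iff perm_less by blast
    moreover have "fst (T (q k)) = fst (T k)"
      using fun_cong[OF q(2), of k] True \<open>q k < n\<close> by (simp add: r0_apply)
    ultimately show ?thesis using T_inj[of "q k" k] True q C_iff by (simp add: prod_eq_iff)
  next
    case False then show ?thesis using q by (auto simp: C_iff permutes_def)
  qed
qed

definition "Col j = {k. k < n \<and> snd (T k) = j}"

lemma finCol [simp]: "finite (Col j)" by (simp add: Col_def)

lemma row_image_Col: "(fst \<circ> T) ` Col j = {..<card (Col j)}" and inj_Col: "inj_on (fst \<circ> T) (Col j)"
proof -
  show inj: "inj_on (fst \<circ> T) (Col j)"
    by (auto simp: inj_on_def Col_def prod_eq_iff intro!: T_inj)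
  have "i' \<in> (fst \<circ> T) ` Col j" if i: "i \<in> (fst \<circ> T) ` Col j" "i' < i" for i i'
  proof -
    obtain k where k: "k < n" "snd (T k) = j" "i = fst (T k)" using i(1) by (auto simp: Col_def)
    have "(i, j) \<in> diagram \<alpha>" using T_in[OF k(1)] k by (metis prod.collapse)
    then have "(i', j) \<in> diagram \<alpha>"
      using part_fun_antitone[OF part, of i' i] i(2) by (auto simp: diagram_part_fun)
    then have "(i', j) \<in> T ` {..<n}" using T by (simp add: bij_betw_def)
    then obtain k' where k': "k' < n" "T k' = (i', j)" by auto
    then show ?thesis by (intro image_eqI[of _ _ k']) (simp_all add: Col_def)
  qed
  then have "(fst \<circ> T) ` Col j = {..<card ((fst \<circ> T) ` Col j)}"
    by (intro lessThan_of_down_closed) auto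
  then show "(fst \<circ> T) ` Col j = {..<card (Col j)}" using card_image[OF inj] by simp
qed

lemma card_Col_rows: "card {k \<in> Col j. fst (T k) < i} = min (card (Col j)) i"
proof -
  have "card {k \<in> Col j. fst (T k) < i} = card ((fst \<circ> T) ` {k \<in> Col j. fst (T k) < i})"
    by (intro card_image[symmetric] inj_on_subset[OF inj_Col]) auto
  also have "(fst \<circ> T) ` {k \<in> Col j. fst (T k) < i} = (fst \<circ> T) ` Col j \<inter> {..<i}" by auto
  also have "\<dots> = {..<min (card (Col j)) i}" unfolding row_image_Col by auto
  finally show ?thesis by simp
qed

lemma card_Col_word:
  assumes "col_inj w" shows "card {k \<in> Col j. w k < i} \<le> min (card (Col j)) i"
proof -
  have "card {k \<in> Col j. w k < i} = card (w ` {k \<in> Col j. w k < i})"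
    using assms by (intro card_image[symmetric]) (auto simp: inj_on_def col_inj_def Col_def)
  also have "\<dots> \<le> card {..<i}" by (intro card_mono) auto
  finally have "card {k \<in> Col j. w k < i} \<le> i" by simp
  moreover have "card {k \<in> Col j. w k < i} \<le> card (Col j)" by (intro card_mono) auto
  ultimately show ?thesis by simp
qed

lemma card_split_Col:
  "card {k. k < n \<and> P k} = (\<Sum>j\<in>snd ` T ` {..<n}. card {k \<in> Col j. P k})"
proof -
  have "{k. k < n \<and> P k} = (\<Union>j\<in>snd ` T ` {..<n}. {k \<in> Col j. P k})" by (auto simp: Col_def)
  also have "card \<dots> = (\<Sum>j\<in>snd ` T ` {..<n}. card {k \<in> Col j. P k})"
    by (intro card_UN_disjoint) (auto simp: Col_def)
  finally show ?thesis .
qed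

lemma shape_partial_sum: "(\<Sum>l<i. shape l) = int (card {k. k < n \<and> fst (T k) < i})"
proof -
  have "{k \<in> {..<n}. r0 k < i} = {k. k < n \<and> fst (T k) < i}" by (auto simp: r0_apply)
  then show ?thesis using partial_sum_words[OF _ r0_in, of i] by simp
qed

text \<open>A column with distinct letters has at most \<open>min (card (Col j)) i\<close> letters
  below \<open>i\<close>, and the row numbers of the tableau attain this bound in every column.
  Summing over the columns gives dominance.\<close>

lemma col_inj_dominance:
  assumes "w \<in> words {..<n} \<beta>" "col_inj w"
  shows "(\<Sum>l<i. \<beta> l) \<le> (\<Sum>l<i. shape l)"
proof -
  have "(\<Sum>l<i. \<beta> l) = int (card {k. k < n \<and> w k < i})"
    using partial_sum_words[OF _ assms(1), of i] by simp
  also have "\<dots> \<le> int (card {k. k < n \<and> fst (T k) < i})"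
    unfolding card_split_Col of_nat_le_iff using card_Col_word[OF assms(2)] card_Col_rows
    by (intro sum_mono) simp
  finally show ?thesis using shape_partial_sum by simp
qed

text \<open>Equal contents force equality in every column of the estimate behind
  \<open>col_inj_dominance\<close>. With \<open>i\<close> the length of a column, this shows that
  the column carries exactly the letters below its length, just as in \<open>r0\<close>; so
  \<open>w\<close> arises from \<open>r0\<close> by permuting within columns.\<close>

lemma col_inj_in_orbit:
  assumes "w \<in> Om" "col_inj w"
  obtains q where "q \<in> C" "w = r0 \<circ> q"
proof -
  have small: "w k < card (Col (snd (T k)))" if k: "k < n" for k
  proof -
    let ?j = "snd (T k)" let ?i = "card (Col ?j)"
    have "card {k. k < n \<and> w k < ?i} = card {k. k < n \<and> fst (T k) < ?i}"
      using partial_sum_words[OF _ assms(1), of ?i] shape_partial_sum[of ?i] by simp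
    then have "(\<Sum>j\<in>snd ` T ` {..<n}. card {k \<in> Col j. w k < ?i}) =
      (\<Sum>j\<in>snd ` T ` {..<n}. min (card (Col j)) ?i)"
      unfolding card_split_Col card_Col_rows .
    then have "card {k \<in> Col ?j. w k < ?i} = min (card (Col ?j)) ?i"
      by (rule sum_mono_inv) (use card_Col_word[OF assms(2)] k in auto)
    then have "{k \<in> Col ?j. w k < ?i} = Col ?j" by (intro card_subset_eq) auto
    then show ?thesis using k by (auto simp: Col_def)
  qed
  have inD: "(w k, snd (T k)) \<in> T ` {..<n}" if k: "k < n" for k
  proof -
    have "w k \<in> (fst \<circ> T) ` Col (snd (T k))" using small[OF k] row_image_Col by simp
    then obtain k' where "k' < n" "snd (T k') = snd (T k)" "w k = fst (T k')" by (auto simp: Col_def)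
    then show ?thesis by (intro image_eqI[of _ _ k']) (simp_all add: prod_eq_iff)
  qed
  define q where "q k = (if k < n then inv_into {..<n} T (w k, snd (T k)) else k)" for k
  have q: "q k < n" "T (q k) = (w k, snd (T k))" if "k < n" for k
    using that inv_into_into[OF inD[OF that]] f_inv_into_f[OF inD[OF that]] by (simp_all add: q_def)
  have inj: "inj_on q {..<n}"
  proof (rule inj_onI)
    fix a b assume "a \<in> {..<n}" "b \<in> {..<n}" "q a = q b"
    then show "a = b" using q[of a] q[of b] assms(2) unfolding col_inj_def by auto
  qed
  have "q ` {..<n} = {..<n}"
    using inj q by (intro endo_inj_surj) auto
  then have "q permutes {..<n}"
    using inj by (intro bij_imp_permutes) (auto simp: bij_betw_def q_def)
  then have "q \<in> C" using q by (simp add: C_iff)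
  moreover have "w = r0 \<circ> q"
  proof
    fix k show "w k = (r0 \<circ> q) k"
      using q[of k] assms(1) by (cases "k < n") (auto simp: r0_apply q_def words_def extensional_def)
  qed
  ultimately show ?thesis using that by blast
qed

lemma sum_C_inv: "(\<Sum>q\<in>C. f q) = (\<Sum>q\<in>C. f (inv q))"
  by (rule sum.reindex_bij_witness[where i = inv and j = inv])
     (auto simp: C_inv permutes_inv_inv[OF Cpermutes])

lemma comp_cancel:
  assumes "p permutes {..<n}"
  shows "inv p \<circ> (p \<circ> q) = q" "p \<circ> (inv p \<circ> q) = q" "t \<circ> p \<circ> inv p = t" "t \<circ> inv p \<circ> p = t"
  using assms by (simp_all add: fun_eq_iff comp_inv)

lemma sum_C_left: "a \<in> C \<Longrightarrow> (\<Sum>q\<in>C. f q) = (\<Sum>q\<in>C. f (a \<circ> q))"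
  by (rule sum.reindex_bij_witness[where i = "\<lambda>q. a \<circ> q" and j = "\<lambda>q. inv a \<circ> q"])
     (auto simp: C_inv C_comp comp_cancel[OF Cpermutes])

lemma sum_C_right: "a \<in> C \<Longrightarrow> (\<Sum>q\<in>C. f q) = (\<Sum>q\<in>C. f (q \<circ> a))"
  by (rule sum.reindex_bij_witness[where i = "\<lambda>q. q \<circ> a" and j = "\<lambda>q. q \<circ> inv a"])
     (auto simp: C_inv C_comp comp_cancel[OF Cpermutes])

lemma Z_commute: "Z r t = Z t r"
proof -
  have "Z r t = (\<Sum>q\<in>C. if r \<circ> inv q = t then of_int (sign (inv q)) else 0)"
    unfolding Z_def by (rule sum_C_inv)
  also have "\<dots> = Z t r" unfolding Z_def
  proof (rule sum.cong)
    fix q assume "q \<in> C"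
    then have q: "q permutes {..<n}" by (rule Cpermutes)
    have "r \<circ> inv q = t \<longleftrightarrow> t \<circ> q = r" using comp_eq_iff[OF q, of t r] by auto
    then show "(if r \<circ> inv q = t then of_int (sign (inv q)) else 0) =
      (if t \<circ> q = r then of_int (sign q) else 0 :: real)" by (simp add: sign_inv[OF q])
  qed simp
  finally show ?thesis .
qed

text \<open>The transposition of two equal letters in one column lies in \<open>C\<close>, fixes
  \<open>w\<close> and reverses the sign.\<close>

lemma Z_not_col_inj:
  assumes "\<not> col_inj w" shows "Z w t = 0"
proof -
  obtain a b where ab: "a < n" "b < n" "snd (T a) = snd (T b)" "w a = w b" "a \<noteq> b"
    using assms by (auto simp: col_inj_def)
  let ?t = "Transposition.transpose a b"
  have t: "?t \<in> C" using ab by (auto simp: C_iff permutes_swap_id Transposition.transpose_def)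
  have w: "w \<circ> ?t = w" using ab by (auto simp: fun_eq_iff Transposition.transpose_def)
  have "Z w t = (\<Sum>q\<in>C. if w \<circ> (?t \<circ> q) = t then of_int (sign (?t \<circ> q)) else 0)"
    unfolding Z_def by (rule sum_C_left[OF t])
  also have "\<dots> = (\<Sum>q\<in>C. - (if w \<circ> q = t then of_int (sign q) else 0))"
    using ab w t by (intro sum.cong)
      (auto simp: o_assoc sign_comp[OF Cpermutes[OF t] Cpermutes] sign_swap_id)
  also have "\<dots> = - Z w t" unfolding Z_def by (simp add: sum_negf)
  finally show ?thesis by simp
qed

lemma Z_orbit:
  assumes "a \<in> C" shows "Z r (t \<circ> a) = of_int (sign a) * Z r t"
proof -
  have "Z r (t \<circ> a) = (\<Sum>q\<in>C. if r \<circ> (q \<circ> a) = t \<circ> a then of_int (sign (q \<circ> a)) else 0)"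
    unfolding Z_def by (rule sum_C_right[OF assms])
  also have "\<dots> = (\<Sum>q\<in>C. of_int (sign a) * (if r \<circ> q = t then of_int (sign q) else 0))"
  proof (rule sum.cong)
    fix q assume q: "q \<in> C"
    have "r \<circ> (q \<circ> a) = t \<circ> a \<longleftrightarrow> r \<circ> q = t"
      using permutes_surj[OF Cpermutes[OF assms]] by (metis fun.map_comp surj_fun_eq o_assoc)
    then show "(if r \<circ> (q \<circ> a) = t \<circ> a then of_int (sign (q \<circ> a)) else 0) =
       of_int (sign a) * (if r \<circ> q = t then of_int (sign q) else 0 :: real)"
      using sign_comp[OF Cpermutes[OF q] Cpermutes[OF assms]] by simp
  qed simp
  finally show ?thesis by (simp add: Z_def sum_distrib_left)
qed

lemma eps_r0: "eps r0 = 1"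
proof -
  have "eps r0 = (\<Sum>q\<in>{id}. if r0 \<circ> q = r0 then of_int (sign q) else 0)"
    unfolding eps_def Z_def by (rule sum.mono_neutral_right) (use YC C_id in auto)
  then show ?thesis by (simp add: sign_id)
qed

text \<open>The column antisymmetrizer has rank one on tabloids: a tabloid is either killed or lies
  in the column orbit of \<open>r0\<close>, where it only contributes a sign. This is the fact
  behind the irreducibility of Specht modules.\<close>

lemma Z_eq:
  assumes "t \<in> Om" shows "Z r t = eps t * eps r"
proof (cases "col_inj t")
  case False
  then show ?thesis using Z_not_col_inj[of t] Z_commute[of r t] eps_def by simp
next
  case True
  then obtain a where a: "a \<in> C" "t = r0 \<circ> a" using col_inj_in_orbit[OF assms] by blast
  have "eps t = of_int (sign a) * eps r0"
    unfolding eps_def a(2) using Z_orbit[OF a(1), of r0 r0] Z_commute by metis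
  moreover have "Z r t = of_int (sign a) * eps r" unfolding a(2) eps_def by (rule Z_orbit[OF a(1)])
  ultimately show ?thesis using eps_r0 by simp
qed

lemma eps_eq_0: "r \<notin> Om \<Longrightarrow> eps r = 0"
proof -
  assume r: "r \<notin> Om"
  have "r \<circ> q \<noteq> r0" if "q \<in> C" for q
    using Om_comp[OF r0_in permutes_inv[OF Cpermutes[OF that]]] r comp_eq_iff[OF Cpermutes[OF that], of r r0] by metis
  then show ?thesis unfolding eps_def Z_def by simp
qed

lemma sum_C_Om:
  assumes "r \<in> Om"
  shows "(\<Sum>q\<in>C. of_int (sign q) * \<Phi> (r \<circ> q)) = (\<Sum>t\<in>Om. \<Phi> t * eps t) * eps r"
proof -
  have "(\<Sum>q\<in>C. of_int (sign q) * \<Phi> (r \<circ> q)) =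
     (\<Sum>q\<in>C. \<Sum>t\<in>Om. \<Phi> t * (if r \<circ> q = t then of_int (sign q) else 0))"
    using assms Cpermutes Om_comp by (intro sum.cong) (auto simp: sum.delta' if_distrib cong: if_cong)
  also have "\<dots> = (\<Sum>t\<in>Om. \<Phi> t * Z r t)"
    unfolding Z_def by (subst sum.swap) (simp add: sum_distrib_left)
  also have "\<dots> = (\<Sum>t\<in>Om. \<Phi> t * (eps t * eps r))" using Z_eq by simp
  finally show ?thesis by (simp add: sum_distrib_right mult.assoc)
qed

lemma Y_inv: "y \<in> Y \<Longrightarrow> inv y \<in> Y"
  using comp_eq_iff[of y r0 r0] by (auto simp: Y_def permutes_inv)

lemma sum_Y_inv: "(\<Sum>q\<in>Y. f q) = (\<Sum>q\<in>Y. f (inv q))"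
  by (rule sum.reindex_bij_witness[where i = inv and j = inv])
     (auto simp: Y_inv permutes_inv_inv[OF Ypermutes])

text \<open>Unfolds the symmetrizer: \<open>g\<close> carries weight only when it has the form
  \<open>y \<circ> inv q\<close> with \<open>y\<close> in the row and \<open>q\<close> in the column
  stabiliser, and then the weight is the sign of \<open>q\<close>.\<close>

lemma sum_eps_weight:
  "(\<Sum>g\<in>G. eps (r0 \<circ> g) * \<Phi> g) = (\<Sum>y\<in>Y. \<Sum>q\<in>C. of_int (sign q) * \<Phi> (y \<circ> inv q))"
proof -
  have "(\<Sum>g\<in>G. eps (r0 \<circ> g) * \<Phi> g) = (\<Sum>g\<in>G. \<Sum>q\<in>C. if r0 \<circ> g \<circ> q = r0 then of_int (sign q) * \<Phi> g else 0)"
    unfolding eps_def Z_def sum_distrib_right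
    by (rule sum.cong[OF refl], rule sum.cong[OF refl]) simp
  also have "\<dots> = (\<Sum>q\<in>C. \<Sum>g\<in>G. if r0 \<circ> g \<circ> q = r0 then of_int (sign q) * \<Phi> g else 0)" by (rule sum.swap)
  also have "\<dots> = (\<Sum>q\<in>C. \<Sum>y\<in>Y. of_int (sign q) * \<Phi> (y \<circ> inv q))"
  proof (rule sum.cong)
    fix q assume q: "q \<in> C"
    have "(\<Sum>g\<in>G. if r0 \<circ> g \<circ> q = r0 then of_int (sign q) * \<Phi> g else 0) =
      (\<Sum>g\<in>{g \<in> G. r0 \<circ> g \<circ> q = r0}. of_int (sign q) * \<Phi> g)"
      by (rule sum.inter_filter[symmetric]) simp
    also have "\<dots> = (\<Sum>y\<in>Y. of_int (sign q) * \<Phi> (y \<circ> inv q))"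
    proof (rule sum.reindex_bij_witness[where i = "\<lambda>y. y \<circ> inv q" and j = "\<lambda>g. g \<circ> q"])
      note qp = Cpermutes[OF q]
      fix g assume g: "g \<in> {g \<in> G. r0 \<circ> g \<circ> q = r0}"
      show 1: "g \<circ> q \<circ> inv q = g" by (simp add: fun_eq_iff comp_inv[OF qp])
      show "g \<circ> q \<in> Y" using g qp by (auto simp: Y_def o_assoc permutes_compose)
      show "of_int (sign q) * \<Phi> (g \<circ> q \<circ> inv q) = of_int (sign q) * \<Phi> g" using 1 by simp
    next
      note qp = Cpermutes[OF q]
      fix y assume y: "y \<in> Y"
      show 1: "y \<circ> inv q \<circ> q = y" by (simp add: fun_eq_iff comp_inv[OF qp])
      show "y \<circ> inv q \<in> {g \<in> G. r0 \<circ> g \<circ> q = r0}" using y qp 1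
        by (auto simp: Y_def permutes_compose permutes_inv) (metis fun.map_comp)
    qed
    finally show "(\<Sum>g\<in>G. if r0 \<circ> g \<circ> q = r0 then of_int (sign q) * \<Phi> g else 0) =
       (\<Sum>y\<in>Y. of_int (sign q) * \<Phi> (y \<circ> inv q))" .
  qed simp
  finally show ?thesis by (subst sum.swap) 
qed

text \<open>The Young symmetrizer squares to \<open>nrm\<close> times itself: after unfolding one
  factor, the sum over \<open>C\<close> collapses by the rank-one property in the form
  \<open>sum_C_Om\<close>.\<close>

lemma eps_convolution: "(\<Sum>g\<in>G. eps (r0 \<circ> g) * eps (r \<circ> inv g)) = nrm * eps r"
proof (cases "r \<in> Om")
  case False
  have "eps (r \<circ> inv g) = 0" if "g \<in> G" for g
    using False Om_comp[of "r \<circ> inv g" g] that by (intro eps_eq_0) (auto simp: comp_cancel)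
  then show ?thesis using eps_eq_0[OF False] by simp
next
  case True
  have "(\<Sum>g\<in>G. eps (r0 \<circ> g) * eps (r \<circ> inv g)) =
     (\<Sum>y\<in>Y. \<Sum>q\<in>C. of_int (sign q) * eps (r \<circ> inv (y \<circ> inv q)))" by (rule sum_eps_weight)
  also have "\<dots> = (\<Sum>y\<in>Y. \<Sum>q\<in>C. of_int (sign q) * eps (r \<circ> q \<circ> inv y))"
    by (rule sum.cong[OF refl], rule sum.cong[OF refl])
       (simp add: o_inv_distrib permutes_inv_inv[OF Cpermutes]
        permutes_bij[OF Ypermutes] permutes_bij[OF permutes_inv[OF Cpermutes]] o_assoc)
  also have "\<dots> = (\<Sum>y\<in>Y. \<Sum>q\<in>C. of_int (sign q) * eps (r \<circ> q \<circ> y))"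
    by (subst sum_Y_inv) (simp add: permutes_inv_inv[OF Ypermutes])
  also have "\<dots> = (\<Sum>y\<in>Y. (\<Sum>t\<in>Om. eps (t \<circ> y) * eps t) * eps r)"
    by (intro sum.cong refl sum_C_Om[OF True, of "\<lambda>t. eps (t \<circ> y)" for y])
  finally show ?thesis by (simp add: nrm_def sum_distrib_right)
qed

text \<open>Row symmetrization turns \<open>nrm\<close> into a sum of squares: for \<open>v\<close>,
  the sum of the translates of \<open>eps\<close> under \<open>Y\<close>, the squared norm of
  \<open>v\<close> is \<open>card Y * nrm\<close>, and \<open>v r0 = card Y\<close> is
  nonzero.\<close>

lemma nrm_pos: "nrm > 0"
proof -
  define v where "v r = (\<Sum>y\<in>Y. eps (r \<circ> y))" for r
  have Yc: "y \<circ> y' \<in> Y" if "y \<in> Y" "y' \<in> Y" for y y'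
    using that by (auto simp: Y_def permutes_compose o_assoc)
  have v_inv: "v (r \<circ> y') = v r" if "y' \<in> Y" for r y'
    unfolding v_def
    by (rule sum.reindex_bij_witness[where i = "\<lambda>y. inv y' \<circ> y" and j = "\<lambda>y. y' \<circ> y"])
       (use that in \<open>auto simp: comp_cancel[OF Ypermutes] Y_inv Yc o_assoc[symmetric] simp del: o_apply\<close>)
  have n1: "nrm = (\<Sum>r\<in>Om. v r * eps r)"
    unfolding nrm_def v_def by (subst sum.swap) (simp add: sum_distrib_right)
  have n2: "nrm = (\<Sum>r\<in>Om. v r * eps (r \<circ> y))" if y: "y \<in> Y" for y
  proof -
    have "nrm = (\<Sum>r\<in>Om. v (r \<circ> y) * eps (r \<circ> y))" unfolding n1
      by (rule sum.reindex_bij_witness[where i = "\<lambda>r. r \<circ> y" and j = "\<lambda>r. r \<circ> inv y"])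
         (use y in \<open>auto simp: comp_cancel[OF Ypermutes] Om_comp Ypermutes permutes_inv\<close>)
    then show ?thesis using v_inv[OF y] by simp
  qed
  have "(\<Sum>y\<in>Y. nrm) = (\<Sum>y\<in>Y. \<Sum>r\<in>Om. v r * eps (r \<circ> y))" by (rule sum.cong[OF refl n2])
  then have "card Y * nrm = (\<Sum>y\<in>Y. \<Sum>r\<in>Om. v r * eps (r \<circ> y))" by simp
  also have "\<dots> = (\<Sum>r\<in>Om. v r * v r)"
    by (subst sum.swap) (simp add: v_def sum_distrib_left[symmetric])
  also have "\<dots> > 0"
  proof (rule sum_pos2[OF _ r0_in])
    have "v r0 = card Y" unfolding v_def using eps_r0 by (simp add: Y_def)
    moreover have "id \<in> Y" by (simp add: Y_def permutes_id)
    then have "card Y > 0" using card_gt_0_iff finY by blast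
    ultimately show "0 < v r0 * v r0" by simp
  qed auto
  finally show ?thesis by (simp add: zero_less_mult_iff)
qed

text \<open>Up to the factor \<open>nrm\<close>, the coefficients of the Young symmetrizer summed
  over all conjugates of \<open>p\<close>.\<close>

definition chi :: "(nat \<Rightarrow> nat) \<Rightarrow> real" where
  "chi p = (\<Sum>g\<in>G. eps (r0 \<circ> g \<circ> p \<circ> inv g)) / nrm"

text \<open>The polytabloid of \<open>T \<circ> g\<close>. Indexing by group elements turns spans
  and sums over tableaux into ones over \<open>G\<close>.\<close>

definition ptab :: "(nat \<Rightarrow> nat) \<Rightarrow> (nat \<Rightarrow> nat) \<Rightarrow> complex" where
  "ptab g r = complex_of_real (eps (r \<circ> inv g))"

lemma polytabloid_eq_ptab:
  assumes g: "g permutes {..<n}" and T': "\<And>k. k < n \<Longrightarrow> T' k = T (g k)"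
  shows "polytabloid \<alpha> T' = ptab g"
proof
  fix r
  have tab: "tabloid \<alpha> T' = r0 \<circ> g"
    using g by (auto simp: fun_eq_iff tabloid_def n_def[symmetric] r0_apply T' perm_less restrict_def)
  have gi: "inv g permutes {..<n}" using g by (rule permutes_inv)
  have cs: "column_stabilizer \<alpha> T' = {p. p permutes {..<n} \<and> (\<forall>k<n. snd (T (g (p k))) = snd (T (g k)))}"
    unfolding column_stabilizer_def n_def[symmetric] by (auto simp: T' perm_less)
  have "polytabloid \<alpha> T' r = (\<Sum>q\<in>C. if r \<circ> inv g \<circ> q = r0 then of_int (sign q) else 0)"
    unfolding polytabloid_def cs tab
  proof (rule sum.reindex_bij_witness[where i = "\<lambda>q. inv g \<circ> q \<circ> g" and j = "\<lambda>p. g \<circ> p \<circ> inv g"])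
    fix p assume "p \<in> {p. p permutes {..<n} \<and> (\<forall>k<n. snd (T (g (p k))) = snd (T (g k)))}"
    then have p: "p permutes {..<n}" "\<And>k. k < n \<Longrightarrow> snd (T (g (p k))) = snd (T (g k))" by auto
    show "inv g \<circ> (g \<circ> p \<circ> inv g) \<circ> g = p" by (simp add: fun_eq_iff comp_inv[OF g])
    show "g \<circ> p \<circ> inv g \<in> C"
      using p perm_less[OF gi] by (auto simp: C_iff comp_inv[OF g] intro!: permutes_compose g gi)
    have s: "sign (g \<circ> p \<circ> inv g) = sign p"
      by (simp add: sign_comp sign_inv g gi p permutes_compose sign_idempotent)
    have "r \<circ> inv g \<circ> (g \<circ> p \<circ> inv g) = r0 \<longleftrightarrow> r = r0 \<circ> g \<circ> inv p"
    proof -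
      have "r \<circ> inv g \<circ> (g \<circ> p \<circ> inv g) = r \<circ> p \<circ> inv g" by (simp add: fun_eq_iff comp_inv[OF g])
      moreover have "r \<circ> p \<circ> inv g = r0 \<longleftrightarrow> r \<circ> p = r0 \<circ> g"
        using comp_eq_iff[OF gi, of "r \<circ> p" r0] permutes_inv_inv[OF g] by simp
      ultimately show ?thesis using comp_eq_iff[OF p(1), of r "r0 \<circ> g"] by simp
    qed
    then show "(if r \<circ> inv g \<circ> (g \<circ> p \<circ> inv g) = r0 then of_int (sign (g \<circ> p \<circ> inv g)) else 0) =
      of_int (sign p) * (if r = r0 \<circ> g \<circ> inv p then 1 else 0 :: complex)" using s by simp
  next
    fix q assume "q \<in> C"
    then have q: "q permutes {..<n}" "\<And>k. k < n \<Longrightarrow> snd (T (q k)) = snd (T k)" by (auto simp: C_iff)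
    show "g \<circ> (inv g \<circ> q \<circ> g) \<circ> inv g = q" by (simp add: fun_eq_iff comp_inv[OF g])
    show "inv g \<circ> q \<circ> g \<in> {p. p permutes {..<n} \<and> (\<forall>k<n. snd (T (g (p k))) = snd (T (g k)))}"
      using q perm_less[OF g] by (auto simp: comp_inv[OF g] intro!: permutes_compose g gi)
  qed
  also have "\<dots> = ptab g r"
    unfolding ptab_def eps_def Z_def of_real_sum by (intro sum.cong refl) simp
  finally show "polytabloid \<alpha> T' r = ptab g r" .
qed

lemma polytabloids_eq: "polytabloid \<alpha> ` tableaux \<alpha> = ptab ` G"
proof (intro equalityI subsetI)
  fix v assume "v \<in> polytabloid \<alpha> ` tableaux \<alpha>"
  then obtain T' where T': "v = polytabloid \<alpha> T'" "bij_betw T' {..<n} (diagram \<alpha>)"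
    by (auto simp: tableaux_def n_def)
  define g where "g k = (if k < n then inv_into {..<n} T (T' k) else k)" for k
  have "bij_betw (inv_into {..<n} T \<circ> T') {..<n} {..<n}"
    using T' T bij_betw_inv_into bij_betw_trans by blast
  then have "bij_betw g {..<n} {..<n}"
    by (subst bij_betw_cong[where g = "inv_into {..<n} T \<circ> T'"]) (auto simp: g_def)
  then have g: "g permutes {..<n}" by (rule bij_imp_permutes) (simp add: g_def)
  have "T' k = T (g k)" if "k < n" for k
  proof -
    have "T' k \<in> T ` {..<n}" using that T'(2) T by (auto simp: bij_betw_def)
    then show ?thesis using that by (simp add: g_def f_inv_into_f)
  qed
  then have "v = ptab g" using T' polytabloid_eq_ptab[OF g] by auto
  then show "v \<in> ptab ` G" using g by auto
next
  fix v assume "v \<in> ptab ` G"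
  then obtain g where g: "g permutes {..<n}" "v = ptab g" by auto
  have "T \<circ> g \<in> tableaux \<alpha>"
    using bij_betw_trans[OF permutes_imp_bij[OF g(1)] T] by (simp add: tableaux_def n_def)
  moreover have "polytabloid \<alpha> (T \<circ> g) = v" using polytabloid_eq_ptab[OF g(1)] g(2) by simp
  ultimately show "v \<in> polytabloid \<alpha> ` tableaux \<alpha>" by blast
qed

lemma specht_eq: "specht_module \<alpha> = cfun.span (ptab ` G)"
  by (simp add: specht_module_def polytabloids_eq)

text \<open>The image of the indicator of the tabloid \<open>s\<close> under a projection onto the
  Specht module that is built from the Young symmetrizer.\<close>

definition ker :: "(nat \<Rightarrow> nat) \<Rightarrow> (nat \<Rightarrow> nat) \<Rightarrow> complex" where
  "ker s r = (\<Sum>g | g \<in> G \<and> r0 \<circ> g = s. ptab g r) / complex_of_real nrm"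

lemma sum_fun_apply: "(\<Sum>x\<in>A. F x) y = (\<Sum>x\<in>A. F x y)"
  for F :: "'b \<Rightarrow> 'c \<Rightarrow> complex"
  by (induction A rule: infinite_finite_induct) auto

lemma ker_in: "ker s \<in> specht_module \<alpha>"
proof -
  have "ker s = cfun_scale (1 / complex_of_real nrm) (\<Sum>g | g \<in> G \<and> r0 \<circ> g = s. ptab g)"
    by (auto simp: ker_def cfun_scale_def sum_fun_apply)
  also have "\<dots> \<in> specht_module \<alpha>" unfolding specht_eq
    by (intro cfun.span_scale cfun.span_sum cfun.span_base) auto
  finally show ?thesis .
qed

lemma sum_over_Om:
  "(\<Sum>s\<in>Om. \<Sum>g | g \<in> G \<and> r0 \<circ> g = s. f s g) = (\<Sum>g\<in>G. f (r0 \<circ> g) g)"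
proof -
  have "(\<Sum>s\<in>Om. \<Sum>g | g \<in> G \<and> r0 \<circ> g = s. f s g) = (\<Sum>s\<in>Om. \<Sum>g | g \<in> G \<and> r0 \<circ> g = s. f (r0 \<circ> g) g)"
    by (intro sum.cong) auto
  also have "\<dots> = (\<Sum>g\<in>G. f (r0 \<circ> g) g)"
    by (rule sum.group) (use r0_in Om_comp in auto)
  finally show ?thesis .
qed

text \<open>The identity is linear in \<open>v\<close>, so it has to be checked for polytabloids
  only; there it is \<open>eps_convolution\<close> after replacing \<open>g\<close> by
  \<open>g \<circ> h\<close>.\<close>

lemma specht_reproducing:
  assumes "v \<in> specht_module \<alpha>"
  shows "v = (\<Sum>s\<in>Om. cfun_scale (v s) (ker s))"
proof -
  let ?V = "{v. v = (\<Sum>s\<in>Om. cfun_scale (v s) (ker s))}"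
  have "cfun.subspace ?V"
  proof (rule cfun.subspaceI)
    show "0 \<in> ?V" by (simp add: cfun_scale_def fun_eq_iff sum_fun_apply)
  next
    fix x y assume "x \<in> ?V" "y \<in> ?V"
    then have x: "x = (\<Sum>s\<in>Om. cfun_scale (x s) (ker s))" and y: "y = (\<Sum>s\<in>Om. cfun_scale (y s) (ker s))" by simp_all
    have "(\<Sum>s\<in>Om. cfun_scale ((x + y) s) (ker s)) = (\<Sum>s\<in>Om. cfun_scale (x s) (ker s)) + (\<Sum>s\<in>Om. cfun_scale (y s) (ker s))"
      by (simp add: fun_eq_iff sum_fun_apply cfun_scale_def distrib_right sum.distrib)
    then show "x + y \<in> ?V" using x y by simp
  next
    fix c x assume "x \<in> ?V"
    then have x: "x = (\<Sum>s\<in>Om. cfun_scale (x s) (ker s))" by simp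
    have "(\<Sum>s\<in>Om. cfun_scale ((cfun_scale c x) s) (ker s)) = cfun_scale c (\<Sum>s\<in>Om. cfun_scale (x s) (ker s))"
      by (simp add: cfun.scale_sum_right, simp add: cfun_scale_def mult.assoc)
    then show "cfun_scale c x \<in> ?V" using x by simp
  qed
  moreover have "ptab ` G \<subseteq> ?V"
  proof (clarsimp, rule ext)
    fix h r assume h: "h permutes {..<n}"
    have "(\<Sum>s\<in>Om. cfun_scale (ptab h s) (ker s)) r = (\<Sum>s\<in>Om. \<Sum>g | g \<in> G \<and> r0 \<circ> g = s. ptab h s * ptab g r / nrm)"
      by (simp add: sum_fun_apply cfun_scale_def ker_def sum_divide_distrib sum_distrib_left)
    also have "\<dots> = (\<Sum>g\<in>G. ptab h (r0 \<circ> g) * ptab g r / nrm)" by (rule sum_over_Om)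
    also have "\<dots> = (\<Sum>g\<in>G. ptab h (r0 \<circ> (g \<circ> h)) * ptab (g \<circ> h) r / nrm)"
      by (rule sum_permutations_compose_right[OF h])
    also have "\<dots> = (\<Sum>g\<in>G. complex_of_real (eps (r0 \<circ> g) * eps (r \<circ> inv h \<circ> inv g))) / nrm"
      unfolding sum_divide_distrib
    proof (rule sum.cong[OF refl])
      fix g assume "g \<in> G"
      then have g: "g permutes {..<n}" by simp
      have "r0 \<circ> (g \<circ> h) \<circ> inv h = r0 \<circ> g" by (simp add: fun_eq_iff comp_inv[OF h])
      moreover have "r \<circ> inv (g \<circ> h) = r \<circ> inv h \<circ> inv g"
        using g h by (simp add: o_inv_distrib permutes_bij o_assoc)
      ultimately show "ptab h (r0 \<circ> (g \<circ> h)) * ptab (g \<circ> h) r / nrm =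
         complex_of_real (eps (r0 \<circ> g) * eps (r \<circ> inv h \<circ> inv g)) / nrm"
        unfolding ptab_def by simp
    qed
    also have "\<dots> = complex_of_real (nrm * eps (r \<circ> inv h)) / nrm"
      unfolding eps_convolution[symmetric] by simp
    also have "\<dots> = ptab h r" using nrm_pos by (simp add: ptab_def)
    finally show "ptab h r = (\<Sum>s\<in>Om. cfun_scale (ptab h s) (ker s)) r" by simp
  qed
  ultimately have "cfun.span (ptab ` G) \<subseteq> ?V" by (intro cfun.span_minimal)
  then show ?thesis using assms specht_eq by blast
qed

lemma linear_perm_act: "Vector_Spaces.linear cfun_scale cfun_scale (perm_act p)"
  by unfold_locales (auto simp: perm_act_def cfun_scale_def fun_eq_iff)

lemma perm_act_specht:
  assumes p: "p permutes {..<n}" and "v \<in> specht_module \<alpha>"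
  shows "perm_act p v \<in> specht_module \<alpha>"
proof -
  interpret l: Vector_Spaces.linear cfun_scale cfun_scale "perm_act p" by (rule linear_perm_act)
  have "perm_act p ` ptab ` G \<subseteq> ptab ` G"
  proof (clarsimp)
    fix g assume g: "g permutes {..<n}"
    have "perm_act p (ptab g) = ptab (g \<circ> inv p)"
      unfolding perm_act_def ptab_def
        o_inv_distrib[OF permutes_bij[OF g] permutes_bij[OF permutes_inv[OF p]]] permutes_inv_inv[OF p]
      by (simp add: o_assoc)
    then show "perm_act p (ptab g) \<in> ptab ` G" using g p permutes_compose permutes_inv by blast
  qed
  then have "cfun.span (perm_act p ` ptab ` G) \<subseteq> specht_module \<alpha>"
    unfolding specht_eq by (rule cfun.span_mono)
  moreover have "perm_act p v \<in> cfun.span (perm_act p ` ptab ` G)"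
    using assms(2) unfolding specht_eq l.span_image by blast
  ultimately show ?thesis by blast
qed

lemma irr_char_eq:
  assumes p: "p permutes {..<n}"
  shows "irr_char \<alpha> p = complex_of_real (chi p)"
proof -
  have "irr_char \<alpha> p = (\<Sum>s\<in>Om. perm_act p (ker s) s)"
    unfolding irr_char_def
  proof (rule cfun_trace_eq_sum_kernel)
    show "cfun.subspace (specht_module \<alpha>)" unfolding specht_eq by (rule cfun.subspace_span)
  qed (use ker_in specht_reproducing perm_act_specht[OF p] linear_perm_act in auto)
  also have "\<dots> = (\<Sum>s\<in>Om. \<Sum>g | g \<in> G \<and> r0 \<circ> g = s. ptab g (s \<circ> p) / nrm)"
    by (simp add: perm_act_def ker_def sum_divide_distrib)
  also have "\<dots> = (\<Sum>g\<in>G. ptab g (r0 \<circ> g \<circ> p) / nrm)" by (rule sum_over_Om)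
  also have "\<dots> = complex_of_real (chi p)"
    by (simp add: chi_def ptab_def sum_divide_distrib)
  finally show ?thesis .
qed

lemma class_fun_chi: "class_fun n chi"
  unfolding class_fun_def
proof (intro allI impI)
  fix p h assume p: "p permutes {..<n}" and h: "h permutes {..<n}"
  have "(\<Sum>g\<in>G. eps (r0 \<circ> g \<circ> p \<circ> inv g)) = (\<Sum>g\<in>G. eps (r0 \<circ> (g \<circ> h) \<circ> p \<circ> inv (g \<circ> h)))"
    by (rule sum_permutations_compose_right[OF h])
  also have "\<dots> = (\<Sum>g\<in>G. eps (r0 \<circ> g \<circ> (h \<circ> p \<circ> inv h) \<circ> inv g))"
    using h by (intro sum.cong refl) (simp add: o_inv_distrib permutes_bij o_assoc)
  finally show "chi (h \<circ> p \<circ> inv h) = chi p" by (simp add: chi_def)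
qed

text \<open>Against a class function the averaging over conjugates inside \<open>chi\<close> has no
  effect, so the bare symmetrizer coefficients may take its place.\<close>

lemma chi_ip:
  assumes F: "class_fun n F"
  shows "char_ip n chi F = (\<Sum>p\<in>G. eps (r0 \<circ> p) * F p) / nrm"
proof -
  have "(\<Sum>p\<in>G. chi p * F p) = (\<Sum>g\<in>G. \<Sum>p\<in>G. eps (r0 \<circ> (g \<circ> p \<circ> inv g)) * F p) / nrm"
    by (subst sum.swap) (simp add: chi_def sum_distrib_right sum_divide_distrib o_assoc)
  also have "\<dots> = (\<Sum>g\<in>G. \<Sum>p\<in>G. eps (r0 \<circ> p) * F p) / nrm"
  proof -
    have "(\<Sum>p\<in>G. eps (r0 \<circ> (g \<circ> p \<circ> inv g)) * F p) = (\<Sum>p\<in>G. eps (r0 \<circ> p) * F p)" if "g \<in> G" for g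
    proof -
      have "(\<Sum>p\<in>G. eps (r0 \<circ> p) * F p) = (\<Sum>p\<in>G. eps (r0 \<circ> (g \<circ> p \<circ> inv g)) * F (g \<circ> p \<circ> inv g))"
        using that by (intro sum_perm_conj) simp
      then show ?thesis using F that by (simp add: class_fun_def)
    qed
    then show ?thesis by simp
  qed
  also have "\<dots> = fact n * (\<Sum>p\<in>G. eps (r0 \<circ> p) * F p) / nrm"
    using card_permutations[of "{..<n}" n] by simp
  finally show ?thesis by (simp add: char_ip_def)
qed

lemma sum_eps_perm_char:
  "(\<Sum>p\<in>G. eps (r0 \<circ> p) * perm_char {..<n} \<beta> p) = (\<Sum>w\<in>words {..<n} \<beta>. \<Sum>y\<in>Y. Z w (w \<circ> y))"
proof -
  have "(\<Sum>p\<in>G. eps (r0 \<circ> p) * perm_char {..<n} \<beta> p) =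
    (\<Sum>w\<in>words {..<n} \<beta>. \<Sum>p\<in>G. eps (r0 \<circ> p) * (if w \<circ> p = w then 1 else 0))"
    by (subst sum.swap) (simp add: perm_char_eq_sum sum_distrib_left)
  also have "\<dots> = (\<Sum>w\<in>words {..<n} \<beta>. \<Sum>y\<in>Y. Z w (w \<circ> y))"
  proof (rule sum.cong[OF refl])
    fix w :: "nat \<Rightarrow> nat"
    have "(\<Sum>p\<in>G. eps (r0 \<circ> p) * (if w \<circ> p = w then 1 else 0)) =
       (\<Sum>y\<in>Y. \<Sum>q\<in>C. of_int (sign q) * (if w \<circ> (y \<circ> inv q) = w then 1 else 0))"
      by (rule sum_eps_weight)
    also have "\<dots> = (\<Sum>y\<in>Y. Z w (w \<circ> y))" unfolding Z_def
    proof (rule sum.cong[OF refl], rule sum.cong[OF refl])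
      fix y q assume "q \<in> C"
      then have "w \<circ> (y \<circ> inv q) = w \<longleftrightarrow> w \<circ> q = w \<circ> y"
        using comp_eq_iff[OF Cpermutes, of q w "w \<circ> y"] by (auto simp: o_assoc)
      then show "of_int (sign q) * (if w \<circ> (y \<circ> inv q) = w then 1 else 0) =
         (if w \<circ> q = w \<circ> y then of_int (sign q) else 0 :: real)" by simp
    qed
    finally show "(\<Sum>p\<in>G. eps (r0 \<circ> p) * (if w \<circ> p = w then 1 else 0)) = (\<Sum>y\<in>Y. Z w (w \<circ> y))" .
  qed
  finally show ?thesis .
qed

text \<open>A word whose content is not dominated by the shape repeats a letter in some column, so
  all its entries \<open>Z\<close> vanish.\<close>

lemma chi_ip_perm_char_0:
  assumes "(\<Sum>l<i. \<beta> l) > (\<Sum>l<i. shape l)"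
  shows "char_ip n chi (perm_char {..<n} \<beta>) = 0"
proof -
  have "Z w t = 0" if "w \<in> words {..<n} \<beta>" for w t
    using col_inj_dominance[OF that, of i] assms Z_not_col_inj[of w] by force
  then show ?thesis by (simp add: chi_ip[OF class_fun_perm_char] sum_eps_perm_char)
qed

text \<open>For words with the content of the shape, the rank-one form of \<open>Z\<close>
  reproduces exactly the sum that defines \<open>nrm\<close>.\<close>

lemma chi_ip_shape: "char_ip n chi (perm_char {..<n} shape) = 1"
proof -
  have "(\<Sum>w\<in>Om. \<Sum>y\<in>Y. Z w (w \<circ> y)) = (\<Sum>w\<in>Om. \<Sum>y\<in>Y. eps (w \<circ> y) * eps w)"
    using Z_eq Om_comp Ypermutes by simp
  also have "\<dots> = nrm" unfolding nrm_def by (rule sum.swap)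
  finally show ?thesis using nrm_pos by (simp add: chi_ip[OF class_fun_perm_char] sum_eps_perm_char)
qed

text \<open>The rank-one property collapses the antisymmetrizer, \<open>eps_convolution\<close>
  collapses the sum over \<open>g\<close> to a factor \<open>nrm\<close>, and what is left is the
  sum defining \<open>nrm\<close>. The two factors cancel the two normalizations.\<close>

lemma chi_ip_chi: "char_ip n chi chi = 1"
proof -
  have "(\<Sum>p\<in>G. eps (r0 \<circ> p) * chi p) = (\<Sum>g\<in>G. \<Sum>p\<in>G. eps (r0 \<circ> p) * eps (r0 \<circ> g \<circ> p \<circ> inv g)) / nrm"
    by (subst sum.swap) (simp add: chi_def sum_distrib_left sum_divide_distrib)
  also have "(\<Sum>g\<in>G. \<Sum>p\<in>G. eps (r0 \<circ> p) * eps (r0 \<circ> g \<circ> p \<circ> inv g)) =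
     (\<Sum>g\<in>G. \<Sum>y\<in>Y. (\<Sum>t\<in>Om. eps (t \<circ> inv g) * eps t) * eps (r0 \<circ> g \<circ> y))"
  proof (rule sum.cong[OF refl])
    fix g assume "g \<in> G"
    then have g: "g permutes {..<n}" by simp
    have "(\<Sum>p\<in>G. eps (r0 \<circ> p) * eps (r0 \<circ> g \<circ> p \<circ> inv g)) =
       (\<Sum>y\<in>Y. \<Sum>q\<in>C. of_int (sign q) * eps (r0 \<circ> g \<circ> (y \<circ> inv q) \<circ> inv g))" by (rule sum_eps_weight)
    also have "\<dots> = (\<Sum>y\<in>Y. (\<Sum>t\<in>Om. eps (t \<circ> inv g) * eps t) * eps (r0 \<circ> g \<circ> y))"
    proof (rule sum.cong[OF refl])
      fix y assume y: "y \<in> Y"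
      have "(\<Sum>q\<in>C. of_int (sign q) * eps (r0 \<circ> g \<circ> (y \<circ> inv q) \<circ> inv g)) =
        (\<Sum>q\<in>C. of_int (sign q) * eps (r0 \<circ> g \<circ> y \<circ> q \<circ> inv g))"
        by (subst sum_C_inv) (simp add: sign_inv[OF Cpermutes] permutes_inv_inv[OF Cpermutes] o_assoc)
      also have "\<dots> = (\<Sum>t\<in>Om. eps (t \<circ> inv g) * eps t) * eps (r0 \<circ> g \<circ> y)"
        by (intro sum_C_Om Om_comp r0_in g Ypermutes[OF y])
      finally show "(\<Sum>q\<in>C. of_int (sign q) * eps (r0 \<circ> g \<circ> (y \<circ> inv q) \<circ> inv g)) =
        (\<Sum>t\<in>Om. eps (t \<circ> inv g) * eps t) * eps (r0 \<circ> g \<circ> y)" .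
    qed
    finally show "(\<Sum>p\<in>G. eps (r0 \<circ> p) * eps (r0 \<circ> g \<circ> p \<circ> inv g)) =
       (\<Sum>y\<in>Y. (\<Sum>t\<in>Om. eps (t \<circ> inv g) * eps t) * eps (r0 \<circ> g \<circ> y))" .
  qed
  also have "\<dots> = (\<Sum>g\<in>G. \<Sum>y\<in>Y. \<Sum>t\<in>Om. eps t * (eps (r0 \<circ> g \<circ> y) * eps (t \<circ> inv g)))"
    by (intro sum.cong refl) (simp add: sum_distrib_left mult_ac)
  also have "\<dots> = (\<Sum>y\<in>Y. \<Sum>g\<in>G. \<Sum>t\<in>Om. eps t * (eps (r0 \<circ> g \<circ> y) * eps (t \<circ> inv g)))"
    by (rule sum.swap)
  also have "\<dots> = (\<Sum>y\<in>Y. \<Sum>t\<in>Om. \<Sum>g\<in>G. eps t * (eps (r0 \<circ> g \<circ> y) * eps (t \<circ> inv g)))"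
    by (rule sum.cong[OF refl]) (rule sum.swap)
  also have "\<dots> = (\<Sum>y\<in>Y. \<Sum>t\<in>Om. eps t * (nrm * eps (t \<circ> y)))"
  proof (rule sum.cong[OF refl], rule sum.cong[OF refl])
    fix y t assume "y \<in> Y"
    then have y: "y permutes {..<n}" by (rule Ypermutes)
    have "(\<Sum>g\<in>G. eps (r0 \<circ> g) * eps (t \<circ> y \<circ> inv g)) =
      (\<Sum>g\<in>G. eps (r0 \<circ> (g \<circ> y)) * eps (t \<circ> y \<circ> inv (g \<circ> y)))"
      by (rule sum_permutations_compose_right[OF y])
    also have "\<dots> = (\<Sum>g\<in>G. eps (r0 \<circ> g \<circ> y) * eps (t \<circ> inv g))"
    proof (rule sum.cong[OF refl])
      fix g assume "g \<in> G"
      then have "t \<circ> y \<circ> inv (g \<circ> y) = t \<circ> inv g"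
        using y by (simp add: o_inv_distrib permutes_bij o_assoc comp_cancel)
      then show "eps (r0 \<circ> (g \<circ> y)) * eps (t \<circ> y \<circ> inv (g \<circ> y)) = eps (r0 \<circ> g \<circ> y) * eps (t \<circ> inv g)"
        by (simp add: o_assoc)
    qed
    finally show "(\<Sum>g\<in>G. eps t * (eps (r0 \<circ> g \<circ> y) * eps (t \<circ> inv g))) = eps t * (nrm * eps (t \<circ> y))"
      by (simp add: eps_convolution sum_distrib_left[symmetric])
  qed
  also have "\<dots> = nrm * nrm"
    by (subst (2) nrm_def) (simp add: sum_distrib_left algebra_simps)
  finally have *: "(\<Sum>p\<in>G. eps (r0 \<circ> p) * chi p) = nrm * nrm / nrm" .
  show ?thesis unfolding chi_ip[OF class_fun_chi] * using nrm_pos by simp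
qed

end

lemma ex_young_tableau:
  assumes "\<alpha> \<in> partitions_of n"
  obtains T where "young_tableau \<alpha> n T"
proof -
  have "card {..<n} = card (diagram \<alpha>)" using assms card_diagram by (simp add: partitions_of_def)
  then obtain T where "bij_betw T {..<n} (diagram \<alpha>)"
    using finite_same_card_bij[of "{..<n}" "diagram \<alpha>"] by auto
  then show ?thesis using assms that by (auto simp: partitions_of_def young_tableau_def)
qed

section \<open>Jacobi--Trudi characters\<close>

text \<open>The staircase vector of the determinant. Truncated subtraction makes it 0 from index
  \<open>N - 1\<close> on, so indices beyond \<open>N\<close> are not shifted.\<close>

definition dl :: "nat \<Rightarrow> nat \<Rightarrow> int" where "dl N i = int (N - 1 - i)"

text \<open>The determinant of the complete symmetric functions \<open>h\<close> with index \<open>\<eta> i - dl N j\<close>, read as a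
  combination of permutation characters; a negative index gives an empty set of words and contributes 0.\<close>

definition jt :: "nat \<Rightarrow> nat \<Rightarrow> (nat \<Rightarrow> int) \<Rightarrow> (nat \<Rightarrow> nat) \<Rightarrow> real" where
  "jt n N \<eta> p = (\<Sum>\<sigma> | \<sigma> permutes {..<N}. of_int (sign \<sigma>) * perm_char {..<n} (\<lambda>i. \<eta> i - dl N (\<sigma> i)) p)"

definition comps :: "nat \<Rightarrow> nat \<Rightarrow> (nat \<Rightarrow> nat) set" where
  "comps N m = {c. (\<forall>i\<ge>N. c i = 0) \<and> (\<Sum>i<N. c i) = m}"

lemma class_fun_sum:
  "(\<And>x. x \<in> A \<Longrightarrow> class_fun n (F x)) \<Longrightarrow> class_fun n (\<lambda>p. \<Sum>x\<in>A. c x * F x p)"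
  by (auto simp: class_fun_def)

lemma class_fun_jt: "class_fun n (jt n N \<eta>)"
  unfolding jt_def by (intro class_fun_sum class_fun_perm_char)

lemma words_relabel:
  assumes "bij s" "w \<in> words S (\<beta> \<circ> s)"
  shows "(\<lambda>k\<in>S. s (w k)) \<in> words S \<beta>"
proof -
  have "content S (\<lambda>k\<in>S. s (w k)) i = content S w (inv s i)" for i
    unfolding content_def using assms(1)
    by (intro arg_cong[of _ _ card]) (auto simp: bij_def surj_f_inv_f)
  then show ?thesis using assms by (auto simp: words_def bij_is_surj surj_f_inv_f)
qed

text \<open>Renaming the letters of words commutes with permuting their positions.\<close>

lemma perm_char_relabel:
  assumes s: "bij s" and p: "p permutes S"
  shows "perm_char S (\<beta> \<circ> s) p = perm_char S \<beta> p"
proof -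
  have pS: "p k \<in> S \<longleftrightarrow> k \<in> S" for k using permutes_in_image[OF p] .
  have i: "s (inv s x) = x" "inv s (s x) = x" for x
    using s by (simp_all add: bij_is_surj surj_f_inv_f bij_is_inj)
  have fix_iff: "(\<lambda>k\<in>S. t (w k)) \<circ> p = (\<lambda>k\<in>S. t (w k))"
    if "w \<circ> p = w" for w :: "nat \<Rightarrow> nat" and t :: "nat \<Rightarrow> nat"
    using that by (auto simp: fun_eq_iff pS restrict_def)
  have ext: "(\<lambda>k\<in>S. t (w k)) = w" if "\<And>x. t x = x" "w \<in> extensional S" for w t
    using that by (auto simp: fun_eq_iff extensional_def restrict_def)
  have "bij_betw (\<lambda>w. \<lambda>k\<in>S. s (w k)) {w \<in> words S (\<beta> \<circ> s). w \<circ> p = w} {w \<in> words S \<beta>. w \<circ> p = w}"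
  proof (rule bij_betwI[where g = "\<lambda>w. \<lambda>k\<in>S. inv s (w k)"])
    show "(\<lambda>w. \<lambda>k\<in>S. s (w k)) \<in> {w \<in> words S (\<beta> \<circ> s). w \<circ> p = w} \<rightarrow> {w \<in> words S \<beta>. w \<circ> p = w}"
      using words_relabel[OF s] fix_iff by blast
    have "\<beta> = (\<beta> \<circ> s) \<circ> inv s" by (simp add: fun_eq_iff i)
    then show "(\<lambda>w. \<lambda>k\<in>S. inv s (w k)) \<in> {w \<in> words S \<beta>. w \<circ> p = w} \<rightarrow> {w \<in> words S (\<beta> \<circ> s). w \<circ> p = w}"
      using words_relabel[OF bij_imp_bij_inv[OF s], of _ S "\<beta> \<circ> s"] fix_iff by auto
  qed (auto simp: restrict_def fun_eq_iff i words_def extensional_def)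
  then show ?thesis by (simp add: perm_char_def bij_betw_same_card)
qed

text \<open>The determinant alternates in its rows: reindexing by \<open>\<sigma> \<circ> s\<close>
  only renames letters in each content, which \<open>perm_char_relabel\<close> absorbs.\<close>

lemma jt_permute:
  assumes s: "s permutes {..<N}" and p: "p permutes {..<n}"
  shows "jt n N (\<eta> \<circ> s) p = of_int (sign s) * jt n N \<eta> p"
proof -
  have "jt n N (\<eta> \<circ> s) p = (\<Sum>\<sigma> | \<sigma> permutes {..<N}.
      of_int (sign (\<sigma> \<circ> s)) * perm_char {..<n} (\<lambda>i. (\<eta> \<circ> s) i - dl N ((\<sigma> \<circ> s) i)) p)"
    unfolding jt_def by (rule sum_permutations_compose_right[OF s])
  also have "\<dots> = (\<Sum>\<sigma> | \<sigma> permutes {..<N}. of_int (sign s) *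
      (of_int (sign \<sigma>) * perm_char {..<n} (\<lambda>i. \<eta> i - dl N (\<sigma> i)) p))"
  proof (rule sum.cong[OF refl])
    fix \<sigma> assume "\<sigma> \<in> {\<sigma>. \<sigma> permutes {..<N}}"
    then have "sign (\<sigma> \<circ> s) = sign \<sigma> * sign s"
      using s sign_compose permutation_permutes finite_lessThan by blast
    moreover have "perm_char {..<n} ((\<lambda>i. \<eta> i - dl N (\<sigma> i)) \<circ> s) p = perm_char {..<n} (\<lambda>i. \<eta> i - dl N (\<sigma> i)) p"
      by (rule perm_char_relabel[OF permutes_bij[OF s] p])
    ultimately show "of_int (sign (\<sigma> \<circ> s)) * perm_char {..<n} (\<lambda>i. (\<eta> \<circ> s) i - dl N ((\<sigma> \<circ> s) i)) p =
       of_int (sign s) * (of_int (sign \<sigma>) * perm_char {..<n} (\<lambda>i. \<eta> i - dl N (\<sigma> i)) p)"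
      by (simp add: o_def)
  qed
  finally show ?thesis by (simp add: jt_def sum_distrib_left)
qed

lemma perm_char_neg: "\<beta> i < 0 \<Longrightarrow> perm_char S \<beta> p = 0"
proof -
  assume "\<beta> i < 0"
  then have "words S \<beta> = {}" by (auto simp: words_def) (metis of_nat_less_0_iff)
  then show ?thesis by (simp add: perm_char_def)
qed

text \<open>Subtracting staircase entries keeps a negative entry negative, so every term of the
  determinant is a count over an empty set of words.\<close>

lemma jt_neg: "\<eta> i < 0 \<Longrightarrow> jt n N \<eta> p = 0"
  unfolding jt_def by (intro sum.neutral ballI) (simp add: perm_char_neg[of _ i] dl_def)

lemma jt_swap:
  assumes "i < N" "j < N" "i \<noteq> j" "p permutes {..<n}"
  shows "jt n N (\<eta> \<circ> Transposition.transpose i j) p = - jt n N \<eta> p"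
  using jt_permute[of "Transposition.transpose i j" N p n \<eta>] assms
  by (simp add: permutes_swap_id sign_swap_id)

lemma jt_repeat:
  assumes "i < N" "j < N" "i \<noteq> j" "p permutes {..<n}" "\<eta> i = \<eta> j"
  shows "jt n N \<eta> p = 0"
proof -
  have "\<eta> \<circ> Transposition.transpose i j = \<eta>"
    using assms(5) by (auto simp: fun_eq_iff Transposition.transpose_def)
  then show ?thesis using jt_swap[OF assms(1-4), of \<eta>] by simp
qed

section \<open>Restriction to a product of two symmetric groups\<close>

lemma permutes_disjoint_commute:
  assumes "q permutes Q" "r permutes R" "Q \<inter> R = {}"
  shows "q \<circ> r = r \<circ> q"
proof
  fix x
  have r: "r y = y" if "y \<notin> R" for y using permutes_not_in[OF assms(2) that] .
  have q: "q y = y" if "y \<notin> Q" for y using permutes_not_in[OF assms(1) that] .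
  have Q: "y \<notin> R" if "y \<in> Q" for y using that assms(3) by blast
  consider "x \<in> Q" | "x \<in> R" | "x \<notin> Q" "x \<notin> R" by blast
  then show "(q \<circ> r) x = (r \<circ> q) x"
    using permutes_in_image[OF assms(1), of x] permutes_in_image[OF assms(2), of x] r q Q
    by cases (auto, metis)
qed

lemma permutes_split:
  assumes p: "p permutes Q \<union> R" and d: "Q \<inter> R = {}" and fin: "finite Q" "finite R"
    and R: "\<And>k. k \<in> R \<Longrightarrow> p k \<in> R"
  shows "(\<lambda>k. if k \<in> Q then p k else k) permutes Q" "(\<lambda>k. if k \<in> R then p k else k) permutes R"
    "(\<lambda>k. if k \<in> Q then p k else k) \<circ> (\<lambda>k. if k \<in> R then p k else k) = p"
proof -
  have inj: "inj p" using permutes_inj[OF p] .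
  have pR: "p ` R = R" using fin inj R by (intro endo_inj_surj) (auto intro: inj_on_subset)
  have Q: "p k \<in> Q" if "k \<in> Q" for k
  proof -
    have "p k \<in> Q \<union> R" using that permutes_in_image[OF p] by blast
    moreover have "p k \<notin> R"
    proof
      assume "p k \<in> R"
      then obtain k' where "k' \<in> R" "p k = p k'" using pR by (metis imageE)
      then show False using inj that d by (auto dest: injD)
    qed
    ultimately show ?thesis by blast
  qed
  have pQ: "p ` Q = Q" using fin inj Q by (intro endo_inj_surj) (auto intro: inj_on_subset)
  have "bij_betw (\<lambda>k. if k \<in> A then p k else k) A A" if "p ` A = A" for A
  proof -
    have "bij_betw p A A" using that inj by (auto simp: bij_betw_def intro: inj_on_subset)
    then show ?thesis by (rule bij_betw_cong[THEN iffD1, rotated]) simp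
  qed
  from this[OF pQ] this[OF pR]
  show "(\<lambda>k. if k \<in> Q then p k else k) permutes Q" "(\<lambda>k. if k \<in> R then p k else k) permutes R"
    by (auto intro: bij_imp_permutes)
  show "(\<lambda>k. if k \<in> Q then p k else k) \<circ> (\<lambda>k. if k \<in> R then p k else k) = p"
    using d R Q p by (auto simp: fun_eq_iff permutes_def)
qed

text \<open>A word fixed by \<open>q \<circ> r\<close> consists of a fixed word on \<open>R\<close>
  and a fixed word on \<open>Q\<close> that uses up the remaining letters. The bound
  \<open>N\<close> confines the words on \<open>R\<close> to a finite set.\<close>

lemma perm_char_split:
  assumes fin: "finite Q" "finite R" and d: "Q \<inter> R = {}" and q: "q permutes Q" and r: "r permutes R"
    and \<beta>: "\<And>i. i \<ge> N \<Longrightarrow> \<beta> i = 0"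
  shows "perm_char (Q \<union> R) \<beta> (q \<circ> r) =
    (\<Sum>g \<in> {g \<in> R \<rightarrow>\<^sub>E {..<N}. g \<circ> r = g}. perm_char Q (\<lambda>i. \<beta> i - int (content R g i)) q)"
proof -
  have qQ: "q k \<in> Q \<longleftrightarrow> k \<in> Q" for k using permutes_in_image[OF q] .
  have rR: "r k \<in> R \<longleftrightarrow> k \<in> R" for k using permutes_in_image[OF r] .
  have qo: "k \<notin> Q \<Longrightarrow> q k = k" for k using q by (auto simp: permutes_def)
  have ro: "k \<notin> R \<Longrightarrow> r k = k" for k using r by (auto simp: permutes_def)
  have cont: "content (Q \<union> R) w i = content Q w i + content R w i" for w i
  proof -
    have "{k \<in> Q \<union> R. w k = i} = {k \<in> Q. w k = i} \<union> {k \<in> R. w k = i}" by auto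
    then show ?thesis unfolding content_def using fin d by (simp add: card_Un_disjoint disjoint_iff)
  qed
  have cc: "content A w i = content A w' i" if "\<And>k. k \<in> A \<Longrightarrow> w k = w' k" for A w w' i
    unfolding content_def by (intro arg_cong[of _ _ card]) (use that in auto)
  define X where "X = {w \<in> words (Q \<union> R) \<beta>. w \<circ> (q \<circ> r) = w}"
  define Gs where "Gs = {g \<in> R \<rightarrow>\<^sub>E {..<N}. g \<circ> r = g}"
  define B where "B g = {u \<in> words Q (\<lambda>i. \<beta> i - int (content R g i)). u \<circ> q = u}" for g
  have "bij_betw (\<lambda>(g, u). (\<lambda>k. if k \<in> Q then u k else g k)) (Sigma Gs B) X"
  proof (rule bij_betwI[where g = "\<lambda>w. (restrict w R, restrict w Q)"])
    show "(\<lambda>(g, u). (\<lambda>k. if k \<in> Q then u k else g k)) \<in> Sigma Gs B \<rightarrow> X"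
    proof (clarsimp)
      fix g u assume g: "g \<in> Gs" and u: "u \<in> B g"
      let ?w = "\<lambda>k. if k \<in> Q then u k else g k"
      have "content (Q \<union> R) ?w i = content Q u i + content R g i" for i
      proof -
        have "k \<notin> Q" if "k \<in> R" for k using that d by auto
        then show ?thesis by (simp add: cont cc[of Q ?w u] cc[of R ?w g])
      qed
      then have "?w \<in> words (Q \<union> R) \<beta>"
        using g u by (auto simp: words_def B_def Gs_def extensional_def PiE_def)
      moreover have "?w \<circ> (q \<circ> r) = ?w"
      proof
        fix k
        have "u (q k) = u k" "g (r k) = g k"
          using g u by (auto simp: Gs_def B_def fun_eq_iff)
        moreover have "r k \<notin> Q" if "k \<in> R" using that rR d by blast
        ultimately show "(?w \<circ> (q \<circ> r)) k = ?w k"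
          using d qQ[of k] rR[of k] qo[of "r k"] ro[of k] by (auto simp: disjoint_iff)
      qed
      ultimately show "?w \<in> X" by (simp add: X_def)
    qed
    show "(\<lambda>w. (restrict w R, restrict w Q)) \<in> X \<rightarrow> Sigma Gs B"
    proof (clarsimp)
      fix w assume w: "w \<in> X"
      have fixw: "w (q (r k)) = w k" for k using w by (auto simp: X_def fun_eq_iff)
      have "w k < N" if "k \<in> R" for k
      proof (rule ccontr)
        assume "\<not> w k < N"
        then have "\<beta> (w k) = 0" by (simp add: \<beta>)
        moreover have "int (content (Q \<union> R) w (w k)) = \<beta> (w k)" using w by (simp add: X_def words_def)
        ultimately have "content (Q \<union> R) w (w k) = 0" by simp
        then have "{j \<in> Q \<union> R. w j = w k} = {}" unfolding content_def using fin by simp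
        then show False using that by blast
      qed
      moreover have "restrict w R \<circ> r = restrict w R"
        using rR fixw qo d by (auto simp: fun_eq_iff restrict_def disjoint_iff) metis
      ultimately have g: "restrict w R \<in> Gs" by (auto simp: Gs_def)
      have "content Q (restrict w Q) i = content (Q \<union> R) w i - content R (restrict w R) i" for i
        using cc[of Q "restrict w Q" w] cc[of R "restrict w R" w] by (simp add: cont)
      then have "restrict w Q \<in> words Q (\<lambda>i. \<beta> i - int (content R (restrict w R) i))"
        using w cc[of R "restrict w R" w] by (auto simp: words_def X_def cont eq_diff_eq)
      moreover have "restrict w Q \<circ> q = restrict w Q"
        using qQ fixw ro d by (auto simp: fun_eq_iff restrict_def disjoint_iff) metis
      ultimately show "restrict w R \<in> Gs \<and> restrict w Q \<in> B (restrict w R)"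
        using g by (simp add: B_def)
    qed
  next
    fix w assume "w \<in> X"
    then show "(case (restrict w R, restrict w Q) of (g, u) \<Rightarrow> (\<lambda>k. if k \<in> Q then u k else g k)) = w"
      by (auto simp: X_def words_def extensional_def fun_eq_iff)
  next
    fix x assume "x \<in> Sigma Gs B"
    then show "(restrict (case x of (g, u) \<Rightarrow> (\<lambda>k. if k \<in> Q then u k else g k)) R,
        restrict (case x of (g, u) \<Rightarrow> (\<lambda>k. if k \<in> Q then u k else g k)) Q) = x"
      using d by (auto simp: Gs_def B_def words_def extensional_def fun_eq_iff PiE_def)
  qed
  then have "card X = card (Sigma Gs B)" using bij_betw_same_card by metis
  moreover have "finite Gs"
    unfolding Gs_def by (rule finite_subset[of _ "R \<rightarrow>\<^sub>E {..<N}"]) (auto intro: finite_PiE fin)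
  moreover have "finite (B g)" for g unfolding B_def using fin by simp
  ultimately have "card X = (\<Sum>g\<in>Gs. card (B g))" by simp
  then show ?thesis by (simp add: perm_char_def X_def Gs_def B_def)
qed

lemma jt_split:
  assumes m: "m \<le> n" and q: "q permutes {..<n - m}" and r: "r permutes {n - m..<n}"
    and \<eta>: "\<And>i. i \<ge> N \<Longrightarrow> \<eta> i = 0"
  shows "jt n N \<eta> (q \<circ> r) =
    (\<Sum>g \<in> {g \<in> {n - m..<n} \<rightarrow>\<^sub>E {..<N}. g \<circ> r = g}. jt (n - m) N (\<lambda>i. \<eta> i - int (content {n - m..<n} g i)) q)"
proof -
  have U: "{..<n} = {..<n - m} \<union> {n - m..<n}" using m by auto
  have "jt n N \<eta> (q \<circ> r) = (\<Sum>\<sigma> | \<sigma> permutes {..<N}. \<Sum>g \<in> {g \<in> {n - m..<n} \<rightarrow>\<^sub>E {..<N}. g \<circ> r = g}.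
      of_int (sign \<sigma>) * perm_char {..<n - m} (\<lambda>i. \<eta> i - int (content {n - m..<n} g i) - dl N (\<sigma> i)) q)"
    unfolding jt_def
  proof (rule sum.cong[OF refl])
    fix \<sigma> assume \<sigma>: "\<sigma> \<in> {\<sigma>. \<sigma> permutes {..<N}}"
    have "perm_char {..<n} (\<lambda>i. \<eta> i - dl N (\<sigma> i)) (q \<circ> r) = (\<Sum>g \<in> {g \<in> {n - m..<n} \<rightarrow>\<^sub>E {..<N}. g \<circ> r = g}.
        perm_char {..<n - m} (\<lambda>i. \<eta> i - dl N (\<sigma> i) - int (content {n - m..<n} g i)) q)"
      unfolding U
    proof (rule perm_char_split[OF _ _ _ q r])
      fix i assume "N \<le> i"
      then show "\<eta> i - dl N (\<sigma> i) = 0" using \<eta> \<sigma> by (auto simp: permutes_def dl_def)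
    qed auto
    then show "of_int (sign \<sigma>) * perm_char {..<n} (\<lambda>i. \<eta> i - dl N (\<sigma> i)) (q \<circ> r) =
      (\<Sum>g \<in> {g \<in> {n - m..<n} \<rightarrow>\<^sub>E {..<N}. g \<circ> r = g}.
      of_int (sign \<sigma>) * perm_char {..<n - m} (\<lambda>i. \<eta> i - int (content {n - m..<n} g i) - dl N (\<sigma> i)) q)"
      by (simp add: sum_distrib_left algebra_simps)
  qed
  also have "\<dots> = (\<Sum>g \<in> {g \<in> {n - m..<n} \<rightarrow>\<^sub>E {..<N}. g \<circ> r = g}. jt (n - m) N (\<lambda>i. \<eta> i - int (content {n - m..<n} g i)) q)"
    unfolding jt_def by (rule sum.swap)
  finally show ?thesis .
qed

lemma finite_comps [simp]: "finite (comps N m)"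
proof (rule finite_subset)
  show "comps N m \<subseteq> {c. \<forall>i. (i \<in> {..<N} \<longrightarrow> c i \<in> {..m}) \<and> (i \<notin> {..<N} \<longrightarrow> c i = 0)}"
    by (auto simp: comps_def intro: member_le_sum)
  show "finite {c. \<forall>i. (i \<in> {..<N} \<longrightarrow> c i \<in> {..m}) \<and> (i \<notin> {..<N} \<longrightarrow> c i = (0::nat))}"
    by (rule finite_set_of_finite_funs) auto
qed

lemma words_nonempty:
  assumes "finite R" "c \<in> comps N (card R)"
  shows "words R (\<lambda>i. int (c i)) \<noteq> {}"
  using assms
proof (induction R arbitrary: c rule: finite_induct)
  case empty
  then have "c i = 0" for i by (cases "i < N") (auto simp: comps_def)
  then have "(\<lambda>_. undefined) \<in> words {} (\<lambda>i. int (c i))" by (simp add: words_def content_def)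
  then show ?case by blast
next
  case (insert a R)
  then have s: "(\<Sum>i<N. c i) = Suc (card R)" by (simp add: comps_def)
  then obtain j where j: "j < N" "c j > 0"
    by (metis lessThan_iff nat.distinct(1) not_gr_zero sum.neutral)
  let ?c = "c(j := c j - 1)"
  have "(\<Sum>i<N. ?c i) + 1 = (\<Sum>i<N. c i)"
    using j by (simp add: sum.remove[of "{..<N}" j])
  then have "?c \<in> comps N (card R)" using s j insert.prems by (auto simp: comps_def)
  then obtain w where w: "w \<in> words R (\<lambda>i. int (?c i))" using insert.IH by blast
  have "content (insert a R) (w(a := j)) i = content R w i + (if i = j then 1 else 0)" for i
  proof -
    have "{k \<in> insert a R. (w(a := j)) k = i} = {k \<in> R. w k = i} \<union> (if i = j then {a} else {})"
      using insert.hyps by auto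
    then show ?thesis unfolding content_def using insert.hyps by simp
  qed
  then have "w(a := j) \<in> words (insert a R) (\<lambda>i. int (c i))"
    using w j by (auto simp: words_def extensional_def split: if_splits)
  then show ?case by blast
qed

lemma content_in_comps:
  assumes "finite R" "g \<in> R \<rightarrow>\<^sub>E {..<N}" shows "content R g \<in> comps N (card R)"
proof -
  have "(\<Sum>i<N. card {k \<in> R. g k = i}) = (\<Sum>i<N. \<Sum>k | k \<in> R \<and> g k = i. 1)" by simp
  also have "\<dots> = (\<Sum>k\<in>R. 1)" by (rule sum.group) (use assms in auto)
  finally have "(\<Sum>i<N. content R g i) = card R" by (simp add: content_def)
  moreover have "content R g i = 0" if "i \<ge> N" for i
  proof -
    have "{k \<in> R. g k = i} = {}" using that PiE_mem[OF assms(2)] by fastforce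
    then show ?thesis unfolding content_def by (simp only: card.empty)
  qed
  ultimately show ?thesis by (simp add: comps_def)
qed

lemma words_eq_content:
  assumes "finite R" "c \<in> comps N (card R)"
  shows "{g \<in> R \<rightarrow>\<^sub>E {..<N}. content R g = c} = words R (\<lambda>i. int (c i))"
proof (intro equalityI subsetI)
  fix g assume g: "g \<in> words R (\<lambda>i. int (c i))"
  then have c: "content R g i = c i" for i by (simp add: words_def)
  have "g k < N" if "k \<in> R" for k
  proof (rule ccontr)
    assume "\<not> g k < N"
    then have "content R g (g k) = 0" using assms(2) c by (simp add: comps_def)
    then show False using that assms(1) by (auto simp: content_def)
  qed
  then show "g \<in> {g \<in> R \<rightarrow>\<^sub>E {..<N}. content R g = c}" using g c by (auto simp: words_def PiE_def)
qed (auto simp: words_def PiE_def)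

lemma sum_by_content:
  fixes \<phi> h :: "(nat \<Rightarrow> nat) \<Rightarrow> real"
  assumes "finite R"
  shows "(\<Sum>g \<in> R \<rightarrow>\<^sub>E {..<N}. \<phi> (content R g) * h g) =
    (\<Sum>c\<in>comps N (card R). \<phi> c * (\<Sum>g\<in>words R (\<lambda>i. int (c i)). h g))"
proof -
  have "(\<Sum>g \<in> R \<rightarrow>\<^sub>E {..<N}. \<phi> (content R g) * h g) =
    (\<Sum>c\<in>comps N (card R). \<Sum>g | g \<in> R \<rightarrow>\<^sub>E {..<N} \<and> content R g = c. \<phi> (content R g) * h g)"
    by (rule sum.group[symmetric]) (use assms content_in_comps in \<open>auto intro: finite_PiE\<close>)
  also have "\<dots> = (\<Sum>c\<in>comps N (card R). \<Sum>g\<in>words R (\<lambda>i. int (c i)). \<phi> c * h g)"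
  proof (rule sum.cong[OF refl])
    fix c assume c: "c \<in> comps N (card R)"
    have "(\<Sum>g | g \<in> R \<rightarrow>\<^sub>E {..<N} \<and> content R g = c. \<phi> (content R g) * h g) =
      (\<Sum>g | g \<in> R \<rightarrow>\<^sub>E {..<N} \<and> content R g = c. \<phi> c * h g)" by (rule sum.cong) auto
    then show "(\<Sum>g | g \<in> R \<rightarrow>\<^sub>E {..<N} \<and> content R g = c. \<phi> (content R g) * h g) =
      (\<Sum>g\<in>words R (\<lambda>i. int (c i)). \<phi> c * h g)" using words_eq_content[OF assms c] by simp
  qed
  finally show ?thesis by (simp only: sum_distrib_left)
qed

text \<open>The words of one content form a single orbit, so by orbit counting each content
  contributes the order of the group once.\<close>

lemma sum_fixed_words:
  fixes \<phi> :: "(nat \<Rightarrow> nat) \<Rightarrow> real"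
  assumes "finite R"
  shows "(\<Sum>r | r permutes R. \<Sum>g \<in> {g \<in> R \<rightarrow>\<^sub>E {..<N}. g \<circ> r = g}. \<phi> (content R g)) =
    fact (card R) * (\<Sum>c\<in>comps N (card R). \<phi> c)"
proof -
  have fin: "finite (R \<rightarrow>\<^sub>E {..<N})" using assms by (intro finite_PiE) auto
  have finp: "finite {r. r permutes R}" using finite_permutations[OF assms] .
  have "(\<Sum>r | r permutes R. \<Sum>g \<in> {g \<in> R \<rightarrow>\<^sub>E {..<N}. g \<circ> r = g}. \<phi> (content R g)) =
    (\<Sum>r | r permutes R. \<Sum>g \<in> R \<rightarrow>\<^sub>E {..<N}. \<phi> (content R g) * (if g \<circ> r = g then 1 else 0))"
    by (rule sum.cong[OF refl]) (simp add: sum.inter_filter[OF fin] if_distrib cong: if_cong)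
  also have "\<dots> = (\<Sum>g \<in> R \<rightarrow>\<^sub>E {..<N}. \<phi> (content R g) * real (card {r. r permutes R \<and> g \<circ> r = g}))"
    by (subst sum.swap) (simp add: sum_distrib_left[symmetric] sum.If_cases[OF finp] Int_def)
  also have "\<dots> = (\<Sum>c\<in>comps N (card R). \<phi> c * (\<Sum>g\<in>words R (\<lambda>i. int (c i)). real (card {r. r permutes R \<and> g \<circ> r = g})))"
    by (rule sum_by_content[OF assms])
  also have "\<dots> = (\<Sum>c\<in>comps N (card R). \<phi> c * fact (card R))"
  proof (rule sum.cong[OF refl])
    fix c assume "c \<in> comps N (card R)"
    from sum_card_stabilizer[OF assms words_nonempty[OF assms this]]
    have "real (\<Sum>g\<in>words R (\<lambda>i. int (c i)). card {r. r permutes R \<and> g \<circ> r = g}) = fact (card R)"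
      by (simp only: of_nat_fact)
    then show "\<phi> c * (\<Sum>g\<in>words R (\<lambda>i. int (c i)). real (card {r. r permutes R \<and> g \<circ> r = g})) =
       \<phi> c * fact (card R)" by simp
  qed
  finally show ?thesis by (simp add: sum_distrib_left mult.commute)
qed

text \<open>With the sign, a word with a repeated letter cancels through a transposition in its
  stabiliser, while a word with distinct letters has trivial stabiliser. Only compositions with
  entries 0 and 1 survive, as for elementary symmetric functions.\<close>

lemma sum_sign_fixed_words:
  fixes \<phi> :: "(nat \<Rightarrow> nat) \<Rightarrow> real"
  assumes "finite R"
  shows "(\<Sum>r | r permutes R. of_int (sign r) * (\<Sum>g \<in> {g \<in> R \<rightarrow>\<^sub>E {..<N}. g \<circ> r = g}. \<phi> (content R g))) =
    fact (card R) * (\<Sum>c\<in>{c \<in> comps N (card R). \<forall>i. c i \<le> 1}. \<phi> c)"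
proof -
  have fin: "finite (R \<rightarrow>\<^sub>E {..<N})" using assms by (intro finite_PiE) auto
  have finp: "finite {r. r permutes R}" using finite_permutations[OF assms] .
  define h where "h g = (\<Sum>r | r permutes R \<and> g \<circ> r = g. of_int (sign r) :: real)" for g :: "nat \<Rightarrow> nat"
  have "(\<Sum>r | r permutes R. of_int (sign r) * (\<Sum>g \<in> {g \<in> R \<rightarrow>\<^sub>E {..<N}. g \<circ> r = g}. \<phi> (content R g))) =
    (\<Sum>r | r permutes R. \<Sum>g \<in> R \<rightarrow>\<^sub>E {..<N}. \<phi> (content R g) * (if g \<circ> r = g then of_int (sign r) else 0))"
    by (intro sum.cong refl)
       (simp add: sum.inter_filter[OF fin] sum_distrib_left if_distrib mult.commute cong: if_cong)
  also have "\<dots> = (\<Sum>g \<in> R \<rightarrow>\<^sub>E {..<N}. \<phi> (content R g) * h g)"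
    by (subst sum.swap) (simp add: h_def sum_distrib_left[symmetric] sum.If_cases[OF finp] Int_def)
  also have "\<dots> = (\<Sum>c\<in>comps N (card R). \<phi> c * (\<Sum>g\<in>words R (\<lambda>i. int (c i)). h g))"
    by (rule sum_by_content[OF assms])
  also have "\<dots> = (\<Sum>c\<in>comps N (card R). if \<forall>i. c i \<le> 1 then \<phi> c * fact (card R) else 0)"
  proof (rule sum.cong[OF refl])
    fix c assume c: "c \<in> comps N (card R)"
    show "\<phi> c * (\<Sum>g\<in>words R (\<lambda>i. int (c i)). h g) = (if \<forall>i. c i \<le> 1 then \<phi> c * fact (card R) else 0)"
    proof (cases "\<forall>i. c i \<le> 1")
      case True
      have "h g = real (card {r. r permutes R \<and> g \<circ> r = g})" if g: "g \<in> words R (\<lambda>i. int (c i))" for g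
      proof -
        have inj: "a = b" if "a \<in> R" "b \<in> R" "g a = g b" for a b
        proof (rule ccontr)
          assume "a \<noteq> b"
          then have "2 \<le> card {a, b}" by simp
          also have "\<dots> \<le> card {k \<in> R. g k = g a}" by (intro card_mono) (use assms that in auto)
          also have "\<dots> = c (g a)" using g by (auto simp: words_def content_def)
          also have "\<dots> \<le> 1" using True by blast
          finally show False by simp
        qed
        have "{r. r permutes R \<and> g \<circ> r = g} = {id}"
        proof (intro equalityI subsetI)
          fix r assume r: "r \<in> {r. r permutes R \<and> g \<circ> r = g}"
          have "r x = x" for x
          proof (cases "x \<in> R")
            case True
            then show ?thesis using r inj[of "r x" x] permutes_in_image[of r R x] by (auto simp: fun_eq_iff)
          qed (use r in \<open>auto simp: permutes_def\<close>)
          then show "r \<in> {id}" by auto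
        qed (simp add: permutes_id)
        then show ?thesis by (simp add: h_def sign_id)
      qed
      then have "(\<Sum>g\<in>words R (\<lambda>i. int (c i)). h g) = real (\<Sum>g\<in>words R (\<lambda>i. int (c i)). card {r. r permutes R \<and> g \<circ> r = g})"
        by simp
      then show ?thesis using True sum_card_stabilizer[OF assms words_nonempty[OF assms c]]
        by (metis of_nat_fact)
    next
      case False
      then obtain i where i: "c i \<ge> 2" by (metis Suc_1 not_less_eq_eq)
      have "h g = 0" if g: "g \<in> words R (\<lambda>i. int (c i))" for g
      proof -
        have "card {k \<in> R. g k = i} \<ge> 2" using g i by (auto simp: words_def content_def)
        then obtain a b where ab: "a \<in> R" "b \<in> R" "g a = i" "g b = i" "a \<noteq> b"
          using card_le_Suc0_iff_eq[of "{k \<in> R. g k = i}"] assms by force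
        let ?t = "Transposition.transpose a b"
        have t: "?t permutes R" using ab by (simp add: permutes_swap_id)
        have gt: "g \<circ> ?t = g" using ab by (auto simp: fun_eq_iff Transposition.transpose_def)
        have "h g = (\<Sum>r | r permutes R \<and> g \<circ> r = g. - of_int (sign r))" unfolding h_def
        proof (rule sum.reindex_bij_witness[where i = "\<lambda>r. ?t \<circ> r" and j = "\<lambda>r. ?t \<circ> r"])
          fix r assume r: "r \<in> {r. r permutes R \<and> g \<circ> r = g}"
          show "?t \<circ> (?t \<circ> r) = r" by (simp add: fun_eq_iff)
          show "?t \<circ> r \<in> {r. r permutes R \<and> g \<circ> r = g}"
            using r t gt by (auto simp: permutes_compose o_assoc)
          have "sign (?t \<circ> r) = sign ?t * sign r"
            using r t assms sign_compose permutation_permutes by blast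
          then show "- of_int (sign (?t \<circ> r)) = (of_int (sign r) :: real)"
            using ab by (simp add: sign_swap_id)
        next
          fix r assume r: "r \<in> {r. r permutes R \<and> g \<circ> r = g}"
          show "?t \<circ> (?t \<circ> r) = r" by (simp add: fun_eq_iff)
          show "?t \<circ> r \<in> {r. r permutes R \<and> g \<circ> r = g}"
            using r t gt by (auto simp: permutes_compose o_assoc)
        qed
        then show ?thesis by (simp add: h_def sum_negf)
      qed
      then show ?thesis using False by auto
    qed
  qed
  also have "\<dots> = (\<Sum>c\<in>{c \<in> comps N (card R). \<forall>i. c i \<le> 1}. \<phi> c * fact (card R))"
    by (rule sum.inter_filter[symmetric]) simp
  finally show ?thesis by (simp add: sum_distrib_left mult.commute)
qed

lemma words_glue:
  assumes "m \<le> n" "w \<in> words {..<n - m} (\<lambda>i. \<nu> (Suc i))" "\<nu> 0 = int m"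
  shows "(\<lambda>k. if k < n - m then Suc (w k) else if k < n then 0 else undefined) \<in> words {..<n} \<nu>"
    (is "?v \<in> _")
proof -
  have "int (content {..<n} ?v i) = \<nu> i" for i
  proof (cases i)
    case 0
    have "{k \<in> {..<n}. ?v k = 0} = {n - m..<n}" by auto
    then show ?thesis using assms 0 by (simp add: content_def)
  next
    case (Suc j)
    have "{k \<in> {..<n}. ?v k = Suc j} = {k \<in> {..<n - m}. w k = j}" by auto
    then show ?thesis using assms Suc by (simp add: content_def words_def)
  qed
  then show ?thesis by (auto simp: words_def extensional_def)
qed

text \<open>With the letter 0 on the last \<open>m\<close> positions, the stabiliser becomes a
  product over two blocks of consecutive points.\<close>

lemma words_normal_form:
  assumes w: "w \<in> words {..<n} \<nu>" and m: "\<nu> 0 = int m" "m \<le> n"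
  obtains v where "v \<in> words {..<n} \<nu>" "\<And>k. k < n \<Longrightarrow> v k = 0 \<longleftrightarrow> n - m \<le> k"
proof -
  have c: "card {k \<in> {..<n}. w k = 0} = m" 
  proof -
    have "int (content {..<n} w 0) = \<nu> 0" using w by (simp add: words_def)
    then show ?thesis using m by (simp add: content_def)
  qed
  have "card {k \<in> {..<n}. w k \<noteq> 0} = card ({..<n} - {k \<in> {..<n}. w k = 0})"
    by (intro arg_cong[of _ _ card]) auto
  also have "\<dots> = n - m" using c by (subst card_Diff_subset) auto
  finally have c': "card {k \<in> {..<n}. w k \<noteq> 0} = n - m" .
  have s: "{k. k < n \<and> n - m \<le> k} = {n - m..<n}" "{k. k < n \<and> \<not> n - m \<le> k} = {..<n - m}" by auto
  have eq: "image_mset (\<lambda>k. n - m \<le> k) (mset_set {..<n}) = image_mset (\<lambda>k. w k = 0) (mset_set {..<n})"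
  proof (rule multiset_eqI)
    fix b
    have *: "count (image_mset f (mset_set {..<n})) b = card {k \<in> {..<n}. f k = b}" for f :: "nat \<Rightarrow> bool"
      by (simp add: count_image_mset vimage_def Int_def conj_commute)
    show "count (image_mset (\<lambda>k. n - m \<le> k) (mset_set {..<n})) b = count (image_mset (\<lambda>k. w k = 0) (mset_set {..<n})) b"
      unfolding * using c c' m by (cases b) (simp_all add: s)
  qed
  obtain p where p: "p permutes {..<n}" "\<forall>k\<in>{..<n}. (n - m \<le> k) = (w (p k) = 0)"
    by (rule image_mset_eq_implies_permutes[OF finite_lessThan eq])
  show ?thesis using that[of "w \<circ> p"] words_comp[OF _ p(1) w] p(2) by auto
qed

lemma class_fun_comp_disjoint:
  assumes "class_fun n F" "m \<le> n" "r permutes {n - m..<n}"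
  shows "class_fun (n - m) (\<lambda>q. F (q \<circ> r))"
  unfolding class_fun_def
proof (intro allI impI)
  fix p g assume p: "p permutes {..<n - m}" and g: "g permutes {..<n - m}"
  have sub: "x permutes {..<n - m} \<Longrightarrow> x permutes {..<n}" for x using permutes_subset by fastforce
  have rn: "r permutes {..<n}" using assms(3) by (rule permutes_subset) auto
  have "inv g \<circ> r = r \<circ> inv g"
    by (rule permutes_disjoint_commute[OF permutes_inv[OF g] assms(3)]) auto
  then have "g \<circ> p \<circ> inv g \<circ> r = g \<circ> (p \<circ> r) \<circ> inv g" by (simp add: o_assoc[symmetric])
  then show "F (g \<circ> p \<circ> inv g \<circ> r) = F (p \<circ> r)"
    using assms(1) sub[OF p] sub[OF g] rn unfolding class_fun_def
    by (metis permutes_compose)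
qed

text \<open>In symmetric functions this is the adjoint of multiplication by \<open>h_m\<close>: the
  stabiliser of a word splits off the symmetric group on the positions of the letter 0, and the
  average over that factor is taken separately.\<close>

lemma char_ip_peel:
  assumes F: "class_fun n F" and m: "\<nu> 0 = int m" "m \<le> n"
  shows "char_ip n (perm_char {..<n} \<nu>) F =
    (\<Sum>r | r permutes {n - m..<n}. char_ip (n - m) (perm_char {..<n - m} (\<lambda>i. \<nu> (Suc i))) (\<lambda>q. F (q \<circ> r))) / fact m"
proof (cases "words {..<n} \<nu> = {}")
  case True
  then have "words {..<n - m} (\<lambda>i. \<nu> (Suc i)) = {}" using words_glue[where \<nu> = \<nu>, OF m(2) _ m(1)] by blast
  then show ?thesis using True by (simp add: char_ip_def perm_char_def)
next
  case False
  let ?Q = "{..<n - m}" and ?R = "{n - m..<n}"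
  obtain v where v: "v \<in> words {..<n} \<nu>" "\<And>k. k < n \<Longrightarrow> v k = 0 \<longleftrightarrow> n - m \<le> k"
    using words_normal_form[where \<nu> = \<nu>, OF _ m] False by blast
  define v' where "v' = (\<lambda>k\<in>?Q. v k - 1)"
  have v': "v' \<in> words ?Q (\<lambda>i. \<nu> (Suc i))"
  proof -
    have "content ?Q v' i = content {..<n} v (Suc i)" for i
    proof -
      have "{k \<in> ?Q. v' k = i} = {k \<in> {..<n}. v k = Suc i}"
      proof (intro equalityI subsetI)
        fix k assume k: "k \<in> {k \<in> ?Q. v' k = i}"
        then have "v k \<noteq> 0" using v(2)[of k] by auto
        then show "k \<in> {k \<in> {..<n}. v k = Suc i}" using k by (auto simp: v'_def)
      next
        fix k assume k: "k \<in> {k \<in> {..<n}. v k = Suc i}"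
        then have "k < n - m" using v(2)[of k] by auto
        then show "k \<in> {k \<in> ?Q. v' k = i}" using k by (auto simp: v'_def)
      qed
      then show ?thesis by (simp add: content_def)
    qed
    then show ?thesis using v(1) by (auto simp: words_def v'_def)
  qed
  have U: "{..<n} = ?Q \<union> ?R" using m by auto
  have sum_split: "(\<Sum>p | p permutes {..<n} \<and> v \<circ> p = v. H p) =
     (\<Sum>r | r permutes ?R. \<Sum>q | q permutes ?Q \<and> v' \<circ> q = v'. H (q \<circ> r))" for H :: "(nat \<Rightarrow> nat) \<Rightarrow> real"
  proof -
    have "(\<Sum>r | r permutes ?R. \<Sum>q | q permutes ?Q \<and> v' \<circ> q = v'. H (q \<circ> r)) =
      (\<Sum>(r, q) \<in> {r. r permutes ?R} \<times> {q. q permutes ?Q \<and> v' \<circ> q = v'}. H (q \<circ> r))"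
      by (simp add: sum.cartesian_product)
    also have "\<dots> = (\<Sum>p | p permutes {..<n} \<and> v \<circ> p = v. H p)"
    proof (rule sum.reindex_bij_witness[where j = "\<lambda>(r, q). q \<circ> r" and
        i = "\<lambda>p. (\<lambda>k. if k \<in> ?R then p k else k, \<lambda>k. if k \<in> ?Q then p k else k)"])
      fix x assume "x \<in> {r. r permutes ?R} \<times> {q. q permutes ?Q \<and> v' \<circ> q = v'}"
      then obtain r q where x: "x = (r, q)" and r: "r permutes ?R" and q: "q permutes ?Q" "v' \<circ> q = v'" by auto
      have rR: "k \<in> ?R \<Longrightarrow> r k \<in> ?R" for k using permutes_in_image[OF r] by blast
      have qQ: "k \<in> ?Q \<Longrightarrow> q k \<in> ?Q" for k using permutes_in_image[OF q(1)] by blast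
      have ro: "k \<notin> ?R \<Longrightarrow> r k = k" for k using r by (auto simp: permutes_def)
      have qo: "k \<notin> ?Q \<Longrightarrow> q k = k" for k using q by (auto simp: permutes_def)
      have e1: "(q \<circ> r) k = r k" if "k \<in> ?R" for k using rR[OF that] qo[of "r k"] by auto
      have e2: "(q \<circ> r) k = q k" if "k \<in> ?Q" for k using that ro[of k] by auto
      show "(\<lambda>p. (\<lambda>k. if k \<in> ?R then p k else k, \<lambda>k. if k \<in> ?Q then p k else k)) (case x of (r, q) \<Rightarrow> q \<circ> r) = x"
        using e1 e2 ro qo unfolding x by (auto simp: fun_eq_iff)
      have perm: "q \<circ> r permutes {..<n}"
        unfolding U using permutes_subset[OF q(1), of "?Q \<union> ?R"] permutes_subset[OF r, of "?Q \<union> ?R"]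
        by (intro permutes_compose) auto
      have "v (q (r k)) = v k" for k
      proof -
        consider "k \<in> ?Q" | "k \<in> ?R" | "k \<ge> n" using m by fastforce
        then show ?thesis
        proof cases
          case 1
          have "v' (q k) = v' k" using q(2) by (metis comp_apply)
          then have "v (q k) - 1 = v k - 1" using 1 qQ[OF 1] by (simp add: v'_def)
          moreover have "v (q k) \<noteq> 0" "v k \<noteq> 0" using v(2)[of k] v(2)[of "q k"] 1 qQ[OF 1] by auto
          ultimately show ?thesis using e2[OF 1] by simp
        next
          case 2
          then show ?thesis using e1[OF 2] rR[OF 2] v(2)[of k] v(2)[of "r k"] by auto
        next
          case 3
          then show ?thesis using qo[of k] ro[of k] by auto
        qed
      qed
      then show "(case x of (r, q) \<Rightarrow> q \<circ> r) \<in> {p. p permutes {..<n} \<and> v \<circ> p = v}"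
        using perm x by (auto simp: fun_eq_iff)
      show "H (case x of (r, q) \<Rightarrow> q \<circ> r) = (case x of (r, q) \<Rightarrow> H (q \<circ> r))" by (simp add: x)
    next
      fix p assume "p \<in> {p. p permutes {..<n} \<and> v \<circ> p = v}"
      then have p: "p permutes {..<n}" "\<And>k. v (p k) = v k" by (auto simp: fun_eq_iff)
      have less: "p k < n \<longleftrightarrow> k < n" for k using permutes_in_image[OF p(1), of k] by simp
      have pR: "p k \<in> ?R" if "k \<in> ?R" for k using that v(2)[of k] v(2)[of "p k"] p(2) less[of k] by auto
      have pQ: "p k \<in> ?Q" if "k \<in> ?Q" for k using that v(2)[of k] v(2)[of "p k"] p(2) less[of k] by auto
      have "?Q \<inter> ?R = {}" by auto
      note sp = permutes_split[OF p(1)[unfolded U] this _ _ pR]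
      show "(case (\<lambda>k. if k \<in> ?R then p k else k, \<lambda>k. if k \<in> ?Q then p k else k) of (r, q) \<Rightarrow> q \<circ> r) = p"
        using sp(3) by auto
      have "v' \<circ> (\<lambda>k. if k \<in> ?Q then p k else k) = v'"
        using p(2) pQ by (auto simp: fun_eq_iff v'_def)
      then show "(\<lambda>k. if k \<in> ?R then p k else k, \<lambda>k. if k \<in> ?Q then p k else k) \<in>
         {r. r permutes ?R} \<times> {q. q permutes ?Q \<and> v' \<circ> q = v'}"
        using sp(1,2) by auto
    qed
    finally show ?thesis by simp
  qed
  let ?s = "real (card {q. q permutes ?Q \<and> v' \<circ> q = v'})"
  have "(\<Sum>p | p permutes {..<n} \<and> v \<circ> p = v. (1::real)) = fact m * ?s"
    unfolding sum_split using card_permutations[of ?R m] m by simp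
  then have cs: "real (card {p. p permutes {..<n} \<and> v \<circ> p = v}) = fact m * ?s" by simp
  have "char_ip n (perm_char {..<n} \<nu>) F =
    (\<Sum>r | r permutes ?R. \<Sum>q | q permutes ?Q \<and> v' \<circ> q = v'. F (q \<circ> r)) / (fact m * ?s)"
    unfolding sum_perm_char_stabilizer[OF F v(1)] sum_split cs ..
  also have "\<dots> = (\<Sum>r | r permutes ?R. (\<Sum>q | q permutes ?Q \<and> v' \<circ> q = v'. F (q \<circ> r)) / ?s) / fact m"
    by (simp add: sum_divide_distrib[symmetric])
  also have "\<dots> = (\<Sum>r | r permutes ?R. char_ip (n - m) (perm_char ?Q (\<lambda>i. \<nu> (Suc i))) (\<lambda>q. F (q \<circ> r))) / fact m"
    using sum_perm_char_stabilizer[OF class_fun_comp_disjoint[OF F m(2)] v'] by simp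
  finally show ?thesis .
qed

lemma char_ip_peel_jt:
  assumes m: "\<nu> 0 = int m" "m \<le> n" and \<eta>: "\<And>i. i \<ge> N \<Longrightarrow> \<eta> i = 0"
  shows "char_ip n (perm_char {..<n} \<nu>) (jt n N \<eta>) =
    (\<Sum>c\<in>comps N m. char_ip (n - m) (perm_char {..<n - m} (\<lambda>i. \<nu> (Suc i))) (jt (n - m) N (\<lambda>i. \<eta> i - int (c i))))"
proof -
  let ?R = "{n - m..<n}" and ?G = "perm_char {..<n - m} (\<lambda>i. \<nu> (Suc i))"
  have cR: "card ?R = m" using m by simp
  have "(\<Sum>r | r permutes ?R. char_ip (n - m) ?G (\<lambda>q. jt n N \<eta> (q \<circ> r))) =
    (\<Sum>q | q permutes {..<n - m}. ?G q * (\<Sum>r | r permutes ?R. jt n N \<eta> (q \<circ> r))) / fact (n - m)"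
    unfolding char_ip_def sum_divide_distrib[symmetric] sum_distrib_left
    by (subst sum.swap) simp
  also have "\<dots> = (\<Sum>q | q permutes {..<n - m}. ?G q * (fact m * (\<Sum>c\<in>comps N m. jt (n - m) N (\<lambda>i. \<eta> i - int (c i)) q))) / fact (n - m)"
  proof -
    have "(\<Sum>r | r permutes ?R. jt n N \<eta> (q \<circ> r)) = fact m * (\<Sum>c\<in>comps N m. jt (n - m) N (\<lambda>i. \<eta> i - int (c i)) q)"
      if q: "q permutes {..<n - m}" for q
    proof -
      have "(\<Sum>r | r permutes ?R. jt n N \<eta> (q \<circ> r)) =
        (\<Sum>r | r permutes ?R. \<Sum>g \<in> {g \<in> ?R \<rightarrow>\<^sub>E {..<N}. g \<circ> r = g}. jt (n - m) N (\<lambda>i. \<eta> i - int (content ?R g i)) q)"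
        using jt_split[OF m(2) q _ \<eta>] by (intro sum.cong refl) auto
      also have "\<dots> = fact (card ?R) * (\<Sum>c\<in>comps N (card ?R). jt (n - m) N (\<lambda>i. \<eta> i - int (c i)) q)"
        by (rule sum_fixed_words[where \<phi> = "\<lambda>c. jt (n - m) N (\<lambda>i. \<eta> i - int (c i)) q"]) simp
      finally show ?thesis unfolding cR .
    qed
    then show ?thesis by simp
  qed
  also have "\<dots> = fact m * (\<Sum>c\<in>comps N m. char_ip (n - m) ?G (jt (n - m) N (\<lambda>i. \<eta> i - int (c i))))"
    unfolding char_ip_def sum_divide_distrib[symmetric]
    by (subst sum.swap) (simp add: sum_distrib_left mult_ac)
  finally show ?thesis unfolding char_ip_peel[where \<nu> = \<nu>, OF class_fun_jt m] by simp
qed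

section \<open>Horizontal strips and orthonormality of Jacobi--Trudi characters\<close>

definition partn :: "nat \<Rightarrow> (nat \<Rightarrow> nat) \<Rightarrow> bool" where
  "partn N \<alpha> \<longleftrightarrow> (\<forall>i. \<alpha> (Suc i) \<le> \<alpha> i) \<and> (\<forall>i\<ge>N. \<alpha> i = 0)"

definition jtp :: "nat \<Rightarrow> nat \<Rightarrow> (nat \<Rightarrow> nat) \<Rightarrow> (nat \<Rightarrow> nat) \<Rightarrow> real" where
  "jtp n N \<alpha> = jt n N (\<lambda>i. int (\<alpha> i) + dl N i)"

text \<open>Terms that do not remove a horizontal strip cancel in pairs: at the first row which loses too
  many cells, exchanging two neighbouring entries of the exponent vector changes the sign.\<close>

lemma jt_pieri:
  assumes \<alpha>: "partn N \<alpha>" and p: "p permutes {..<n}"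
  shows "(\<Sum>c\<in>comps N m. jt n N (\<lambda>i. int (\<alpha> i) + dl N i - int (c i)) p) =
    (\<Sum>c\<in>{c \<in> comps N m. \<forall>i. c i + \<alpha> (Suc i) \<le> \<alpha> i}. jt n N (\<lambda>i. int (\<alpha> i) + dl N i - int (c i)) p)"
proof -
  define f where "f c = jt n N (\<lambda>i. int (\<alpha> i) + dl N i - int (c i)) p" for c
  define bad where "bad = {c \<in> comps N m. \<exists>i. \<alpha> i < c i + \<alpha> (Suc i)}"
  define i0 where "i0 c = (LEAST i. \<alpha> i < c i + \<alpha> (Suc i))" for c
  \<comment> \<open>The gap between neighbouring entries of \<open>\<alpha>\<close> plus the
    staircase. Exchanging the two entries that remain after subtracting \<open>c\<close> is the same
    as replacing \<open>c\<close> by the vector \<open>\<tau> c\<close> below.\<close>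
  define d where "d i = \<alpha> i - \<alpha> (Suc i) + 1" for i
  define \<tau> where "\<tau> c = (if Suc (i0 c) < N then c(i0 c := c (Suc (i0 c)) + d (i0 c), Suc (i0 c) := c (i0 c) - d (i0 c)) else c)" for c
  have anti: "\<alpha> (Suc i) \<le> \<alpha> i" for i using \<alpha> by (simp add: partn_def)
  have i0: "\<alpha> (i0 c) < c (i0 c) + \<alpha> (Suc (i0 c))" "i0 c < N" "j < i0 c \<Longrightarrow> c j + \<alpha> (Suc j) \<le> \<alpha> j" if "c \<in> bad" for c j
  proof -
    have ex: "\<exists>i. \<alpha> i < c i + \<alpha> (Suc i)" using that by (simp add: bad_def)
    show 1: "\<alpha> (i0 c) < c (i0 c) + \<alpha> (Suc (i0 c))" unfolding i0_def by (rule LeastI_ex[OF ex])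
    show "i0 c < N"
    proof (rule ccontr)
      assume "\<not> i0 c < N"
      then show False using 1 that \<alpha> by (auto simp: bad_def comps_def partn_def)
    qed
    show "c j + \<alpha> (Suc j) \<le> \<alpha> j" if "j < i0 c"
      using not_less_Least[OF that[unfolded i0_def]] by simp
  qed
  have i0_eqI: "i0 c = i" if "\<alpha> i < c i + \<alpha> (Suc i)" "\<And>j. j < i \<Longrightarrow> c j + \<alpha> (Suc j) \<le> \<alpha> j" for c i
    unfolding i0_def by (rule Least_equality) (use that in \<open>auto simp: not_less[symmetric]\<close>)
  have \<tau>: "\<tau> c \<in> bad \<and> i0 (\<tau> c) = i0 c \<and> \<tau> (\<tau> c) = c \<and> f (\<tau> c) = - f c" if c: "c \<in> bad" for c
  proof (cases "Suc (i0 c) < N")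
    \<comment> \<open>The last row has no neighbour to be exchanged with. There
      \<open>\<alpha> (Suc i)\<close> and the staircase entry are 0, so losing too many cells makes
      the entry negative, and the term vanishes by itself; thus the fixed point of
      \<open>\<tau>\<close> is harmless.\<close>
    case False
    then have "Suc (i0 c) = N" using i0(2)[OF c] by simp
    then have "int (\<alpha> (i0 c)) + dl N (i0 c) - int (c (i0 c)) < 0"
      using i0(1)[OF c] \<alpha> by (simp add: dl_def partn_def)
    then have "f c = 0" unfolding f_def by (rule jt_neg)
    then show ?thesis using False c by (simp add: \<tau>_def)
  next
    case True
    let ?i = "i0 c"
    have \<tau>c: "\<tau> c = c(?i := c (Suc ?i) + d ?i, Suc ?i := c ?i - d ?i)" using True by (simp add: \<tau>_def)
    have dle: "d ?i \<le> c ?i" using i0(1)[OF c] anti[of ?i] by (simp add: d_def)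
    have S: "(\<Sum>i<N. x i) = x ?i + x (Suc ?i) + (\<Sum>i\<in>{..<N} - {?i} - {Suc ?i}. x i)" for x :: "nat \<Rightarrow> nat"
      using True by (simp add: sum.remove[of "{..<N}" ?i] sum.remove[of "{..<N} - {?i}" "Suc ?i"])
    have "(\<Sum>i<N. \<tau> c i) = (\<Sum>i<N. c i)"
      unfolding S using dle by (simp add: \<tau>c)
    then have "\<tau> c \<in> comps N m" using c True by (auto simp: bad_def comps_def \<tau>c)
    moreover have b: "\<alpha> ?i < \<tau> c ?i + \<alpha> (Suc ?i)" using anti[of ?i] by (simp add: \<tau>c d_def)
    ultimately have bad: "\<tau> c \<in> bad" by (auto simp: bad_def)
    have i: "i0 (\<tau> c) = ?i" using b i0(3)[OF c] by (intro i0_eqI) (auto simp: \<tau>c)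
    have "\<tau> (\<tau> c) = (\<tau> c)(?i := \<tau> c (Suc ?i) + d ?i, Suc ?i := \<tau> c ?i - d ?i)"
      using True i by (subst \<tau>_def) simp
    also have "\<dots> = c" using dle by (auto simp: \<tau>c fun_eq_iff)
    finally have inv: "\<tau> (\<tau> c) = c" .
    have "dl N ?i = dl N (Suc ?i) + 1" using True by (auto simp: dl_def)
    then have "(\<lambda>i. int (\<alpha> i) + dl N i - int (\<tau> c i)) =
       (\<lambda>i. int (\<alpha> i) + dl N i - int (c i)) \<circ> Transposition.transpose ?i (Suc ?i)"
      using dle anti[of ?i] by (auto simp: fun_eq_iff \<tau>c Transposition.transpose_def d_def)
    then have "f (\<tau> c) = - f c" unfolding f_def using jt_swap[of ?i N "Suc ?i" p n] True p by simp
    then show ?thesis using bad i inv by blast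
  qed
  have "(\<Sum>c\<in>bad. f c) = (\<Sum>c\<in>bad. - f c)"
    by (rule sum.reindex_bij_witness[where i = \<tau> and j = \<tau>]) (use \<tau> in auto)
  then have "(\<Sum>c\<in>bad. f c) = 0" by (simp add: sum_negf)
  moreover have "(\<Sum>c\<in>comps N m. f c) = (\<Sum>c\<in>bad. f c) + (\<Sum>c\<in>{c \<in> comps N m. \<forall>i. c i + \<alpha> (Suc i) \<le> \<alpha> i}. f c)"
  proof -
    let ?good = "{c \<in> comps N m. \<forall>i. c i + \<alpha> (Suc i) \<le> \<alpha> i}"
    have "comps N m = bad \<union> ?good" unfolding bad_def using not_le by blast
    moreover have "bad \<inter> ?good = {}" unfolding bad_def using not_le by blast
    moreover have "finite bad" "finite ?good" by (simp_all add: bad_def)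
    ultimately show ?thesis using sum.union_disjoint[of bad ?good f] by simp
  qed
  ultimately show ?thesis by (simp add: f_def)
qed

lemma char_ip_jtp_peel:
  assumes m: "\<nu> 0 = int m" "m \<le> n" and \<alpha>: "partn N \<alpha>"
  shows "char_ip n (perm_char {..<n} \<nu>) (jtp n N \<alpha>) =
    (\<Sum>c\<in>{c \<in> comps N m. \<forall>i. c i + \<alpha> (Suc i) \<le> \<alpha> i}.
       char_ip (n - m) (perm_char {..<n - m} (\<lambda>i. \<nu> (Suc i))) (jtp (n - m) N (\<lambda>i. \<alpha> i - c i)))"
proof -
  let ?G = "perm_char {..<n - m} (\<lambda>i. \<nu> (Suc i))"
  let ?good = "{c \<in> comps N m. \<forall>i. c i + \<alpha> (Suc i) \<le> \<alpha> i}"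
  have "char_ip n (perm_char {..<n} \<nu>) (jtp n N \<alpha>) =
    (\<Sum>c\<in>comps N m. char_ip (n - m) ?G (jt (n - m) N (\<lambda>i. int (\<alpha> i) + dl N i - int (c i))))"
    unfolding jtp_def using \<alpha> by (intro char_ip_peel_jt[where \<nu> = \<nu>, OF m]) (auto simp: partn_def dl_def)
  also have "\<dots> = (\<Sum>q | q permutes {..<n - m}. ?G q * (\<Sum>c\<in>comps N m. jt (n - m) N (\<lambda>i. int (\<alpha> i) + dl N i - int (c i)) q)) / fact (n - m)"
    unfolding char_ip_def sum_divide_distrib[symmetric] sum_distrib_left by (subst sum.swap) simp
  also have "\<dots> = (\<Sum>q | q permutes {..<n - m}. ?G q * (\<Sum>c\<in>?good. jt (n - m) N (\<lambda>i. int (\<alpha> i) + dl N i - int (c i)) q)) / fact (n - m)"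
    using jt_pieri[OF \<alpha>] by simp
  also have "\<dots> = (\<Sum>c\<in>?good. char_ip (n - m) ?G (jt (n - m) N (\<lambda>i. int (\<alpha> i) + dl N i - int (c i))))"
    unfolding char_ip_def sum_divide_distrib[symmetric] sum_distrib_left by (subst sum.swap) simp
  also have "\<dots> = (\<Sum>c\<in>?good. char_ip (n - m) ?G (jtp (n - m) N (\<lambda>i. \<alpha> i - c i)))"
  proof (rule sum.cong[OF refl])
    fix c assume "c \<in> ?good"
    then have "c i \<le> \<alpha> i" for i by (auto intro: le_trans[OF le_add1])
    then have "(\<lambda>i. int (\<alpha> i) + dl N i - int (c i)) = (\<lambda>i. int (\<alpha> i - c i) + dl N i)"
      by (auto simp: fun_eq_iff of_nat_diff)
    then show "char_ip (n - m) ?G (jt (n - m) N (\<lambda>i. int (\<alpha> i) + dl N i - int (c i))) =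
      char_ip (n - m) ?G (jtp (n - m) N (\<lambda>i. \<alpha> i - c i))" by (simp add: jtp_def)
  qed
  finally show ?thesis .
qed

lemma partn_strip:
  assumes "partn N \<alpha>" "\<And>i. c i + \<alpha> (Suc i) \<le> \<alpha> i"
  shows "partn N (\<lambda>i. \<alpha> i - c i)"
proof -
  have "\<alpha> (Suc i) - c (Suc i) \<le> \<alpha> i - c i" for i
    using assms(2)[of i] by linarith
  then show ?thesis using assms(1) by (simp add: partn_def)
qed

text \<open>Peeling off strips computes Kostka numbers. A horizontal strip with
  \<open>\<nu> 0\<close> cells has at most \<open>\<alpha> i\<close> of them in the rows from
  \<open>i\<close> on, so the first \<open>i\<close> rows lose at least
  \<open>\<nu> 0 - \<alpha> i\<close> cells, and the partial sums of what remains are again too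
  small for the rest of \<open>\<nu>\<close>.\<close>

lemma char_ip_jtp_dominance:
  assumes "partn N \<alpha>" "(\<Sum>j<i. \<nu> j) > (\<Sum>j<i. int (\<alpha> j))"
  shows "char_ip n (perm_char {..<n} \<nu>) (jtp n N \<alpha>) = 0"
  using assms
proof (induction i arbitrary: \<alpha> \<nu> n)
  case (Suc i)
  show ?case
  proof (cases "0 \<le> \<nu> 0 \<and> \<nu> 0 \<le> int n")
    case False
    have "perm_char {..<n} \<nu> p = 0" for p
    proof -
      have "words {..<n} \<nu> = {}"
      proof (rule ccontr)
        assume "words {..<n} \<nu> \<noteq> {}"
        then obtain w where "w \<in> words {..<n} \<nu>" by blast
        then have "\<nu> 0 = int (card {k \<in> {..<n}. w k = 0})" by (simp add: words_def content_def)
        moreover have "card {k \<in> {..<n}. w k = 0} \<le> card {..<n}" by (intro card_mono) auto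
        ultimately show False using False by simp
      qed
      then show ?thesis by (simp add: perm_char_def)
    qed
    then show ?thesis by (simp add: char_ip_def)
  next
    case True
    define m where "m = nat (\<nu> 0)"
    have m: "\<nu> 0 = int m" "m \<le> n" using True by (auto simp: m_def)
    show ?thesis unfolding char_ip_jtp_peel[where \<nu> = \<nu>, OF m Suc.prems(1)]
    proof (intro sum.neutral ballI Suc.IH)
      fix c assume "c \<in> {c \<in> comps N m. \<forall>i. c i + \<alpha> (Suc i) \<le> \<alpha> i}"
      then have c: "c \<in> comps N m" "\<And>i. c i + \<alpha> (Suc i) \<le> \<alpha> i" by auto
      show "partn N (\<lambda>i. \<alpha> i - c i)" by (rule partn_strip[OF Suc.prems(1) c(2)])
      \<comment> \<open>The strip condition \<open>c j + \<alpha> (Suc j) \<le> \<alpha> j\<close>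
        telescopes from row \<open>i\<close> on.\<close>
      have tail: "(\<Sum>j=i..<M. c j) \<le> \<alpha> i" for M
      proof -
        have "(\<Sum>j=i..<M. c j) + \<alpha> (max i M) \<le> \<alpha> i"
        proof (induction M)
          case (Suc M)
          show ?case
          proof (cases "i \<le> M")
            case True
            then show ?thesis using Suc c(2)[of M] by (simp add: max_def)
          qed (auto simp: max_def not_le le_Suc_eq)
        qed simp
        then show ?thesis by simp
      qed
      have "m = (\<Sum>j<N. c j)" using c(1) by (simp add: comps_def)
      also have "\<dots> \<le> (\<Sum>j<max i N. c j)" by (intro sum_mono2) auto
      also have "\<dots> = (\<Sum>j<i. c j) + (\<Sum>j=i..<max i N. c j)"
        using sum.atLeastLessThan_concat[of 0 i "max i N" c] by (simp add: atLeast0LessThan)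
      also have "\<dots> \<le> (\<Sum>j<i. c j) + \<alpha> i" using tail by simp
      finally have mle: "int m \<le> (\<Sum>j<i. int (c j)) + int (\<alpha> i)"
        by (metis of_nat_add of_nat_le_iff of_nat_sum)
      have "(\<Sum>j<i. int (\<alpha> j - c j)) = (\<Sum>j<i. int (\<alpha> j)) - (\<Sum>j<i. int (c j))"
      proof -
        have "int (\<alpha> j - c j) = int (\<alpha> j) - int (c j)" for j
          using add_leD1[OF c(2)[of j]] by (simp add: of_nat_diff)
        then show ?thesis by (simp add: sum_subtractf)
      qed
      moreover have "(\<Sum>j<Suc i. \<nu> j) = \<nu> 0 + (\<Sum>j<i. \<nu> (Suc j))" by (rule sum.lessThan_Suc_shift)
      ultimately show "(\<Sum>j<i. int (\<alpha> j - c j)) < (\<Sum>j<i. \<nu> (Suc j))"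
        using Suc.prems(2) mle m(1) by simp
    qed
  qed
qed simp

lemma sum_antitone_le:
  fixes f :: "nat \<Rightarrow> int"
  assumes f: "\<And>i j. i \<le> j \<Longrightarrow> f j \<le> f i" and "finite A"
  shows "(\<Sum>a\<in>A. f a) \<le> (\<Sum>j<card A. f j)"
  using assms(2)
proof (induction "card A" arbitrary: A)
  case (Suc k)
  then have ne: "A \<noteq> {}" by auto
  let ?M = "Max A"
  have M: "?M \<in> A" using Suc ne by simp
  have c: "card (A - {?M}) = k" using Suc M by simp
  have "A \<subseteq> {..?M}" using Suc by auto
  then have "card A \<le> Suc ?M" using card_mono[of "{..?M}" A] by simp
  then have "k \<le> ?M" using Suc.hyps(2) by simp
  then have "f ?M \<le> f k" by (rule f)
  moreover have "(\<Sum>a\<in>A - {?M}. f a) \<le> (\<Sum>j<k. f j)" using Suc.hyps(1)[of "A - {?M}"] Suc.prems c by simp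
  moreover have "(\<Sum>a\<in>A. f a) = f ?M + (\<Sum>a\<in>A - {?M}. f a)" using M Suc.prems by (simp add: sum.remove)
  ultimately show ?case using Suc.hyps(2) by (simp flip: Suc.hyps(2))
qed simp

lemma dl_partial_sum:
  assumes "\<sigma> permutes {..<N}"
  shows "(\<Sum>j<i. dl N (\<sigma> j)) \<le> (\<Sum>j<i. dl N j)"
proof -
  have "(\<Sum>j<i. dl N (\<sigma> j)) = (\<Sum>a\<in>\<sigma> ` {..<i}. dl N a)"
    using permutes_inj[OF assms] by (subst sum.reindex) (auto intro: inj_on_subset)
  also have "\<dots> \<le> (\<Sum>j<card (\<sigma> ` {..<i}). dl N j)" by (rule sum_antitone_le) (auto simp: dl_def)
  also have "card (\<sigma> ` {..<i}) = i" using permutes_inj[OF assms] by (subst card_image) (auto intro: inj_on_subset)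
  finally show ?thesis .
qed

text \<open>The first index moved by \<open>\<sigma>\<close> goes to a later one, and the staircase
  strictly decreases on the indices below \<open>N\<close>.\<close>

lemma dl_partial_sum_strict:
  assumes "\<sigma> permutes {..<N}" "\<sigma> \<noteq> id"
  shows "\<exists>i. (\<Sum>j<i. dl N (\<sigma> j)) < (\<Sum>j<i. dl N j)"
proof -
  have ex: "\<exists>j. \<sigma> j \<noteq> j" using assms(2) by (auto simp: fun_eq_iff)
  define j where "j = (LEAST j. \<sigma> j \<noteq> j)"
  have j: "\<sigma> j \<noteq> j" unfolding j_def by (rule LeastI_ex[OF ex])
  have low: "\<sigma> l = l" if "l < j" for l using not_less_Least[OF that[unfolded j_def]] by simp
  have jN: "j < N" using j assms(1) by (meson lessThan_iff permutes_not_in)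
  have "\<not> \<sigma> j < j"
  proof
    assume "\<sigma> j < j"
    then have "\<sigma> (\<sigma> j) = \<sigma> j" by (rule low)
    then show False using j injD[OF permutes_inj[OF assms(1)]] by blast
  qed
  then have "j < \<sigma> j" using j by simp
  moreover have "\<sigma> j < N" using jN permutes_in_image[OF assms(1), of j] by simp
  ultimately have "dl N (\<sigma> j) < dl N j" by (simp add: dl_def)
  moreover have "(\<Sum>l<j. dl N (\<sigma> l)) = (\<Sum>l<j. dl N l)" using low by (intro sum.cong) auto
  ultimately have "(\<Sum>l<Suc j. dl N (\<sigma> l)) < (\<Sum>l<Suc j. dl N l)" by simp
  then show ?thesis by blast
qed

lemma permutes_dl_eq:
  assumes "\<sigma> permutes {..<N}" "\<And>i. dl N (\<sigma> i) = dl N i"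
  shows "\<sigma> = id"
proof
  fix i
  show "\<sigma> i = id i"
  proof (cases "i < N")
    case True
    then have "\<sigma> i < N" using permutes_in_image[OF assms(1), of i] by simp
    then show ?thesis using assms(2)[of i] True by (simp add: dl_def)
  next
    case False
    then show ?thesis using assms(1) by (simp add: permutes_not_in)
  qed
qed

lemma sum_sign_delta:
  fixes N :: nat
  assumes "\<And>\<sigma>. \<sigma> permutes {..<N} \<Longrightarrow> \<sigma> \<noteq> id \<Longrightarrow> h \<sigma> = 0"
  shows "(\<Sum>\<sigma> | \<sigma> permutes {..<N}. of_int (sign \<sigma>) * h \<sigma>) = (h id :: real)"
proof -
  have "(\<Sum>\<sigma> | \<sigma> permutes {..<N}. of_int (sign \<sigma>) * h \<sigma>) = (\<Sum>\<sigma>\<in>{id}. of_int (sign \<sigma>) * h \<sigma>)"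
    by (rule sum.mono_neutral_right) (use assms finite_permutations[OF finite_lessThan] in \<open>auto simp: permutes_id\<close>)
  then show ?thesis by (simp add: sign_id)
qed

lemma jtp_zero: "jtp 0 N (\<lambda>_. 0) id = 1"
proof -
  have w: "words {} \<beta> = (if \<beta> = (\<lambda>_. 0) then {\<lambda>_. undefined} else {})" for \<beta>
    by (auto simp: words_def content_def fun_eq_iff)
  have "perm_char {..<0} (\<lambda>i. int 0 + dl N i - dl N (\<sigma> i)) id = 0"
    if \<sigma>: "\<sigma> permutes {..<N}" "\<sigma> \<noteq> id" for \<sigma>
  proof -
    have "(\<lambda>i. dl N i - dl N (\<sigma> i)) \<noteq> (\<lambda>_. 0)"
    proof
      assume "(\<lambda>i. dl N i - dl N (\<sigma> i)) = (\<lambda>_. 0)"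
      then have "dl N (\<sigma> i) = dl N i" for i by (metis eq_iff_diff_eq_0)
      then show False using permutes_dl_eq[OF \<sigma>(1)] \<sigma>(2) by blast
    qed
    then show ?thesis by (simp add: perm_char_def w)
  qed
  then have "jtp 0 N (\<lambda>_. 0) id = perm_char {..<0} (\<lambda>i. int 0 + dl N i - dl N (id i)) id"
    unfolding jtp_def jt_def by (rule sum_sign_delta)
  then show ?thesis by (simp add: perm_char_def w)
qed

text \<open>The diagonal Kostka number is 1: the only horizontal strip with
  \<open>\<alpha> 0\<close> cells is the maximal one, with one cell in each column, and removing it
  leaves \<open>\<alpha>\<close> without its first part. The induction is on a bound
  \<open>L\<close> for the number of nonzero parts.\<close>

lemma char_ip_jtp_self:
  assumes "partn N \<alpha>" "\<And>i. i \<ge> L \<Longrightarrow> \<alpha> i = 0" "L \<le> N" "n = (\<Sum>i<N. \<alpha> i)"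
  shows "char_ip n (perm_char {..<n} (\<lambda>i. int (\<alpha> i))) (jtp n N \<alpha>) = 1"
  using assms
proof (induction L arbitrary: \<alpha> n)
  case 0
  then have \<alpha>: "\<alpha> = (\<lambda>_. 0)" by auto
  have n: "n = 0" using 0 by simp
  have "perm_char {} (\<lambda>i. 0) id = 1"
  proof -
    have "words {} (\<lambda>i. 0) = {\<lambda>_. undefined}" by (auto simp: words_def content_def)
    then show ?thesis by (simp add: perm_char_def)
  qed
  then show ?case using jtp_zero[of N] by (simp add: \<alpha> n char_ip_def)
next
  case (Suc L)
  have mono: "\<alpha> (Suc i) \<le> \<alpha> i" for i using Suc.prems(1) by (simp add: partn_def)
  have aN: "\<alpha> N = 0" using Suc.prems(1) by (simp add: partn_def)
  let ?c = "\<lambda>i. \<alpha> i - \<alpha> (Suc i)"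
  have tel: "(\<Sum>i<M. ?c i) + \<alpha> M = \<alpha> 0" for M
  proof (induction M)
    case (Suc M)
    have "(\<Sum>i<Suc M. ?c i) + \<alpha> (Suc M) = (\<Sum>i<M. ?c i) + \<alpha> M" using mono[of M] by simp
    then show ?case using Suc by simp
  qed simp
  have mn: "\<alpha> 0 \<le> n"
    using Suc.prems(3,4) member_le_sum[of 0 "{..<N}" \<alpha>] by simp
  have good: "{c \<in> comps N (\<alpha> 0). \<forall>i. c i + \<alpha> (Suc i) \<le> \<alpha> i} = {?c}"
  proof (intro equalityI subsetI)
    fix c assume c: "c \<in> {c \<in> comps N (\<alpha> 0). \<forall>i. c i + \<alpha> (Suc i) \<le> \<alpha> i}"
    then have le: "c i \<le> ?c i" for i by (metis (mono_tags, lifting) add_le_imp_le_diff mem_Collect_eq)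
    have "(\<Sum>i<N. c i) = (\<Sum>i<N. ?c i)" using c tel[of N] aN by (simp add: comps_def)
    then have "c i = ?c i" if "i < N" for i
      using that le by (intro sum_mono_inv[of c "{..<N}" ?c]) auto
    moreover have "c i = ?c i" if "i \<ge> N" for i
      using that c Suc.prems(1) by (simp add: comps_def partn_def)
    ultimately have "c = ?c" by (auto simp: fun_eq_iff not_less[symmetric])
    then show "c \<in> {?c}" by simp
  next
    fix c assume "c \<in> {?c}"
    then show "c \<in> {c \<in> comps N (\<alpha> 0). \<forall>i. c i + \<alpha> (Suc i) \<le> \<alpha> i}"
      using mono tel[of N] aN Suc.prems(1) by (auto simp: comps_def partn_def)
  qed
  have tail: "(\<lambda>i. \<alpha> i - ?c i) = (\<lambda>i. \<alpha> (Suc i))" using mono by auto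
  have p: "partn N (\<lambda>i. \<alpha> (Suc i))" using Suc.prems(1) by (simp add: partn_def)
  have sN: "(\<Sum>i<N. \<alpha> i) + \<alpha> N = \<alpha> 0 + (\<Sum>i<N. \<alpha> (Suc i))"
    using sum.lessThan_Suc_shift[of \<alpha> N] by simp
  have "char_ip n (perm_char {..<n} (\<lambda>i. int (\<alpha> i))) (jtp n N \<alpha>) =
    char_ip (n - \<alpha> 0) (perm_char {..<n - \<alpha> 0} (\<lambda>i. int (\<alpha> (Suc i)))) (jtp (n - \<alpha> 0) N (\<lambda>i. \<alpha> (Suc i)))"
    using char_ip_jtp_peel[where \<nu> = "\<lambda>i. int (\<alpha> i)" and m = "\<alpha> 0", OF _ mn Suc.prems(1)] tail
    unfolding good by simp
  also have "\<dots> = 1"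
    by (rule Suc.IH[OF p]) (use Suc.prems sN aN in auto)
  finally show ?case .
qed

lemma char_ip_jtp_expand:
  "char_ip n F (jtp n N \<alpha>) =
    (\<Sum>\<sigma> | \<sigma> permutes {..<N}. of_int (sign \<sigma>) * char_ip n F (perm_char {..<n} (\<lambda>i. int (\<alpha> i) + dl N i - dl N (\<sigma> i))))"
  unfolding jtp_def jt_def by (rule char_ip_sum_right)

lemma partial_sum_shift:
  assumes "\<sigma> permutes {..<N}"
  shows "(\<Sum>j<i. int (\<alpha> j)) \<le> (\<Sum>j<i. int (\<alpha> j) + dl N j - dl N (\<sigma> j))"
  using dl_partial_sum[OF assms, of i] by (simp add: sum.distrib sum_subtractf)

lemma partial_sum_shift_strict:
  assumes "\<sigma> permutes {..<N}" "\<sigma> \<noteq> id"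
  obtains i where "(\<Sum>j<i. int (\<alpha> j)) < (\<Sum>j<i. int (\<alpha> j) + dl N j - dl N (\<sigma> j))"
  using dl_partial_sum_strict[OF assms] by (auto simp: sum.distrib sum_subtractf)

text \<open>When one determinant is expanded, each term other than the identity has a content not
  dominated by \<open>\<alpha>\<close> and pairs to zero.\<close>

lemma char_ip_jtp_jtp_self:
  assumes "partn N \<alpha>" "n = (\<Sum>i<N. \<alpha> i)"
  shows "char_ip n (jtp n N \<alpha>) (jtp n N \<alpha>) = 1"
proof -
  have "char_ip n (jtp n N \<alpha>) (perm_char {..<n} (\<lambda>i. int (\<alpha> i) + dl N i - dl N (\<sigma> i))) = 0"
    if "\<sigma> permutes {..<N}" "\<sigma> \<noteq> id" for \<sigma>
    using partial_sum_shift_strict[OF that, of \<alpha>] char_ip_jtp_dominance[OF assms(1)]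
    by (metis char_ip_commute)
  then have "char_ip n (jtp n N \<alpha>) (jtp n N \<alpha>) =
     char_ip n (jtp n N \<alpha>) (perm_char {..<n} (\<lambda>i. int (\<alpha> i) + dl N i - dl N (id i)))"
    unfolding char_ip_jtp_expand[of n "jtp n N \<alpha>"] by (rule sum_sign_delta)
  also have "\<dots> = 1"
    using char_ip_jtp_self[OF assms(1) _ order.refl assms(2)] assms(1)
    by (simp add: char_ip_commute partn_def)
  finally show ?thesis .
qed

lemma char_ip_jtp_0:
  assumes "partn N \<alpha>" "(\<Sum>j<i. int (\<alpha> j)) < (\<Sum>j<i. int (\<beta> j))"
  shows "char_ip n (jtp n N \<alpha>) (jtp n N \<beta>) = 0"
proof -
  have "char_ip n (jtp n N \<alpha>) (perm_char {..<n} (\<lambda>i. int (\<beta> i) + dl N i - dl N (\<sigma> i))) = 0"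
    if "\<sigma> permutes {..<N}" for \<sigma>
    using order.strict_trans2[OF assms(2) partial_sum_shift[OF that]]
      char_ip_jtp_dominance[OF assms(1)] char_ip_commute by metis
  then show ?thesis unfolding char_ip_jtp_expand[of n "jtp n N \<alpha>"] by simp
qed

text \<open>Different partitions differ in some partial sum; expanding the determinant of the one
  with the larger sum makes every term vanish, and symmetry of the pairing covers both
  cases.\<close>

lemma jtp_orthonormal:
  assumes "partn N \<alpha>" "partn N \<beta>" "n = (\<Sum>i<N. \<alpha> i)"
  shows "char_ip n (jtp n N \<alpha>) (jtp n N \<beta>) = (if \<alpha> = \<beta> then 1 else 0)"
proof (cases "\<alpha> = \<beta>")
  case True
  then show ?thesis using char_ip_jtp_jtp_self[OF assms(1,3)] by simp
next
  case False
  have "\<exists>i. (\<Sum>j<i. int (\<alpha> j)) \<noteq> (\<Sum>j<i. int (\<beta> j))"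
  proof (rule ccontr)
    assume a: "\<nexists>i. (\<Sum>j<i. int (\<alpha> j)) \<noteq> (\<Sum>j<i. int (\<beta> j))"
    have "\<alpha> j = \<beta> j" for j
      using a sum.lessThan_Suc[of "\<lambda>j. int (\<alpha> j)" j] sum.lessThan_Suc[of "\<lambda>j. int (\<beta> j)" j]
      by (metis add_left_imp_eq of_nat_eq_iff)
    then show False using False by auto
  qed
  then obtain i where "(\<Sum>j<i. int (\<alpha> j)) < (\<Sum>j<i. int (\<beta> j)) \<or> (\<Sum>j<i. int (\<beta> j)) < (\<Sum>j<i. int (\<alpha> j))"
    by (meson linorder_neqE_linordered_idom)
  then show ?thesis using False char_ip_jtp_0[OF assms(1)] char_ip_jtp_0[OF assms(2)] char_ip_commute
    by metis
qed

lemma partn_part_fun: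
  assumes "is_partition \<alpha>" "length \<alpha> \<le> N" shows "partn N (part_fun \<alpha>)"
  using part_fun_antitone[OF assms(1)] assms(2) by (auto simp: partn_def part_fun_def)

theorem irr_char_eq_jtp:
  assumes \<alpha>: "\<alpha> \<in> partitions_of n" and N: "length \<alpha> \<le> N" and p: "p permutes {..<n}"
  shows "irr_char \<alpha> p = complex_of_real (jtp n N (part_fun \<alpha>) p)"
proof -
  obtain T where "young_tableau \<alpha> n T" using ex_young_tableau[OF \<alpha>] .
  then interpret young_tableau \<alpha> n T .
  let ?J = "jtp n N (part_fun \<alpha>)"
  have pa: "partn N (part_fun \<alpha>)" using partn_part_fun[OF part N] .
  have s: "n = (\<Sum>i<N. part_fun \<alpha> i)" using sum_part_fun[OF N] n_def by simp
  have "char_ip n chi (perm_char {..<n} (\<lambda>i. int (part_fun \<alpha> i) + dl N i - dl N (\<sigma> i))) = 0"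
    if "\<sigma> permutes {..<N}" "\<sigma> \<noteq> id" for \<sigma>
    using partial_sum_shift_strict[OF that, of "part_fun \<alpha>"] chi_ip_perm_char_0
    unfolding shape_def by metis
  then have "char_ip n chi ?J =
     char_ip n chi (perm_char {..<n} (\<lambda>i. int (part_fun \<alpha> i) + dl N i - dl N (id i)))"
    unfolding char_ip_jtp_expand by (rule sum_sign_delta)
  also have "\<dots> = 1" using chi_ip_shape by (simp add: shape_def[abs_def])
  finally have cJ: "char_ip n chi ?J = 1" .
  have "(\<Sum>p\<in>G. (chi p - ?J p)\<^sup>2) = (\<Sum>p\<in>G. chi p * chi p) - 2 * (\<Sum>p\<in>G. chi p * ?J p) + (\<Sum>p\<in>G. ?J p * ?J p)"
    by (simp add: power2_eq_square algebra_simps sum.distrib sum_subtractf sum_distrib_left)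
  also have "\<dots> = fact n * (char_ip n chi chi - 2 * char_ip n chi ?J + char_ip n ?J ?J)"
    by (simp add: char_ip_def field_simps)
  also have "\<dots> = 0" using cJ chi_ip_chi char_ip_jtp_jtp_self[OF pa s] by simp
  finally have "(\<Sum>p\<in>G. (chi p - ?J p)\<^sup>2) = 0" .
  then have "chi p = ?J p" using p by (subst (asm) sum_nonneg_eq_0_iff) auto
  then show ?thesis using irr_char_eq[OF p] by simp
qed

section \<open>Restriction of characters in terms of diagrams\<close>

text \<open>Diagrams are kept as finite down-closed sets of cells, so that removing cells, moving a
  cell and transposing are plain set operations.\<close>

definition ideal :: "(nat \<times> nat) set \<Rightarrow> bool" where
  "ideal I \<longleftrightarrow> finite I \<and> (\<forall>i j i' j'. (i, j) \<in> I \<longrightarrow> i' \<le> i \<longrightarrow> j' \<le> j \<longrightarrow> (i', j') \<in> I)"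

definition rowlen :: "(nat \<times> nat) set \<Rightarrow> nat \<Rightarrow> nat" where
  "rowlen I i = card {j. (i, j) \<in> I}"

definition subs :: "nat \<Rightarrow> (nat \<times> nat) set \<Rightarrow> (nat \<times> nat) set set" where
  "subs m I = {Y. ideal Y \<and> Y \<subseteq> I \<and> card (I - Y) = m}"

definition hstrip :: "(nat \<times> nat) set \<Rightarrow> bool" where
  "hstrip D \<longleftrightarrow> (\<forall>i i' j. (i, j) \<in> D \<longrightarrow> (i', j) \<in> D \<longrightarrow> i = i')"

definition vstrip :: "(nat \<times> nat) set \<Rightarrow> bool" where
  "vstrip D \<longleftrightarrow> (\<forall>i j j'. (i, j) \<in> D \<longrightarrow> (i, j') \<in> D \<longrightarrow> j = j')"

definition in_rows :: "nat \<Rightarrow> (nat \<times> nat) set \<Rightarrow> bool" where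
  "in_rows N I \<longleftrightarrow> (\<forall>i j. (i, j) \<in> I \<longrightarrow> i < N)"

definition idc :: "nat \<Rightarrow> nat \<Rightarrow> (nat \<times> nat) set \<Rightarrow> (nat \<Rightarrow> nat) \<Rightarrow> real" where
  "idc n N I = jtp n N (rowlen I)"

lemma idealD: "ideal I \<Longrightarrow> (i, j) \<in> I \<Longrightarrow> i' \<le> i \<Longrightarrow> j' \<le> j \<Longrightarrow> (i', j') \<in> I"
  by (auto simp: ideal_def)

lemma ideal_finite: "ideal I \<Longrightarrow> finite I" by (simp add: ideal_def)

lemma in_ideal_iff:
  assumes "ideal I" shows "(i, j) \<in> I \<longleftrightarrow> j < rowlen I i"
proof -
  have "finite {j. (i, j) \<in> I}"
    using finite_imageI[OF ideal_finite[OF assms], of snd] by (rule finite_subset[rotated]) force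
  then have "{j. (i, j) \<in> I} = {..<rowlen I i}"
    unfolding rowlen_def using idealD[OF assms] by (intro lessThan_of_down_closed) auto
  then show ?thesis by auto
qed

lemma rowlen_eqI: "(\<And>j. (i, j) \<in> I \<longleftrightarrow> j < k) \<Longrightarrow> rowlen I i = k"
  by (simp add: rowlen_def flip: lessThan_def)

lemma ideal_eq_iff: "ideal I \<Longrightarrow> ideal J \<Longrightarrow> I = J \<longleftrightarrow> rowlen I = rowlen J"
  by (auto simp: in_ideal_iff)

lemma rowlen_mono_Suc:
  assumes "ideal I" shows "rowlen I (Suc i) \<le> rowlen I i"
proof (rule ccontr)
  assume "\<not> ?thesis"
  then have "(Suc i, rowlen I i) \<in> I" using in_ideal_iff[OF assms] by simp
  then have "(i, rowlen I i) \<in> I" using idealD[OF assms] by simp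
  then show False using in_ideal_iff[OF assms] by simp
qed

lemma partn_rowlen: "ideal I \<Longrightarrow> in_rows N I \<Longrightarrow> partn N (rowlen I)"
  using rowlen_mono_Suc[of I] in_ideal_iff[of I] unfolding partn_def in_rows_def
  by (metis not_gr_zero not_less)

lemma ideal_partn: "partn N \<alpha> \<Longrightarrow> ideal {(i, j). j < \<alpha> i} \<and> in_rows N {(i, j). j < \<alpha> i}"
proof -
  assume \<alpha>: "partn N \<alpha>"
  have mono: "\<alpha> i \<le> \<alpha> i'" if "i' \<le> i" for i i'
    using that \<alpha> by (induction rule: dec_induct) (auto simp: partn_def intro: order_trans)
  have r: "i < N" if "j < \<alpha> i" for i j using that \<alpha> by (force simp: partn_def not_less[symmetric])
  have "{(i, j). j < \<alpha> i} \<subseteq> {..<N} \<times> {..<\<alpha> 0}" using r mono[of 0] by (auto intro: less_le_trans)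
  then have "finite {(i, j). j < \<alpha> i}" by (rule finite_subset) simp
  moreover have "j' < \<alpha> i'" if "j < \<alpha> i" "i' \<le> i" "j' \<le> j" for i j i' j'
    using that mono[of i' i] by simp
  ultimately show ?thesis using r by (auto simp: ideal_def in_rows_def)
qed

lemma card_ideal:
  assumes "ideal I" "in_rows N I" shows "card I = (\<Sum>i<N. rowlen I i)"
proof -
  have "I = (SIGMA i:{..<N}. {..<rowlen I i})"
    using assms in_ideal_iff[OF assms(1)] by (auto simp: in_rows_def)
  then have "card I = card (SIGMA i:{..<N}. {..<rowlen I i})" by (rule arg_cong)
  then show ?thesis by simp
qed

lemma idc_orthonormal:
  assumes "ideal I" "in_rows N I" "ideal J" "in_rows N J" "n = card I"
  shows "char_ip n (idc n N I) (idc n N J) = (if I = J then 1 else 0)"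
  unfolding idc_def using assms
  by (subst jtp_orthonormal) (simp_all add: partn_rowlen card_ideal ideal_eq_iff)

lemma finite_subs [simp]: "finite I \<Longrightarrow> finite (subs m I)"
  by (rule finite_subset[of _ "Pow I"]) (auto simp: subs_def)

lemma subs_in_rows: "in_rows N I \<Longrightarrow> Y \<in> subs m I \<Longrightarrow> in_rows N Y"
  by (auto simp: subs_def in_rows_def)

lemma subs_card: "ideal I \<Longrightarrow> Y \<in> subs m I \<Longrightarrow> card Y = card I - m"
proof -
  assume I: "ideal I" and Y: "Y \<in> subs m I"
  then have "card I = card Y + card (I - Y)"
    using card_Un_disjoint[of Y "I - Y"] ideal_finite by (auto simp: subs_def Un_absorb1 finite_subset)
  then show ?thesis using Y by (simp add: subs_def)
qed

lemma rowlen_mono: "ideal I \<Longrightarrow> ideal Y \<Longrightarrow> Y \<subseteq> I \<Longrightarrow> rowlen Y i \<le> rowlen I i"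
  by (metis in_ideal_iff in_mono not_less order_refl)

text \<open>Translates vectors \<open>c\<close> of row losses into subdiagrams; the hypothesis on
  \<open>P\<close> excludes vectors that do not leave a diagram.\<close>

lemma sum_subs:
  assumes I: "ideal I" "in_rows N I"
    and P: "\<And>c. c \<in> comps N m \<Longrightarrow> P c \<Longrightarrow> (\<forall>i. c i \<le> rowlen I i) \<and> (\<forall>i. rowlen I (Suc i) - c (Suc i) \<le> rowlen I i - c i)"
  shows "(\<Sum>c\<in>{c \<in> comps N m. P c}. \<phi> (\<lambda>i. rowlen I i - c i)) =
    (\<Sum>Y\<in>{Y \<in> subs m I. P (\<lambda>i. rowlen I i - rowlen Y i)}. \<phi> (rowlen Y))"
proof (rule sum.reindex_bij_witness[where i = "\<lambda>Y i. rowlen I i - rowlen Y i"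
    and j = "\<lambda>c. {(i, j). j < rowlen I i - c i}"])
  fix c assume c: "c \<in> {c \<in> comps N m. P c}"
  then have le: "c i \<le> rowlen I i" and mono: "rowlen I (Suc i) - c (Suc i) \<le> rowlen I i - c i" for i
    using P by auto
  let ?Y = "{(i, j). j < rowlen I i - c i}"
  have "partn N (\<lambda>i. rowlen I i - c i)" using mono partn_rowlen[OF I] by (auto simp: partn_def)
  then have Y: "ideal ?Y" "in_rows N ?Y" using ideal_partn by blast+
  have rY: "rowlen ?Y = (\<lambda>i. rowlen I i - c i)" by (intro ext rowlen_eqI) simp
  show e: "(\<lambda>i. rowlen I i - rowlen ?Y i) = c" unfolding rY using le by auto
  have sub: "?Y \<subseteq> I" using in_ideal_iff[OF I(1)] by auto
  have "card ?Y + (\<Sum>i<N. c i) = card I"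
    unfolding card_ideal[OF Y] card_ideal[OF I] rY using le by (simp add: sum.distrib[symmetric])
  then have "card (I - ?Y) = m"
    using c card_Diff_subset[OF ideal_finite[OF Y(1)] sub] by (simp add: comps_def)
  then show "?Y \<in> {Y \<in> subs m I. P (\<lambda>i. rowlen I i - rowlen Y i)}"
    using c Y sub e by (simp add: subs_def)
  show "\<phi> (rowlen ?Y) = \<phi> (\<lambda>i. rowlen I i - c i)" by (simp add: rY)
next
  fix Y assume "Y \<in> {Y \<in> subs m I. P (\<lambda>i. rowlen I i - rowlen Y i)}"
  then have Y: "ideal Y" "Y \<subseteq> I" "card (I - Y) = m" "P (\<lambda>i. rowlen I i - rowlen Y i)"
    by (auto simp: subs_def)
  have YN: "in_rows N Y" using Y I by (auto simp: in_rows_def)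
  note le = rowlen_mono[OF I(1) Y(1,2)]
  show "{(i, j). j < rowlen I i - (rowlen I i - rowlen Y i)} = Y"
    using le in_ideal_iff[OF Y(1)] by auto
  have "card Y + (\<Sum>i<N. rowlen I i - rowlen Y i) = card I"
    unfolding card_ideal[OF Y(1) YN] card_ideal[OF I] using le by (simp add: sum.distrib[symmetric])
  moreover have "card Y + m = card I"
    using Y card_Diff_subset[OF ideal_finite[OF Y(1)] Y(2)] card_mono[OF ideal_finite[OF I(1)] Y(2)] by simp
  ultimately have "(\<Sum>i<N. rowlen I i - rowlen Y i) = m" by simp
  moreover have "rowlen I i = 0" if "i \<ge> N" for i using partn_rowlen[OF I] that by (simp add: partn_def)
  ultimately show "(\<lambda>i. rowlen I i - rowlen Y i) \<in> {c \<in> comps N m. P c}"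
    using Y(4) by (simp add: comps_def)
qed

text \<open>Both sides say that the row lengths of \<open>I\<close> and \<open>Y\<close> interlace;
  the right one has the form in which \<open>jt_pieri\<close> states the condition on the
  losses.\<close>

lemma hs_iff:
  assumes "ideal I" "ideal Y" "Y \<subseteq> I"
  shows "hstrip (I - Y) \<longleftrightarrow> (\<forall>i. rowlen I i - rowlen Y i + rowlen I (Suc i) \<le> rowlen I i)"
proof -
  have le: "rowlen Y i \<le> rowlen I i" for i using rowlen_mono[OF assms] .
  have "hstrip (I - Y) \<longleftrightarrow> (\<forall>i. rowlen I (Suc i) \<le> rowlen Y i)"
  proof (intro iffI allI)
    fix i assume h: "hstrip (I - Y)"
    show "rowlen I (Suc i) \<le> rowlen Y i"
    proof (rule ccontr)
      assume "\<not> ?thesis"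
      then have a: "(Suc i, rowlen Y i) \<in> I" using in_ideal_iff[OF assms(1)] by simp
      have b: "(i, rowlen Y i) \<notin> Y" using in_ideal_iff[OF assms(2)] by simp
      then have "(Suc i, rowlen Y i) \<notin> Y" using idealD[OF assms(2), of "Suc i" _ i] by auto
      moreover have "(i, rowlen Y i) \<in> I" using idealD[OF assms(1) a] by simp
      ultimately show False using h a b unfolding hstrip_def by (metis DiffI n_not_Suc_n)
    qed
  next
    assume a: "\<forall>i. rowlen I (Suc i) \<le> rowlen Y i"
    have *: False if "(i, j) \<in> I - Y" "(i', j) \<in> I - Y" "i < i'" for i i' j
    proof -
      have "(Suc i, j) \<in> I" using idealD[OF assms(1), of i' j "Suc i" j] that by simp
      then have "j < rowlen Y i" using a in_ideal_iff[OF assms(1)] less_le_trans by blast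
      then show False using that in_ideal_iff[OF assms(2)] by simp
    qed
    show "hstrip (I - Y)" unfolding hstrip_def using * by (metis nat_neq_iff)
  qed
  also have "\<dots> \<longleftrightarrow> (\<forall>i. rowlen I i - rowlen Y i + rowlen I (Suc i) \<le> rowlen I i)"
  proof -
    have "rowlen I (Suc i) \<le> rowlen Y i \<longleftrightarrow> rowlen I i - rowlen Y i + rowlen I (Suc i) \<le> rowlen I i" for i
      using le[of i] by linarith
    then show ?thesis by simp
  qed
  finally show ?thesis .
qed

lemma vs_iff:
  assumes "ideal I" "ideal Y" "Y \<subseteq> I"
  shows "vstrip (I - Y) \<longleftrightarrow> (\<forall>i. rowlen I i - rowlen Y i \<le> 1)"
proof (intro iffI allI)
  fix i assume v: "vstrip (I - Y)"
  show "rowlen I i - rowlen Y i \<le> 1"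
  proof (rule ccontr)
    assume "\<not> ?thesis"
    then have "(i, rowlen Y i) \<in> I - Y" "(i, Suc (rowlen Y i)) \<in> I - Y"
      using in_ideal_iff[OF assms(1)] in_ideal_iff[OF assms(2)] by auto
    then show False using v unfolding vstrip_def by (metis n_not_Suc_n)
  qed
next
  assume a: "\<forall>i. rowlen I i - rowlen Y i \<le> 1"
  show "vstrip (I - Y)" unfolding vstrip_def
  proof (intro allI impI)
    fix i j j' assume "(i, j) \<in> I - Y" "(i, j') \<in> I - Y"
    then have "j < rowlen I i" "j' < rowlen I i" "rowlen Y i \<le> j" "rowlen Y i \<le> j'"
      using in_ideal_iff[OF assms(1)] in_ideal_iff[OF assms(2)] by auto
    then show "j = j'" using a[rule_format, of i] by linarith
  qed
qed

lemma sum_horizontal: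
  assumes I: "ideal I" "in_rows N I" and q: "q permutes {..<n}"
  shows "(\<Sum>c\<in>comps N m. jt n N (\<lambda>i. int (rowlen I i) + dl N i - int (c i)) q) =
    (\<Sum>Y\<in>{Y \<in> subs m I. hstrip (I - Y)}. idc n N Y q)"
proof -
  let ?P = "\<lambda>c. \<forall>i. c i + rowlen I (Suc i) \<le> rowlen I i"
  have P: "(\<forall>i. c i \<le> rowlen I i) \<and> (\<forall>i. rowlen I (Suc i) - c (Suc i) \<le> rowlen I i - c i)" if "?P c" for c
  proof (intro conjI allI)
    fix i show "c i \<le> rowlen I i" "rowlen I (Suc i) - c (Suc i) \<le> rowlen I i - c i"
      using that[rule_format, of i] by linarith+
  qed
  have "(\<Sum>c\<in>comps N m. jt n N (\<lambda>i. int (rowlen I i) + dl N i - int (c i)) q) =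
    (\<Sum>c\<in>{c \<in> comps N m. ?P c}. jt n N (\<lambda>i. int (rowlen I i) + dl N i - int (c i)) q)"
    by (rule jt_pieri[OF partn_rowlen[OF I] q])
  also have "\<dots> = (\<Sum>c\<in>{c \<in> comps N m. ?P c}. jtp n N (\<lambda>i. rowlen I i - c i) q)"
  proof (rule sum.cong[OF refl])
    fix c assume "c \<in> {c \<in> comps N m. ?P c}"
    then have "c i \<le> rowlen I i" for i using P[of c] by auto
    then have "(\<lambda>i. int (rowlen I i) + dl N i - int (c i)) = (\<lambda>i. int (rowlen I i - c i) + dl N i)"
      by (auto simp: of_nat_diff)
    then show "jt n N (\<lambda>i. int (rowlen I i) + dl N i - int (c i)) q = jtp n N (\<lambda>i. rowlen I i - c i) q"
      by (simp add: jtp_def)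
  qed
  also have "\<dots> = (\<Sum>Y\<in>{Y \<in> subs m I. ?P (\<lambda>i. rowlen I i - rowlen Y i)}. jtp n N (rowlen Y) q)"
    by (rule sum_subs[OF I, where \<phi> = "\<lambda>\<alpha>. jtp n N \<alpha> q"]) (use P in blast)
  also have "{Y \<in> subs m I. ?P (\<lambda>i. rowlen I i - rowlen Y i)} = {Y \<in> subs m I. hstrip (I - Y)}"
    using hs_iff[OF I(1)] by (auto simp: subs_def)
  finally show ?thesis by (simp add: idc_def)
qed

text \<open>Here the bad terms vanish one by one. Since \<open>c\<close> has entries at most 1, a
  remainder that is not a partition increases by exactly 1 at some row, which makes two neighbouring
  entries of the exponent vector equal, or it is negative in the last row.\<close>

lemma sum_vertical:
  assumes I: "ideal I" "in_rows N I" and q: "q permutes {..<n}"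
  shows "(\<Sum>c\<in>{c \<in> comps N m. \<forall>i. c i \<le> 1}. jt n N (\<lambda>i. int (rowlen I i) + dl N i - int (c i)) q) =
    (\<Sum>Y\<in>{Y \<in> subs m I. vstrip (I - Y)}. idc n N Y q)"
proof -
  let ?\<alpha> = "rowlen I"
  let ?P = "\<lambda>c. (\<forall>i. c i \<le> 1) \<and> (\<forall>i. c i \<le> ?\<alpha> i) \<and> (\<forall>i. ?\<alpha> (Suc i) - c (Suc i) \<le> ?\<alpha> i - c i)"
  note pa = partn_rowlen[OF I]
  have "(\<Sum>c\<in>{c \<in> comps N m. \<forall>i. c i \<le> 1}. jt n N (\<lambda>i. int (?\<alpha> i) + dl N i - int (c i)) q) =
    (\<Sum>c\<in>{c \<in> comps N m. ?P c}. jt n N (\<lambda>i. int (?\<alpha> i) + dl N i - int (c i)) q)"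
  proof (rule sum.mono_neutral_right)
    show "\<forall>c\<in>{c \<in> comps N m. \<forall>i. c i \<le> 1} - {c \<in> comps N m. ?P c}.
       jt n N (\<lambda>i. int (?\<alpha> i) + dl N i - int (c i)) q = 0"
    proof
      fix c assume "c \<in> {c \<in> comps N m. \<forall>i. c i \<le> 1} - {c \<in> comps N m. ?P c}"
      then have c: "c \<in> comps N m" "\<And>i. c i \<le> 1" and "\<not> ?P c" by auto
      let ?\<beta> = "\<lambda>i. int (?\<alpha> i) - int (c i)"
      have bN: "?\<beta> i = 0" if "i \<ge> N" for i using that c(1) pa by (simp add: comps_def partn_def)
      have "\<exists>i. ?\<beta> i < ?\<beta> (Suc i)"
      proof (rule ccontr)
        assume "\<nexists>i. ?\<beta> i < ?\<beta> (Suc i)"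
        then have a: "?\<beta> (Suc i) \<le> ?\<beta> i" for i by (meson not_less)
        have nn: "?\<beta> i \<ge> 0" for i
        proof -
          have "?\<beta> (max i N) \<le> ?\<beta> i" by (rule lift_Suc_antimono_le[of ?\<beta>]) (use a in auto)
          then show ?thesis using bN[of "max i N"] by simp
        qed
        have "c i \<le> ?\<alpha> i" for i using nn[of i] by simp
        moreover have "?\<alpha> (Suc i) - c (Suc i) \<le> ?\<alpha> i - c i" for i
          using a[of i] nn[of i] nn[of "Suc i"] by linarith
        ultimately show False using c(2) \<open>\<not> ?P c\<close> by blast
      qed
      then obtain i where i: "?\<beta> i < ?\<beta> (Suc i)" by blast
      have iN: "i < N" using i bN[of i] bN[of "Suc i"] by (cases "i < N") auto
      show "jt n N (\<lambda>i. int (?\<alpha> i) + dl N i - int (c i)) q = 0"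
      proof (cases "Suc i < N")
        case True
        have "?\<alpha> (Suc i) \<le> ?\<alpha> i" using pa by (simp add: partn_def)
        then have "?\<beta> i + 1 = ?\<beta> (Suc i)" using i c(2)[of i] c(2)[of "Suc i"] by linarith
        moreover have "dl N i = dl N (Suc i) + 1" using True by (auto simp: dl_def)
        ultimately show ?thesis
          using True iN q by (intro jt_repeat[of i N "Suc i"]) auto
      next
        case False
        then have "?\<beta> i < 0" "dl N i = 0" using i bN[of "Suc i"] iN by (auto simp: dl_def)
        then show ?thesis by (intro jt_neg[of _ i]) auto
      qed
    qed
  qed auto
  also have "\<dots> = (\<Sum>c\<in>{c \<in> comps N m. ?P c}. jtp n N (\<lambda>i. ?\<alpha> i - c i) q)"
  proof (rule sum.cong[OF refl])
    fix c assume "c \<in> {c \<in> comps N m. ?P c}"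
    then have "(\<lambda>i. int (?\<alpha> i) + dl N i - int (c i)) = (\<lambda>i. int (?\<alpha> i - c i) + dl N i)"
      by (auto simp: of_nat_diff)
    then show "jt n N (\<lambda>i. int (?\<alpha> i) + dl N i - int (c i)) q = jtp n N (\<lambda>i. ?\<alpha> i - c i) q"
      by (simp add: jtp_def)
  qed
  also have "\<dots> = (\<Sum>Y\<in>{Y \<in> subs m I. ?P (\<lambda>i. ?\<alpha> i - rowlen Y i)}. jtp n N (rowlen Y) q)"
    by (rule sum_subs[OF I, where \<phi> = "\<lambda>\<alpha>. jtp n N \<alpha> q"]) blast
  also have "{Y \<in> subs m I. ?P (\<lambda>i. ?\<alpha> i - rowlen Y i)} = {Y \<in> subs m I. vstrip (I - Y)}"
  proof -
    have "?P (\<lambda>i. ?\<alpha> i - rowlen Y i) \<longleftrightarrow> vstrip (I - Y)" if "Y \<in> subs m I" for Y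
    proof -
      have Y: "ideal Y" "Y \<subseteq> I" using that by (auto simp: subs_def)
      have "?\<alpha> (Suc i) - (?\<alpha> (Suc i) - rowlen Y (Suc i)) \<le> ?\<alpha> i - (?\<alpha> i - rowlen Y i)" for i
        using rowlen_mono[OF I(1) Y] rowlen_mono_Suc[OF Y(1)] by simp
      then show ?thesis using vs_iff[OF I(1) Y] by auto
    qed
    then show ?thesis by blast
  qed
  finally show ?thesis by (simp add: idc_def)
qed

text \<open>Averaging over the last block isolates its trivial part, and with the sign its sign
  part: these are the two Pieri rules read as restrictions.\<close>

lemma avg_idc:
  assumes I: "ideal I" "in_rows N I" and m: "m \<le> n" and q: "q permutes {..<n - m}"
  shows "(\<Sum>r | r permutes {n - m..<n}. idc n N I (q \<circ> r)) =
      fact m * (\<Sum>Y\<in>{Y \<in> subs m I. hstrip (I - Y)}. idc (n - m) N Y q)" (is ?A)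
    and "(\<Sum>r | r permutes {n - m..<n}. of_int (sign r) * idc n N I (q \<circ> r)) =
      fact m * (\<Sum>Y\<in>{Y \<in> subs m I. vstrip (I - Y)}. idc (n - m) N Y q)" (is ?B)
proof -
  let ?R = "{n - m..<n}"
  let ?\<phi> = "\<lambda>c. jt (n - m) N (\<lambda>i. int (rowlen I i) + dl N i - int (c i)) q"
  have cR: "card ?R = m" using m by simp
  have sp: "idc n N I (q \<circ> r) = (\<Sum>g \<in> {g \<in> ?R \<rightarrow>\<^sub>E {..<N}. g \<circ> r = g}. ?\<phi> (content ?R g))"
    if r: "r permutes ?R" for r
    unfolding idc_def jtp_def
    by (rule jt_split[OF m q r]) (use partn_rowlen[OF I] in \<open>simp add: partn_def dl_def\<close>)
  have "(\<Sum>r | r permutes ?R. idc n N I (q \<circ> r)) =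
     (\<Sum>r | r permutes ?R. \<Sum>g \<in> {g \<in> ?R \<rightarrow>\<^sub>E {..<N}. g \<circ> r = g}. ?\<phi> (content ?R g))"
    by (rule sum.cong[OF refl]) (simp add: sp)
  also have "\<dots> = fact (card ?R) * (\<Sum>c\<in>comps N (card ?R). ?\<phi> c)"
    by (rule sum_fixed_words) simp
  finally show ?A unfolding cR sum_horizontal[OF I q] .
  have "(\<Sum>r | r permutes ?R. of_int (sign r) * idc n N I (q \<circ> r)) =
     (\<Sum>r | r permutes ?R. of_int (sign r) * (\<Sum>g \<in> {g \<in> ?R \<rightarrow>\<^sub>E {..<N}. g \<circ> r = g}. ?\<phi> (content ?R g)))"
    by (rule sum.cong[OF refl]) (simp add: sp)
  also have "\<dots> = fact (card ?R) * (\<Sum>c\<in>{c \<in> comps N (card ?R). \<forall>i. c i \<le> 1}. ?\<phi> c)"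
    by (rule sum_sign_fixed_words) simp
  finally show ?B unfolding cR sum_vertical[OF I q] .
qed

lemma idc_branching:
  assumes I: "ideal I" "in_rows N I" and n: "1 \<le> n" and q: "q permutes {..<n - 1}"
  shows "idc n N I q = (\<Sum>Y\<in>subs 1 I. idc (n - 1) N Y q)"
proof -
  have "{n - 1..<n} = {n - 1}" using n by auto
  then have "{r. r permutes {n - 1..<n}} = {id}" by auto
  moreover have "{Y \<in> subs 1 I. hstrip (I - Y)} = subs 1 I"
  proof -
    have "hstrip (I - Y)" if Y: "Y \<in> subs 1 I" for Y
    proof -
      obtain x where x: "I - Y = {x}" using Y by (auto simp: subs_def card_1_singleton_iff)
      show ?thesis unfolding x by (cases x) (auto simp: hstrip_def)
    qed
    then show ?thesis by blast
  qed
  ultimately show ?thesis using avg_idc(1)[OF I n q] by simp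
qed

section \<open>Skew characters of degree at most three\<close>

definition mx :: "(nat \<times> nat) set \<Rightarrow> (nat \<times> nat) set" where
  "mx D = {x \<in> D. \<forall>d\<in>D. fst x \<le> fst d \<and> snd x \<le> snd d \<longrightarrow> d = x}"

text \<open>Stops after two removals: with three cells the third one is then forced.\<close>

definition lin3 :: "(nat \<times> nat) set \<Rightarrow> nat" where
  "lin3 D = (\<Sum>x\<in>mx D. card (mx (D - {x})))"

text \<open>For a skew shape with three cells, \<open>hw\<close>, \<open>ew\<close> and \<open>sw\<close> are the multiplicities of the trivial,
  the sign and the two-dimensional character in the skew character, whose degree \<open>lin3\<close> counts the
  linear extensions.\<close>

definition hw :: "(nat \<times> nat) set \<Rightarrow> real" where "hw D = of_bool (hstrip D)"
definition ew :: "(nat \<times> nat) set \<Rightarrow> real" where "ew D = of_bool (vstrip D)"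
definition sw :: "(nat \<times> nat) set \<Rightarrow> real" where "sw D = (real (lin3 D) - hw D - ew D) / 2"

definition B1 :: "(nat \<times> nat) set \<Rightarrow> (nat \<times> nat) set \<Rightarrow> real" where
  "B1 I J = real (card (subs 1 I \<inter> subs 1 J))"

definition B2 :: "(nat \<times> nat) set \<Rightarrow> (nat \<times> nat) set \<Rightarrow> real" where
  "B2 I J = (\<Sum>Y\<in>subs 2 I \<inter> subs 2 J. hw (I - Y) * hw (J - Y) + ew (I - Y) * ew (J - Y))"

text \<open>One product for each irreducible character of the symmetric group on three
  points.\<close>

definition B3 :: "(nat \<times> nat) set \<Rightarrow> (nat \<times> nat) set \<Rightarrow> real" where
  "B3 I J = (\<Sum>Y\<in>subs 3 I \<inter> subs 3 J.
     hw (I - Y) * hw (J - Y) + ew (I - Y) * ew (J - Y) + sw (I - Y) * sw (J - Y))"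

text \<open>Basis of a double count of removal orders: the cell removed first is maximal among all
  removed cells.\<close>

lemma subs_Suc_iff:
  assumes "ideal I"
  shows "(x \<in> I \<and> ideal (I - {x}) \<and> Y \<in> subs m (I - {x})) \<longleftrightarrow> (Y \<in> subs (Suc m) I \<and> x \<in> mx (I - Y))"
proof
  assume a: "x \<in> I \<and> ideal (I - {x}) \<and> Y \<in> subs m (I - {x})"
  then have Y: "ideal Y" "Y \<subseteq> I" "x \<notin> Y" "card (I - {x} - Y) = m" by (auto simp: subs_def)
  have "I - Y = insert x (I - {x} - Y)" using a Y by auto
  then have "card (I - Y) = Suc m" using Y ideal_finite[OF assms] by (metis Diff_iff card_insert_disjoint finite_Diff insertI1)
  moreover have "x \<in> mx (I - Y)"
  proof -
    have "d = x" if "d \<in> I - Y" "fst x \<le> fst d" "snd x \<le> snd d" for d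
    proof (rule ccontr)
      assume "d \<noteq> x"
      then have "(fst d, snd d) \<in> I - {x}" using that by simp
      then have "(fst x, snd x) \<in> I - {x}" using a idealD that by blast
      then show False by simp
    qed
    then show ?thesis using a Y by (simp add: mx_def)
  qed
  ultimately show "Y \<in> subs (Suc m) I \<and> x \<in> mx (I - Y)" using Y by (simp add: subs_def)
next
  assume a: "Y \<in> subs (Suc m) I \<and> x \<in> mx (I - Y)"
  then have Y: "ideal Y" "Y \<subseteq> I" "card (I - Y) = Suc m" "x \<in> I - Y" by (auto simp: subs_def mx_def)
  have "card (I - {x} - Y) = m"
  proof -
    have "I - {x} - Y = (I - Y) - {x}" by auto
    then show ?thesis using Y by simp
  qed
  moreover have "ideal (I - {x})" unfolding ideal_def
  proof (intro conjI allI impI)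
    fix i j i' j' assume b: "(i, j) \<in> I - {x}" "i' \<le> i" "j' \<le> j"
    have "(i', j') \<noteq> x"
    proof
      assume x: "(i', j') = x"
      then have "(i, j) \<notin> Y" using idealD[OF Y(1), of i j i' j'] b Y(4) by auto
      moreover have "d = x" if "d \<in> I - Y" "fst x \<le> fst d" "snd x \<le> snd d" for d
        using a that by (simp add: mx_def)
      ultimately have "(i, j) = x" using b unfolding x[symmetric] by fastforce
      then show False using b by simp
    qed
    then show "(i', j') \<in> I - {x}" using b idealD[OF assms] by auto
  qed (use ideal_finite[OF assms] in simp)
  ultimately show "x \<in> I \<and> ideal (I - {x}) \<and> Y \<in> subs m (I - {x})" using Y by (auto simp: subs_def)
qed

lemma sum_subs_1: "(\<Sum>Y\<in>subs 1 I. g Y) = (\<Sum>x | x \<in> I \<and> ideal (I - {x}). g (I - {x}))"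
proof (rule sum.reindex_bij_witness[where i = "\<lambda>x. I - {x}" and j = "\<lambda>Y. THE x. I - Y = {x}"])
  fix Y assume Y: "Y \<in> subs 1 I"
  then obtain x where x: "I - Y = {x}" by (auto simp: subs_def card_1_singleton_iff)
  then have t: "(THE x. I - Y = {x}) = x" by auto
  have "I - {x} = Y" using x Y by (auto simp: subs_def)
  then show "I - {THE x. I - Y = {x}} = Y" "(THE x. I - Y = {x}) \<in> {x. x \<in> I \<and> ideal (I - {x})}"
    "g (I - {THE x. I - Y = {x}}) = g Y"
    using x Y unfolding t by (auto simp: subs_def)
next
  fix x assume x: "x \<in> {x. x \<in> I \<and> ideal (I - {x})}"
  then have e: "I - (I - {x}) = {x}" by auto
  then show "(THE y. I - (I - {x}) = {y}) = x" by auto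
  show "I - {x} \<in> subs 1 I" using x e by (auto simp: subs_def)
qed

lemma sum_subs_Suc:
  assumes "ideal I"
  shows "(\<Sum>x | x \<in> I \<and> ideal (I - {x}). \<Sum>Y\<in>subs m (I - {x}). g x Y) =
    (\<Sum>Y\<in>subs (Suc m) I. \<Sum>x\<in>mx (I - Y). g x Y)"
proof -
  have fin: "finite I" using ideal_finite[OF assms] .
  have fm: "finite (mx D)" if "finite D" for D using that by (simp add: mx_def)
  have "(\<Sum>x | x \<in> I \<and> ideal (I - {x}). \<Sum>Y\<in>subs m (I - {x}). g x Y) =
    (\<Sum>(x, Y)\<in>(SIGMA x:{x. x \<in> I \<and> ideal (I - {x})}. subs m (I - {x})). g x Y)"
    using fin by (intro sum.Sigma) auto
  also have "\<dots> = (\<Sum>(Y, x)\<in>(SIGMA Y:subs (Suc m) I. mx (I - Y)). g x Y)"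
    by (rule sum.reindex_bij_witness[where i = "\<lambda>(Y, x). (x, Y)" and j = "\<lambda>(x, Y). (Y, x)"])
       (use subs_Suc_iff[OF assms] in auto)
  also have "\<dots> = (\<Sum>Y\<in>subs (Suc m) I. \<Sum>x\<in>mx (I - Y). g x Y)"
    using fin fm by (intro sum.Sigma[symmetric]) auto
  finally show ?thesis .
qed

lemma in_rows_diff: "in_rows N I \<Longrightarrow> in_rows N (I - A)" by (auto simp: in_rows_def)

text \<open>The branching rule applied three times. It supplies the degree equation from which the
  multiplicity of the two-dimensional character is obtained.\<close>

lemma idc_branching_3:
  assumes I: "ideal I" "in_rows N I" and n: "3 \<le> n" and q: "q permutes {..<n - 3}"
  shows "idc n N I q = (\<Sum>Y\<in>subs 3 I. real (lin3 (I - Y)) * idc (n - 3) N Y q)"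
proof -
  have one: "idc (Suc k) N J q = (\<Sum>x | x \<in> J \<and> ideal (J - {x}). idc k N (J - {x}) q)"
    if "ideal J" "in_rows N J" "q permutes {..<k}" for J k
    using idc_branching[OF that(1,2), of "Suc k" q] that(3) sum_subs_1[of "\<lambda>Y. idc k N Y q" J] by simp
  have two: "idc (Suc (Suc k)) N J q = (\<Sum>Y\<in>subs 2 J. real (card (mx (J - Y))) * idc k N Y q)"
    if J: "ideal J" "in_rows N J" "q permutes {..<k}" for J k
  proof -
    have qk: "q permutes {..<Suc k}" by (rule permutes_subset[OF J(3)]) auto
    have "idc (Suc (Suc k)) N J q = (\<Sum>x | x \<in> J \<and> ideal (J - {x}). \<Sum>Y\<in>subs 1 (J - {x}). idc k N Y q)"
      unfolding one[OF J(1,2) qk]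
      by (rule sum.cong[OF refl]) (simp add: one J in_rows_diff sum_subs_1 del: One_nat_def)
    also have "\<dots> = (\<Sum>Y\<in>subs (Suc 1) J. \<Sum>x\<in>mx (J - Y). idc k N Y q)" by (rule sum_subs_Suc[OF J(1)])
    finally show ?thesis by (simp add: numeral_2_eq_2)
  qed
  obtain k where "n = 3 + k" using le_Suc_ex[OF n] by blast
  then have k: "n = Suc (Suc (Suc k))" by simp
  have qk: "q permutes {..<k}" using q k by simp
  have qk': "q permutes {..<Suc (Suc k)}" by (rule permutes_subset[OF qk]) auto
  have "idc n N I q = (\<Sum>x | x \<in> I \<and> ideal (I - {x}). \<Sum>Y\<in>subs 2 (I - {x}). real (card (mx (I - {x} - Y))) * idc k N Y q)"
    unfolding k one[OF I qk']
    by (rule sum.cong[OF refl]) (simp add: two qk I in_rows_diff)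
  also have "\<dots> = (\<Sum>Y\<in>subs (Suc 2) I. \<Sum>x\<in>mx (I - Y). real (card (mx (I - {x} - Y))) * idc k N Y q)"
    by (rule sum_subs_Suc[OF I(1)])
  also have "\<dots> = (\<Sum>Y\<in>subs 3 I. real (lin3 (I - Y)) * idc k N Y q)"
  proof -
    have "I - {x} - Y = I - Y - {x}" for x Y by auto
    then show ?thesis by (simp add: lin3_def sum_distrib_right)
  qed
  finally show ?thesis using k by simp
qed

text \<open>Orthonormality leaves only the pairs of equal subdiagrams, hence the intersection on the
  right.\<close>

lemma sum_idc_product:
  assumes I: "ideal I" "in_rows N I" "card I = n" and J: "ideal J" "in_rows N J" and m: "m \<le> n"
  shows "char_ip (n - m) (\<lambda>q. \<Sum>Y\<in>subs m I. u Y * idc (n - m) N Y q) (\<lambda>q. \<Sum>Y\<in>subs m J. v Y * idc (n - m) N Y q) =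
    (\<Sum>Y\<in>subs m I \<inter> subs m J. u Y * v Y)"
proof -
  have fin: "finite (subs m I)" "finite (subs m J)" using I J ideal_finite by auto
  have "char_ip (n - m) (\<lambda>q. \<Sum>Y\<in>subs m I. u Y * idc (n - m) N Y q) (\<lambda>q. \<Sum>Y\<in>subs m J. v Y * idc (n - m) N Y q) =
    (\<Sum>Y\<in>subs m I. u Y * (\<Sum>Y'\<in>subs m J. v Y' * char_ip (n - m) (idc (n - m) N Y) (idc (n - m) N Y')))"
    by (simp add: char_ip_sum_left char_ip_sum_right)
  also have "\<dots> = (\<Sum>Y\<in>subs m I. u Y * (\<Sum>Y'\<in>subs m J. v Y' * (if Y = Y' then 1 else 0)))"
  proof (rule sum.cong[OF refl])
    fix Y assume Y: "Y \<in> subs m I"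
    have "char_ip (n - m) (idc (n - m) N Y) (idc (n - m) N Y') = (if Y = Y' then 1 else 0)"
      if Y': "Y' \<in> subs m J" for Y'
    proof (rule idc_orthonormal)
      show "in_rows N Y" "in_rows N Y'" by (rule subs_in_rows[OF I(2) Y], rule subs_in_rows[OF J(2) Y'])
      show "ideal Y" "ideal Y'" using Y Y' by (auto simp: subs_def)
      show "n - m = card Y" using subs_card[OF I(1) Y] I(3) by simp
    qed
    then show "u Y * (\<Sum>Y'\<in>subs m J. v Y' * char_ip (n - m) (idc (n - m) N Y) (idc (n - m) N Y')) =
      u Y * (\<Sum>Y'\<in>subs m J. v Y' * (if Y = Y' then 1 else 0))" by simp
  qed
  also have "\<dots> = (\<Sum>Y\<in>subs m I. if Y \<in> subs m J then u Y * v Y else 0)"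
    using fin by (intro sum.cong refl) (simp add: if_distrib sum.delta' cong: if_cong)
  also have "\<dots> = (\<Sum>Y\<in>subs m I \<inter> subs m J. u Y * v Y)"
    using fin by (simp add: sum.inter_restrict)
  finally show ?thesis .
qed

section \<open>Pairing products of characters with two-row permutation characters\<close>

definition two :: "nat \<Rightarrow> nat \<Rightarrow> nat \<Rightarrow> int" where
  "two a b = (\<lambda>i. if i = 0 then int a else if i = 1 then int b else 0)"

lemma perm_char_one_row:
  assumes "q permutes {..<k}"
  shows "perm_char {..<k} (\<lambda>i. if i = 0 then int k else 0) q = 1"
proof -
  have "words {..<k} (\<lambda>i. if i = 0 then int k else 0) = {\<lambda>j\<in>{..<k}. 0}" (is "?W = _")
  proof (intro equalityI subsetI)
    fix w assume w: "w \<in> ?W"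
    have "w j = 0" if "j < k" for j
    proof (rule ccontr)
      assume "w j \<noteq> 0"
      then have "int (content {..<k} w (w j)) = 0" using w by (simp add: words_def)
      then show False using that by (auto simp: content_def)
    qed
    then show "w \<in> {\<lambda>j\<in>{..<k}. 0}" using w by (auto simp: words_def extensional_def fun_eq_iff)
  qed (auto simp: words_def content_def)
  moreover have "(\<lambda>j\<in>{..<k}. 0::nat) \<circ> q = (\<lambda>j\<in>{..<k}. 0)"
    using permutes_in_image[OF assms] by (auto simp: fun_eq_iff restrict_def)
  ultimately have "{w \<in> words {..<k} (\<lambda>i. if i = 0 then int k else 0). w \<circ> q = w} = {\<lambda>j\<in>{..<k}. 0}"
    by auto
  then show ?thesis by (simp add: perm_char_def)
qed

lemma class_fun_mult: "class_fun n F \<Longrightarrow> class_fun n G \<Longrightarrow> class_fun n (\<lambda>p. F p * G p)"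
  by (simp add: class_fun_def)

lemma char_ip_two:
  assumes F: "class_fun n F" and m: "m \<le> n"
  shows "char_ip n (perm_char {..<n} (two m (n - m))) F =
    (\<Sum>r | r permutes {n - m..<n}. \<Sum>q | q permutes {..<n - m}. F (q \<circ> r)) / (fact m * fact (n - m))"
proof -
  have "(\<lambda>i. two m (n - m) (Suc i)) = (\<lambda>i. if i = 0 then int (n - m) else 0)"
    by (auto simp: two_def)
  then have "char_ip n (perm_char {..<n} (two m (n - m))) F =
    (\<Sum>r | r permutes {n - m..<n}. char_ip (n - m) (perm_char {..<n - m} (\<lambda>i. if i = 0 then int (n - m) else 0)) (\<lambda>q. F (q \<circ> r))) / fact m"
    using char_ip_peel[where \<nu> = "two m (n - m)", OF F _ m] by (simp add: two_def)
  also have "\<dots> = (\<Sum>r | r permutes {n - m..<n}. (\<Sum>q | q permutes {..<n - m}. F (q \<circ> r)) / fact (n - m)) / fact m"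
    by (simp add: char_ip_def perm_char_one_row)
  finally show ?thesis by (simp add: sum_divide_distrib[symmetric] mult.commute)
qed

lemma class_fun_idc: "class_fun n (idc n N I)" unfolding idc_def jtp_def by (rule class_fun_jt)

text \<open>\<open>s\<close> and \<open>q\<close> move disjoint points and commute, so conjugating
  the block part amounts to conjugating the whole permutation.\<close>

lemma class_fun_conj_block:
  assumes F: "class_fun n F" and m: "m \<le> n" and q: "q permutes {..<n - m}"
    and r: "r permutes {n - m..<n}" and s: "s permutes {n - m..<n}"
  shows "F (q \<circ> (s \<circ> r \<circ> inv s)) = F (q \<circ> r)"
proof -
  have qs: "q \<circ> s = s \<circ> q" by (rule permutes_disjoint_commute[OF q s]) auto
  have "q \<circ> (s \<circ> r \<circ> inv s) = s \<circ> (q \<circ> r) \<circ> inv s" using qs by (simp add: o_assoc)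
  moreover have "q \<circ> r permutes {..<n}"
    by (rule permutes_compose; rule permutes_subset[OF r] permutes_subset[OF q]) auto
  moreover have "s permutes {..<n}" by (rule permutes_subset[OF s]) auto
  ultimately show ?thesis using F by (simp add: class_fun_def)
qed

lemma sum_indicator_hs:
  "finite I \<Longrightarrow> (\<Sum>Y\<in>{Y \<in> subs m I. hstrip (I - Y)}. g Y) = (\<Sum>Y\<in>subs m I. hw (I - Y) * g Y)"
  "finite I \<Longrightarrow> (\<Sum>Y\<in>{Y \<in> subs m I. vstrip (I - Y)}. g Y) = (\<Sum>Y\<in>subs m I. ew (I - Y) * g Y)"
  by (simp_all add: hw_def ew_def Int_def)

lemma char_ip_two_1:
  assumes I: "ideal I" "in_rows N I" "card I = n" and J: "ideal J" "in_rows N J" and n: "1 \<le> n"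
  shows "char_ip n (perm_char {..<n} (two 1 (n - 1))) (\<lambda>p. idc n N I p * idc n N J p) = B1 I J"
proof -
  have "{n - 1..<n} = {n - 1}" using n by auto
  then have R: "{r. r permutes {n - 1..<n}} = {id}" by auto
  have "char_ip n (perm_char {..<n} (two 1 (n - 1))) (\<lambda>p. idc n N I p * idc n N J p) =
    char_ip (n - 1) (idc n N I) (idc n N J)"
    using char_ip_two[OF class_fun_mult[OF class_fun_idc class_fun_idc] n, of N I N J]
    unfolding R by (simp add: char_ip_def)
  also have "\<dots> = char_ip (n - 1) (\<lambda>q. \<Sum>Y\<in>subs 1 I. 1 * idc (n - 1) N Y q) (\<lambda>q. \<Sum>Y\<in>subs 1 J. 1 * idc (n - 1) N Y q)"
    unfolding char_ip_def using idc_branching[OF I(1,2) n] idc_branching[OF J n] by simp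
  also have "\<dots> = (\<Sum>Y\<in>subs 1 I \<inter> subs 1 J. 1 * 1)" by (rule sum_idc_product[OF I J n])
  finally show ?thesis by (simp add: B1_def)
qed

text \<open>\<open>H\<close> and \<open>E\<close> are the even and odd parts under the transposition
  \<open>t\<close> of the last two points; in the product averaged over \<open>id\<close> and
  \<open>t\<close> the mixed terms cancel.\<close>

lemma char_ip_two_2:
  assumes I: "ideal I" "in_rows N I" "card I = n" and J: "ideal J" "in_rows N J" and n: "2 \<le> n"
  shows "char_ip n (perm_char {..<n} (two 2 (n - 2))) (\<lambda>p. idc n N I p * idc n N J p) = B2 I J"
proof -
  define t where "t = Transposition.transpose (n - 2) (n - 1)"
  have R: "{n - 2..<n} = insert (n - 2) {n - 1}" using n by auto
  have sum2: "(\<Sum>r | r permutes {n - 2..<n}. f r) = f id + f t" for f :: "(nat \<Rightarrow> nat) \<Rightarrow> real"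
    unfolding R using n by (subst sum_over_permutations_insert) (auto simp: t_def)
  have sg: "sign t = - 1" using n by (simp add: t_def sign_swap_id)
  define H where "H K q = (\<Sum>Y\<in>subs 2 K. hw (K - Y) * idc (n - 2) N Y q)" for K q
  define E where "E K q = (\<Sum>Y\<in>subs 2 K. ew (K - Y) * idc (n - 2) N Y q)" for K q
  have HE: "idc n N K q + idc n N K (q \<circ> t) = 2 * H K q" "idc n N K q - idc n N K (q \<circ> t) = 2 * E K q"
    if K: "ideal K" "in_rows N K" and q: "q permutes {..<n - 2}" for K q
    using avg_idc[OF K n q] ideal_finite[OF K(1)] unfolding sum2
    by (simp_all add: sum_indicator_hs sg sign_id H_def E_def fact_numeral)
  have "char_ip n (perm_char {..<n} (two 2 (n - 2))) (\<lambda>p. idc n N I p * idc n N J p) =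
    (\<Sum>q | q permutes {..<n - 2}. idc n N I q * idc n N J q + idc n N I (q \<circ> t) * idc n N J (q \<circ> t)) / (2 * fact (n - 2))"
    using char_ip_two[OF class_fun_mult[OF class_fun_idc class_fun_idc] n, of N I N J]
    unfolding sum2 by (simp add: sum.distrib)
  also have "\<dots> = (\<Sum>q | q permutes {..<n - 2}. 2 * (H I q * H J q + E I q * E J q)) / (2 * fact (n - 2))"
  proof -
    have "idc n N I q * idc n N J q + idc n N I (q \<circ> t) * idc n N J (q \<circ> t) = 2 * (H I q * H J q + E I q * E J q)"
      if q: "q permutes {..<n - 2}" for q
    proof -
      have eqs: "idc n N K q = H K q + E K q" "idc n N K (q \<circ> t) = H K q - E K q"
        if "ideal K" "in_rows N K" for K
        using HE[OF that q] by simp_all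
      show ?thesis unfolding eqs[OF I(1,2)] eqs[OF J] by (simp add: algebra_simps)
    qed
    then show ?thesis by simp
  qed
  also have "\<dots> = char_ip (n - 2) (H I) (H J) + char_ip (n - 2) (E I) (E J)"
    by (simp add: char_ip_def sum_distrib_left[symmetric] sum.distrib add_divide_distrib)
  also have "char_ip (n - 2) (H I) (H J) = (\<Sum>Y\<in>subs 2 I \<inter> subs 2 J. hw (I - Y) * hw (J - Y))"
    unfolding H_def by (rule sum_idc_product[OF I J n])
  also have "char_ip (n - 2) (E I) (E J) = (\<Sum>Y\<in>subs 2 I \<inter> subs 2 J. ew (I - Y) * ew (J - Y))"
    unfolding E_def by (rule sum_idc_product[OF I J n])
  finally show ?thesis by (simp add: B2_def sum.distrib)
qed


text \<open>The isotypic parts \<open>H\<close>, \<open>E\<close>, \<open>S\<close> for the last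
  three points follow from three equations: the trivial average, the sign average and the degree. As
  in the character table of that group, the value is \<open>H + E + 2 * S\<close> at the identity,
  \<open>H - E\<close> at the three transpositions and \<open>H + E - S\<close> at the two
  3-cycles.\<close>

lemma char_ip_two_3:
  assumes I: "ideal I" "in_rows N I" "card I = n" and J: "ideal J" "in_rows N J" and n: "3 \<le> n"
  shows "char_ip n (perm_char {..<n} (two 3 (n - 3))) (\<lambda>p. idc n N I p * idc n N J p) = B3 I J"
proof -
  define a b c where "a = n - 3" "b = n - 2" "c = n - 1"
  have ne: "a \<noteq> b" "a \<noteq> c" "b \<noteq> c" using n by (auto simp: a_b_c_def)
  let ?t = "Transposition.transpose :: nat \<Rightarrow> nat \<Rightarrow> nat \<Rightarrow> nat"
  have R: "{n - 3..<n} = insert a (insert b {c})" using n by (auto simp: a_b_c_def)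
  have sum3: "(\<Sum>r | r permutes {n - 3..<n}. f r) =
     f id + f (?t b c) + f (?t a b) + f (?t a b \<circ> ?t b c) + f (?t a c) + f (?t a c \<circ> ?t b c)"
    for f :: "(nat \<Rightarrow> nat) \<Rightarrow> real"
    unfolding R using ne by (simp add: sum_over_permutations_insert)
  have perm: "?t x y permutes {n - 3..<n}" if "x \<in> {a, b, c}" "y \<in> {a, b, c}" for x y
    unfolding R using that by (intro permutes_swap_id) auto
  have sg: "sign (?t x y) = - 1" if "x \<noteq> y" for x y using that by (simp add: sign_swap_id)
  have sgc: "sign (?t a b \<circ> ?t b c) = 1" "sign (?t a c \<circ> ?t b c) = 1"
    using ne by (simp_all add: sign_compose permutation_swap_id sg)
  define H where "H K q = (\<Sum>Y\<in>subs 3 K. hw (K - Y) * idc (n - 3) N Y q)" for K q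
  define E where "E K q = (\<Sum>Y\<in>subs 3 K. ew (K - Y) * idc (n - 3) N Y q)" for K q
  define S where "S K q = (\<Sum>Y\<in>subs 3 K. sw (K - Y) * idc (n - 3) N Y q)" for K q
  have cls: "idc n N K (q \<circ> ?t a b) = idc n N K (q \<circ> ?t b c)" "idc n N K (q \<circ> ?t a c) = idc n N K (q \<circ> ?t b c)"
    "idc n N K (q \<circ> (?t a c \<circ> ?t b c)) = idc n N K (q \<circ> (?t a b \<circ> ?t b c))"
    if q: "q permutes {..<n - 3}" for K q
  proof -
    \<comment> \<open>All transpositions of the block are conjugate within it, and so are its two
      3-cycles.\<close>
    have 1: "?t a b = ?t a c \<circ> ?t b c \<circ> inv (?t a c)" "?t a c = ?t a b \<circ> ?t b c \<circ> inv (?t a b)"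
      "?t a c \<circ> ?t b c = ?t b c \<circ> (?t a b \<circ> ?t b c) \<circ> inv (?t b c)"
      using ne by (auto simp: fun_eq_iff Transposition.transpose_def)
    show "idc n N K (q \<circ> ?t a b) = idc n N K (q \<circ> ?t b c)"
      by (subst 1(1)) (rule class_fun_conj_block[OF class_fun_idc n q]; rule perm; simp)
    show "idc n N K (q \<circ> ?t a c) = idc n N K (q \<circ> ?t b c)"
      by (subst 1(2)) (rule class_fun_conj_block[OF class_fun_idc n q]; rule perm; simp)
    show "idc n N K (q \<circ> (?t a c \<circ> ?t b c)) = idc n N K (q \<circ> (?t a b \<circ> ?t b c))"
      unfolding 1(3) by (rule class_fun_conj_block[OF class_fun_idc n q])
        (auto intro!: permutes_compose perm)
  qed
  have HE: "idc n N K q + 3 * idc n N K (q \<circ> ?t b c) + 2 * idc n N K (q \<circ> (?t a b \<circ> ?t b c)) = 6 * H K q"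
     "idc n N K q - 3 * idc n N K (q \<circ> ?t b c) + 2 * idc n N K (q \<circ> (?t a b \<circ> ?t b c)) = 6 * E K q"
     "idc n N K q = H K q + E K q + 2 * S K q"
    if K: "ideal K" "in_rows N K" and q: "q permutes {..<n - 3}" for K q
  proof -
    have f3: "fact 3 = (6 :: real)" by (simp add: fact_numeral)
    show "idc n N K q + 3 * idc n N K (q \<circ> ?t b c) + 2 * idc n N K (q \<circ> (?t a b \<circ> ?t b c)) = 6 * H K q"
      using avg_idc(1)[OF K n q] ideal_finite[OF K(1)] unfolding sum3 cls[OF q] f3
      by (simp add: sum_indicator_hs H_def)
    show "idc n N K q - 3 * idc n N K (q \<circ> ?t b c) + 2 * idc n N K (q \<circ> (?t a b \<circ> ?t b c)) = 6 * E K q"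
      using avg_idc(2)[OF K n q] ideal_finite[OF K(1)] unfolding sum3 cls[OF q] f3 sgc
      using ne by (simp add: sum_indicator_hs E_def sg sign_id)
    have "H K q + E K q + 2 * S K q = (\<Sum>Y\<in>subs 3 K. real (lin3 (K - Y)) * idc (n - 3) N Y q)"
      unfolding H_def E_def S_def sum_distrib_left sum.distrib[symmetric]
      by (rule sum.cong[OF refl]) (simp add: sw_def field_simps)
    then show "idc n N K q = H K q + E K q + 2 * S K q"
      using idc_branching_3[OF K n q] by simp
  qed
  have pt: "(\<Sum>r | r permutes {n - 3..<n}. idc n N I (q \<circ> r) * idc n N J (q \<circ> r)) =
     6 * (H I q * H J q + E I q * E J q + S I q * S J q)" if q: "q permutes {..<n - 3}" for q
  proof -
    have eqs: "idc n N K q = H K q + E K q + 2 * S K q" "idc n N K (q \<circ> ?t b c) = H K q - E K q"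
      "idc n N K (q \<circ> (?t a b \<circ> ?t b c)) = H K q + E K q - S K q" if "ideal K" "in_rows N K" for K
      using HE[OF that q] by simp_all
    show ?thesis unfolding sum3 cls[OF q] comp_id eqs[OF I(1,2)] eqs[OF J]
      by (simp add: algebra_simps)
  qed
  have "char_ip n (perm_char {..<n} (two 3 (n - 3))) (\<lambda>p. idc n N I p * idc n N J p) =
    (\<Sum>q | q permutes {..<n - 3}. \<Sum>r | r permutes {n - 3..<n}. idc n N I (q \<circ> r) * idc n N J (q \<circ> r)) / (6 * fact (n - 3))"
    using char_ip_two[OF class_fun_mult[OF class_fun_idc class_fun_idc] n, of N I N J]
    by (subst sum.swap) (simp add: fact_numeral)
  also have "\<dots> = (\<Sum>q | q permutes {..<n - 3}. 6 * (H I q * H J q + E I q * E J q + S I q * S J q)) / (6 * fact (n - 3))"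
    using pt by simp
  also have "\<dots> = char_ip (n - 3) (H I) (H J) + char_ip (n - 3) (E I) (E J) + char_ip (n - 3) (S I) (S J)"
    by (simp add: char_ip_def sum_distrib_left[symmetric] sum.distrib add_divide_distrib)
  also have "char_ip (n - 3) (H I) (H J) = (\<Sum>Y\<in>subs 3 I \<inter> subs 3 J. hw (I - Y) * hw (J - Y))"
    unfolding H_def by (rule sum_idc_product[OF I J n])
  also have "char_ip (n - 3) (E I) (E J) = (\<Sum>Y\<in>subs 3 I \<inter> subs 3 J. ew (I - Y) * ew (J - Y))"
    unfolding E_def by (rule sum_idc_product[OF I J n])
  also have "char_ip (n - 3) (S I) (S J) = (\<Sum>Y\<in>subs 3 I \<inter> subs 3 J. sw (I - Y) * sw (J - Y))"
    unfolding S_def by (rule sum_idc_product[OF I J n])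
  finally show ?thesis by (simp add: B3_def sum.distrib)
qed

section \<open>Kronecker coefficients in terms of diagrams\<close>

lemma rowlen_diagram: "rowlen (diagram \<alpha>) = part_fun \<alpha>"
  by (intro ext rowlen_eqI) (simp add: diagram_part_fun)

lemma ideal_diagram: "is_partition \<alpha> \<Longrightarrow> ideal (diagram \<alpha>)"
  unfolding diagram_part_fun using ideal_partn[OF partn_part_fun[OF _ order.refl]] by blast

lemma in_rows_diagram: "length \<alpha> \<le> N \<Longrightarrow> in_rows N (diagram \<alpha>)"
  by (auto simp: in_rows_def diagram_def)

lemma irr_char_idc:
  assumes "\<alpha> \<in> partitions_of n" "length \<alpha> \<le> N" "p permutes {..<n}"
  shows "irr_char \<alpha> p = complex_of_real (idc n N (diagram \<alpha>) p)"
  using irr_char_eq_jtp[OF assms] by (simp add: idc_def rowlen_diagram)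

text \<open>The determinant with two rows, \<open>h_(n-k) h_k - h_(n-k+1) h_(k-1)\<close>. Swapping
  the two letters puts the smaller index first, so that the block peeled off later is the small
  one.\<close>

lemma irr_char_two_row:
  assumes k: "1 \<le> k" "2 * k \<le> n" and p: "p permutes {..<n}"
  shows "irr_char [n - k, k] p =
    complex_of_real (perm_char {..<n} (two k (n - k)) p - perm_char {..<n} (two (k - 1) (n - (k - 1))) p)"
proof -
  let ?t = "Transposition.transpose 0 (1::nat)"
  have R: "{..<2} = insert 0 {1::nat}" by auto
  have sum2: "(\<Sum>\<sigma> | \<sigma> permutes {..<2::nat}. f \<sigma>) = f id + f ?t" for f :: "(nat \<Rightarrow> nat) \<Rightarrow> real"
    unfolding R by (subst sum_over_permutations_insert) auto
  have m: "[n - k, k] \<in> partitions_of n" using k by (auto simp: partitions_of_def is_partition_def)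
  have rel: "perm_char {..<n} (two u v \<circ> ?t) p = perm_char {..<n} (two u v) p" for u v
    by (rule perm_char_relabel[OF _ p]) simp
  have "jtp n 2 (part_fun [n - k, k]) p =
     perm_char {..<n} (\<lambda>i. int (part_fun [n - k, k] i) + dl 2 i - dl 2 (id i)) p -
     perm_char {..<n} (\<lambda>i. int (part_fun [n - k, k] i) + dl 2 i - dl 2 (?t i)) p"
    unfolding jtp_def jt_def sum2 by (simp add: sign_id sign_swap_id)
  also have "(\<lambda>i. int (part_fun [n - k, k] i) + dl 2 i - dl 2 (id i)) = two k (n - k) \<circ> ?t"
    by (auto simp: fun_eq_iff part_fun_def two_def Transposition.transpose_def less_Suc_eq numeral_2_eq_2)
  also have "(\<lambda>i. int (part_fun [n - k, k] i) + dl 2 i - dl 2 (?t i)) = two (k - 1) (n - (k - 1)) \<circ> ?t"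
    using k by (auto simp: fun_eq_iff part_fun_def two_def Transposition.transpose_def dl_def less_Suc_eq numeral_2_eq_2 of_nat_diff)
  finally show ?thesis using irr_char_eq_jtp[OF m _ p, of 2] unfolding rel by simp
qed

lemma kronecker_coeff_two_row:
  assumes k: "1 \<le> k" "2 * k \<le> n" and \<beta>: "\<beta> \<in> partitions_of n" and \<gamma>: "\<gamma> \<in> partitions_of n"
    and N: "length \<beta> \<le> N" "length \<gamma> \<le> N"
  shows "(\<Sum>p | p permutes {..<n}. irr_char [n - k, k] p * irr_char \<beta> p * cnj (irr_char \<gamma> p)) / fact n =
    complex_of_real (char_ip n (perm_char {..<n} (two k (n - k))) (\<lambda>p. idc n N (diagram \<beta>) p * idc n N (diagram \<gamma>) p) -
      char_ip n (perm_char {..<n} (two (k - 1) (n - (k - 1)))) (\<lambda>p. idc n N (diagram \<beta>) p * idc n N (diagram \<gamma>) p))"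
proof -
  have "(\<Sum>p | p permutes {..<n}. irr_char [n - k, k] p * irr_char \<beta> p * cnj (irr_char \<gamma> p)) =
    (\<Sum>p | p permutes {..<n}. complex_of_real ((perm_char {..<n} (two k (n - k)) p - perm_char {..<n} (two (k - 1) (n - (k - 1))) p) *
       (idc n N (diagram \<beta>) p * idc n N (diagram \<gamma>) p)))"
    by (rule sum.cong[OF refl])
       (simp add: irr_char_two_row[OF k] irr_char_idc[OF \<beta> N(1)] irr_char_idc[OF \<gamma> N(2)])
  then show ?thesis
    by (simp add: char_ip_def left_diff_distrib sum_subtractf diff_divide_distrib)
qed

theorem kronecker_coeff_three:
  assumes n: "n \<ge> 6" and \<beta>: "\<beta> \<in> partitions_of n" and \<gamma>: "\<gamma> \<in> partitions_of n"
  shows "kronecker_coeff [n - 3, 3] \<beta> \<gamma> =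
    complex_of_real (B3 (diagram \<beta>) (diagram \<gamma>) - B2 (diagram \<beta>) (diagram \<gamma>))"
proof -
  define N where "N = max (length \<beta>) (length \<gamma>)"
  have N: "length \<beta> \<le> N" "length \<gamma> \<le> N" by (auto simp: N_def)
  have I: "ideal (diagram \<beta>)" "in_rows N (diagram \<beta>)" "card (diagram \<beta>) = n"
    "ideal (diagram \<gamma>)" "in_rows N (diagram \<gamma>)"
    using \<beta> \<gamma> N by (auto simp: partitions_of_def ideal_diagram in_rows_diagram card_diagram)
  have "sum_list [n - 3, 3] = n" using n by simp
  then have "kronecker_coeff [n - 3, 3] \<beta> \<gamma> =
    (\<Sum>p | p permutes {..<n}. irr_char [n - 3, 3] p * irr_char \<beta> p * cnj (irr_char \<gamma> p)) / fact n"
    unfolding kronecker_coeff_def char_multiplicity_def by simp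
  also have "\<dots> = complex_of_real (B3 (diagram \<beta>) (diagram \<gamma>) - B2 (diagram \<beta>) (diagram \<gamma>))"
    using kronecker_coeff_two_row[OF _ _ \<beta> \<gamma> N, of 3] char_ip_two_3[OF I] char_ip_two_2[OF I] n by simp
  finally show ?thesis .
qed

text \<open>Since the two factors commute, (n-3,3) can act as the diagram and (n-1,1) as the two-row
  determinant. The subtracted term then pairs with the trivial character, where orthonormality
  applies.\<close>

theorem kronecker_coeff_three_hook:
  assumes n: "n \<ge> 6" and \<gamma>: "\<gamma> \<in> partitions_of n"
  shows "kronecker_coeff [n - 3, 3] [n - 1, 1] \<gamma> =
    complex_of_real (B1 (diagram [n - 3, 3]) (diagram \<gamma>) - (if diagram [n - 3, 3] = diagram \<gamma> then 1 else 0))"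
proof -
  let ?\<beta> = "[n - 3, 3]"
  have \<beta>: "?\<beta> \<in> partitions_of n" using n by (auto simp: partitions_of_def is_partition_def)
  define N where "N = max (length ?\<beta>) (length \<gamma>)"
  have N: "length ?\<beta> \<le> N" "length \<gamma> \<le> N" by (auto simp: N_def)
  have I: "ideal (diagram ?\<beta>)" "in_rows N (diagram ?\<beta>)" "card (diagram ?\<beta>) = n"
    "ideal (diagram \<gamma>)" "in_rows N (diagram \<gamma>)"
    using \<beta> \<gamma> N by (auto simp: partitions_of_def ideal_diagram in_rows_diagram card_diagram)
  have "sum_list ?\<beta> = n" using n by simp
  then have "kronecker_coeff ?\<beta> [n - 1, 1] \<gamma> =
    (\<Sum>p | p permutes {..<n}. irr_char [n - 1, 1] p * irr_char ?\<beta> p * cnj (irr_char \<gamma> p)) / fact n"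
    unfolding kronecker_coeff_def char_multiplicity_def by (simp add: mult.commute)
  also have "\<dots> = complex_of_real (B1 (diagram ?\<beta>) (diagram \<gamma>) -
      char_ip n (perm_char {..<n} (two 0 n)) (\<lambda>p. idc n N (diagram ?\<beta>) p * idc n N (diagram \<gamma>) p))"
    using kronecker_coeff_two_row[OF _ _ \<beta> \<gamma> N, of 1] char_ip_two_1[OF I] n by simp
  also have "char_ip n (perm_char {..<n} (two 0 n)) (\<lambda>p. idc n N (diagram ?\<beta>) p * idc n N (diagram \<gamma>) p) =
     char_ip n (idc n N (diagram ?\<beta>)) (idc n N (diagram \<gamma>))"
  proof -
    have "{r. r permutes {n..<n}} = {id :: nat \<Rightarrow> nat}" by auto
    then show ?thesis
      using char_ip_two[OF class_fun_mult[OF class_fun_idc class_fun_idc], of 0 n N "diagram ?\<beta>" N "diagram \<gamma>"]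
      by (simp add: char_ip_def)
  qed
  also have "\<dots> = (if diagram ?\<beta> = diagram \<gamma> then 1 else 0)"
    by (rule idc_orthonormal) (use I in auto)
  finally show ?thesis .
qed

lemma part_fun_inj:
  assumes "is_partition \<alpha>" "is_partition \<beta>" "part_fun \<alpha> = part_fun \<beta>"
  shows "\<alpha> = \<beta>"
proof -
  have len: "length \<gamma> = card {i. part_fun \<gamma> i \<noteq> 0}" if "is_partition \<gamma>" for \<gamma>
  proof -
    have "{i. part_fun \<gamma> i \<noteq> 0} = {..<length \<gamma>}"
      using that by (auto simp: part_fun_def is_partition_def in_set_conv_nth split: if_splits)
    then show ?thesis by simp
  qed
  have l: "length \<alpha> = length \<beta>" using len[OF assms(1)] len[OF assms(2)] assms(3) by simp
  show ?thesis
  proof (rule nth_equalityI[OF l])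
    fix i assume "i < length \<alpha>"
    then show "\<alpha> ! i = \<beta> ! i" using fun_cong[OF assms(3), of i] l by (simp add: part_fun_def)
  qed
qed

lemma finite_partitions_of: "finite (partitions_of n)"
proof (rule finite_subset)
  show "partitions_of n \<subseteq> {xs. set xs \<subseteq> {..n} \<and> length xs \<le> n}"
  proof
    fix \<alpha> assume \<alpha>: "\<alpha> \<in> partitions_of n"
    have "0 \<notin> set xs \<Longrightarrow> length xs \<le> sum_list xs" for xs :: "nat list" by (induction xs) auto
    from this[of \<alpha>] have "length \<alpha> \<le> sum_list \<alpha>" using \<alpha> by (auto simp: partitions_of_def is_partition_def)
    moreover have "x \<le> sum_list \<alpha>" if "x \<in> set \<alpha>" for x using that by (intro member_le_sum_list) auto
    ultimately show "\<alpha> \<in> {xs. set xs \<subseteq> {..n} \<and> length xs \<le> n}" using \<alpha> by (auto simp: partitions_of_def)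
  qed
  show "finite {xs. set xs \<subseteq> {..n} \<and> length xs \<le> n}" by (rule finite_lists_length_le) simp
qed

section \<open>Linear independence of Schur functions\<close>

definition psum :: "nat list \<Rightarrow> nat \<Rightarrow> nat" where "psum \<alpha> i = (\<Sum>l<i. part_fun \<alpha> l)"

text \<open>The monomial whose exponents are the parts of \<open>\<alpha>\<close>, obtained by
  filling each cell with its row number.\<close>

definition shape_mset :: "nat list \<Rightarrow> nat multiset" where
  "shape_mset \<alpha> = image_mset fst (mset_set (diagram \<alpha>))"

lemma size_filter_image_mset_set:
  "finite A \<Longrightarrow> size (filter_mset P (image_mset f (mset_set A))) = card {x \<in> A. P (f x)}"
  by (simp add: filter_mset_image_mset)

lemma card_diagram_rows: "card {x \<in> diagram \<alpha>. fst x < i} = psum \<alpha> i"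
proof -
  have "{x \<in> diagram \<alpha>. fst x < i} = (\<Union>l<i. {x \<in> diagram \<alpha>. fst x = l})" by auto
  also have "card \<dots> = (\<Sum>l<i. card {x \<in> diagram \<alpha>. fst x = l})" by (intro card_UN_disjoint) auto
  finally show ?thesis by (simp add: card_diagram_row psum_def)
qed

lemma ssyt_entry_ge_row:
  assumes \<alpha>: "is_partition \<alpha>" and T: "T \<in> ssyt \<alpha>" and "(i, j) \<in> diagram \<alpha>"
  shows "i \<le> T (i, j)"
  using assms(3)
proof (induction i)
  case (Suc i)
  then have "(i, j) \<in> diagram \<alpha>" using idealD[OF ideal_diagram[OF \<alpha>]] by simp
  then have "i \<le> T (i, j)" "T (i, j) < T (Suc i, j)" using Suc T by (auto simp: ssyt_def)
  then show ?case by simp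
qed simp

text \<open>Strict columns make an entry at least its row number, so the entries below
  \<open>i\<close> fit into the first \<open>i\<close> rows.\<close>

lemma schur_nonzero_dominance:
  assumes \<gamma>: "is_partition \<gamma>" and "schur \<gamma> (shape_mset \<beta>) \<noteq> 0"
  shows "psum \<beta> i \<le> psum \<gamma> i"
proof -
  have "{T \<in> ssyt \<gamma>. image_mset T (mset_set (diagram \<gamma>)) = shape_mset \<beta>} \<noteq> {}"
    using assms(2) unfolding schur_def by (metis card.empty of_nat_0)
  then obtain T where T: "T \<in> ssyt \<gamma>" "image_mset T (mset_set (diagram \<gamma>)) = shape_mset \<beta>" by blast
  have "psum \<beta> i = size (filter_mset (\<lambda>x. x < i) (shape_mset \<beta>))"
    unfolding shape_mset_def by (simp add: size_filter_image_mset_set card_diagram_rows)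
  also have "\<dots> = card {x \<in> diagram \<gamma>. T x < i}"
    unfolding T(2)[symmetric] by (simp add: size_filter_image_mset_set)
  also have "\<dots> \<le> card {x \<in> diagram \<gamma>. fst x < i}"
    by (rule card_mono) (use ssyt_entry_ge_row[OF \<gamma> T(1)] in fastforce)+
  finally show ?thesis by (simp add: card_diagram_rows)
qed

lemma schur_shape_nonzero:
  assumes "is_partition \<beta>" shows "schur \<beta> (shape_mset \<beta>) \<noteq> 0"
proof -
  let ?S = "{T \<in> ssyt \<beta>. image_mset T (mset_set (diagram \<beta>)) = shape_mset \<beta>}"
  have "finite ?S"
  proof (rule finite_subset)
    show "?S \<subseteq> diagram \<beta> \<rightarrow>\<^sub>E set_mset (shape_mset \<beta>)"
    proof
      fix T assume T: "T \<in> ?S"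
      then have "shape_mset \<beta> = image_mset T (mset_set (diagram \<beta>))" by simp
      then have "set_mset (shape_mset \<beta>) = T ` diagram \<beta>" by simp
      then show "T \<in> diagram \<beta> \<rightarrow>\<^sub>E set_mset (shape_mset \<beta>)" using T by (auto simp: ssyt_def PiE_def)
    qed
  qed (simp add: finite_PiE)
  moreover have "restrict fst (diagram \<beta>) \<in> ?S"
    unfolding shape_mset_def by (auto simp: ssyt_def intro!: image_mset_cong)
  ultimately show ?thesis unfolding schur_def by (metis (no_types, lifting) card_eq_0_iff empty_iff of_nat_eq_0_iff)
qed

text \<open>Triangularity under dominance. Among the shapes with nonzero coefficient,
  \<open>\<beta>\<close> is chosen with the largest total of partial sums: any such shape whose
  Schur function contains the monomial of \<open>\<beta>\<close> dominates \<open>\<beta>\<close>,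
  hence has the same total, hence the same partial sums.\<close>

lemma schur_independent:
  assumes S: "finite S" "\<And>\<gamma>. \<gamma> \<in> S \<Longrightarrow> is_partition \<gamma>"
    and 0: "\<And>M. (\<Sum>\<gamma>\<in>S. d \<gamma> * schur \<gamma> M) = 0" and \<gamma>: "\<gamma> \<in> S"
  shows "d \<gamma> = 0"
proof (rule ccontr)
  assume "d \<gamma> \<noteq> 0"
  define X where "X = {\<gamma> \<in> S. d \<gamma> \<noteq> 0}"
  have X: "finite X" "X \<noteq> {}" using S(1) \<gamma> \<open>d \<gamma> \<noteq> 0\<close> by (auto simp: X_def)
  \<comment> \<open>Exceeds every length occurring in \<open>X\<close>, so the partial sums up to
    \<open>K\<close> determine the shape.\<close>
  define K where "K = Suc (Max (length ` X))"
  have K: "length \<beta> < K" if "\<beta> \<in> X" for \<beta> using that X by (simp add: K_def less_Suc_eq_le)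
  define w where "w \<beta> = (\<Sum>i<Suc K. psum \<beta> i)" for \<beta>
  obtain \<beta> where \<beta>: "\<beta> \<in> X" "\<And>\<gamma>. \<gamma> \<in> X \<Longrightarrow> w \<gamma> \<le> w \<beta>"
    using Max_in[of "w ` X"] Max_ge[of "w ` X"] X by fastforce
  have p\<beta>: "is_partition \<beta>" "\<beta> \<in> S" "d \<beta> \<noteq> 0" using \<beta> S by (auto simp: X_def)
  have "d \<gamma> * schur \<gamma> (shape_mset \<beta>) = 0" if g: "\<gamma> \<in> S - {\<beta>}" for \<gamma>
  proof (rule ccontr)
    assume "d \<gamma> * schur \<gamma> (shape_mset \<beta>) \<noteq> 0"
    then have gX: "\<gamma> \<in> X" and "schur \<gamma> (shape_mset \<beta>) \<noteq> 0" using g by (auto simp: X_def)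
    then have le: "psum \<beta> i \<le> psum \<gamma> i" for i using schur_nonzero_dominance S g by blast
    have "w \<beta> = w \<gamma>" using \<beta>(2)[OF gX] sum_mono[of "{..<Suc K}" "psum \<beta>" "psum \<gamma>"] le unfolding w_def by simp
    then have eq: "psum \<beta> i = psum \<gamma> i" if "i < Suc K" for i
      using that le unfolding w_def by (intro sum_mono_inv[of "psum \<beta>" "{..<Suc K}" "psum \<gamma>"]) auto
    have "part_fun \<beta> i = part_fun \<gamma> i" for i
    proof (cases "i < K")
      case True
      then show ?thesis using eq[of i] eq[of "Suc i"] by (simp add: psum_def)
    next
      case False
      then show ?thesis using K[OF \<beta>(1)] K[OF gX] by (simp add: part_fun_def)
    qed
    then have "\<beta> = \<gamma>" using part_fun_inj p\<beta> S g by blast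
    then show False using g by simp
  qed
  then have "(\<Sum>\<gamma>\<in>S - {\<beta>}. d \<gamma> * schur \<gamma> (shape_mset \<beta>)) = 0" by (rule sum.neutral[OF ballI])
  then have "(\<Sum>\<gamma>\<in>S. d \<gamma> * schur \<gamma> (shape_mset \<beta>)) = d \<beta> * schur \<beta> (shape_mset \<beta>)"
    using sum.remove[OF S(1) p\<beta>(2), of "\<lambda>\<gamma>. d \<gamma> * schur \<gamma> (shape_mset \<beta>)"] by simp
  then show False using 0 schur_shape_nonzero[OF p\<beta>(1)] p\<beta>(3) by (metis mult_eq_0_iff)
qed

lemma schur_expansion_unique:
  assumes c: "is_schur_expansion c f" and c': "is_schur_expansion c' f"
  shows "c = c'"
proof
  fix \<gamma>
  let ?S = "{\<gamma>. c \<gamma> \<noteq> 0} \<union> {\<gamma>. c' \<gamma> \<noteq> 0}"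
  have fin: "finite ?S" using c c' by (simp add: is_schur_expansion_def)
  have "f M = (\<Sum>\<gamma>\<in>?S. e \<gamma> * schur \<gamma> M)" if "is_schur_expansion e f" "{\<gamma>. e \<gamma> \<noteq> 0} \<subseteq> ?S" for e M
  proof -
    have "f M = (\<Sum>\<gamma> | e \<gamma> \<noteq> 0. e \<gamma> * schur \<gamma> M)"
      using that(1) by (simp add: is_schur_expansion_def)
    also have "\<dots> = (\<Sum>\<gamma>\<in>?S. e \<gamma> * schur \<gamma> M)"
      using fin that(2) by (intro sum.mono_neutral_left) auto
    finally show ?thesis .
  qed
  from this[OF c] this[OF c']
  have ext: "f M = (\<Sum>\<gamma>\<in>?S. c \<gamma> * schur \<gamma> M)" "f M = (\<Sum>\<gamma>\<in>?S. c' \<gamma> * schur \<gamma> M)" for M by blast+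
  show "c \<gamma> = c' \<gamma>"
  proof (cases "\<gamma> \<in> ?S")
    case True
    have "c \<gamma> - c' \<gamma> = 0"
    proof (rule schur_independent[OF fin _ _ True, of "\<lambda>\<gamma>. c \<gamma> - c' \<gamma>"])
      show "is_partition \<gamma>" if "\<gamma> \<in> ?S" for \<gamma> using that c c' by (auto simp: is_schur_expansion_def)
      show "(\<Sum>\<gamma>\<in>?S. (c \<gamma> - c' \<gamma>) * schur \<gamma> M) = 0" for M
        using ext[of M] by (simp add: left_diff_distrib sum_subtractf)
    qed
    then show ?thesis by simp
  qed auto
qed

text \<open>By uniqueness of Schur expansions, the coefficients quantified in
  \<open>multiplicity_free\<close> are the Kronecker coefficients.\<close>

lemma multiplicity_free_iff:
  assumes "sum_list \<alpha> = n"
  shows "multiplicity_free (kronecker_schur \<alpha> \<beta>) \<longleftrightarrow>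
    (\<forall>\<gamma>\<in>partitions_of n. kronecker_coeff \<alpha> \<beta> \<gamma> = 0 \<or> kronecker_coeff \<alpha> \<beta> \<gamma> = 1)"
proof -
  define c where "c \<gamma> = (if \<gamma> \<in> partitions_of n then kronecker_coeff \<alpha> \<beta> \<gamma> else 0)" for \<gamma>
  have sub: "{\<gamma>. c \<gamma> \<noteq> 0} \<subseteq> partitions_of n" by (auto simp: c_def)
  have e: "is_schur_expansion c (kronecker_schur \<alpha> \<beta>)"
    unfolding is_schur_expansion_def
  proof (intro conjI)
    show "finite {\<gamma>. c \<gamma> \<noteq> 0}" using finite_subset[OF sub finite_partitions_of] .
    show "\<forall>\<gamma>. c \<gamma> \<noteq> 0 \<longrightarrow> is_partition \<gamma>" using sub by (auto simp: partitions_of_def)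
    show "kronecker_schur \<alpha> \<beta> = (\<lambda>M. \<Sum>\<gamma> | c \<gamma> \<noteq> 0. c \<gamma> * schur \<gamma> M)"
    proof
      fix M
      have "kronecker_schur \<alpha> \<beta> M = (\<Sum>\<gamma>\<in>partitions_of n. c \<gamma> * schur \<gamma> M)"
        unfolding kronecker_schur_def assms by (intro sum.cong) (auto simp: c_def)
      also have "\<dots> = (\<Sum>\<gamma> | c \<gamma> \<noteq> 0. c \<gamma> * schur \<gamma> M)"
        using sub finite_partitions_of by (intro sum.mono_neutral_right) auto
      finally show "kronecker_schur \<alpha> \<beta> M = (\<Sum>\<gamma> | c \<gamma> \<noteq> 0. c \<gamma> * schur \<gamma> M)" .
    qed
  qed
  have "multiplicity_free (kronecker_schur \<alpha> \<beta>) \<longleftrightarrow> (\<forall>\<gamma>. c \<gamma> = 0 \<or> c \<gamma> = 1)"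
    unfolding multiplicity_free_def using e schur_expansion_unique by blast
  then show ?thesis by (auto simp: c_def)
qed

section \<open>Counting removable cells\<close>

definition cle :: "nat \<times> nat \<Rightarrow> nat \<times> nat \<Rightarrow> bool" where
  "cle x y \<longleftrightarrow> fst x \<le> fst y \<and> snd x \<le> snd y"

lemma cle_pair [simp]: "cle (i, j) (i', j') \<longleftrightarrow> i \<le> i' \<and> j \<le> j'" by (simp add: cle_def)

lemma cle_refl: "cle x x" by (simp add: cle_def)

lemma cle_trans: "cle x y \<Longrightarrow> cle y z \<Longrightarrow> cle x z" by (auto simp: cle_def)

lemma cle_antisym: "cle x y \<Longrightarrow> cle y x \<Longrightarrow> x = y" by (auto simp: cle_def prod_eq_iff)

lemma ideal_cle: "ideal I \<Longrightarrow> y \<in> I \<Longrightarrow> cle x y \<Longrightarrow> x \<in> I"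
  unfolding cle_def using idealD[of I "fst y" "snd y" "fst x" "snd x"] by simp

lemma idealI:
  assumes "finite I" "\<And>i j. (Suc i, j) \<in> I \<Longrightarrow> (i, j) \<in> I" "\<And>i j. (i, Suc j) \<in> I \<Longrightarrow> (i, j) \<in> I"
  shows "ideal I"
proof -
  have r: "(i', j) \<in> I" if "(i, j) \<in> I" "i' \<le> i" for i i' j
    using that(2,1) assms(2) by (induction rule: inc_induct) auto
  have c: "(i, j') \<in> I" if "(i, j) \<in> I" "j' \<le> j" for i j j'
    using that(2,1) assms(3) by (induction rule: inc_induct) auto
  show ?thesis using assms(1) r c unfolding ideal_def by blast
qed

text \<open>The complementary view of \<open>subs\<close>: the weights depend on the removed cells
  alone.\<close>

definition removable :: "nat \<Rightarrow> (nat \<times> nat) set \<Rightarrow> (nat \<times> nat) set set" where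
  "removable k I = {D. D \<subseteq> I \<and> card D = k \<and> ideal (I - D)}"

lemma sum_subs_rem: "(\<Sum>Y\<in>subs k I. g (I - Y)) = (\<Sum>D\<in>removable k I. g D)"
  by (rule sum.reindex_bij_witness[where i = "\<lambda>D. I - D" and j = "\<lambda>Y. I - Y"])
     (auto simp: subs_def removable_def double_diff)

lemma finite_rem [simp]: "finite I \<Longrightarrow> finite (removable k I)"
  by (rule finite_subset[of _ "Pow I"]) (auto simp: removable_def)

lemma rem_up_closed: "D \<in> removable k I \<Longrightarrow> x \<in> D \<Longrightarrow> y \<in> I \<Longrightarrow> cle x y \<Longrightarrow> y \<in> D"
  using ideal_cle[of "I - D" y x] by (auto simp: removable_def)

lemma remI:
  assumes "ideal I" "D \<subseteq> I" "card D = k" "\<And>x y. x \<in> D \<Longrightarrow> y \<in> I \<Longrightarrow> cle x y \<Longrightarrow> y \<in> D"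
  shows "D \<in> removable k I"
proof -
  have "ideal (I - D)" unfolding ideal_def
  proof (intro conjI allI impI)
    fix i j i' j' assume a: "(i, j) \<in> I - D" "i' \<le> i" "j' \<le> j"
    then show "(i', j') \<in> I - D"
      using idealD[OF assms(1), of i j i' j'] assms(4)[of "(i', j')" "(i, j)"] by auto
  qed (use ideal_finite[OF assms(1)] in simp)
  then show ?thesis using assms by (simp add: removable_def)
qed

definition corners :: "(nat \<times> nat) set \<Rightarrow> (nat \<times> nat) set" where
  "corners I = {x \<in> I. \<forall>y\<in>I. cle x y \<longrightarrow> y = x}"

lemma mx_eq_cor: "mx D = corners D" by (auto simp: mx_def corners_def cle_def)

lemma cor_iff_ideal:
  assumes "ideal I" "x \<in> I" shows "ideal (I - {x}) \<longleftrightarrow> x \<in> corners I"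
proof
  assume i: "ideal (I - {x})"
  have "y = x" if "y \<in> I" "cle x y" for y
    using ideal_cle[OF i, of y x] that by auto
  then show "x \<in> corners I" using assms(2) by (simp add: corners_def)
next
  assume "x \<in> corners I"
  then have "{x} \<in> removable 1 I" using assms by (intro remI) (auto simp: corners_def)
  then show "ideal (I - {x})" by (simp add: removable_def)
qed

text \<open>Among the cells above \<open>x\<close>, one with the largest coordinate sum is a
  corner.\<close>

lemma cor_above:
  assumes "ideal I" "x \<in> I" obtains c where "c \<in> corners I" "cle x c"
proof -
  let ?A = "{y \<in> I. cle x y}" let ?f = "\<lambda>y. fst y + snd y"
  have fin: "finite ?A" using ideal_finite[OF assms(1)] by simp
  have ne: "?A \<noteq> {}" using assms(2) cle_refl[of x] by blast
  obtain c where c: "c \<in> ?A" "\<And>y. y \<in> ?A \<Longrightarrow> ?f y \<le> ?f c"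
  proof -
    have "Max (?f ` ?A) \<in> ?f ` ?A" using fin ne by (intro Max_in) auto
    then obtain c where "c \<in> ?A" "Max (?f ` ?A) = ?f c" by blast
    moreover have "?f y \<le> Max (?f ` ?A)" if "y \<in> ?A" for y using that fin by (intro Max_ge) auto
    ultimately show ?thesis using that by metis
  qed
  have "y = c" if "y \<in> I" "cle c y" for y
  proof -
    have "?f y \<le> ?f c" using c cle_trans that by blast
    then show ?thesis using that(2) by (auto simp: cle_def prod_eq_iff)
  qed
  then have "c \<in> corners I" using c by (simp add: corners_def)
  then show ?thesis using that c by blast
qed

lemma card_cor_pair:
  assumes "u \<noteq> v" shows "card (corners {u, v}) = of_bool (\<not> cle u v) + of_bool (\<not> cle v u)"
proof -
  have "corners {u, v} = (if cle u v then {} else {u}) \<union> (if cle v u then {} else {v})"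
    using assms by (auto simp: corners_def cle_refl)
  then show ?thesis using assms by simp
qed

text \<open>Indicates that the three cells can be removed in the order \<open>a\<close>,
  \<open>b\<close>, \<open>c\<close>.\<close>

definition ord3 :: "nat \<times> nat \<Rightarrow> nat \<times> nat \<Rightarrow> nat \<times> nat \<Rightarrow> nat" where
  "ord3 a b c = of_bool (\<not> cle a b \<and> \<not> cle a c \<and> \<not> cle b c)"

lemma lin3_triple:
  assumes "x \<noteq> y" "x \<noteq> z" "y \<noteq> z"
  shows "lin3 {x, y, z} = ord3 x y z + ord3 x z y + ord3 y x z + ord3 y z x + ord3 z x y + ord3 z y x"
proof -
  let ?D = "{x, y, z}"
  have "lin3 ?D = (\<Sum>a\<in>?D. if \<forall>d\<in>?D. cle a d \<longrightarrow> d = a then card (corners (?D - {a})) else 0)"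
    unfolding lin3_def mx_eq_cor corners_def[of ?D] by (rule sum.inter_filter) simp
  also have "\<dots> = (if \<not> cle x y \<and> \<not> cle x z then card (corners {y, z}) else 0) +
     (if \<not> cle y x \<and> \<not> cle y z then card (corners {x, z}) else 0) +
     (if \<not> cle z x \<and> \<not> cle z y then card (corners {x, y}) else 0)"
  proof -
    have "?D - {x} = {y, z}" "?D - {y} = {x, z}" "?D - {z} = {x, y}" using assms by auto
    then show ?thesis using assms by (simp add: eq_commute[of y x] eq_commute[of z x] eq_commute[of z y])
  qed
  finally show ?thesis using assms by (simp add: card_cor_pair ord3_def)
qed

lemma hs_iff_inj: "hstrip D \<longleftrightarrow> inj_on snd D" and vs_iff_inj: "vstrip D \<longleftrightarrow> inj_on fst D"
  unfolding hstrip_def vstrip_def inj_on_def by fastforce+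

lemma hw_triple:
  assumes "x \<noteq> y" "x \<noteq> z" "y \<noteq> z"
  shows "hw {x, y, z} = of_bool (snd x \<noteq> snd y \<and> snd x \<noteq> snd z \<and> snd y \<noteq> snd z)"
    and "ew {x, y, z} = of_bool (fst x \<noteq> fst y \<and> fst x \<noteq> fst z \<and> fst y \<noteq> fst z)"
proof -
  have "{y, z} - {x} = {y, z}" "{z} - {y} = {z}" using assms by auto
  then show "hw {x, y, z} = of_bool (snd x \<noteq> snd y \<and> snd x \<noteq> snd z \<and> snd y \<noteq> snd z)"
    "ew {x, y, z} = of_bool (fst x \<noteq> fst y \<and> fst x \<noteq> fst z \<and> fst y \<noteq> fst z)"
    by (simp_all add: hw_def ew_def hs_iff_inj vs_iff_inj inj_on_insert conj_ac)
qed

lemma hw_pair: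
  assumes "x \<noteq> y"
  shows "hw {x, y} = of_bool (snd x \<noteq> snd y)" "ew {x, y} = of_bool (fst x \<noteq> fst y)"
proof -
  have "{y} - {x} = {y}" using assms by auto
  then show "hw {x, y} = of_bool (snd x \<noteq> snd y)" "ew {x, y} = of_bool (fst x \<noteq> fst y)"
    by (simp_all add: hw_def ew_def hs_iff_inj vs_iff_inj inj_on_insert)
qed

definition w3 :: "(nat \<times> nat) set \<Rightarrow> (nat \<times> nat) set \<Rightarrow> real" where
  "w3 D E = hw D * hw E + ew D * ew E + sw D * sw E"

definition w2 :: "(nat \<times> nat) set \<Rightarrow> (nat \<times> nat) set \<Rightarrow> real" where
  "w2 D E = hw D * hw E + ew D * ew E"

text \<open>Comparable cells in different rows and columns are opposite vertices of a rectangle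
  whose four vertices would all have to be removed.\<close>

lemma rem_comparable:
  assumes D: "D \<in> removable k I" "ideal I" "k \<le> 3" and x: "x \<in> D" "y \<in> D" "cle x y"
  shows "fst x = fst y \<or> snd x = snd y"
proof (rule ccontr)
  assume n: "\<not> ?thesis"
  then have lt: "fst x < fst y" "snd x < snd y" using x(3) by (auto simp: cle_def)
  have DI: "D \<subseteq> I" and card: "card D = k" using D by (auto simp: removable_def)
  have "(fst x, snd y) \<in> I" "(fst y, snd x) \<in> I"
    using ideal_cle[OF D(2), of y] x DI lt by (auto simp: cle_def)
  then have "(fst x, snd y) \<in> D" "(fst y, snd x) \<in> D"
    using rem_up_closed[OF D(1) x(1)] lt by (auto simp: cle_def)
  then have "{x, y, (fst x, snd y), (fst y, snd x)} \<subseteq> D" using x by auto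
  moreover have "card {x, y, (fst x, snd y), (fst y, snd x)} = 4"
    using lt by (cases x; cases y) auto
  moreover have "finite D" using DI ideal_finite[OF D(2)] finite_subset by blast
  ultimately have "4 \<le> card D" by (metis card_mono)
  then show False using card D(3) by simp
qed

text \<open>In a removable triple, cells in different rows and columns are incomparable, so any two
  cells are related in one direction. Listing the triple in this order leaves three relative
  positions for each pair.\<close>

definition lex_adj :: "nat \<times> nat \<Rightarrow> nat \<times> nat \<Rightarrow> bool" where
  "lex_adj x y \<longleftrightarrow> fst x = fst y \<and> snd x < snd y \<or> fst x < fst y \<and> snd y \<le> snd x"

text \<open>The 27 combinations of relative positions, with coordinates and truth values as free
  variables so that each case is plain arithmetic.\<close>

lemma lex_triple_arith:
  fixes a b c d e f :: nat
 assumes P: "a = c \<and> b < d \<or> a < c \<and> b = d \<or> a < c \<and> d < b"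
 and Q: "a = e \<and> b < f \<or> a < e \<and> b = f \<or> a < e \<and> f < b"
 and R: "c = e \<and> d < f \<or> c < e \<and> d = f \<or> c < e \<and> f < d"
 and lx: "lxy = (a \<le> c \<and> b \<le> d)" "lyx = (c \<le> a \<and> d \<le> b)" "lxz = (a \<le> e \<and> b \<le> f)" "lzx = (e \<le> a \<and> f \<le> b)" "lyz = (c \<le> e \<and> d \<le> f)" "lzy = (e \<le> c \<and> f \<le> d)"
 and s: "s = (real (of_bool (\<not> lxy \<and> \<not> lxz \<and> \<not> lyz) + of_bool (\<not> lxz \<and> \<not> lxy \<and> \<not> lzy) + of_bool (\<not> lyx \<and> \<not> lyz \<and> \<not> lxz) +
      of_bool (\<not> lyz \<and> \<not> lyx \<and> \<not> lzx) + of_bool (\<not> lzx \<and> \<not> lzy \<and> \<not> lxy) + of_bool (\<not> lzy \<and> \<not> lzx \<and> \<not> lyx)) -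
      of_bool (b \<noteq> d \<and> b \<noteq> f \<and> d \<noteq> f) - of_bool (a \<noteq> c \<and> a \<noteq> e \<and> c \<noteq> e)) / 2"
 shows "s = 0 \<and> (a = c \<and> c = e \<or> b = d \<and> d = f) \<or> s = 1 \<or> s = 2 \<and> \<not> lxy \<and> \<not> lyx \<and> \<not> lxz \<and> \<not> lzx \<and> \<not> lyz \<and> \<not> lzy"
  unfolding s lx using P Q R by (elim disjE conjE; simp)

text \<open>Three incomparable cells carry the regular character, which contains the two-dimensional
  one twice; a straight line carries only the trivial or the sign character; every other triple
  contains the two-dimensional character once.\<close>

lemma triple_classify:
  assumes "lex_adj x y" "lex_adj x z" "lex_adj y z"
  shows "sw {x, y, z} = 0 \<and> ((fst x = fst y \<and> fst y = fst z) \<or> (snd x = snd y \<and> snd y = snd z)) \<or>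
     sw {x, y, z} = 1 \<or> sw {x, y, z} = 2 \<and> \<not> cle x y \<and> \<not> cle y x \<and> \<not> cle x z \<and> \<not> cle z x \<and> \<not> cle y z \<and> \<not> cle z y"
proof -
  have ne: "x \<noteq> y" "x \<noteq> z" "y \<noteq> z" using assms by (auto simp: lex_adj_def)
  obtain a b where x: "x = (a, b)" by (cases x)
  obtain c d where y: "y = (c, d)" by (cases y)
  obtain e f where z: "z = (e, f)" by (cases z)
  have P: "a = c \<and> b < d \<or> a < c \<and> b = d \<or> a < c \<and> d < b"
    and Q: "a = e \<and> b < f \<or> a < e \<and> b = f \<or> a < e \<and> f < b"
    and R: "c = e \<and> d < f \<or> c < e \<and> d = f \<or> c < e \<and> f < d"
    using assms by (auto simp: x y z lex_adj_def)
  from lex_triple_arith[OF P Q R refl refl refl refl refl refl refl] show ?thesis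
    unfolding sw_def lin3_triple[OF ne] hw_triple[OF ne] ord3_def
    unfolding x y z cle_pair fst_conv snd_conv .
qed

text \<open>Any two cells are related and there is no 3-cycle, so the triple can be listed in
  increasing order.\<close>

lemma rem_3_classify:
  assumes "D \<in> removable 3 I" "ideal I"
  obtains x y z where "D = {x, y, z}" "lex_adj x y" "lex_adj x z" "lex_adj y z"
proof -
  have "card D = 3" using assms by (simp add: removable_def)
  then obtain x y z where D: "D = {x, y, z}" "x \<noteq> y" "x \<noteq> z" "y \<noteq> z"
    by (auto simp: card_3_iff)
  have la: "lex_adj u v \<or> lex_adj v u" if "u \<in> D" "v \<in> D" "u \<noteq> v" for u v
  proof -
    have "fst u = fst v \<or> snd u = snd v" if "cle u v \<or> cle v u"
      using that rem_comparable[OF assms order.refl \<open>u \<in> D\<close> \<open>v \<in> D\<close>]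
        rem_comparable[OF assms order.refl \<open>v \<in> D\<close> \<open>u \<in> D\<close>] by auto
    then show ?thesis using \<open>u \<noteq> v\<close> unfolding lex_adj_def cle_def prod_eq_iff by linarith
  qed
  have no: False if "lex_adj u v" "lex_adj v w" "lex_adj w u" for u v w
    using that by (auto simp: lex_adj_def)
  have P: "lex_adj x y \<or> lex_adj y x" "lex_adj x z \<or> lex_adj z x" "lex_adj y z \<or> lex_adj z y"
    using la[of x y] la[of x z] la[of y z] D by auto
  have "\<exists>u v w. D = {u, v, w} \<and> lex_adj u v \<and> lex_adj u w \<and> lex_adj v w"
  proof -
    have "D = {x, z, y}" "D = {y, x, z}" "D = {y, z, x}" "D = {z, x, y}" "D = {z, y, x}"
      using D(1) by auto
    then show ?thesis using P no D(1) by metis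
  qed
  then show ?thesis using that by blast
qed

lemma sw_nonneg: "D \<in> removable 3 I \<Longrightarrow> ideal I \<Longrightarrow> 0 \<le> sw D"
proof -
  assume "D \<in> removable 3 I" "ideal I"
  then obtain x y z where D: "D = {x, y, z}" "lex_adj x y" "lex_adj x z" "lex_adj y z"
    by (rule rem_3_classify)
  show "0 \<le> sw D" unfolding D(1) using triple_classify[OF D(2-4)] by auto
qed

lemma hw_nonneg: "0 \<le> hw D" "0 \<le> ew D" by (simp_all add: hw_def ew_def)

lemma subs_rem: "Y \<in> subs k I \<Longrightarrow> I - Y \<in> removable k I"
  by (auto simp: subs_def removable_def double_diff)

lemma w2_nonneg: "0 \<le> w2 D E" by (simp add: w2_def hw_nonneg)

lemma w3_nonneg: "D \<in> removable 3 I \<Longrightarrow> ideal I \<Longrightarrow> E \<in> removable 3 J \<Longrightarrow> ideal J \<Longrightarrow> 0 \<le> w3 D E"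
  by (simp add: w3_def hw_nonneg sw_nonneg)

lemma B2_w2: "B2 I J = (\<Sum>Y\<in>subs 2 I \<inter> subs 2 J. w2 (I - Y) (J - Y))"
  by (simp add: B2_def w2_def)

lemma B3_w3: "B3 I J = (\<Sum>Y\<in>subs 3 I \<inter> subs 3 J. w3 (I - Y) (J - Y))"
  by (simp add: B3_def w3_def)

section \<open>Transposition of diagrams\<close>

abbreviation conj :: "(nat \<times> nat) set \<Rightarrow> (nat \<times> nat) set" where "conj I \<equiv> prod.swap ` I"

lemma conj_conj: "conj (conj I) = I" by (simp add: image_image)

lemma conj_diff: "conj (A - B) = conj A - conj B" by (rule image_set_diff) simp

lemma mem_conj: "(i, j) \<in> conj I \<longleftrightarrow> (j, i) \<in> I" by force

lemma ideal_conj: "ideal I \<Longrightarrow> ideal (conj I)"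
  unfolding ideal_def mem_conj by auto

lemma card_conj: "card (conj I) = card I" by (simp add: card_image)

lemma subs_conj: "subs k (conj I) = (\<lambda>Y. conj Y) ` subs k I"
proof -
  have sub: "conj Y \<in> subs k (conj J)" if "Y \<in> subs k J" for Y J
    using that ideal_conj[of Y] image_mono[of Y J prod.swap] card_conj[of "J - Y"]
    unfolding subs_def mem_Collect_eq conj_diff by simp
  show ?thesis
  proof (intro equalityI subsetI)
    fix Y assume "Y \<in> subs k (conj I)"
    then have "conj Y \<in> subs k I" using sub[of Y "conj I"] by (simp add: conj_conj)
    then show "Y \<in> (\<lambda>Y. conj Y) ` subs k I" by (intro image_eqI[of _ _ "conj Y"]) (simp_all add: conj_conj)
  qed (use sub in auto)
qed

lemma hw_conj: "hw (conj D) = ew D" "ew (conj D) = hw D"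
proof -
  have "hstrip (conj D) = vstrip D" "vstrip (conj D) = hstrip D" unfolding hstrip_def vstrip_def mem_conj by blast+
  then show "hw (conj D) = ew D" "ew (conj D) = hw D" by (simp_all add: hw_def ew_def)
qed

lemma cor_conj: "corners (conj D) = conj (corners D)"
proof -
  have cm: "(i, j) \<in> corners E \<longleftrightarrow> (i, j) \<in> E \<and> (\<forall>i' j'. (i', j') \<in> E \<longrightarrow> i \<le> i' \<longrightarrow> j \<le> j' \<longrightarrow> i' = i \<and> j' = j)" for i j E
    by (auto simp: corners_def)
  have "(i, j) \<in> corners (conj D) \<longleftrightarrow> (i, j) \<in> conj (corners D)" for i j unfolding mem_conj cm by metis
  then show ?thesis by (intro set_eqI) (metis prod.collapse)
qed

lemma lin3_conj: "lin3 (conj D) = lin3 D"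
proof -
  have "card (corners (conj D - {prod.swap x})) = card (corners (D - {x}))" for x
  proof -
    have "conj D - {prod.swap x} = conj (D - {x})" using conj_diff[of D "{x}"] by simp
    then show ?thesis by (simp add: cor_conj card_conj)
  qed
  then show ?thesis unfolding lin3_def mx_eq_cor cor_conj
    by (subst sum.reindex) (auto intro: inj_onI)
qed

text \<open>Transposition swaps horizontal and vertical strips and preserves linear extensions. On
  characters it multiplies two of the three factors by the sign, which leaves the Kronecker
  coefficient unchanged.\<close>

lemma B_conj: "B3 (conj I) (conj J) - B2 (conj I) (conj J) = B3 I J - B2 I J"
proof -
  have inj: "inj_on (\<lambda>Y. conj Y) A" for A by (rule inj_on_inverseI[where g = "\<lambda>Y. conj Y"]) (rule conj_conj)
  have int: "subs k (conj I) \<inter> subs k (conj J) = (\<lambda>Y. conj Y) ` (subs k I \<inter> subs k J)" for k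
    unfolding subs_conj using inj[of UNIV] by (simp add: image_Int)
  have "B3 (conj I) (conj J) = B3 I J"
    unfolding B3_def int by (subst sum.reindex[OF inj])
      (simp add: conj_diff[symmetric] hw_conj sw_def lin3_conj algebra_simps)
  moreover have "B2 (conj I) (conj J) = B2 I J"
    unfolding B2_def int by (subst sum.reindex[OF inj])
      (simp add: conj_diff[symmetric] hw_conj algebra_simps)
  ultimately show ?thesis by simp
qed

section \<open>Criteria for a coefficient of at least two\<close>

definition multiple :: "(nat \<times> nat) set \<Rightarrow> bool" where
  "multiple I \<longleftrightarrow> (\<exists>J. ideal J \<and> card J = card I \<and> 2 \<le> B3 I J - B2 I J)"

lemma multiple_conj: "multiple (conj I) \<Longrightarrow> multiple I"
proof -
  assume "multiple (conj I)"
  then obtain J where J: "ideal J" "card J = card (conj I)" "2 \<le> B3 (conj I) J - B2 (conj I) J"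
    unfolding multiple_def by blast
  have "B3 (conj I) J - B2 (conj I) J = B3 I (conj J) - B2 I (conj J)"
    using B_conj[of I "conj J"] unfolding conj_conj .
  then show ?thesis unfolding multiple_def using J ideal_conj[OF J(1)] card_conj[of I] card_conj[of J]
    by (intro exI[of _ "conj J"]) simp
qed

text \<open>Here \<open>J\<close> is the diagram with the cell \<open>c\<close> moved to
  \<open>c'\<close>. Common subdiagrams with cells removed lie inside \<open>K\<close>, so
  \<open>B2\<close> becomes a sum over corners of \<open>K\<close> and \<open>B3\<close> a sum over
  removable pairs of \<open>K\<close>. All summands are nonnegative, hence a superset
  \<open>C\<close> of the corners and a few pairs \<open>L\<close> suffice.\<close>

lemma multiple_move:
  assumes K: "ideal K" and c: "c \<notin> K" "c' \<notin> K" "c \<noteq> c'" and I: "ideal (insert c K)" "ideal (insert c' K)"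
    and C: "finite C" "corners K \<subseteq> C" and L: "finite L" "L \<subseteq> removable 2 K"
    and ge: "2 \<le> (\<Sum>P\<in>L. w3 (insert c P) (insert c' P)) - (\<Sum>y\<in>C. w2 {c, y} {c', y})"
  shows "multiple (insert c K)"
proof -
  have fin: "finite K" using ideal_finite[OF K] .
  have subs: "subs (Suc k) (insert c K) \<inter> subs (Suc k) (insert c' K) = subs k K" for k
  proof -
    have ins: "card (insert a K - Y) = Suc (card (K - Y))" if "Y \<subseteq> K" "a \<notin> K" for a Y
    proof -
      have "insert a K - Y = insert a (K - Y)" using that by auto
      then show ?thesis using that fin by simp
    qed
    show ?thesis
    proof (intro equalityI subsetI)
      fix Y assume "Y \<in> subs (Suc k) (insert c K) \<inter> subs (Suc k) (insert c' K)"
      then have Y: "ideal Y" "Y \<subseteq> insert c K" "Y \<subseteq> insert c' K" "card (insert c K - Y) = Suc k"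
        by (simp_all add: subs_def)
      have "Y \<subseteq> K" using Y(2,3) c by blast
      then show "Y \<in> subs k K" using Y(1,4) ins[OF _ c(1)] by (simp add: subs_def)
    next
      fix Y assume "Y \<in> subs k K"
      then have Y: "ideal Y" "Y \<subseteq> K" "card (K - Y) = k" by (simp_all add: subs_def)
      show "Y \<in> subs (Suc k) (insert c K) \<inter> subs (Suc k) (insert c' K)"
        using Y ins[OF Y(2) c(1)] ins[OF Y(2) c(2)] by (simp add: subs_def subset_insertI2)
    qed
  qed
  have D: "insert a K - Y = insert a (K - Y)" if "Y \<in> subs k K" "a \<notin> K" for a Y k
    using that by (auto simp: subs_def)
  have "B2 (insert c K) (insert c' K) = (\<Sum>Y\<in>subs 1 K. w2 (insert c (K - Y)) (insert c' (K - Y)))"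
    unfolding B2_w2 using subs[of 1] c D by (simp add: numeral_2_eq_2)
  also have "\<dots> = (\<Sum>x | x \<in> K \<and> ideal (K - {x}). w2 (insert c (K - (K - {x}))) (insert c' (K - (K - {x}))))"
    by (rule sum_subs_1)
  also have "\<dots> = (\<Sum>x\<in>corners K. w2 {c, x} {c', x})"
  proof (rule sum.cong)
    show "{x. x \<in> K \<and> ideal (K - {x})} = corners K" using cor_iff_ideal[OF K] by (auto simp: corners_def)
    fix x assume "x \<in> corners K"
    then have "K - (K - {x}) = {x}" by (auto simp: corners_def)
    then show "w2 (insert c (K - (K - {x}))) (insert c' (K - (K - {x}))) = w2 {c, x} {c', x}" by simp
  qed
  also have "\<dots> \<le> (\<Sum>y\<in>C. w2 {c, y} {c', y})" by (rule sum_mono2[OF C]) (rule w2_nonneg)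
  finally have b2: "B2 (insert c K) (insert c' K) \<le> (\<Sum>y\<in>C. w2 {c, y} {c', y})" .
  have "B3 (insert c K) (insert c' K) = (\<Sum>Y\<in>subs 2 K. w3 (insert c (K - Y)) (insert c' (K - Y)))"
    unfolding B3_w3 using subs[of 2] c D by (simp add: numeral_3_eq_3 numeral_2_eq_2)
  also have "\<dots> = (\<Sum>P\<in>removable 2 K. w3 (insert c P) (insert c' P))"
    by (rule sum_subs_rem[where g = "\<lambda>P. w3 (insert c P) (insert c' P)"])
  also have "\<dots> \<ge> (\<Sum>P\<in>L. w3 (insert c P) (insert c' P))"
  proof (rule sum_mono2)
    fix P assume "P \<in> removable 2 K - L"
    then have P: "P \<subseteq> K" "card P = 2" "ideal (K - P)" by (auto simp: removable_def)
    have "insert a P \<in> removable 3 (insert a K)" if "a \<notin> K" for a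
    proof -
      have "insert a K - insert a P = K - P" using that P by auto
      moreover have "a \<notin> P" "finite P" using that P fin finite_subset by auto
      ultimately show ?thesis using P by (auto simp: removable_def)
    qed
    note r = this
    show "0 \<le> w3 (insert c P) (insert c' P)" by (rule w3_nonneg[OF r[OF c(1)] I(1) r[OF c(2)] I(2)])
  qed (use L fin in auto)
  finally have "2 \<le> B3 (insert c K) (insert c' K) - B2 (insert c K) (insert c' K)" using ge b2 by linarith
  then show ?thesis unfolding multiple_def using I c fin by (intro exI[of _ "insert c' K"]) simp
qed

text \<open>The removable dominoes: by \<open>domsE\<close>, a corner and a further cell in its row
  or column.\<close>

definition doms :: "(nat \<times> nat) set \<Rightarrow> (nat \<times> nat) set set" where
  "doms I = {D \<in> removable 2 I. \<not> D \<subseteq> corners I}"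

lemma cor_incomparable: "x \<in> corners I \<Longrightarrow> y \<in> I \<Longrightarrow> x \<noteq> y \<Longrightarrow> \<not> cle x y" by (auto simp: corners_def)

lemma incomparable_coords: "\<not> cle x y \<Longrightarrow> \<not> cle y x \<Longrightarrow> fst x \<noteq> fst y \<and> snd x \<noteq> snd y"
  by (auto simp: cle_def)

lemma cor_sub: "corners I \<subseteq> I" by (auto simp: corners_def)

lemma domsE:
  assumes "D \<in> doms I" "ideal I"
  obtains x y where "D = {x, y}" "x \<noteq> y" "cle x y" "x \<in> I" "x \<notin> corners I" "y \<in> corners I" "fst x = fst y \<or> snd x = snd y"
proof -
  have D: "D \<in> removable 2 I" "D \<subseteq> I" "card D = 2" "\<not> D \<subseteq> corners I" using assms by (auto simp: doms_def removable_def)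
  then obtain x where x: "x \<in> D" "x \<notin> corners I" by blast
  then obtain y where y: "y \<in> I" "cle x y" "y \<noteq> x" using D by (auto simp: corners_def)
  have yD: "y \<in> D" using rem_up_closed[OF D(1) x(1) y(1,2)] .
  have De: "D = {x, y}"
  proof (rule card_subset_eq[symmetric])
    show "finite D" using D(3) card.infinite by fastforce
  qed (use x yD y D(3) in auto)
  have "y \<in> corners I"
  proof -
    have "u = y" if u: "u \<in> I" "cle y u" for u
    proof -
      have "u \<in> D" using rem_up_closed[OF D(1) yD u] .
      then show ?thesis using De u y cle_antisym by blast
    qed
    then show ?thesis using y by (simp add: corners_def)
  qed
  moreover have "fst x = fst y \<or> snd x = snd y"
    using rem_comparable[OF D(1) assms(2) _ x(1) yD y(2)] by simp
  ultimately show ?thesis using that De x y D(2) by blast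
qed

lemma domsI: "D \<in> removable 2 I \<Longrightarrow> x \<in> D \<Longrightarrow> y \<in> D \<Longrightarrow> x \<noteq> y \<Longrightarrow> cle x y \<Longrightarrow> D \<in> doms I"
  unfolding doms_def using cor_incomparable[of x I y] by (auto simp: removable_def)

lemma hw_le_1: "hw D \<le> 1" "ew D \<le> 1" by (simp_all add: hw_def ew_def)

lemma choose2: "2 * (d choose 2) = d * (d - 1)"
  using times_binomial_minus1_eq[of 2 d] by simp

lemma choose3: "6 * (d choose 3) = d * ((d - 1) * (d - 2))"
proof -
  have "3 * (d choose 3) = d * ((d - 1) choose 2)" using times_binomial_minus1_eq[of 3 d] by simp
  then have "6 * (d choose 3) = d * (2 * ((d - 1) choose 2))" by simp
  moreover have "d - 1 - 1 = d - 2" by simp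
  ultimately show ?thesis unfolding choose2 by simp
qed

text \<open>A pair of corners weighs at most 2 and a domino at most 1; the pairs of corners are
  counted by a binomial coefficient.\<close>

lemma B2_self_le:
  assumes "ideal I"
  shows "B2 I I \<le> real (card (corners I) * (card (corners I) - 1) + card (doms I))"
proof -
  have fin: "finite I" using ideal_finite[OF assms] .
  let ?A = "{D \<in> removable 2 I. D \<subseteq> corners I}"
  have finc: "finite (corners I)" using fin cor_sub finite_subset by blast
  have "B2 I I = (\<Sum>D\<in>removable 2 I. w2 D D)"
    unfolding B2_w2 using sum_subs_rem[where g = "\<lambda>D. w2 D D" and k = 2] by simp
  also have "removable 2 I = ?A \<union> doms I" by (auto simp: doms_def)
  also have "(\<Sum>D\<in>?A \<union> doms I. w2 D D) = (\<Sum>D\<in>?A. w2 D D) + (\<Sum>D\<in>doms I. w2 D D)"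
    using fin by (intro sum.union_disjoint) (auto simp: doms_def)
  also have "(\<Sum>D\<in>?A. w2 D D) \<le> (\<Sum>D\<in>?A. 2)"
    using hw_le_1 by (intro sum_mono) (auto simp: w2_def hw_def ew_def)
  also have "(\<Sum>D\<in>?A. (2::real)) \<le> 2 * real (card (corners I) choose 2)"
  proof -
    have "card ?A \<le> card {D. D \<subseteq> corners I \<and> card D = 2}"
      using finc by (intro card_mono) (auto simp: removable_def)
    then show ?thesis using n_subsets[OF finc, of 2] by simp
  qed
  also have "(\<Sum>D\<in>doms I. w2 D D) \<le> (\<Sum>D\<in>doms I. 1)"
  proof (rule sum_mono)
    fix D assume "D \<in> doms I"
    then obtain x y where "D = {x, y}" "x \<noteq> y" "fst x = fst y \<or> snd x = snd y"
      using domsE[OF _ assms] by metis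
    then show "w2 D D \<le> 1" by (auto simp: w2_def hw_pair)
  qed
  finally have "B2 I I \<le> 2 * real (card (corners I) choose 2) + real (card (doms I))" by simp
  moreover have "2 * real (card (corners I) choose 2) = real (card (corners I) * (card (corners I) - 1))"
    using choose2[of "card (corners I)"] by (metis of_nat_mult of_nat_numeral)
  ultimately show ?thesis by simp
qed

text \<open>Three disjoint families are counted: three corners weigh 1 + 1 + 4 = 6, a domino with a
  further corner weighs 2, and the triples in \<open>Os\<close> weigh at least 1. The last
  hypothesis keeps \<open>Os\<close> apart from the other two families, whose triples contain a
  corner incomparable to the rest.\<close>

lemma B3_self_ge:
  assumes I: "ideal I" and Os: "Os \<subseteq> removable 3 I" "\<And>D. D \<in> Os \<Longrightarrow> 1 \<le> w3 D D"
    "\<And>D z. D \<in> Os \<Longrightarrow> z \<in> D \<Longrightarrow> \<exists>u\<in>D. u \<noteq> z \<and> (cle u z \<or> cle z u)"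
  shows "real (card (corners I) * ((card (corners I) - 1) * (card (corners I) - 2)) + 2 * (card (corners I) - 1) * card (doms I) + card Os) \<le> B3 I I"
proof -
  have fin: "finite I" using ideal_finite[OF I] .
  have finc: "finite (corners I)" using fin cor_sub finite_subset by blast
  have find: "finite (doms I)" using fin by (simp add: doms_def)
  have finO: "finite Os" using Os(1) fin finite_subset by fastforce
  let ?A = "{D. D \<subseteq> corners I \<and> card D = 3}"
  let ?S = "SIGMA D:doms I. corners I - D"
  let ?T = "(\<lambda>(D, z). insert z D) ` ?S"
  have inc: "\<not> cle z u \<and> \<not> cle u z" if D: "D \<in> doms I" and z: "z \<in> corners I - D" and u: "u \<in> D" for D z u
  proof -
    have "u \<in> I" "D \<in> removable 2 I" using D u by (auto simp: doms_def removable_def)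
    then show ?thesis using z u cor_incomparable[of z I u] rem_up_closed[of D 2 I u z] by (auto simp: corners_def)
  qed
  have A: "?A \<subseteq> removable 3 I"
  proof
    fix D assume "D \<in> ?A"
    then show "D \<in> removable 3 I" using cor_sub[of I] cor_incomparable[of _ I] by (intro remI[OF I]) fastforce+
  qed
  have wA: "w3 D D = 6" if "D \<in> ?A" for D
  proof -
    have "card D = 3" using that by simp
    then obtain x y z where D: "D = {x, y, z}" "x \<noteq> y" "x \<noteq> z" "y \<noteq> z"
      unfolding card_3_iff by blast
    have n: "\<not> cle u v" if "u \<in> D" "v \<in> D" "u \<noteq> v" for u v
      using that \<open>D \<in> ?A\<close> cor_incomparable[of u I v] cor_sub[of I] by auto
    then have i: "\<not> cle x y" "\<not> cle y x" "\<not> cle x z" "\<not> cle z x" "\<not> cle y z" "\<not> cle z y" using D by auto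
    note f = incomparable_coords[OF i(1,2)] incomparable_coords[OF i(3,4)] incomparable_coords[OF i(5,6)]
    show ?thesis unfolding D(1) w3_def sw_def lin3_triple[OF D(2-4)] hw_triple[OF D(2-4)] ord3_def
      using i f by simp
  qed
  have T: "?T \<subseteq> removable 3 I"
  proof
    fix E assume "E \<in> ?T"
    then obtain D z where E: "E = insert z D" and D: "D \<in> doms I" and z: "z \<in> corners I - D" by auto
    have DI: "D \<in> removable 2 I" "D \<subseteq> I" "card D = 2" using D by (auto simp: doms_def removable_def)
    have "finite D" using DI fin finite_subset by blast
    then have "card E = 3" using E z DI by simp
    moreover have "E \<subseteq> I" using E z DI cor_sub by blast
    moreover have "v \<in> E" if "u \<in> E" "v \<in> I" "cle u v" for u v
      using that E rem_up_closed[OF DI(1), of u v] cor_incomparable[of z I v] z by auto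
    ultimately show "E \<in> removable 3 I" by (intro remI[OF I])
  qed
  have wT: "w3 E E = 2" if ET: "E \<in> ?T" for E
  proof -
    obtain D z where E: "E = insert z D" and D: "D \<in> doms I" and z: "z \<in> corners I - D" using ET by auto
    obtain x y where xy: "D = {x, y}" "x \<noteq> y" "cle x y" "fst x = fst y \<or> snd x = snd y"
      using domsE[OF D I] by metis
    have ne: "z \<noteq> x" "z \<noteq> y" using z xy by auto
    have i: "\<not> cle z x" "\<not> cle x z" "\<not> cle z y" "\<not> cle y z" using inc[OF D z] xy by auto
    have nyx: "\<not> cle y x" using xy cle_antisym by blast
    note f = incomparable_coords[OF i(1,2)] incomparable_coords[OF i(3,4)]
    have "\<not> (fst x = fst y \<and> snd x = snd y)" using xy(2) by (simp add: prod_eq_iff)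
    then show ?thesis unfolding E xy(1) w3_def sw_def lin3_triple[OF ne xy(2)] hw_triple[OF ne xy(2)] ord3_def
      using i f nyx xy(3,4) by auto
  qed
  have inj: "inj_on (\<lambda>(D, z). insert z D) ?S"
  proof (rule inj_onI, clarify)
    fix D z D' z' assume D: "D \<in> doms I" and z: "z \<in> corners I" "z \<notin> D" and D': "D' \<in> doms I" and z': "z' \<in> corners I" "z' \<notin> D'"
      and eq: "insert z D = insert z' D'"
    obtain x y where xy: "D = {x, y}" "x \<noteq> y" "cle x y" "x \<notin> corners I" "y \<in> corners I" using domsE[OF D I] by metis
    obtain x' y' where xy': "D' = {x', y'}" "x' \<noteq> y'" "cle x' y'" "x' \<notin> corners I" "y' \<in> corners I" using domsE[OF D' I] by metis
    have xx: "x = x'" using eq xy xy' z z' by auto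
    have "z = z'"
    proof (rule ccontr)
      assume "z \<noteq> z'"
      then have "z \<in> D'" using eq by auto
      then have "z = y'" using xy' z by auto
      then show False using inc[OF D, of z x] z xy xy' xx by auto
    qed
    then have "D = D'" using eq z z' insert_ident[of z D D'] by simp
    then show "D = D' \<and> z = z'" using \<open>z = z'\<close> by simp
  qed
  have cT: "card ?T = card (doms I) * (card (corners I) - 1)"
  proof -
    have "card (corners I - D) = card (corners I) - 1" if D: "D \<in> doms I" for D
    proof -
      obtain x y where xy: "D = {x, y}" "x \<notin> corners I" "y \<in> corners I" using domsE[OF D I] by metis
      then have "corners I - D = corners I - {y}" by auto
      then show ?thesis using xy by simp
    qed
    then have "card ?S = card (doms I) * (card (corners I) - 1)"
      using find finc by (subst card_SigmaI) auto
    then show ?thesis using card_image[OF inj] by simp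
  qed
  have disj: "?A \<inter> ?T = {}" "(?A \<union> ?T) \<inter> Os = {}"
  proof -
    show "?A \<inter> ?T = {}"
    proof (rule ccontr)
      assume "?A \<inter> ?T \<noteq> {}"
      then obtain D z where "insert z D \<subseteq> corners I" "D \<in> doms I" by auto
      then show False by (auto simp: doms_def)
    qed
    have "D \<notin> Os" if DA: "D \<in> ?A" for D
    proof
      assume DO: "D \<in> Os"
      have "D \<noteq> {}" using DA by auto
      then obtain z where z: "z \<in> D" by blast
      obtain u where "u \<in> D" "u \<noteq> z" "cle u z \<or> cle z u" using Os(3)[OF DO z] by blast
      then show False using DA z cor_incomparable[of u I z] cor_incomparable[of z I u] cor_sub[of I] by auto
    qed
    moreover have "E \<notin> Os" if E: "E \<in> ?T" for E
    proof
      assume EO: "E \<in> Os"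
      obtain D z where E: "E = insert z D" and D: "D \<in> doms I" and z: "z \<in> corners I - D" using E by auto
      obtain u where "u \<in> E" "u \<noteq> z" "cle u z \<or> cle z u" using Os(3)[OF EO, of z] E by blast
      then show False using inc[OF D z, of u] E by auto
    qed
    ultimately show "(?A \<union> ?T) \<inter> Os = {}" by blast
  qed
  have finA: "finite ?A" by (rule finite_subset[OF A]) (use fin in simp)
  have finT: "finite ?T" by (rule finite_subset[OF T]) (use fin in simp)
  have "real (6 * (card (corners I) choose 3) + 2 * (card (doms I) * (card (corners I) - 1)) + card Os) =
     (\<Sum>D\<in>?A. 6) + (\<Sum>D\<in>?T. 2) + (\<Sum>D\<in>Os. 1)"
    using cT n_subsets[OF finc, of 3] by simp
  also have "\<dots> \<le> (\<Sum>D\<in>?A. w3 D D) + (\<Sum>D\<in>?T. w3 D D) + (\<Sum>D\<in>Os. w3 D D)"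
    using wA wT Os(2) by (intro add_mono sum_mono) auto
  also have "\<dots> = (\<Sum>D\<in>(?A \<union> ?T) \<union> Os. w3 D D)"
    using disj finA finT finO by (simp add: sum.union_disjoint)
  also have "\<dots> \<le> (\<Sum>D\<in>removable 3 I. w3 D D)"
    using A T Os(1) fin w3_nonneg[OF _ I _ I] by (intro sum_mono2) auto
  also have "\<dots> = B3 I I"
    unfolding B3_w3 using sum_subs_rem[where g = "\<lambda>D. w3 D D" and k = 3] by simp
  finally show ?thesis unfolding choose3 by (simp add: mult_ac)
qed

text \<open>The coefficient at \<open>J = I\<close>. The cubic term in the number of corners
  outweighs the quadratic one, so extra triples matter only when corners are few.\<close>

lemma multiple_self:
  assumes I: "ideal I" and Os: "Os \<subseteq> removable 3 I" "\<And>D. D \<in> Os \<Longrightarrow> 1 \<le> w3 D D"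
    "\<And>D z. D \<in> Os \<Longrightarrow> z \<in> D \<Longrightarrow> \<exists>u\<in>D. u \<noteq> z \<and> (cle u z \<or> cle z u)"
    and ge: "card (corners I) * (card (corners I) - 1) + card (doms I) + 2 \<le>
      card (corners I) * ((card (corners I) - 1) * (card (corners I) - 2)) + 2 * (card (corners I) - 1) * card (doms I) + card Os"
  shows "multiple I"
proof -
  have "2 \<le> B3 I I - B2 I I"
    using B2_self_le[OF I] B3_self_ge[OF I Os] of_nat_mono[OF ge, where 'a = real] by simp
  then show ?thesis unfolding multiple_def using I by blast
qed

text \<open>For two corners and \<open>k\<close> dominoes, \<open>multiple_self\<close> asks for
  \<open>2 + k + 2 \<le> 2 * k + card Os\<close>; this is the origin of the 4.\<close>

lemma multiple_two_corners:
  assumes I: "ideal I" "card (corners I) = 2" and Ps: "Ps \<subseteq> doms I"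
    and Os: "Os \<subseteq> removable 3 I" "\<And>D. D \<in> Os \<Longrightarrow> 1 \<le> w3 D D"
    "\<And>D z. D \<in> Os \<Longrightarrow> z \<in> D \<Longrightarrow> \<exists>u\<in>D. u \<noteq> z \<and> (cle u z \<or> cle z u)"
    and ge: "4 \<le> card Ps + card Os"
  shows "multiple I"
proof -
  have "finite (doms I)" using ideal_finite[OF I(1)] by (simp add: doms_def)
  then have "card Ps \<le> card (doms I)" using Ps by (rule card_mono)
  then show ?thesis using multiple_self[OF I(1) Os] I(2) ge by simp
qed

section \<open>Dominoes and connected triples at a corner\<close>

lemma upset_rem:
  assumes "ideal I" "D = {y \<in> I. cle b y}" "card D = k" shows "D \<in> removable k I"
  using assms by (intro remI) (auto intro: cle_trans)

definition conn3 :: "(nat \<times> nat) set \<Rightarrow> (nat \<times> nat) set \<Rightarrow> bool" where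
  "conn3 I D \<longleftrightarrow> D \<in> removable 3 I \<and> 1 \<le> w3 D D \<and> (\<forall>z\<in>D. \<exists>u\<in>D. u \<noteq> z \<and> (cle u z \<or> cle z u))"

lemma cor_mem_iff:
  assumes "ideal I" shows "(i, j) \<in> corners I \<longleftrightarrow> (i, j) \<in> I \<and> (Suc i, j) \<notin> I \<and> (i, Suc j) \<notin> I"
proof
  assume "(i, j) \<in> I \<and> (Suc i, j) \<notin> I \<and> (i, Suc j) \<notin> I"
  then have a: "(i, j) \<in> I" "(Suc i, j) \<notin> I" "(i, Suc j) \<notin> I" by auto
  have "y = (i, j)" if y: "y \<in> I" "cle (i, j) y" for y
  proof -
    obtain k l where kl: "y = (k, l)" by (cases y)
    have "k \<le> i" using idealD[OF assms, of k l "Suc i" j] y a kl by (cases "k \<le> i") auto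
    moreover have "l \<le> j" using idealD[OF assms, of k l i "Suc j"] y a kl by (cases "l \<le> j") auto
    ultimately show ?thesis using y kl by simp
  qed
  then show "(i, j) \<in> corners I" using a by (simp add: corners_def)
qed (auto simp: corners_def)

text \<open>With no cell directly below \<open>(i, j)\<close>, only the rest of its row lies weakly
  to its lower right.\<close>

lemma upset_row:
  assumes I: "ideal I" and c: "(i, j + k) \<in> corners I" and n: "(Suc i, j) \<notin> I"
  shows "{y \<in> I. cle (i, j) y} = {i} \<times> {j..j + k}"
proof (intro equalityI subsetI)
  fix y assume y: "y \<in> {y \<in> I. cle (i, j) y}"
  obtain a b where ab: "y = (a, b)" by (cases y)
  have "a \<le> i" using idealD[OF I, of a b "Suc i" j] y n ab by (cases "a \<le> i") auto
  moreover have "b \<le> j + k"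
    using idealD[OF I, of a b i "Suc (j + k)"] y c ab by (cases "b \<le> j + k") (auto simp: cor_mem_iff[OF I])
  ultimately show "y \<in> {i} \<times> {j..j + k}" using y ab by auto
next
  fix y assume "y \<in> {i} \<times> {j..j + k}"
  then show "y \<in> {y \<in> I. cle (i, j) y}" using idealD[OF I, of i "j + k"] c by (auto simp: cor_mem_iff[OF I])
qed

lemma upset_col:
  assumes I: "ideal I" and c: "(i + k, j) \<in> corners I" and n: "(i, Suc j) \<notin> I"
  shows "{y \<in> I. cle (i, j) y} = {i..i + k} \<times> {j}"
proof (intro equalityI subsetI)
  fix y assume y: "y \<in> {y \<in> I. cle (i, j) y}"
  obtain a b where ab: "y = (a, b)" by (cases y)
  have "b \<le> j" using idealD[OF I, of a b i "Suc j"] y n ab by (cases "b \<le> j") auto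
  moreover have "a \<le> i + k"
    using idealD[OF I, of a b "Suc (i + k)" j] y c ab by (cases "a \<le> i + k") (auto simp: cor_mem_iff[OF I])
  ultimately show "y \<in> {i..i + k} \<times> {j}" using y ab by auto
next
  fix y assume "y \<in> {i..i + k} \<times> {j}"
  then show "y \<in> {y \<in> I. cle (i, j) y}" using idealD[OF I, of "i + k" j] c by (auto simp: cor_mem_iff[OF I])
qed

lemma row2:
  assumes "ideal I" "(i, Suc j) \<in> corners I" "(Suc i, j) \<notin> I"
  shows "{(i, j), (i, Suc j)} \<in> doms I"
proof -
  have "{(i, j), (i, Suc j)} = {i} \<times> {j..j + 1}" by (auto simp: le_Suc_eq)
  then have "{(i, j), (i, Suc j)} \<in> removable 2 I"
    using upset_row[of I i j 1] assms by (intro upset_rem[of _ _ "(i, j)"]) auto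
  then show ?thesis by (rule domsI[of _ _ "(i, j)" "(i, Suc j)"]) auto
qed

lemma col2:
  assumes "ideal I" "(Suc i, j) \<in> corners I" "(i, Suc j) \<notin> I"
  shows "{(i, j), (Suc i, j)} \<in> doms I"
proof -
  have "{(i, j), (Suc i, j)} = {i..i + 1} \<times> {j}" by (auto simp: le_Suc_eq)
  then have "{(i, j), (Suc i, j)} \<in> removable 2 I"
    using upset_col[of I i 1 j] assms by (intro upset_rem[of _ _ "(i, j)"]) auto
  then show ?thesis by (rule domsI[of _ _ "(i, j)" "(Suc i, j)"]) auto
qed

lemma row3:
  assumes "ideal I" "(i, Suc (Suc j)) \<in> corners I" "(Suc i, j) \<notin> I"
  shows "conn3 I {(i, j), (i, Suc j), (i, Suc (Suc j))}"
proof -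
  have "{(i, j), (i, Suc j), (i, Suc (Suc j))} = {i} \<times> {j..j + 2}" by (auto simp: le_Suc_eq numeral_2_eq_2)
  then have "{(i, j), (i, Suc j), (i, Suc (Suc j))} \<in> removable 3 I"
    using upset_row[of I i j 2] assms by (intro upset_rem[of _ _ "(i, j)"]) auto
  then show ?thesis
    by (auto simp: conn3_def w3_def sw_def hw_triple lin3_triple ord3_def)
qed

lemma col3:
  assumes "ideal I" "(Suc (Suc i), j) \<in> corners I" "(i, Suc j) \<notin> I"
  shows "conn3 I {(i, j), (Suc i, j), (Suc (Suc i), j)}"
proof -
  have "{(i, j), (Suc i, j), (Suc (Suc i), j)} = {i..i + 2} \<times> {j}" by (auto simp: le_Suc_eq numeral_2_eq_2)
  then have "{(i, j), (Suc i, j), (Suc (Suc i), j)} \<in> removable 3 I"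
    using upset_col[of I i 2 j] assms by (intro upset_rem[of _ _ "(i, j)"]) auto
  then show ?thesis
    by (auto simp: conn3_def w3_def sw_def hw_triple lin3_triple ord3_def)
qed

text \<open>The two neighbours of the corner become free once the corner is removed, because nothing
  lies below the left one or to the right of the upper one.\<close>

lemma inner_corner3:
  assumes I: "ideal I" and c: "(Suc i, Suc j) \<in> corners I" and n: "(Suc (Suc i), j) \<notin> I" "(i, Suc (Suc j)) \<notin> I"
  shows "conn3 I {(Suc i, Suc j), (i, Suc j), (Suc i, j)}"
proof -
  have u: "{y \<in> I. cle (Suc i, j) y} = {(Suc i, j), (Suc i, Suc j)}"
  proof -
    have "{y \<in> I. cle (Suc i, j) y} = {Suc i} \<times> {j..j + 1}" by (rule upset_row[OF I]) (use c n in auto)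
    also have "\<dots> = {(Suc i, j), (Suc i, Suc j)}" by (auto simp: le_Suc_eq)
    finally show ?thesis .
  qed
  have v: "{y \<in> I. cle (i, Suc j) y} = {(i, Suc j), (Suc i, Suc j)}"
  proof -
    have "{y \<in> I. cle (i, Suc j) y} = {i..i + 1} \<times> {Suc j}" by (rule upset_col[OF I]) (use c n in auto)
    also have "\<dots> = {(i, Suc j), (Suc i, Suc j)}" by (auto simp: le_Suc_eq)
    finally show ?thesis .
  qed
  have w: "{y \<in> I. cle (Suc i, Suc j) y} = {(Suc i, Suc j)}" using c by (auto simp: corners_def)
  have "{(Suc i, Suc j), (i, Suc j), (Suc i, j)} \<in> removable 3 I"
  proof (rule remI[OF I])
    show "{(Suc i, Suc j), (i, Suc j), (Suc i, j)} \<subseteq> I" using u v by auto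
    fix x y assume x: "x \<in> {(Suc i, Suc j), (i, Suc j), (Suc i, j)}" and y: "y \<in> I" "cle x y"
    then have "y \<in> {y \<in> I. cle (Suc i, j) y} \<union> {y \<in> I. cle (i, Suc j) y} \<union> {y \<in> I. cle (Suc i, Suc j) y}" by blast
    then show "y \<in> {(Suc i, Suc j), (i, Suc j), (Suc i, j)}" unfolding u v w by blast
  qed simp
  then show ?thesis
    by (auto simp: conn3_def w3_def sw_def hw_triple lin3_triple ord3_def)
qed

lemma outer_corner3:
  assumes I: "ideal I" and c: "(i, Suc j) \<in> corners I" "(Suc i, j) \<in> corners I"
  shows "conn3 I {(i, j), (i, Suc j), (Suc i, j)}"
proof -
  have eq: "{(i, j), (i, Suc j), (Suc i, j)} = {y \<in> I. cle (i, j) y}"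
  proof (intro equalityI subsetI)
    fix y assume y: "y \<in> {y \<in> I. cle (i, j) y}"
    obtain a b where ab: "y = (a, b)" by (cases y)
    have "(Suc i, Suc j) \<notin> I" "(i, Suc (Suc j)) \<notin> I" "(Suc (Suc i), j) \<notin> I"
      using c by (auto simp: cor_mem_iff[OF I])
    note n = this
    have "\<not> (Suc i \<le> a \<and> Suc j \<le> b)" using idealD[OF I, of a b "Suc i" "Suc j"] y ab n(1) by auto
    moreover have "b \<le> Suc j"
      using idealD[OF I, of a b i "Suc (Suc j)"] y ab n(2) by (cases "b \<le> Suc j") auto
    moreover have "a \<le> Suc i"
      using idealD[OF I, of a b "Suc (Suc i)" j] y ab n(3) by (cases "a \<le> Suc i") auto
    ultimately show "y \<in> {(i, j), (i, Suc j), (Suc i, j)}" using y ab by auto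
  qed (use c idealD[OF I, of i "Suc j" i j] in \<open>auto simp: cor_mem_iff[OF I]\<close>)
  have "{(i, j), (i, Suc j), (Suc i, j)} \<in> removable 3 I" by (rule upset_rem[OF I eq]) simp
  then show ?thesis
    by (auto simp: conn3_def w3_def sw_def hw_triple lin3_triple ord3_def)
qed

lemma multiple_two_corners':
  assumes "ideal I" "card (corners I) = 2" "Ps \<subseteq> doms I" "\<And>D. D \<in> Os \<Longrightarrow> conn3 I D" "4 \<le> card Ps + card Os"
  shows "multiple I"
  by (rule multiple_two_corners[OF assms(1-3), of Os]) (use assms(4,5) in \<open>auto simp: conn3_def\<close>)

section \<open>Classification of the exceptional diagrams\<close>

text \<open>The union of two rectangles with lower right cells \<open>(p, s)\<close> and
  \<open>(q, t)\<close>, counted from 0; for \<open>p < q\<close> and \<open>t < s\<close> this is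
  the general diagram with two corners.\<close>

definition shapeL :: "nat \<Rightarrow> nat \<Rightarrow> nat \<Rightarrow> nat \<Rightarrow> (nat \<times> nat) set" where
  "shapeL p q s t = {(i, j). i \<le> p \<and> j \<le> s \<or> i \<le> q \<and> j \<le> t}"

lemma mem_shapeL: "(i, j) \<in> shapeL p q s t \<longleftrightarrow> i \<le> p \<and> j \<le> s \<or> i \<le> q \<and> j \<le> t"
  by (simp add: shapeL_def)

lemma shapeL_ideal: "ideal (shapeL p q s t)"
proof (rule idealI)
  show "finite (shapeL p q s t)"
    by (rule finite_subset[of _ "{..p + q} \<times> {..s + t}"]) (auto simp: shapeL_def)
qed (auto simp: mem_shapeL)

lemma shapeL_conj: "conj (shapeL p q s t) = shapeL t s q p"
proof (intro set_eqI)
  fix x :: "nat \<times> nat"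
  obtain i j where x: "x = (i, j)" by (cases x)
  show "x \<in> conj (shapeL p q s t) \<longleftrightarrow> x \<in> shapeL t s q p" unfolding x mem_conj mem_shapeL by auto
qed

lemma shapeL_cor:
  assumes "p < q" "t < s" shows "corners (shapeL p q s t) = {(p, s), (q, t)}"
proof (intro set_eqI)
  fix x :: "nat \<times> nat"
  obtain i j where x: "x = (i, j)" by (cases x)
  show "x \<in> corners (shapeL p q s t) \<longleftrightarrow> x \<in> {(p, s), (q, t)}"
    unfolding x cor_mem_iff[OF shapeL_ideal] mem_shapeL using assms by auto
qed

lemma card_shapeL: "p < q \<Longrightarrow> t < s \<Longrightarrow> card (shapeL p q s t) = Suc p * Suc s + (q - p) * Suc t"
proof -
  assume a: "p < q" "t < s"
  have "shapeL p q s t = {..p} \<times> {..s} \<union> {p<..q} \<times> {..t}" using a by (auto simp: shapeL_def)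
  then show ?thesis by (simp add: card_Un_disjoint card_cartesian_product disjoint_iff)
qed

lemma multiple_shapeL:
  assumes "p < q" "t < s" "Ps \<subseteq> doms (shapeL p q s t)" "\<And>D. D \<in> Os \<Longrightarrow> conn3 (shapeL p q s t) D" "4 \<le> card Ps + card Os"
  shows "multiple (shapeL p q s t)"
  by (rule multiple_two_corners'[OF shapeL_ideal _ assms(3-5)]) (use assms(1,2) in \<open>auto simp: shapeL_cor\<close>)

lemma neq_setI: "x \<in> A \<Longrightarrow> x \<notin> B \<Longrightarrow> A \<noteq> B" by blast

lemma ex_Suc: "1 \<le> n \<Longrightarrow> \<exists>m. n = Suc m" by presburger

lemma ex_Suc2: "2 \<le> n \<Longrightarrow> \<exists>m. n = Suc (Suc m)" by presburger

text \<open>At the upper corner \<open>(p, s)\<close>, \<open>1 \<le> p\<close> gives a vertical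
  domino, \<open>t + 2 \<le> s\<close> a horizontal one, and both together the triple of
  \<open>inner_corner3\<close>. At the lower corner \<open>(q, t)\<close>, \<open>1 \<le> t\<close>
  gives a horizontal domino and \<open>p + 2 \<le> q\<close> a vertical one. One more unit of room
  gives a straight triple. This lemma and its numbered companions each exhibit four pieces.\<close>

lemma multiple_shapeL_1:
  assumes "p < q" "t < s" "1 \<le> p" "t + 2 \<le> s" "1 \<le> t"
  shows "multiple (shapeL p q s t)"
proof -
  obtain p' s' t' where e: "p = Suc p'" "s = Suc s'" "t = Suc t'"
    using ex_Suc[of p] ex_Suc[of s] ex_Suc[of t] assms by auto
  let ?Ps = "{{(p, s'), (p, s)}, {(p', s), (p, s)}, {(q, t'), (q, t)}}"
  let ?Os = "{{(p, s), (p', s), (p, s')}}"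
  show ?thesis
  proof (rule multiple_shapeL[OF assms(1,2), of ?Ps ?Os])
    show "?Ps \<subseteq> doms (shapeL p q s t)"
      using assms e by (auto intro!: row2 col2 shapeL_ideal simp: shapeL_cor mem_shapeL)
    show "conn3 (shapeL p q s t) D" if "D \<in> ?Os" for D
      using that assms e by (auto intro!: inner_corner3 shapeL_ideal simp: shapeL_cor mem_shapeL)
    show "4 \<le> card ?Ps + card ?Os" using assms e by (simp add: doubleton_eq_iff)
  qed
qed

text \<open>Diagonally adjacent corners block the horizontal domino at the upper and the vertical
  one at the lower corner; the cell \<open>(p, t)\<close> beneath both supplies the triple of
  \<open>outer_corner3\<close> instead.\<close>

lemma multiple_shapeL_2:
  assumes "2 \<le> p" "1 \<le> t"
  shows "multiple (shapeL p (Suc p) (Suc t) t)"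
proof -
  obtain p' t' where e: "p = Suc (Suc p')" "t = Suc t'"
    using ex_Suc2[of p] ex_Suc[of t] assms by auto
  let ?s = "Suc t" and ?q = "Suc p"
  let ?Ps = "{{(Suc p', ?s), (p, ?s)}, {(?q, t'), (?q, t)}}"
  let ?A = "{(p, t), (p, ?s), (?q, t)}" and ?B = "{(p', ?s), (Suc p', ?s), (p, ?s)}"
  have "(p, t) \<notin> ?B" by simp
  then have ne: "?A \<noteq> ?B" by (rule neq_setI[OF insertI1])
  show ?thesis
  proof (rule multiple_shapeL[of _ _ _ _ ?Ps "{?A, ?B}"])
    show "?Ps \<subseteq> doms (shapeL p ?q ?s t)"
      using e by (auto intro!: row2 col2 shapeL_ideal simp: shapeL_cor mem_shapeL)
    show "conn3 (shapeL p ?q ?s t) D" if "D \<in> {?A, ?B}" for D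
      using that e by (auto intro!: outer_corner3 col3 shapeL_ideal simp: shapeL_cor mem_shapeL)
    show "4 \<le> card ?Ps + card {?A, ?B}" using e ne by (simp add: doubleton_eq_iff)
  qed auto
qed

lemma multiple_shapeL_3:
  assumes "p < q" "t < s" "1 \<le> p" "t + 2 \<le> s" "p + 2 \<le> q"
  shows "multiple (shapeL p q s t)"
proof -
  obtain p' s' q' where e: "p = Suc p'" "s = Suc s'" "q = Suc q'"
    using ex_Suc[of p] ex_Suc[of s] ex_Suc[of q] assms by auto
  let ?Ps = "{{(p, s'), (p, s)}, {(p', s), (p, s)}, {(q', t), (q, t)}}"
  let ?Os = "{{(p, s), (p', s), (p, s')}}"
  show ?thesis
  proof (rule multiple_shapeL[OF assms(1,2), of ?Ps ?Os])
    show "?Ps \<subseteq> doms (shapeL p q s t)"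
      using assms e by (auto intro!: row2 col2 shapeL_ideal simp: shapeL_cor mem_shapeL)
    show "conn3 (shapeL p q s t) D" if "D \<in> ?Os" for D
      using that assms e by (auto intro!: inner_corner3 shapeL_ideal simp: shapeL_cor mem_shapeL)
    show "4 \<le> card ?Ps + card ?Os" using assms e by (simp add: doubleton_eq_iff)
  qed
qed

lemma multiple_shapeL_4:
  assumes "p < q" "t < s" "1 \<le> p" "t + 3 \<le> s"
  shows "multiple (shapeL p q s t)"
proof -
  obtain p' where p: "p = Suc p'" using ex_Suc[of p] assms by auto
  obtain s' where s: "s = Suc (Suc s')" using ex_Suc2[of s] assms by auto
  let ?Ps = "{{(p, Suc s'), (p, s)}, {(p', s), (p, s)}}"
  let ?A = "{(p, s'), (p, Suc s'), (p, s)}" and ?B = "{(p, s), (p', s), (p, Suc s')}"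
  have "(p, s') \<notin> ?B" using s by simp
  then have ne: "?A \<noteq> ?B" by (rule neq_setI[OF insertI1])
  show ?thesis
  proof (rule multiple_shapeL[OF assms(1,2), of ?Ps "{?A, ?B}"])
    show "?Ps \<subseteq> doms (shapeL p q s t)"
      using assms p s by (auto intro!: row2 col2 shapeL_ideal simp: shapeL_cor mem_shapeL)
    show "conn3 (shapeL p q s t) D" if "D \<in> {?A, ?B}" for D
      using that assms p s by (auto intro!: inner_corner3 row3 shapeL_ideal simp: shapeL_cor mem_shapeL)
    show "4 \<le> card ?Ps + card {?A, ?B}" using p s ne by (simp add: doubleton_eq_iff)
  qed
qed

lemma multiple_shapeL_5:
  assumes "p < q" "t < s" "2 \<le> p" "t + 2 \<le> s"
  shows "multiple (shapeL p q s t)"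
proof -
  obtain p' s' where e: "p = Suc (Suc p')" "s = Suc s'"
    using ex_Suc2[of p] ex_Suc[of s] assms by auto
  let ?Ps = "{{(p, s'), (p, s)}, {(Suc p', s), (p, s)}}"
  let ?A = "{(p', s), (Suc p', s), (p, s)}" and ?B = "{(p, s), (Suc p', s), (p, s')}"
  have "(p', s) \<notin> ?B" using e by simp
  then have ne: "?A \<noteq> ?B" by (rule neq_setI[OF insertI1])
  show ?thesis
  proof (rule multiple_shapeL[OF assms(1,2), of ?Ps "{?A, ?B}"])
    show "?Ps \<subseteq> doms (shapeL p q s t)"
      using assms e by (auto intro!: row2 col2 shapeL_ideal simp: shapeL_cor mem_shapeL)
    show "conn3 (shapeL p q s t) D" if "D \<in> {?A, ?B}" for D
      using that assms e by (auto intro!: inner_corner3 col3 shapeL_ideal simp: shapeL_cor mem_shapeL)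
    show "4 \<le> card ?Ps + card {?A, ?B}" using e ne by (simp add: doubleton_eq_iff)
  qed
qed

lemma multiple_shapeL_6:
  assumes "t + 3 \<le> s" "p + 3 \<le> q"
  shows "multiple (shapeL p q s t)"
proof -
  obtain q' s' where e: "q = Suc (Suc q')" "s = Suc (Suc s')"
    using ex_Suc2[of q] ex_Suc2[of s] assms by auto
  let ?Ps = "{{(p, Suc s'), (p, s)}, {(Suc q', t), (q, t)}}"
  let ?A = "{(p, s'), (p, Suc s'), (p, s)}" and ?B = "{(q', t), (Suc q', t), (q, t)}"
  have "(p, s') \<notin> ?B" using assms e by simp
  then have ne: "?A \<noteq> ?B" by (rule neq_setI[OF insertI1])
  show ?thesis
  proof (rule multiple_shapeL[of _ _ _ _ ?Ps "{?A, ?B}"])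
    show "?Ps \<subseteq> doms (shapeL p q s t)"
      using assms e by (auto intro!: row2 col2 shapeL_ideal simp: shapeL_cor mem_shapeL)
    show "conn3 (shapeL p q s t) D" if "D \<in> {?A, ?B}" for D
      using that assms e by (auto intro!: row3 col3 shapeL_ideal simp: shapeL_cor mem_shapeL)
    show "4 \<le> card ?Ps + card {?A, ?B}" using assms e ne by (simp add: doubleton_eq_iff)
  qed (use assms in auto)
qed

lemma multiple_shapeL_7:
  assumes "p < q" "t + 3 \<le> s" "2 \<le> t"
  shows "multiple (shapeL p q s t)"
proof -
  obtain t' where t: "t = Suc (Suc t')" using ex_Suc2[of t] assms by auto
  obtain s' where s: "s = Suc (Suc s')" using ex_Suc2[of s] assms by auto
  let ?Ps = "{{(p, Suc s'), (p, s)}, {(q, Suc t'), (q, t)}}"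
  let ?A = "{(p, s'), (p, Suc s'), (p, s)}" and ?B = "{(q, t'), (q, Suc t'), (q, t)}"
  have "(p, s') \<notin> ?B" using assms by simp
  then have ne: "?A \<noteq> ?B" by (rule neq_setI[OF insertI1])
  show ?thesis
  proof (rule multiple_shapeL[of _ _ _ _ ?Ps "{?A, ?B}"])
    show "?Ps \<subseteq> doms (shapeL p q s t)"
      using assms s t by (auto intro!: row2 col2 shapeL_ideal simp: shapeL_cor mem_shapeL)
    show "conn3 (shapeL p q s t) D" if "D \<in> {?A, ?B}" for D
      using that assms s t by (auto intro!: row3 shapeL_ideal simp: shapeL_cor mem_shapeL)
    show "4 \<le> card ?Ps + card {?A, ?B}" using assms s t ne by (simp add: doubleton_eq_iff)
  qed (use assms in auto)
qed

lemma cor2_rem: "ideal I \<Longrightarrow> x \<in> corners I \<Longrightarrow> y \<in> corners I \<Longrightarrow> x \<noteq> y \<Longrightarrow> {x, y} \<in> removable 2 I"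
  by (rule remI) (auto simp: corners_def)

lemma doms_rem: "D \<in> doms I \<Longrightarrow> D \<in> removable 2 I" by (simp add: doms_def)

lemmas w_simps = w3_def w2_def sw_def hw_triple lin3_triple ord3_def hw_pair

text \<open>Covers rows of nearly equal length, where \<open>J = I\<close> offers too few pieces.
  The last cell of the second row starts a third row; the pairs weigh at least 3 + 1 + 1, and the
  corners of \<open>K\<close> weigh 2 + 1.\<close>

lemma multiple_two_row_move:
  assumes "3 \<le> t" "t < s" shows "multiple (shapeL 0 1 s t)"
proof -
  obtain t' where t: "t = Suc (Suc t')" using ex_Suc2[of t] assms by auto
  obtain s' where s: "s = Suc s'" using ex_Suc[of s] assms by auto
  have b: "1 \<le> t'" "Suc t' < s'" using assms s t by auto
  let ?K = "shapeL 0 1 s (Suc t')" and ?c = "(1, t)" and ?c' = "(2::nat, 0::nat)"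
  have I: "shapeL 0 1 s t = insert ?c ?K" using b s t by (auto simp: shapeL_def le_Suc_eq)
  let ?P = "{(0::nat, s), (1, Suc t')}" and ?Q = "{(1::nat, t'), (1, Suc t')}" and ?R = "{(0::nat, s'), (0, s)}"
  have corners: "corners ?K = {(0, s), (1, Suc t')}" using b s by (intro shapeL_cor) auto
  have "multiple (insert ?c ?K)"
  proof (rule multiple_move[of ?K ?c ?c' "{(0, s), (1, Suc t')}" "{?P, ?Q, ?R}"])
    show "ideal (insert ?c ?K)" using I shapeL_ideal by metis
    show "ideal (insert ?c' ?K)"
      by (rule idealI) (use ideal_finite[OF shapeL_ideal] in \<open>auto simp: mem_shapeL\<close>)
    have "?P \<in> removable 2 ?K" by (rule cor2_rem[OF shapeL_ideal]) (use b s in \<open>auto simp: shapeL_cor\<close>)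
    moreover have "?Q \<in> doms ?K" by (rule row2[OF shapeL_ideal]) (use b s in \<open>auto simp: shapeL_cor mem_shapeL\<close>)
    moreover have "?R \<in> doms ?K" unfolding s by (rule row2[OF shapeL_ideal]) (use s b in \<open>auto simp: shapeL_cor mem_shapeL\<close>)
    ultimately show "{?P, ?Q, ?R} \<subseteq> removable 2 ?K" using doms_rem by auto
    have 1: "w3 (insert ?c ?P) (insert ?c' ?P) = 3" using b s t by (simp add: w_simps)
    have 2: "w3 (insert ?c ?Q) (insert ?c' ?Q) = 1" using b s t by (simp add: w_simps)
    have 3: "w3 (insert ?c ?R) (insert ?c' ?R) \<ge> 1" using b s t by (cases "s' \<le> t") (simp_all add: w_simps)
    have 4: "w2 {?c, (0, s)} {?c', (0, s)} = 2" "w2 {?c, (1, Suc t')} {?c', (1, Suc t')} = 1"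
      using b s t by (simp_all add: w_simps)
    have ne: "?P \<noteq> ?Q" "?P \<noteq> ?R" "?Q \<noteq> ?R" by (auto simp: doubleton_eq_iff)
    show "2 \<le> (\<Sum>P\<in>{?P, ?Q, ?R}. w3 (insert ?c P) (insert ?c' P)) - (\<Sum>y\<in>{(0, s), (1, Suc t')}. w2 {?c, y} {?c', y})"
      using ne 1 2 3 4 by simp
  qed (use corners t in \<open>auto simp: shapeL_ideal mem_shapeL\<close>)
  then show ?thesis using I by simp
qed

text \<open>The last cell of the first row starts a third row: 3 + 1 + 1 against 1 + 2.\<close>

lemma multiple_two_row_2:
  assumes "4 \<le> s" shows "multiple (shapeL 0 1 s 1)"
proof -
  obtain s' where s: "s = Suc (Suc s')" using ex_Suc2[of s] assms by auto
  have b: "2 \<le> s'" using assms s by auto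
  let ?K = "shapeL 0 1 (Suc s') 1" and ?c = "(0, s)" and ?c' = "(2::nat, 0::nat)"
  have I: "shapeL 0 1 s 1 = insert ?c ?K" using b s by (auto simp: shapeL_def le_Suc_eq)
  let ?P = "{(0::nat, Suc s'), (1, 1::nat)}" and ?Q = "{(0::nat, s'), (0, Suc s')}" and ?R = "{(1::nat, 0::nat), (1, Suc 0)}"
  have corners: "corners ?K = {(0, Suc s'), (1, 1)}" using b s by (intro shapeL_cor) auto
  have "multiple (insert ?c ?K)"
  proof (rule multiple_move[of ?K ?c ?c' "{(0, Suc s'), (1, 1)}" "{?P, ?Q, ?R}"])
    show "ideal (insert ?c ?K)" using I shapeL_ideal by metis
    show "ideal (insert ?c' ?K)"
      by (rule idealI) (use ideal_finite[OF shapeL_ideal] in \<open>auto simp: mem_shapeL\<close>)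
    have "?P \<in> removable 2 ?K" by (rule cor2_rem[OF shapeL_ideal]) (use b s in \<open>auto simp: shapeL_cor\<close>)
    moreover have "?Q \<in> doms ?K" by (rule row2[OF shapeL_ideal]) (use b in \<open>auto simp: shapeL_cor mem_shapeL\<close>)
    moreover have "?R \<in> doms ?K" by (rule row2[OF shapeL_ideal]) (use b s in \<open>auto simp: shapeL_cor mem_shapeL\<close>)
    ultimately show "{?P, ?Q, ?R} \<subseteq> removable 2 ?K" using doms_rem by auto
    have 1: "w3 (insert ?c ?P) (insert ?c' ?P) = 3" using b s by (simp add: w_simps)
    have 2: "w3 (insert ?c ?Q) (insert ?c' ?Q) = 1" using b s by (simp add: w_simps)
    have 3: "w3 (insert ?c ?R) (insert ?c' ?R) = 1" using b s by (simp add: w_simps)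
    have 4: "w2 {?c, (0, Suc s')} {?c', (0, Suc s')} = 1" "w2 {?c, (1, 1)} {?c', (1, 1)} = 2"
      using b s by (simp_all add: w_simps)
    have ne: "?P \<noteq> ?Q" "?P \<noteq> ?R" "?Q \<noteq> ?R" by (auto simp: doubleton_eq_iff)
    show "2 \<le> (\<Sum>P\<in>{?P, ?Q, ?R}. w3 (insert ?c P) (insert ?c' P)) - (\<Sum>y\<in>{(0, Suc s'), (1, 1)}. w2 {?c, y} {?c', y})"
      using ne 1 2 3 4 by simp
  qed (use corners s in \<open>auto simp: shapeL_ideal mem_shapeL\<close>)
  then show ?thesis using I by simp
qed

text \<open>The last cell of the first row is moved into the angle of the hook, again with balance 3
  + 1 + 1 against 1 + 2.\<close>

lemma multiple_hook_2:
  assumes "4 \<le> s" shows "multiple (shapeL 0 2 s 0)"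
proof -
  obtain s' where s: "s = Suc (Suc s')" using ex_Suc2[of s] assms by auto
  have b: "2 \<le> s'" using assms s by auto
  let ?K = "shapeL 0 2 (Suc s') 0" and ?c = "(0, s)" and ?c' = "(1::nat, 1::nat)"
  have I: "shapeL 0 2 s 0 = insert ?c ?K" using b s by (auto simp: shapeL_def le_Suc_eq)
  let ?P = "{(0::nat, Suc s'), (2, 0::nat)}" and ?Q = "{(0::nat, s'), (0, Suc s')}" and ?R = "{(1::nat, 0::nat), (Suc 1, 0)}"
  have corners: "corners ?K = {(0, Suc s'), (2, 0)}" using b s by (intro shapeL_cor) auto
  have "multiple (insert ?c ?K)"
  proof (rule multiple_move[of ?K ?c ?c' "{(0, Suc s'), (2, 0)}" "{?P, ?Q, ?R}"])
    show "ideal (insert ?c ?K)" using I shapeL_ideal by metis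
    show "ideal (insert ?c' ?K)"
      by (rule idealI) (use ideal_finite[OF shapeL_ideal] in \<open>auto simp: mem_shapeL\<close>)
    have "?P \<in> removable 2 ?K" by (rule cor2_rem[OF shapeL_ideal]) (use b s in \<open>auto simp: shapeL_cor\<close>)
    moreover have "?Q \<in> doms ?K" by (rule row2[OF shapeL_ideal]) (use b in \<open>auto simp: shapeL_cor mem_shapeL\<close>)
    moreover have "?R \<in> doms ?K" by (rule col2[OF shapeL_ideal]) (use b s in \<open>auto simp: shapeL_cor mem_shapeL\<close>)
    ultimately show "{?P, ?Q, ?R} \<subseteq> removable 2 ?K" using doms_rem by auto
    have 1: "w3 (insert ?c ?P) (insert ?c' ?P) = 3" using b s by (simp add: w_simps)
    have 2: "w3 (insert ?c ?Q) (insert ?c' ?Q) = 1" using b s by (simp add: w_simps)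
    have 3: "w3 (insert ?c ?R) (insert ?c' ?R) = 1" using b s by (simp add: w_simps)
    have 4: "w2 {?c, (0, Suc s')} {?c', (0, Suc s')} = 1" "w2 {?c, (2, 0)} {?c', (2, 0)} = 2"
      using b s by (simp_all add: w_simps)
    have ne: "?P \<noteq> ?Q" "?P \<noteq> ?R" "?Q \<noteq> ?R" by (auto simp: doubleton_eq_iff)
    show "2 \<le> (\<Sum>P\<in>{?P, ?Q, ?R}. w3 (insert ?c P) (insert ?c' P)) - (\<Sum>y\<in>{(0, Suc s'), (2, 0)}. w2 {?c, y} {?c', y})"
      using ne 1 2 3 4 by simp
  qed (use corners s in \<open>auto simp: shapeL_ideal mem_shapeL\<close>)
  then show ?thesis using I by simp
qed

text \<open>A rectangle has a single corner, and the coefficient at \<open>J = I\<close> is too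
  small. Its corner cell starts a new row instead, with balance 2 + 1 + 1 against 1 + 1. The bound
  \<open>3 \<le> a\<close> keeps the column of the moved cell apart from those of the horizontal
  domino.\<close>

lemma multiple_rectangle:
  assumes "2 \<le> b" "3 \<le> a" shows "multiple ({..b} \<times> {..a})"
proof -
  obtain b' where b: "b = Suc (Suc b')" using ex_Suc2[of b] assms by auto
  obtain a' where a: "a = Suc (Suc a')" using ex_Suc2[of a] assms by auto
  have a1: "1 \<le> a'" using assms a by simp
  let ?K = "shapeL (Suc b') b a (Suc a')" and ?c = "(b, a)" and ?c' = "(Suc b, 0)"
  have I: "{..b} \<times> {..a} = insert ?c ?K" using a b by (auto simp: shapeL_def le_Suc_eq)
  let ?P = "{(Suc b', a), (b, Suc a')}" and ?Q = "{(b, a'), (b, Suc a')}" and ?R = "{(b', a), (Suc b', a)}"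
  have corners: "corners ?K = {(Suc b', a), (b, Suc a')}" using a b by (intro shapeL_cor) auto
  have "multiple (insert ?c ?K)"
  proof (rule multiple_move[of ?K ?c ?c' "{(Suc b', a), (b, Suc a')}" "{?P, ?Q, ?R}"])
    show "ideal (insert ?c ?K)" unfolding I[symmetric] by (rule idealI) auto
    show "ideal (insert ?c' ?K)"
      by (rule idealI) (use ideal_finite[OF shapeL_ideal] in \<open>auto simp: mem_shapeL\<close>)
    have "?P \<in> removable 2 ?K" by (rule cor2_rem[OF shapeL_ideal]) (use a b in \<open>auto simp: shapeL_cor\<close>)
    moreover have "?Q \<in> doms ?K" by (rule row2[OF shapeL_ideal]) (use a b in \<open>auto simp: shapeL_cor mem_shapeL\<close>)
    moreover have "?R \<in> doms ?K" by (rule col2[OF shapeL_ideal]) (use a b in \<open>auto simp: shapeL_cor mem_shapeL\<close>)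
    ultimately show "{?P, ?Q, ?R} \<subseteq> removable 2 ?K" using doms_rem by auto
    have 1: "w3 (insert ?c ?P) (insert ?c' ?P) = 2" using a b a1 by (simp add: w_simps)
    have 2: "w3 (insert ?c ?Q) (insert ?c' ?Q) = 1" using a b a1 by (simp add: w_simps)
    have 3: "w3 (insert ?c ?R) (insert ?c' ?R) = 1" using a b a1 by (simp add: w_simps)
    have 4: "w2 {?c, (Suc b', a)} {?c', (Suc b', a)} = 1" "w2 {?c, (b, Suc a')} {?c', (b, Suc a')} = 1"
      using a b a1 by (simp_all add: w_simps)
    have ne: "?P \<noteq> ?Q" "?P \<noteq> ?R" "?Q \<noteq> ?R" "(Suc b', a) \<noteq> (b, Suc a')" using a b by (auto simp: doubleton_eq_iff)
    show "2 \<le> (\<Sum>P\<in>{?P, ?Q, ?R}. w3 (insert ?c P) (insert ?c' P)) - (\<Sum>y\<in>{(Suc b', a), (b, Suc a')}. w2 {?c, y} {?c', y})"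
      using ne 1 2 3 4 by simp
  qed (use corners a b in \<open>auto simp: shapeL_ideal mem_shapeL\<close>)
  then show ?thesis using I by simp
qed

section \<open>Diagrams with three or more corners\<close>

lemma no_doms_down:
  assumes I: "ideal I" "doms I = {}" and c: "(i, Suc j) \<in> corners I"
  shows "(Suc i, j) \<in> corners I"
proof (rule ccontr)
  assume n: "(Suc i, j) \<notin> corners I"
  have "(Suc i, j) \<in> I" using row2[OF I(1) c] I(2) by auto
  moreover have s: "(Suc i, Suc j) \<notin> I" using c by (simp add: cor_mem_iff[OF I(1)])
  ultimately have "(Suc (Suc i), j) \<in> I" using n by (simp add: cor_mem_iff[OF I(1)])
  then obtain x where x: "x \<in> corners I" "cle (Suc (Suc i), j) x" by (rule cor_above[OF I(1)])
  obtain k l where kl: "x = (k, l)" by (cases x)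
  have xI: "(k, l) \<in> I" using x kl cor_sub by blast
  have "l \<le> j" using idealD[OF I(1) xI, of "Suc i" "Suc j"] s x kl by (cases "l \<le> j") auto
  then have l: "l = j" using x kl by simp
  obtain k' where k': "k = Suc k'" "Suc i \<le> k'" using x kl ex_Suc[of k] by auto
  have "(k', Suc j) \<notin> I" using idealD[OF I(1), of k' "Suc j" "Suc i" "Suc j"] s k' by auto
  then show False using col2[OF I(1), of k' j] x kl l k' I(2) by auto
qed

lemma no_doms_up:
  assumes I: "ideal I" "doms I = {}" and c: "(Suc i, j) \<in> corners I"
  shows "(i, Suc j) \<in> corners I"
proof (rule ccontr)
  assume n: "(i, Suc j) \<notin> corners I"
  have "(i, Suc j) \<in> I" using col2[OF I(1) c] I(2) by auto
  moreover have s: "(Suc i, Suc j) \<notin> I" using c by (simp add: cor_mem_iff[OF I(1)])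
  ultimately have "(i, Suc (Suc j)) \<in> I" using n by (simp add: cor_mem_iff[OF I(1)])
  then obtain x where x: "x \<in> corners I" "cle (i, Suc (Suc j)) x" by (rule cor_above[OF I(1)])
  obtain k l where kl: "x = (k, l)" by (cases x)
  have xI: "(k, l) \<in> I" using x kl cor_sub by blast
  have "k \<le> i" using idealD[OF I(1) xI, of "Suc i" "Suc j"] s x kl by (cases "k \<le> i") auto
  then have k: "k = i" using x kl by simp
  obtain l' where l': "l = Suc l'" "Suc j \<le> l'" using x kl ex_Suc[of l] by auto
  have "(Suc i, l') \<notin> I" using idealD[OF I(1), of "Suc i" l' "Suc i" "Suc j"] s l' by auto
  then show False using row2[OF I(1), of i l'] x kl k l' I(2) by auto
qed

text \<open>Without dominoes a corner propagates one step in both directions, so corners fill their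
  whole antidiagonal.\<close>

lemma no_doms_antidiagonal:
  assumes I: "ideal I" "doms I = {}" and c: "(i, j) \<in> corners I" and t: "t \<le> i + j"
  shows "(t, i + j - t) \<in> corners I"
proof (cases "i \<le> t")
  case True
  then show ?thesis using t
  proof (induction t rule: dec_induct)
    case (step t)
    then have "i + j - t = Suc (i + j - Suc t)" by simp
    then show ?case using no_doms_down[OF I, of t "i + j - Suc t"] step by simp
  qed (use c in simp)
next
  case False
  then have "t \<le> i" by simp
  then show ?thesis
  proof (induction t rule: inc_induct)
    case (step t)
    then have "i + j - t = Suc (i + j - Suc t)" by simp
    then show ?case using no_doms_up[OF I, of t "i + j - Suc t"] step by simp
  qed (use c in simp)
qed

text \<open>A corner on the antidiagonal with coordinate sum \<open>k\<close> brings
  \<open>k + 1\<close> corners, so three corners confine the diagram to the staircase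
  (3,2,1).\<close>

lemma no_doms_card:
  assumes I: "ideal I" "doms I = {}" "card (corners I) = 3"
  shows "card I \<le> 6"
proof -
  have fin: "finite (corners I)" using I(3) card.infinite by fastforce
  have sum: "i + j \<le> 2" if c: "(i, j) \<in> corners I" for i j
  proof -
    have "(\<lambda>t. (t, i + j - t)) ` {..i + j} \<subseteq> corners I" using no_doms_antidiagonal[OF I(1,2) c] by auto
    then have "card ((\<lambda>t. (t, i + j - t)) ` {..i + j}) \<le> 3" using card_mono[OF fin] I(3) by metis
    then show ?thesis by (simp add: card_image inj_on_def)
  qed
  have "I \<subseteq> {(0, 0), (0, 1), (0, 2), (1, 0), (1, 1), (2, 0)}"
  proof
    fix x assume "x \<in> I"
    then obtain c where c: "c \<in> corners I" "cle x c" by (rule cor_above[OF I(1)])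
    obtain i j k l where e: "x = (i, j)" "c = (k, l)" by (cases x; cases c)
    then have "i + j \<le> 2" using sum[of k l] c by auto
    then have "(i = 0 \<and> (j = 0 \<or> j = 1 \<or> j = 2)) \<or> (i = 1 \<and> (j = 0 \<or> j = 1)) \<or> (i = 2 \<and> j = 0)" by presburger
    then show "x \<in> {(0, 0), (0, 1), (0, 2), (1, 0), (1, 1), (2, 0)}" using e by auto
  qed
  then have "card I \<le> card {(0, 0), (0, 1), (0, 2), (1, 0), (1, 1), (2::nat, 0::nat)}" by (intro card_mono) auto
  then show ?thesis by simp
qed

text \<open>With \<open>d\<close> corners and \<open>k\<close> dominoes,
  \<open>multiple_self\<close> applies outright for \<open>d \<ge> 4\<close>. For
  \<open>d = 3\<close> its condition is \<open>8 + k \<le> 6 + 4 * k\<close>, so a single domino is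
  enough, and diagrams without one have at most six cells.\<close>

lemma multiple_many_corners:
  assumes I: "ideal I" "16 < card I" and d: "3 \<le> card (corners I)"
  shows "multiple I"
proof -
  define d where "d = card (corners I)"
  define k where "k = card (doms I)"
  have "d * (d - 1) + k + 2 \<le> d * ((d - 1) * (d - 2)) + 2 * (d - 1) * k"
  proof (cases "d = 3")
    case True
    have "doms I \<noteq> {}" using no_doms_card[OF I(1)] True I(2) by (auto simp: d_def)
    moreover have "finite (doms I)" using ideal_finite[OF I(1)] by (simp add: doms_def)
    ultimately have "1 \<le> k" by (simp add: k_def Suc_le_eq card_gt_0_iff)
    then show ?thesis using True by simp
  next
    case False
    then have "4 \<le> d" using d d_def by simp
    then obtain e where e: "d = 4 + e" using le_Suc_ex by blast
    show ?thesis unfolding e by (simp add: algebra_simps)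
  qed
  then show ?thesis
    by (intro multiple_self[OF I(1), of "{}"]) (auto simp: d_def k_def)
qed

section \<open>Assembling the classification\<close>

lemma ideal_Un_corners: "ideal I \<Longrightarrow> x \<in> I \<longleftrightarrow> (\<exists>c\<in>corners I. cle x c)"
proof -
  assume I: "ideal I"
  show ?thesis
  proof
    assume "x \<in> I"
    then obtain c where "c \<in> corners I" "cle x c" by (rule cor_above[OF I])
    then show "\<exists>c\<in>corners I. cle x c" by blast
  next
    assume "\<exists>c\<in>corners I. cle x c"
    then obtain c where "c \<in> corners I" "cle x c" by blast
    then show "x \<in> I" using ideal_cle[OF I, of c x] cor_sub[of I] by auto
  qed
qed

lemma multiple_shapeL_B:
  assumes "1 \<le> p" "p < q" "2 \<le> s" "16 < card (shapeL p q s 0)"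
  shows "multiple (shapeL p q s 0)"
proof -
  consider "p + 2 \<le> q" | "3 \<le> s" | "2 \<le> p" | "p = 1" "s = 2" "q = 2" using assms by linarith
  then show ?thesis
  proof cases
    case 1
    then show ?thesis using assms by (intro multiple_shapeL_3) auto
  next
    case 2
    then show ?thesis using assms by (intro multiple_shapeL_4) auto
  next
    case 3
    then show ?thesis using assms by (intro multiple_shapeL_5) auto
  next
    \<comment> \<open>The diagram (3,3,1), with seven cells.\<close>
    case 4
    then have "card (shapeL p q s 0) = 7" by (simp add: card_shapeL)
    then show ?thesis using assms by simp
  qed
qed

lemma multiple_shapeL_two_row:
  assumes "1 \<le> t" "t < s" "16 < card (shapeL 0 1 s t)"
  shows "multiple (shapeL 0 1 s t)"
proof -
  have n: "14 < s + t" using assms card_shapeL[of 0 1 t s] by simp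
  \<comment> \<open>A long overhang leaves room for straight triples in both rows; a short one makes
    both rows long, so that a cell can be moved.\<close>
  consider "t = 1" | "2 \<le> t" "t + 3 \<le> s" | "2 \<le> t" "s \<le> t + 2" using assms by linarith
  then show ?thesis
  proof cases
    case 1
    then show ?thesis using multiple_two_row_2[of s] n by simp
  next
    case 2
    then show ?thesis using multiple_shapeL_7[of 0 1 t s] by simp
  next
    case 3
    then show ?thesis using multiple_two_row_move[of t s] n assms by simp
  qed
qed

text \<open>Transposition exchanges the parameters \<open>p, q, s, t\<close> with
  \<open>t, s, q, p\<close>, which halves the cases. The shapes that escape are (n-1,1) and its
  transpose.\<close>

lemma multiple_shapeL_all:
  assumes "p < q" "t < s" "16 < card (shapeL p q s t)"
  shows "multiple (shapeL p q s t) \<or> (p = 0 \<and> t = 0 \<and> (q = 1 \<or> s = 1))"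
proof -
  have cc: "card (shapeL t s q p) = card (shapeL p q s t)" for p q s t
    using card_conj[of "shapeL p q s t"] by (simp add: shapeL_conj)
  have cj: "multiple (shapeL p q s t)" if "multiple (shapeL t s q p)" for p q s t
    using that multiple_conj[of "shapeL p q s t"] by (simp add: shapeL_conj)
  consider "1 \<le> p" "1 \<le> t" | "1 \<le> p" "t = 0" | "p = 0" "1 \<le> t" | "p = 0" "t = 0" by linarith
  then show ?thesis
  proof cases
    case 1
    consider "t + 2 \<le> s" | "p + 2 \<le> q" | "s = Suc t" "q = Suc p" using assms by linarith
    then show ?thesis
    proof cases
      case a: 1
      then show ?thesis using multiple_shapeL_1[OF assms(1,2)] 1 by simp
    next
      case a: 2
      then show ?thesis using multiple_shapeL_1[OF assms(2,1)] 1 cj by simp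
    next
      case a: 3
      \<comment> \<open>For \<open>p = t = 1\<close> the diagram is (3,3,2), with eight
        cells.\<close>
      have "p \<noteq> 1 \<or> t \<noteq> 1" using assms(3) card_shapeL[of 1 2 1 2] a by (auto simp: numeral_2_eq_2)
      then have "2 \<le> p \<or> 2 \<le> t" using 1 by auto
      then show ?thesis using multiple_shapeL_2[of p t] multiple_shapeL_2[of t p] cj[of t "Suc t" "Suc p" p] 1 a by auto
    qed
  next
    case 2
    show ?thesis
    proof (cases "s = 1")
      case True
      then show ?thesis using multiple_shapeL_two_row[of p q] cj[of 0 1 q p] cc[of 0 1 q p] 2 assms by simp
    next
      case False
      then show ?thesis using multiple_shapeL_B[of p q s] 2 assms by simp
    qed
  next
    case 3
    show ?thesis
    proof (cases "q = 1")
      case True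
      then show ?thesis using multiple_shapeL_two_row[of t s] 3 assms by simp
    next
      case False
      then show ?thesis using multiple_shapeL_B[of t s q] cj[of t s q 0] cc[of t s q 0] 3 assms by simp
    qed
  next
    case 4
    have n: "16 < s + 1 + q" using assms 4 card_shapeL[of 0 q 0 s] by simp
    consider "q = 1" | "s = 1" | "q = 2" "4 \<le> s" | "s = 2" "4 \<le> q" | "3 \<le> s" "3 \<le> q" using assms n by linarith
    then show ?thesis
    proof cases
      case a: 3
      then show ?thesis using multiple_hook_2 4 by simp
    next
      case a: 4
      then show ?thesis using multiple_hook_2[of q] cj[of 0 2 q 0] 4 by simp
    next
      case a: 5
      then show ?thesis using multiple_shapeL_6[of 0 s 0 q] 4 by simp
    qed (use 4 in auto)
  qed
qed

lemma ideal_classification: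
  assumes I: "ideal I" "16 < card I"
  shows "multiple I \<or> (\<exists>a b. I = {..b} \<times> {..a} \<and> (a \<le> 1 \<or> b \<le> 1)) \<or>
    (\<exists>s\<ge>1. I = shapeL 0 1 s 0) \<or> (\<exists>q\<ge>1. I = shapeL 0 q 1 0)"
proof -
  have fin: "finite (corners I)" using ideal_finite[OF I(1)] cor_sub finite_subset by blast
  have "corners I \<noteq> {}"
  proof
    assume "corners I = {}"
    then have "I = {}" using ideal_Un_corners[OF I(1)] by blast
    then show False using I(2) by simp
  qed
  then have "card (corners I) \<noteq> 0" using fin by simp
  then consider "card (corners I) = 1" | "card (corners I) = 2" | "3 \<le> card (corners I)" by linarith
  then show ?thesis
  proof cases
    case 1
    then obtain c where "corners I = {c}" by (auto simp: card_1_singleton_iff)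
    then obtain b a where c: "corners I = {(b, a)}" by (cases c) auto
    have "x \<in> I \<longleftrightarrow> x \<in> {..b} \<times> {..a}" for x
      unfolding ideal_Un_corners[OF I(1)] c by (cases x) simp
    then have e: "I = {..b} \<times> {..a}" by blast
    show ?thesis
    proof (cases "a \<le> 1 \<or> b \<le> 1")
      case False
      have "card I = Suc b * Suc a" unfolding e by (simp add: card_cartesian_product)
      \<comment> \<open>Excludes the square with nine cells, too small for
        \<open>multiple_rectangle\<close> in either orientation.\<close>
      then have "3 \<le> a \<or> 3 \<le> b" using I(2) False
        by (cases "a = 2"; cases "b = 2") auto
      moreover have "conj ({..a} \<times> {..b}) = I" unfolding e by auto
      ultimately show ?thesis
        using multiple_rectangle[of b a] multiple_rectangle[of a b] multiple_conj[of I] False e conj_conj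
        by (metis linorder_not_le One_nat_def Suc_leI numeral_2_eq_2)
    qed (use e in blast)
  next
    case 2
    then obtain x y where xy: "corners I = {x, y}" "x \<noteq> y" by (auto simp: card_2_iff)
    have "\<not> cle x y" "\<not> cle y x"
      using cor_incomparable[of x I y] cor_incomparable[of y I x] xy cor_sub[of I] by auto
    then have "fst x < fst y \<and> snd y < snd x \<or> fst y < fst x \<and> snd x < snd y" by (auto simp: cle_def)
    then obtain p q s t where c: "corners I = {(p, s), (q, t)}" "p < q" "t < s"
      using xy by (metis insert_commute prod.collapse)
    have "z \<in> I \<longleftrightarrow> z \<in> shapeL p q s t" for z
      unfolding ideal_Un_corners[OF I(1)] c by (cases z) (simp add: mem_shapeL)
    then have e: "I = shapeL p q s t" by blast
    have "multiple I \<or> (p = 0 \<and> t = 0 \<and> (q = 1 \<or> s = 1))"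
      using multiple_shapeL_all[OF c(2,3)] I(2) unfolding e by simp
    then show ?thesis
    proof (elim disjE conjE)
      assume a: "p = 0" "t = 0" "q = 1"
      then have "1 \<le> s \<and> I = shapeL 0 1 s 0" using e c by simp
      then show ?thesis by blast
    next
      assume a: "p = 0" "t = 0" "s = 1"
      then have "1 \<le> q \<and> I = shapeL 0 q 1 0" using e c by simp
      then show ?thesis by blast
    qed blast
  next
    case 3
    then show ?thesis using multiple_many_corners[OF I] by blast
  qed
qed

section \<open>The rectangle with two rows\<close>

definition tworow :: "nat \<Rightarrow> nat \<Rightarrow> (nat \<times> nat) set" where
  "tworow a b = {(i, j). i = 0 \<and> j < a \<or> i = 1 \<and> j < b}"

lemma mem_tworow: "(i, j) \<in> tworow a b \<longleftrightarrow> i = 0 \<and> j < a \<or> i = 1 \<and> j < b"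
  by (simp add: tworow_def)

lemma finite_tworow [simp]: "finite (tworow a b)"
  by (rule finite_subset[of _ "{..1} \<times> {..a + b}"]) (auto simp: tworow_def)

lemma ideal_tworow: "b \<le> a \<Longrightarrow> ideal (tworow a b)"
  by (rule idealI) (auto simp: mem_tworow)

lemma card_tworow: "card (tworow a b) = a + b"
proof -
  have "tworow a b = {0} \<times> {..<a} \<union> {1} \<times> {..<b}" by (auto simp: tworow_def)
  then show ?thesis by (simp add: card_Un_disjoint card_cartesian_product disjoint_iff)
qed

lemma subs_tworow:
  assumes "Y \<in> subs k (tworow m m)"
  obtains a b where "Y = tworow a b" "b \<le> a" "a \<le> m" "a + b + k = 2 * m"
proof -
  have Y: "ideal Y" "Y \<subseteq> tworow m m" "card (tworow m m - Y) = k" using assms by (auto simp: subs_def)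
  let ?a = "rowlen Y 0" and ?b = "rowlen Y 1"
  have "x \<in> Y \<longleftrightarrow> x \<in> tworow ?a ?b" for x
  proof -
    obtain i j where x: "x = (i, j)" by (cases x)
    have "i < 2" if "(i, j) \<in> Y" using Y(2) that by (auto simp: tworow_def)
    then show ?thesis unfolding x mem_tworow using in_ideal_iff[OF Y(1), of i j] by (auto simp: less_2_cases_iff)
  qed
  then have e: "Y = tworow ?a ?b" by blast
  have "?b \<le> ?a" using rowlen_mono_Suc[OF Y(1), of 0] by simp
  moreover have "?a \<le> m"
  proof (rule ccontr)
    assume "\<not> ?a \<le> m"
    then have "(0, m) \<in> Y" using in_ideal_iff[OF Y(1)] by simp
    then show False using Y(2) by (auto simp: tworow_def)
  qed
  moreover have "?a + ?b + k = 2 * m"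
  proof -
    have "finite Y" using ideal_finite[OF Y(1)] .
    then have "k = card (tworow m m) - card Y" "card Y \<le> card (tworow m m)"
      using Y card_Diff_subset[of Y "tworow m m"] by (auto intro: card_mono)
    moreover have "card Y = ?a + ?b" using e card_tworow by metis
    ultimately show ?thesis by (simp add: card_tworow)
  qed
  ultimately show ?thesis using that e by blast
qed

lemma tworow_eq_iff: "tworow a b = tworow c d \<longleftrightarrow> a = c \<and> b = d"
proof
  assume e: "tworow a b = tworow c d"
  have "j < a \<longleftrightarrow> j < c" "j < b \<longleftrightarrow> j < d" for j
    using arg_cong[OF e, of "\<lambda>X. (0, j) \<in> X"] arg_cong[OF e, of "\<lambda>X. (1, j) \<in> X"] by (simp_all add: mem_tworow)
  then show "a = c \<and> b = d" by (metis nat_neq_iff)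
qed simp

text \<open>A cell in row 2 or below brings along the cells of row 2 in columns up to its own, all
  of them outside a two-row subdiagram.\<close>

lemma row_two_small:
  assumes J: "ideal J" and Y: "Y \<subseteq> tworow a b" and c: "card (J - Y) \<le> 2" and m: "(i, j) \<in> J" "2 \<le> i"
  shows "j \<le> 1"
proof -
  have "{2} \<times> {..j} \<subseteq> J - Y"
    using idealD[OF J m(1)] m(2) Y by (auto simp: tworow_def)
  then have "card ({2::nat} \<times> {..j}) \<le> card (J - Y)"
    using ideal_finite[OF J] by (intro card_mono) auto
  then show ?thesis using c by (simp add: card_cartesian_product)
qed

text \<open>Only four subdiagrams of the rectangle occur, and each leaves a skew part with a single
  irreducible character: a row of three cells, a rotated hook, a row of two and a column of two. The
  coefficient is \<open>(t1 - t3) + (t2 - t4)\<close>; both brackets are 0 or 1, and if the first is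
  1 the second vanishes.\<close>

lemma square_two_row:
  assumes J: "ideal J" "card J = 2 * m" and m: "5 \<le> m"
  shows "B3 (tworow m m) J - B2 (tworow m m) J = 0 \<or> B3 (tworow m m) J - B2 (tworow m m) J = 1"
proof -
  \<comment> \<open>From \<open>5 \<le> m\<close> comes \<open>2 \<le> r\<close>, so columns
    \<open>r\<close> and \<open>r + 1\<close> avoid columns 0 and 1, to which
    \<open>row_two_small\<close> confines the rows from 2 on.\<close>
  define r where "r = m - 3"
  have r: "m = r + 3" "2 \<le> r" using m by (auto simp: r_def)
  let ?I = "tworow m m"
  let ?Y1 = "tworow (r + 3) r" and ?Y2 = "tworow (r + 2) (r + 1)"
  let ?Y3 = "tworow (r + 3) (r + 1)" and ?Y4 = "tworow (r + 2) (r + 2)"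
  have subsJ: "tworow a b \<in> subs k J \<longleftrightarrow> tworow a b \<subseteq> J" if "b \<le> a" "a + b + k = 2 * m" for a b k
    using that ideal_tworow[of b a] J(2) card_Diff_subset[of "tworow a b" J] by (auto simp: subs_def card_tworow)
  have subsI: "tworow a b \<in> subs k ?I" if "b \<le> a" "a \<le> m" "a + b + k = 2 * m" for a b k
  proof -
    have s: "tworow a b \<subseteq> ?I" using that by (auto simp: tworow_def)
    then show ?thesis using that ideal_tworow[of b a] card_Diff_subset[of "tworow a b" ?I]
      by (auto simp: subs_def card_tworow)
  qed
  have S3: "subs 3 ?I = {?Y1, ?Y2}"
  proof (intro equalityI subsetI)
    fix Y assume "Y \<in> subs 3 ?I"
    then obtain a b where "Y = tworow a b" "b \<le> a" "a \<le> m" "a + b + 3 = 2 * m" by (rule subs_tworow)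
    moreover from this have "a = r + 3 \<and> b = r \<or> a = r + 2 \<and> b = r + 1" using r by linarith
    ultimately show "Y \<in> {?Y1, ?Y2}" by auto
  qed (use subsI r in auto)
  have S2: "subs 2 ?I = {?Y3, ?Y4}"
  proof (intro equalityI subsetI)
    fix Y assume "Y \<in> subs 2 ?I"
    then obtain a b where "Y = tworow a b" "b \<le> a" "a \<le> m" "a + b + 2 = 2 * m" by (rule subs_tworow)
    moreover from this have "a = r + 3 \<and> b = r + 1 \<or> a = r + 2 \<and> b = r + 2" using r by linarith
    ultimately show "Y \<in> {?Y3, ?Y4}" by auto
  qed (use subsI r in auto)
  have D1: "?I - ?Y1 = {(1, r), (1, r + 1), (1, r + 2)}" using r by (auto simp: tworow_def)
  have D2: "?I - ?Y2 = {(0, r + 2), (1, r + 1), (1, r + 2)}" using r by (auto simp: tworow_def)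
  have D3: "?I - ?Y3 = {(1, r + 1), (1, r + 2)}" using r by (auto simp: tworow_def)
  have D4: "?I - ?Y4 = {(0, r + 2), (1, r + 2)}" using r by (auto simp: tworow_def)
  have W: "w3 (?I - ?Y1) E = hw E" "w3 (?I - ?Y2) E = sw E" "w2 (?I - ?Y3) E = hw E" "w2 (?I - ?Y4) E = ew E" for E
    unfolding D1 D2 D3 D4 by (simp_all add: w_simps)
  define t1 where "t1 = (if ?Y1 \<subseteq> J then hw (J - ?Y1) else 0)"
  define t2 where "t2 = (if ?Y2 \<subseteq> J then sw (J - ?Y2) else 0)"
  define t3 where "t3 = (if ?Y3 \<subseteq> J then hw (J - ?Y3) else 0)"
  define t4 where "t4 = (if ?Y4 \<subseteq> J then ew (J - ?Y4) else 0)"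
  have two: "(\<Sum>Y\<in>{A, B} \<inter> X. g Y) = (if A \<in> X then g A else 0) + (if B \<in> X then g B else 0)"
    if "A \<noteq> B" for A B :: "(nat \<times> nat) set" and X and g :: "_ \<Rightarrow> real"
    using that by (simp add: Int_insert_left)
  have s: "?Y1 \<in> subs 3 J \<longleftrightarrow> ?Y1 \<subseteq> J" "?Y2 \<in> subs 3 J \<longleftrightarrow> ?Y2 \<subseteq> J"
    "?Y3 \<in> subs 2 J \<longleftrightarrow> ?Y3 \<subseteq> J" "?Y4 \<in> subs 2 J \<longleftrightarrow> ?Y4 \<subseteq> J"
    by (rule subsJ; use r in simp)+
  have ne: "?Y1 \<noteq> ?Y2" "?Y3 \<noteq> ?Y4" by (simp_all add: tworow_eq_iff)
  have B3: "B3 ?I J = t1 + t2"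
    unfolding B3_w3 S3 t1_def t2_def two[OF ne(1)] s W ..
  have B2: "B2 ?I J = t3 + t4"
    unfolding B2_w2 S2 t3_def t4_def two[OF ne(2)] s W ..
  have Y31: "?Y3 = insert (1, r) ?Y1" by (auto simp: tworow_def)
  have Y42: "?Y4 = insert (1, r + 1) ?Y2" by (auto simp: tworow_def)
  have cJ: "card (J - tworow a b) = k" if "tworow a b \<subseteq> J" "a + b + k = 2 * m" for a b k
    using that J(2) card_Diff_subset[of "tworow a b" J] by (simp add: card_tworow)
  \<comment> \<open>Passing from \<open>?Y3\<close> to \<open>?Y1\<close> adds the cell
    \<open>(1, r)\<close> to the removed part, whose column is otherwise empty there; so a
    horizontal strip stays one.\<close>
  have A: "(t1 = 0 \<or> t1 = 1) \<and> (t3 = 0 \<or> t3 = 1) \<and> t3 \<le> t1"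
  proof -
    have "hstrip (J - ?Y1)" if Y3: "?Y3 \<subseteq> J" and h: "hstrip (J - ?Y3)" 
    proof -
      have "i \<le> 1" if "(i, r) \<in> J" for i
        using row_two_small[OF J(1) order.refl, of "r + 3" "r + 1" i r] cJ[OF Y3, of 2] that r
        by (cases "i \<le> 1") auto
      then have no: "(i, r) \<notin> J - ?Y3" for i by (cases "i = 0") (auto simp: tworow_def le_Suc_eq)
      have "J - ?Y1 = insert (1, r) (J - ?Y3)" using Y3 by (auto simp: tworow_def)
      then show ?thesis using h no unfolding hstrip_def by auto
    qed
    then show ?thesis using Y31 by (auto simp: t1_def t3_def hw_def)
  qed
  have B: "t2 - t4 = 0 \<or> t2 - t4 = 1"
  proof (cases "?Y2 \<subseteq> J")
    case False
    then show ?thesis using Y42 by (auto simp: t2_def t4_def)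
  next
    case Y2: True
    let ?D = "J - ?Y2"
    have D: "?D \<in> removable 3 J" using subs_rem[of ?Y2 3 J] subsJ[of "r + 1" "r + 2" 3] Y2 r by simp
    obtain x y z where xyz: "?D = {x, y, z}" "lex_adj x y" "lex_adj x z" "lex_adj y z"
      by (rule rem_3_classify[OF D J(1)])
    have ne: "x \<noteq> y" "x \<noteq> z" "y \<noteq> z" using xyz by (auto simp: lex_adj_def)
    have t2: "t2 = sw {x, y, z}" using Y2 xyz(1) by (simp add: t2_def)
    consider (chain) "sw {x, y, z} = 0" "(fst x = fst y \<and> fst y = fst z) \<or> (snd x = snd y \<and> snd y = snd z)"
      | (one) "sw {x, y, z} = 1"
      | (anti) "sw {x, y, z} = 2" "\<not> cle x y \<and> \<not> cle y x \<and> \<not> cle x z \<and> \<not> cle z x \<and> \<not> cle y z \<and> \<not> cle z y"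
      using triple_classify[OF xyz(2-4)] by blast
    then show ?thesis
    proof cases
      case one
      then show ?thesis using t2 by (auto simp: t4_def ew_def)
    next
      \<comment> \<open>Were \<open>t4\<close> nonzero, the two cells outside \<open>?Y4\<close>
        would lie in different rows, so the straight triple would be part of column
        \<open>r + 1\<close>, whose cells in rows 0 and 1 belong to \<open>?Y4\<close> and whose
        lower cells are excluded by \<open>row_two_small\<close>.\<close>
      case chain
      have "t4 = 0"
      proof (rule ccontr)
        assume "t4 \<noteq> 0"
        then have Y4: "?Y4 \<subseteq> J" and v: "vstrip (J - ?Y4)" by (auto simp: t4_def ew_def split: if_splits)
        have c2: "card (J - ?Y4) = 2" using cJ[OF Y4, of 2] r by simp
        then obtain u w where uw: "J - ?Y4 = {u, w}" "u \<noteq> w" by (auto simp: card_2_iff)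
        have a: "(1, r + 1) \<in> J" using Y4 unfolding Y42 by simp
        have "(1, r + 1) \<notin> ?Y2" by (simp add: mem_tworow)
        then have "?D = insert (1, r + 1) (J - ?Y4)" unfolding Y42 using a by blast
        then have DD: "?D = insert (1, r + 1) {u, w}" unfolding uw(1) .
        have "inj_on fst {u, w}" using v unfolding vs_iff_inj uw(1) .
        then have "fst u \<noteq> fst w" using uw(2) inj_onD[of fst "{u, w}" u w] by blast
        moreover have sub: "u \<in> {x, y, z}" "w \<in> {x, y, z}" "(1, r + 1) \<in> {x, y, z}" using DD xyz(1) by auto
        ultimately have "snd x = snd y \<and> snd y = snd z" using chain(2) by auto
        then have su: "snd u = r + 1" "snd w = r + 1" using sub by auto
        have "i \<le> 1" if "(i, r + 1) \<in> J" for i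
          using row_two_small[OF J(1) order.refl, of "r + 2" "r + 2" i "r + 1"] c2 that r
          by (cases "i \<le> 1") auto
        then have "fst u \<le> 1" using uw(1) su by (metis Diff_iff insertI1 prod.collapse)
        then have "(fst u, snd u) \<in> ?Y4" using su by (auto simp: mem_tworow)
        then show False using uw(1) by (metis Diff_iff insertI1 prod.collapse)
      qed
      then show ?thesis using chain t2 by simp
    next
      \<comment> \<open>Incomparable cells outside \<open>?Y2\<close> are addable to it, and
        (r+2,r+1) has just three addable cells. This determines \<open>J\<close> and forces
        \<open>t4 = 1\<close>.\<close>
      case anti
      have nc: "\<not> cle u w" if "u \<in> ?D" "w \<in> ?D" "u \<noteq> w" for u w
        using that anti(2) unfolding xyz(1) by auto
      have pred: "w \<in> ?Y2" if "u \<in> ?D" "cle w u" "w \<noteq> u" for u w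
        using that nc[of w u] ideal_cle[OF J(1), of u w] by blast
      have "u \<in> {(0, r + 2), (1, r + 1), (2, 0)}" if u: "u \<in> ?D" for u
      proof -
        obtain i j where ij: "u = (i, j)" by (cases u)
        have nY: "(i, j) \<notin> ?Y2" using u ij by simp
        have up: "(i - 1, j) \<in> ?Y2" if "0 < i" using pred[OF u, of "(i - 1, j)"] that ij by auto
        have lf: "(i, j - 1) \<in> ?Y2" if "0 < j" using pred[OF u, of "(i, j - 1)"] that ij by auto
        have "i = 0 \<or> i = 1 \<or> i = 2" using up by (cases "0 < i") (auto simp: mem_tworow)
        then show ?thesis using nY lf ij by (cases "0 < j") (auto simp: mem_tworow)
      qed
      then have "?D \<subseteq> {(0, r + 2), (1, r + 1), (2, 0)}" by blast
      moreover have "card ?D = 3" using cJ[OF Y2, of 3] r by simp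
      ultimately have De: "?D = {(0, r + 2), (1, r + 1), (2, 0)}" by (intro card_subset_eq) auto
      then have Y4: "?Y4 \<subseteq> J" unfolding Y42 using Y2 by auto
      have "J - ?Y4 = ?D - {(1, r + 1)}" unfolding Y42 by auto
      also have "\<dots> = {(0, r + 2), (2, 0)}" unfolding De by auto
      finally have "t4 = 1" using Y4 by (simp add: t4_def hw_pair)
      then show ?thesis using anti t2 by simp
    qed
  qed
  \<comment> \<open>If the two strip indicators differ, the cell \<open>(1, r)\<close> is missing
    from \<open>J\<close>, whereas both \<open>?Y2\<close> and \<open>?Y4\<close> contain
    it.\<close>
  have C: "t2 = 0 \<and> t4 = 0" if "t1 \<noteq> t3"
  proof -
    have "\<not> ?Y3 \<subseteq> J"
    proof
      assume Y3: "?Y3 \<subseteq> J"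
      have "hstrip (J - ?Y1) \<Longrightarrow> hstrip (J - ?Y3)" unfolding Y31 hstrip_def by blast
      then show False using that A Y3 Y31 by (auto simp: t1_def t3_def hw_def split: if_splits)
    qed
    moreover have "?Y1 \<subseteq> J" using that A by (auto simp: t1_def split: if_splits)
    ultimately have "(1, r) \<notin> J" using Y31 by auto
    moreover have "(1, r) \<in> ?Y2" "(1, r) \<in> ?Y4" by (auto simp: mem_tworow)
    ultimately show ?thesis by (auto simp: t2_def t4_def)
  qed
  show ?thesis
  proof (cases "t1 = t3")
    case True
    then show ?thesis using B unfolding B3 B2 by auto
  next
    case False
    then have "t1 - t3 = 1" using A by auto
    then show ?thesis using C[OF False] unfolding B3 B2 by auto
  qed
qed

section \<open>From diagrams back to partitions\<close>

lemma partition_of_ideal: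
  assumes J: "ideal J"
  obtains \<gamma> where "\<gamma> \<in> partitions_of (card J)" "diagram \<gamma> = J"
proof -
  have anti: "rowlen J l \<le> rowlen J i" if "i \<le> l" for i l
    using that by (induction rule: dec_induct) (auto intro: order_trans rowlen_mono_Suc[OF J])
  have "\<exists>L. rowlen J L = 0"
  proof -
    have "in_rows (Suc (Max (insert 0 (fst ` J)))) J"
      unfolding in_rows_def
    proof (intro allI impI)
      fix i j assume "(i, j) \<in> J"
      then have "i \<in> insert 0 (fst ` J)" by force
      then show "i < Suc (Max (insert 0 (fst ` J)))" using ideal_finite[OF J] by (simp add: less_Suc_eq_le)
    qed
    then show ?thesis using partn_rowlen[OF J] unfolding partn_def by blast
  qed
  define L where "L = (LEAST L. rowlen J L = 0)"
  have L0: "rowlen J L = 0" unfolding L_def by (rule LeastI_ex) fact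
  have Lpos: "rowlen J i \<noteq> 0" if "i < L" for i
    using not_less_Least[OF that[unfolded L_def]] .
  define \<gamma> where "\<gamma> = map (rowlen J) [0..<L]"
  have d: "diagram \<gamma> = J"
  proof (intro set_eqI)
    fix x :: "nat \<times> nat"
    obtain i j where x: "x = (i, j)" by (cases x)
    have "i < L" if "j < rowlen J i" using that anti[of L i] L0 by (cases "i < L") auto
    then show "x \<in> diagram \<gamma> \<longleftrightarrow> x \<in> J" unfolding x in_ideal_iff[OF J] by (auto simp: diagram_def \<gamma>_def)
  qed
  have "sorted_wrt (\<ge>) \<gamma>" using anti by (auto simp: \<gamma>_def sorted_wrt_iff_nth_less)
  moreover have "\<forall>x\<in>set \<gamma>. x \<noteq> 0" using Lpos by (auto simp: \<gamma>_def simp del: neq0_conv)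
  ultimately have "is_partition \<gamma>" unfolding is_partition_def by auto
  moreover have "sum_list \<gamma> = card J" using card_diagram[of \<gamma>] d by simp
  ultimately show ?thesis using that d by (simp add: partitions_of_def)
qed

lemma diagram_inj: "is_partition \<alpha> \<Longrightarrow> is_partition \<beta> \<Longrightarrow> diagram \<alpha> = diagram \<beta> \<Longrightarrow> \<alpha> = \<beta>"
  using part_fun_inj rowlen_diagram by metis

lemma diagram_replicate: "diagram (replicate b a) = {..<b} \<times> {..<a}"
  by (auto simp: diagram_def)

lemma diagram_two_row: "diagram [a, b] = tworow a b"
  by (auto simp: diagram_def tworow_def less_Suc_eq)

lemma sorted_replicate: "sorted_wrt (\<lambda>x y. y \<le> x) (replicate k (a :: nat))"
  by (auto simp: sorted_wrt_iff_nth_less)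

lemma kronecker_coeff_three_row:
  assumes n: "n \<ge> 6" and \<gamma>: "\<gamma> \<in> partitions_of n"
  shows "kronecker_coeff [n - 3, 3] [n] \<gamma> = (if diagram [n - 3, 3] = diagram \<gamma> then 1 else 0)"
proof -
  let ?\<beta> = "[n - 3, 3]"
  have \<beta>: "?\<beta> \<in> partitions_of n" using n by (auto simp: partitions_of_def is_partition_def)
  have n1: "[n] \<in> partitions_of n" using n by (auto simp: partitions_of_def is_partition_def)
  have one: "irr_char [n] p = 1" if p: "p permutes {..<n}" for p
  proof -
    have s: "{\<sigma>. \<sigma> permutes {..<1::nat}} = {id}" by (auto simp: lessThan_Suc)
    have "(\<lambda>i. int (part_fun [n] i)) = (\<lambda>i. if i = 0 then int n else 0)"
      by (auto simp: part_fun_def)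
    then have "jtp n 1 (part_fun [n]) p = 1"
      unfolding jtp_def jt_def s using perm_char_one_row[OF p] by (simp add: sign_id)
    then show ?thesis using irr_char_eq_jtp[OF n1 _ p, of 1] by simp
  qed
  define N where "N = max (length ?\<beta>) (length \<gamma>)"
  have N: "length ?\<beta> \<le> N" "length \<gamma> \<le> N" by (auto simp: N_def)
  have I: "ideal (diagram ?\<beta>)" "in_rows N (diagram ?\<beta>)" "card (diagram ?\<beta>) = n"
    "ideal (diagram \<gamma>)" "in_rows N (diagram \<gamma>)"
    using \<beta> \<gamma> N by (auto simp: partitions_of_def ideal_diagram in_rows_diagram card_diagram)
  have "sum_list ?\<beta> = n" using n by simp
  then have "kronecker_coeff ?\<beta> [n] \<gamma> =
    (\<Sum>p | p permutes {..<n}. irr_char ?\<beta> p * irr_char [n] p * cnj (irr_char \<gamma> p)) / fact n"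
    unfolding kronecker_coeff_def char_multiplicity_def by simp
  also have "\<dots> = complex_of_real (char_ip n (idc n N (diagram ?\<beta>)) (idc n N (diagram \<gamma>)))"
    by (simp add: one irr_char_idc[OF \<beta> N(1)] irr_char_idc[OF \<gamma> N(2)] char_ip_def)
  also have "char_ip n (idc n N (diagram ?\<beta>)) (idc n N (diagram \<gamma>)) = (if diagram ?\<beta> = diagram \<gamma> then 1 else 0)"
    by (rule idc_orthonormal) (use I in auto)
  finally show ?thesis by simp
qed

lemma kronecker_coeff_conj:
  assumes n: "n \<ge> 6" and \<beta>: "\<beta> \<in> partitions_of n" and \<gamma>: "\<gamma> \<in> partitions_of n"
    and \<beta>': "\<beta>' \<in> partitions_of n" "diagram \<beta>' = conj (diagram \<beta>)"
  obtains \<gamma>' where "\<gamma>' \<in> partitions_of n" "kronecker_coeff [n - 3, 3] \<beta> \<gamma> = kronecker_coeff [n - 3, 3] \<beta>' \<gamma>'"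
proof -
  have "ideal (conj (diagram \<gamma>))" "card (conj (diagram \<gamma>)) = n"
    using \<gamma> by (auto simp: partitions_of_def ideal_diagram ideal_conj card_conj card_diagram)
  then obtain \<gamma>' where \<gamma>': "\<gamma>' \<in> partitions_of n" "diagram \<gamma>' = conj (diagram \<gamma>)"
    using partition_of_ideal by metis
  then have "kronecker_coeff [n - 3, 3] \<beta> \<gamma> = kronecker_coeff [n - 3, 3] \<beta>' \<gamma>'"
    using kronecker_coeff_three[OF n \<beta> \<gamma>] kronecker_coeff_three[OF n \<beta>'(1) \<gamma>'(1)] \<beta>'(2) B_conj by simp
  then show ?thesis using that \<gamma>' by blast
qed

lemma mult_free_row:
  assumes "n \<ge> 6" "\<gamma> \<in> partitions_of n"
  shows "kronecker_coeff [n - 3, 3] [n] \<gamma> \<in> {0, 1}"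
  using kronecker_coeff_three_row[OF assms] by simp

text \<open>For \<open>J = I\<close> the two corners of (n-3,3) give 2 - 1, where
  \<open>7 \<le> n\<close> makes its rows unequal. For \<open>J \<noteq> I\<close> the intersection
  is the only possible common subdiagram with one cell removed.\<close>

lemma mult_free_hook:
  assumes "n \<ge> 7" "\<gamma> \<in> partitions_of n"
  shows "kronecker_coeff [n - 3, 3] [n - 1, 1] \<gamma> \<in> {0, 1}"
proof -
  let ?I = "diagram [n - 3, 3]" and ?J = "diagram \<gamma>"
  have n: "n \<ge> 6" using assms by simp
  have e: "?I = tworow (n - 3) 3" by (rule diagram_two_row)
  have I: "ideal ?I" unfolding e using assms(1) by (intro ideal_tworow) simp
  define X where "X = B1 ?I ?J - (if ?I = ?J then 1 else 0)"
  have "X = 0 \<or> X = 1"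
  proof (cases "?I = ?J")
    case True
    have "?I = shapeL 0 1 (n - 4) 2" unfolding e using assms(1) by (auto simp: tworow_def shapeL_def)
    then have corners: "corners ?I = {(0, n - 4), (1, 2)}" using shapeL_cor[of 0 1 2 "n - 4"] assms(1) by simp
    have "card (subs 1 ?I) = (\<Sum>Y\<in>subs 1 ?I. 1)" by simp
    also have "\<dots> = (\<Sum>x | x \<in> ?I \<and> ideal (?I - {x}). 1)" by (rule sum_subs_1)
    also have "{x. x \<in> ?I \<and> ideal (?I - {x})} = corners ?I" using cor_iff_ideal[OF I] cor_sub[of ?I] by blast
    finally have "card (subs 1 ?I) = 2" unfolding corners by simp
    then show ?thesis using True by (simp add: B1_def X_def)
  next
    case False
    have "subs 1 ?I \<inter> subs 1 ?J \<subseteq> {?I \<inter> ?J}"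
    proof
      fix Y assume "Y \<in> subs 1 ?I \<inter> subs 1 ?J"
      then have Y: "Y \<subseteq> ?I" "Y \<subseteq> ?J" "card (?I - Y) = 1" "card (?J - Y) = 1" by (auto simp: subs_def)
      obtain x y where xy: "?I - Y = {x}" "?J - Y = {y}" using Y(3,4) by (auto simp: card_1_singleton_iff)
      have "x \<noteq> y"
      proof
        assume "x = y"
        then have "?I = ?J" using xy Y(1,2) by (metis Diff_partition)
        then show False using False by simp
      qed
      have "z \<in> Y" if "z \<in> ?I" "z \<in> ?J" for z
        using that xy \<open>x \<noteq> y\<close> by (metis DiffI singletonD)
      then have "?I \<inter> ?J = Y" using Y(1,2) by blast
      then show "Y \<in> {?I \<inter> ?J}" by simp
    qed
    then have "card (subs 1 ?I \<inter> subs 1 ?J) \<le> 1" using card_mono[of "{?I \<inter> ?J}"] by simp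
    then have "card (subs 1 ?I \<inter> subs 1 ?J) = 0 \<or> card (subs 1 ?I \<inter> subs 1 ?J) = 1" by linarith
    then show ?thesis using False by (auto simp: B1_def X_def)
  qed
  then show ?thesis unfolding kronecker_coeff_three_hook[OF n assms(2)] X_def[symmetric] by auto
qed

lemma mult_free_square:
  assumes "m \<ge> 5" "\<gamma> \<in> partitions_of (2 * m)"
  shows "kronecker_coeff [2 * m - 3, 3] [m, m] \<gamma> \<in> {0, 1}"
proof -
  have p: "[m, m] \<in> partitions_of (2 * m)" using assms(1) by (auto simp: partitions_of_def is_partition_def)
  have "ideal (diagram \<gamma>)" "card (diagram \<gamma>) = 2 * m"
    using assms(2) by (auto simp: partitions_of_def ideal_diagram card_diagram)
  then have "B3 (tworow m m) (diagram \<gamma>) - B2 (tworow m m) (diagram \<gamma>) \<in> {0, 1}"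
    using square_two_row[OF _ _ assms(1)] by simp
  then have "complex_of_real (B3 (tworow m m) (diagram \<gamma>) - B2 (tworow m m) (diagram \<gamma>)) \<in> {0, 1}"
    by (metis insertCI insertE of_real_0 of_real_1 singletonD)
  moreover have "kronecker_coeff [2 * m - 3, 3] [m, m] \<gamma> =
      complex_of_real (B3 (tworow m m) (diagram \<gamma>) - B2 (tworow m m) (diagram \<gamma>))"
    using kronecker_coeff_three[OF _ p assms(2)] assms(1) by (simp add: diagram_two_row del: of_real_diff)
  ultimately show ?thesis by simp
qed

lemma multiple_not_mult_free:
  assumes n: "n \<ge> 6" and \<alpha>: "\<alpha> \<in> partitions_of n" and "multiple (diagram \<alpha>)"
  obtains \<gamma> where "\<gamma> \<in> partitions_of n" "kronecker_coeff [n - 3, 3] \<alpha> \<gamma> \<notin> {0, 1}"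
proof -
  obtain J where J: "ideal J" "card J = card (diagram \<alpha>)" "2 \<le> B3 (diagram \<alpha>) J - B2 (diagram \<alpha>) J"
    using assms(3) unfolding multiple_def by blast
  have "card J = n" using J(2) \<alpha> by (simp add: card_diagram partitions_of_def)
  then obtain \<gamma> where \<gamma>: "\<gamma> \<in> partitions_of n" "diagram \<gamma> = J" using partition_of_ideal[OF J(1)] by metis
  have "kronecker_coeff [n - 3, 3] \<alpha> \<gamma> = complex_of_real (B3 (diagram \<alpha>) J - B2 (diagram \<alpha>) J)"
    using kronecker_coeff_three[OF n \<alpha> \<gamma>(1)] \<gamma>(2) by simp
  then have "kronecker_coeff [n - 3, 3] \<alpha> \<gamma> \<notin> {0, 1}" using J(3) by (auto simp del: of_real_diff)
  then show ?thesis using that \<gamma> by blast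
qed

theorem theorem4p8:
  fixes n :: nat and \<alpha> :: "nat list"
  assumes "n > 16" and "\<alpha> \<in> partitions_of n"
  shows "multiplicity_free (kronecker_schur [n - 3, 3] \<alpha>) \<longleftrightarrow>
           \<alpha> = [n] \<or> \<alpha> = replicate n 1 \<or> \<alpha> = [n - 1, 1] \<or> \<alpha> = 2 # replicate (n - 2) 1 \<or>
           (even n \<and> (\<alpha> = [n div 2, n div 2] \<or> \<alpha> = replicate (n div 2) 2))"
proof -
  let ?K = "kronecker_coeff [n - 3, 3]"
  have n: "n \<ge> 6" "n \<ge> 7" "sum_list [n - 3, 3] = n" using assms(1) by auto
  have mf: "multiplicity_free (kronecker_schur [n - 3, 3] \<beta>) \<longleftrightarrow> (\<forall>\<gamma>\<in>partitions_of n. ?K \<beta> \<gamma> \<in> {0, 1})" for \<beta>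
    using multiplicity_free_iff[OF n(3)] by simp
  have pa: "is_partition \<alpha>" "card (diagram \<alpha>) = n" using assms(2) by (auto simp: partitions_of_def card_diagram)
  \<comment> \<open>The list is closed under transposition, so only (n), (n-1,1) and (n/2,n/2)
    require a computation.\<close>
  have conj_free: "multiplicity_free (kronecker_schur [n - 3, 3] \<beta>)"
    if b: "\<beta> \<in> partitions_of n" "\<beta>' \<in> partitions_of n" "diagram \<beta>' = conj (diagram \<beta>)"
      "multiplicity_free (kronecker_schur [n - 3, 3] \<beta>')" for \<beta> \<beta>'
    unfolding mf
  proof
    fix \<gamma> assume "\<gamma> \<in> partitions_of n"
    then obtain \<gamma>' where "\<gamma>' \<in> partitions_of n" "?K \<beta> \<gamma> = ?K \<beta>' \<gamma>'"
      using kronecker_coeff_conj[OF n(1) b(1) _ b(2,3)] by metis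
    then show "?K \<beta> \<gamma> \<in> {0, 1}" using b(4) mf by simp
  qed
  have row: "multiplicity_free (kronecker_schur [n - 3, 3] [n])"
    using mult_free_row[OF n(1)] mf by blast
  have hook: "multiplicity_free (kronecker_schur [n - 3, 3] [n - 1, 1])"
    using mult_free_hook[OF n(2)] mf by blast
  have square: "multiplicity_free (kronecker_schur [n - 3, 3] [n div 2, n div 2])" if "even n"
    unfolding mf
  proof
    fix \<gamma> assume g: "\<gamma> \<in> partitions_of n"
    define m where "m = n div 2"
    have m: "n = 2 * m" "5 \<le> m" using that assms(1) by (auto simp: m_def)
    show "?K [n div 2, n div 2] \<gamma> \<in> {0, 1}" using mult_free_square[OF m(2)] g m(1) by simp
  qed
  have parts: "[n] \<in> partitions_of n" "replicate n 1 \<in> partitions_of n" "[n - 1, 1] \<in> partitions_of n"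
    "2 # replicate (n - 2) 1 \<in> partitions_of n"
    using assms(1) sorted_replicate by (auto simp: partitions_of_def is_partition_def sum_list_replicate)
  have parts2: "[n div 2, n div 2] \<in> partitions_of n" "replicate (n div 2) 2 \<in> partitions_of n" if "even n"
    using assms(1) that sorted_replicate by (auto simp: partitions_of_def is_partition_def sum_list_replicate)
  have dhook: "diagram [n - 1, 1] = shapeL 0 1 (n - 2) 0"
    unfolding diagram_two_row using assms(1) by (auto simp: tworow_def shapeL_def)
  have dhook': "diagram (2 # replicate (n - 2) 1) = shapeL 0 (n - 2) 1 0"
    using assms(1) by (auto simp: diagram_def shapeL_def nth_Cons split: nat.splits)
  show ?thesis
  proof
    assume "\<alpha> = [n] \<or> \<alpha> = replicate n 1 \<or> \<alpha> = [n - 1, 1] \<or> \<alpha> = 2 # replicate (n - 2) 1 \<or>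
           (even n \<and> (\<alpha> = [n div 2, n div 2] \<or> \<alpha> = replicate (n div 2) 2))"
    then show "multiplicity_free (kronecker_schur [n - 3, 3] \<alpha>)"
    proof (elim disjE conjE)
      assume a: "\<alpha> = replicate n 1"
      have "diagram [n] = conj (diagram \<alpha>)" unfolding a diagram_replicate by (auto simp: diagram_def image_iff)
      then show ?thesis using conj_free[OF assms(2) parts(1) _ row] by simp
    next
      assume a: "\<alpha> = 2 # replicate (n - 2) 1"
      have "diagram [n - 1, 1] = conj (diagram \<alpha>)" unfolding a dhook dhook' shapeL_conj ..
      then show ?thesis using conj_free[OF assms(2) parts(3) _ hook] by simp
    next
      assume a: "even n" "\<alpha> = replicate (n div 2) 2"
      have "diagram [n div 2, n div 2] = conj (diagram \<alpha>)"
        unfolding a diagram_replicate diagram_two_row by (auto simp: tworow_def image_iff)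
      then show ?thesis using conj_free[OF assms(2) parts2(1)[OF a(1)] _ square[OF a(1)]] by simp
    qed (use row hook square in auto)
  next
    assume free: "multiplicity_free (kronecker_schur [n - 3, 3] \<alpha>)"
    have "\<not> multiple (diagram \<alpha>)"
      using multiple_not_mult_free[OF n(1) assms(2)] free mf by metis
    then consider a b where "diagram \<alpha> = {..b} \<times> {..a}" "a \<le> 1 \<or> b \<le> 1"
      | s where "1 \<le> s" "diagram \<alpha> = shapeL 0 1 s 0" | q where "1 \<le> q" "diagram \<alpha> = shapeL 0 q 1 0"
      using ideal_classification[OF ideal_diagram[OF pa(1)]] pa(2) assms(1) by auto
    then show "\<alpha> = [n] \<or> \<alpha> = replicate n 1 \<or> \<alpha> = [n - 1, 1] \<or> \<alpha> = 2 # replicate (n - 2) 1 \<or>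
           (even n \<and> (\<alpha> = [n div 2, n div 2] \<or> \<alpha> = replicate (n div 2) 2))"
    proof cases
      case 1
      have "is_partition (replicate (Suc b) (Suc a))"
        using sorted_replicate[of "Suc b" "Suc a"] by (auto simp: is_partition_def)
      moreover have "diagram (replicate (Suc b) (Suc a)) = diagram \<alpha>"
        unfolding diagram_replicate 1 by (simp add: lessThan_Suc_atMost)
      ultimately have \<alpha>: "\<alpha> = replicate (Suc b) (Suc a)" using diagram_inj[OF pa(1)] by simp
      have nn: "n = Suc b * Suc a" using assms(2) \<alpha> by (simp add: partitions_of_def sum_list_replicate)
      \<comment> \<open>Coordinates start at 0: \<open>a = 0\<close> is a single column,
        \<open>b = 0\<close> a single row, and \<open>a = 1\<close> or \<open>b = 1\<close> a
        rectangle with two columns or two rows, which makes \<open>n\<close> even.\<close>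
      consider "a = 0" | "b = 0" | "a = 1" | "b = 1" using 1(2) by linarith
      then show ?thesis
      proof cases
        case 3
        then have "even n" "n div 2 = Suc b" "Suc a = 2" using nn by auto
        then show ?thesis using \<alpha> by metis
      next
        case 4
        then have "even n" "n div 2 = Suc a" "\<alpha> = [Suc a, Suc a]" using nn \<alpha> by auto
        then show ?thesis by simp
      qed (use \<alpha> nn in auto)
    next
      case 2
      have "n = s + 2" using pa(2) card_shapeL[of 0 1 0 s] 2 by simp
      then have "diagram \<alpha> = diagram [n - 1, 1]" unfolding dhook using 2 by simp
      then show ?thesis using diagram_inj[OF pa(1)] parts(3) by (simp add: partitions_of_def)
    next
      case 3
      have "n = q + 2" using pa(2) card_shapeL[of 0 q 0 1] 3 by simp
      then have "diagram \<alpha> = diagram (2 # replicate (n - 2) 1)" unfolding dhook' using 3 by simp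
      then show ?thesis using diagram_inj[OF pa(1)] parts(4) by (simp add: partitions_of_def)
    qed
  qed
qed

end
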